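(* Let $p\in[1,+\infty)$, $a\in(0,a_{\max}]$ and $b>0$ be such that $ab\le1$. Then the sequence $(\Lambda^{k,\star})_{k\ge1}$ converges to $\Lambda^\star_{\mathrm{hom}}$ as $k\to+\infty$.
   Context: Notation. $\mathbb{T}^d=(\mathbb{R}/\mathbb{Z})^d$, $V\in C^\infty(\mathbb{T}^d)$ is real-valued, $Z=\int_{\mathbb{T}^d}e^{-V}$. $\mathcal{S}_d^+$ is the set of real symmetric positive semidefinite $d\times d$ matrices. $|\cdot|_{\mathrm F}$ is a fixed matrix norm monotone for the Loewner order ($|M_1|_{\mathrm F}\le|M_2|_{\mathrm F}$ whenever $0\le M_1\le M_2$), and $a_{\max}=1/|\mathrm{Id}_d|_{\mathrm F}$. For $a,b>0$, $\mathcal{M}_{a,b}=\{M\in\mathcal{S}_d^+: a|\xi|^2\le\xi^\top M\xi\le\frac1b|\xi|^2\ \forall\xi\in\mathbb{R}^d\}$. $\mathfrak{D}_p^{a,b}$ is the set of measurable $\mathcal{D}:\mathbb{T}^d\to\mathcal{S}_d^+$ with $\mathcal{D}(q)e^{-V(q)}\in\mathcal{M}_{a,b}$ for a.e. $q$ and $\int_{\mathbb{T}^d}|\mathcal{D}(q)|_{\mathrm F}^pe^{-pV(q)}dq\le1$. Optimization for the oscillating potential. For an integer $k\ge1$ let $V_{\#,k}(q)=V(kq)$ and let $\mathfrak{D}_{\#,k,p}^{a,b}$ be the set of measurable $\mathcal{D}:\mathbb{T}^d\to\mathcal{S}_d^+$ with $\mathcal{D}(q)e^{-V_{\#,k}(q)}\in\mathcal{M}_{a,b}$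 for a.e. $q$ and $\int_{\mathbb{T}^d}|\mathcal{D}(q)|_{\mathrm F}^pe^{-pV_{\#,k}(q)}dq\le1$ (these functions are only required to be $\mathbb{Z}^d$-periodic). For $\mathcal{D}\in\mathfrak{D}_{\#,k,p}^{a,b}$ set $$\Lambda^k(\mathcal{D})=\min_{u\in H^1(\mathbb{T}^d)\setminus\{0\}}\left\{\frac{\int_{\mathbb{T}^d}\nabla u^\top\mathcal{D}\nabla u\,e^{-V_{\#,k}}}{\int_{\mathbb{T}^d}u^2e^{-V_{\#,k}}}\ :\ \int_{\mathbb{T}^d}u\,e^{-V_{\#,k}}=0\right\},\qquad \Lambda^{k,\star}=\max_{\mathcal{D}\in\mathfrak{D}_{\#,k,p}^{a,b}}\Lambda^k(\mathcal{D}).$$ Homogenized problem. For $\mathcal{D}\in\mathfrak{D}_p^{a,b}$ let $\mathcal{A}(q)=\mathcal{D}(q)e^{-V(q)}$; with $(e_1,\dots,e_d)$ the canonical basis of $\mathbb{R}^d$, let $w_i\in H^1(\mathbb{T}^d)$ be the unique solution of $-\operatorname{div}(\mathcal{A}(e_i+\nabla w_i))=0$ on $\mathbb{T}^d$ with $\int_{\mathbb{T}^d}w_i=0$; let $\overline{\mathcal{A}}$ be the constant matrix with entries $\overline{\mathcal{A}}_{ij}=\int_{\mathbb{T}^d}(e_i+\nabla w_i)^\top\mathcal{A}(e_j+\nabla w_j)\,dq$ and $\overline{\mathcal{D}}=Z^{-1}\overline{\mathcal{A}}$. Set $$\Lambda_{\mathrm{hom}}(\mathcal{D})=\inf_{u\in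 H^{1,0}(\mathbb{T}^d)\setminus\{0\}}\frac{\int_{\mathbb{T}^d}\nabla u^\top\overline{\mathcal{D}}\nabla u}{\int_{\mathbb{T}^d}u^2},\qquad \Lambda_{\mathrm{hom}}^\star=\sup_{\mathcal{D}\in\mathfrak{D}_p^{a,b}}\Lambda_{\mathrm{hom}}(\mathcal{D}),$$ where $H^{1,0}(\mathbb{T}^d)=\{u\in H^1(\mathbb{T}^d):\int_{\mathbb{T}^d}u=0\}$. *)

theory Defs
  imports "HOL-Analysis.Analysis"
begin

section \<open>Functions on the torus\<close>

text \<open>
  A function on the torus $(R/Z)^d$ is represented by a $Z^d$-periodic function on the
  type \<^typ>\<open>real^'n\<close>, where \<open>d = CARD('n)\<close>; integrals over the torus are integrals over
  the unit cube. The faces of the cube are null sets.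
\<close>

definition periodic :: "(real^'n \<Rightarrow> 'b) \<Rightarrow> bool" where
  "periodic f \<longleftrightarrow> (\<forall>q z. (\<forall>i. z $ i \<in> \<int>) \<longrightarrow> f (q + z) = f q)"

abbreviation torus :: "(real^'n) measure" where
  "torus \<equiv> lebesgue_on (cbox 0 1)"

definition partial_deriv :: "'n \<Rightarrow> (real^'n \<Rightarrow> real) \<Rightarrow> real^'n \<Rightarrow> real" where
  "partial_deriv i f x = frechet_derivative f (at x) (axis i 1)"

primrec C_k :: "nat \<Rightarrow> (real^'n \<Rightarrow> real) \<Rightarrow> bool" where
  "C_k 0 f \<longleftrightarrow> continuous_on UNIV f"
| "C_k (Suc k) f \<longleftrightarrow> (\<forall>x. f differentiable (at x)) \<and> (\<forall>i. C_k k (partial_deriv i f))"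

definition smooth_torus :: "(real^'n \<Rightarrow> real) \<Rightarrow> bool" where
  "smooth_torus f \<longleftrightarrow> periodic f \<and> (\<forall>k. C_k k f)"


section \<open>The Sobolev space \<open>H\<^sup>1\<close> of the torus\<close>

definition weak_gradient :: "(real^'n \<Rightarrow> real) \<Rightarrow> (real^'n \<Rightarrow> real^'n) \<Rightarrow> bool" where
  "weak_gradient u g \<longleftrightarrow>
     periodic g \<and> g \<in> borel_measurable lebesgue \<and> integrable torus (\<lambda>q. (norm (g q))\<^sup>2) \<and>
     (\<forall>\<phi> i. smooth_torus \<phi> \<longrightarrow>
        (\<integral>q. u q * partial_deriv i \<phi> q \<partial>torus) = - (\<integral>q. g q $ i * \<phi> q \<partial>torus))"

definition H1 :: "(real^'n \<Rightarrow> real) set" where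
  "H1 = {u. periodic u \<and> u \<in> borel_measurable lebesgue \<and> integrable torus (\<lambda>q. (u q)\<^sup>2) \<and>
            (\<exists>g. weak_gradient u g)}"

text \<open>
  Elements of \<open>H1\<close> are functions rather than classes modulo null sets. The weak gradient is
  determined almost everywhere, and \<open>grad\<close> selects a representative. Accordingly, a function
  is nonzero as an element of the Sobolev space when it is not almost everywhere zero.
\<close>

definition grad :: "(real^'n \<Rightarrow> real) \<Rightarrow> real^'n \<Rightarrow> real^'n" where
  "grad u = (SOME g. weak_gradient u g)"

definition nonzero :: "(real^'n \<Rightarrow> real) \<Rightarrow> bool" where
  "nonzero u \<longleftrightarrow> \<not> (AE q in torus. u q = 0)"

definition H10 :: "(real^'n \<Rightarrow> real) set" where
  "H10 = {u \<in> H1. (\<integral>q. u q \<partial>torus) = 0}"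


section \<open>Matrices\<close>

definition psd :: "(real^'n^'n) set" where
  "psd = {M. transpose M = M \<and> (\<forall>\<xi>. 0 \<le> \<xi> \<bullet> (M *v \<xi>))}"

definition loewner_le :: "real^'n^'n \<Rightarrow> real^'n^'n \<Rightarrow> bool" where
  "loewner_le M\<^sub>1 M\<^sub>2 \<longleftrightarrow> M\<^sub>2 - M\<^sub>1 \<in> psd"

definition loewner_monotone_norm :: "(real^'n^'n \<Rightarrow> real) \<Rightarrow> bool" where
  "loewner_monotone_norm N \<longleftrightarrow>
     (\<forall>M. 0 \<le> N M) \<and>
     (\<forall>M. N M = 0 \<longleftrightarrow> M = 0) \<and>
     (\<forall>c M. N (c *\<^sub>R M) = \<bar>c\<bar> * N M) \<and>
     (\<forall>M\<^sub>1 M\<^sub>2. N (M\<^sub>1 + M\<^sub>2) \<le> N M\<^sub>1 + N M\<^sub>2) \<and>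
     (\<forall>M\<^sub>1 M\<^sub>2. loewner_le 0 M\<^sub>1 \<longrightarrow> loewner_le M\<^sub>1 M\<^sub>2 \<longrightarrow> N M\<^sub>1 \<le> N M\<^sub>2)"

definition a_max :: "(real^'n^'n \<Rightarrow> real) \<Rightarrow> real" where
  "a_max N = 1 / N (mat 1)"

definition M_ab :: "real \<Rightarrow> real \<Rightarrow> (real^'n^'n) set" where
  "M_ab a b = {M \<in> psd. \<forall>\<xi>. a * (norm \<xi>)\<^sup>2 \<le> \<xi> \<bullet> (M *v \<xi>) \<and>
                             \<xi> \<bullet> (M *v \<xi>) \<le> (1 / b) * (norm \<xi>)\<^sup>2}"


section \<open>Optimization of the spectral gap\<close>

text \<open>
  The norm constraint uses the nonnegative Lebesgue integral, so that it includes finiteness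
  of the integral.
\<close>

definition admissible ::
    "(real^'n^'n \<Rightarrow> real) \<Rightarrow> real \<Rightarrow> real \<Rightarrow> real \<Rightarrow> (real^'n \<Rightarrow> real) \<Rightarrow> (real^'n \<Rightarrow> real^'n^'n) set" where
  "admissible N p a b V = {D.
     periodic D \<and> D \<in> borel_measurable lebesgue \<and> (\<forall>q. D q \<in> psd) \<and>
     (AE q in torus. exp (- V q) *\<^sub>R D q \<in> M_ab a b) \<and>
     (\<integral>\<^sup>+q. ennreal (N (D q) powr p * exp (- p * V q)) \<partial>torus) \<le> 1}"

text \<open>
  Minima and maxima are written as \<^const>\<open>Inf\<close> and \<^const>\<open>Sup\<close>, with which they coincide
  when attained. The sets below are nonempty and bounded in the relevant direction for the
  parameters of interest.
\<close>

definition spectral_gap :: "(real^'n \<Rightarrow> real) \<Rightarrow> (real^'n \<Rightarrow> real^'n^'n) \<Rightarrow> real" where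
  "spectral_gap V D =
     Inf {(\<integral>q. grad u q \<bullet> (D q *v grad u q) * exp (- V q) \<partial>torus) /
          (\<integral>q. (u q)\<^sup>2 * exp (- V q) \<partial>torus) | u.
          u \<in> H1 \<and> nonzero u \<and> (\<integral>q. u q * exp (- V q) \<partial>torus) = 0}"

definition oscillating :: "(real^'n \<Rightarrow> real) \<Rightarrow> nat \<Rightarrow> real^'n \<Rightarrow> real" where
  "oscillating V k q = V (real k *\<^sub>R q)"

definition Lambda_k_star ::
    "(real^'n^'n \<Rightarrow> real) \<Rightarrow> real \<Rightarrow> real \<Rightarrow> real \<Rightarrow> (real^'n \<Rightarrow> real) \<Rightarrow> nat \<Rightarrow> real" where
  "Lambda_k_star N p a b V k =
     Sup (spectral_gap (oscillating V k) ` admissible N p a b (oscillating V k))"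


section \<open>The homogenized problem\<close>

definition corrector_eq :: "(real^'n \<Rightarrow> real^'n^'n) \<Rightarrow> 'n \<Rightarrow> (real^'n \<Rightarrow> real) \<Rightarrow> bool" where
  "corrector_eq A i w \<longleftrightarrow>
     (\<forall>\<phi>\<in>H1. (\<integral>q. grad \<phi> q \<bullet> (A q *v (axis i 1 + grad w q)) \<partial>torus) = 0)"

text \<open>The corrector is unique up to a null set; \<open>SOME\<close> picks a representative.\<close>

definition corrector :: "(real^'n \<Rightarrow> real^'n^'n) \<Rightarrow> 'n \<Rightarrow> real^'n \<Rightarrow> real" where
  "corrector A i = (SOME w. w \<in> H10 \<and> corrector_eq A i w)"

definition A_bar :: "(real^'n \<Rightarrow> real^'n^'n) \<Rightarrow> real^'n^'n" where
  "A_bar A = (\<chi> i j. \<integral>q. (axis i 1 + grad (corrector A i) q) \<bullet>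
                          (A q *v (axis j 1 + grad (corrector A j) q)) \<partial>torus)"

definition D_bar :: "(real^'n \<Rightarrow> real) \<Rightarrow> (real^'n \<Rightarrow> real^'n^'n) \<Rightarrow> real^'n^'n" where
  "D_bar V D = inverse (\<integral>q. exp (- V q) \<partial>torus) *\<^sub>R A_bar (\<lambda>q. exp (- V q) *\<^sub>R D q)"

definition Lambda_hom :: "(real^'n \<Rightarrow> real) \<Rightarrow> (real^'n \<Rightarrow> real^'n^'n) \<Rightarrow> real" where
  "Lambda_hom V D =
     Inf {(\<integral>q. grad u q \<bullet> (D_bar V D *v grad u q) \<partial>torus) / (\<integral>q. (u q)\<^sup>2 \<partial>torus) | u.
          u \<in> H10 \<and> nonzero u}"

definition Lambda_hom_star ::
    "(real^'n^'n \<Rightarrow> real) \<Rightarrow> real \<Rightarrow> real \<Rightarrow> real \<Rightarrow> (real^'n \<Rightarrow> real) \<Rightarrow> real" where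
  "Lambda_hom_star N p a b V = Sup (Lambda_hom V ` admissible N p a b V)"

end

theory Submission
  imports Defs
begin

text \<open>
  Averaging an admissible diffusion for the oscillating potential over the translations by \<open>j / k\<close>
  keeps it admissible and, by concavity, does not decrease its spectral gap; the averaged diffusion
  is \<open>E(k q)\<close> for some \<open>E\<close> admissible for \<open>V\<close>. Hence only two estimates are needed.

  Upper bound, uniform in \<open>E\<close>: the homogenized infimum is attained at \<open>cos (2 \<pi> m \<bullet> q)\<close> for a
  frequency \<open>m\<close> bounded in terms of \<open>a\<close> and \<open>b\<close>, and the first-order two-scale expansion of this
  function is a test function with error \<open>O(1 / k)\<close>: the leading terms average exactly, because
  \<open>f(k q)\<close> only has frequencies divisible by \<open>k\<close>.

  Lower bound, for a fixed \<open>D\<close>: if \<open>P\<^sub>j\<close> denotes the corrected unit vector fields and \<open>\<xi>\<close> the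
  projection of \<open>\<nabla>u\<close> to frequencies at most \<open>R\<close>, then expanding the nonnegative energy of
  \<open>\<nabla>u - \<Sum>\<^sub>j \<xi>\<^sub>j P\<^sub>j(k q)\<close> bounds the energy of \<open>u\<close> from below by the homogenized energy of its low
  frequencies. The cross term converges since the fluxes \<open>A P\<^sub>j\<close> are divergence free, and the
  high frequencies of \<open>u\<close> are controlled by the Poincare inequality. No compactness is used.
\<close>

section \<open>Smooth periodic functions\<close>

text \<open>The averaged coefficient changes with \<open>k\<close> and nothing controls how, so the
  constants of the upper bound may depend only on \<open>a\<close>, \<open>b\<close>, the bound of
  \<open>exp (- V)\<close> and its integral. All that is known about the correctors there comes from
  ellipticity. The lower bound needs only one nearly optimal diffusion, so its thresholds may depend
  on that diffusion. Coefficients are merely measurable, so correctors and their gradients are only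
  square integrable. The slowly varying factors that multiply them are therefore trigonometric
  polynomials: \<open>cosm m\<close> above, the projected gradient below. This keeps the products in
  L2 and, once \<open>k\<close> exceeds the frequencies, makes their averages exact. Concavity holds
  because the gap is an infimum of quotients linear in the diffusion; the norm constraint survives
  averaging since \<open>N\<close> to the power \<open>p\<close> is convex for
  \<open>1 \<le> p\<close>. Gradients are carried as explicit pairs \<open>H1g u g\<close>, so that
  the choice made by \<open>grad\<close> matters only almost everywhere. Dilation by
  \<open>k\<close> and averaging over its fibres, \<open>fold_torus\<close>, are adjoint, and weak
  equations change scale through this pair.\<close>

lemma partial_deriv_eqI: "(f has_derivative f') (at x) \<Longrightarrow> partial_deriv i f x = f' (axis i 1)"
  unfolding partial_deriv_def using frechet_derivative_at by force

lemma partial_deriv_const [simp]: "partial_deriv i (\<lambda>_. c) = (\<lambda>_. 0)"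
  by (auto simp: fun_eq_iff intro!: partial_deriv_eqI[THEN trans] derivative_eq_intros)

lemma partial_deriv_add:
  assumes "f differentiable (at x)" "g differentiable (at x)"
  shows "partial_deriv i (\<lambda>x. f x + g x) x = partial_deriv i f x + partial_deriv i g x"
  using has_derivative_add[OF assms[unfolded frechet_derivative_works]]
  by (subst partial_deriv_eqI) (auto simp: partial_deriv_def)

lemma partial_deriv_mult:
  assumes "f differentiable (at x)" "g differentiable (at x)"
  shows "partial_deriv i (\<lambda>x. f x * g x) x = f x * partial_deriv i g x + partial_deriv i f x * g x"
  using has_derivative_mult[OF assms[unfolded frechet_derivative_works]]
  by (subst partial_deriv_eqI) (auto simp: partial_deriv_def)

lemma affine_has_derivative:
  fixes f :: "real^'n \<Rightarrow> real"
  assumes "f differentiable (at (c *\<^sub>R x + s))"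
  shows "((\<lambda>x. f (c *\<^sub>R x + s)) has_derivative
           (\<lambda>h. frechet_derivative f (at (c *\<^sub>R x + s)) (c *\<^sub>R h))) (at x)"
proof -
  have 1: "((\<lambda>x. c *\<^sub>R x + s) has_derivative (\<lambda>h. c *\<^sub>R h)) (at x)"
    by (auto intro!: derivative_eq_intros)
  show ?thesis
    using diff_chain_at[OF 1 assms[unfolded frechet_derivative_works]] by (simp add: o_def)
qed

lemma partial_deriv_affine:
  fixes f :: "real^'n \<Rightarrow> real"
  assumes "f differentiable (at (c *\<^sub>R x + s))"
  shows "partial_deriv i (\<lambda>x. f (c *\<^sub>R x + s)) x = c * partial_deriv i f (c *\<^sub>R x + s)"
proof -
  interpret linear "frechet_derivative f (at (c *\<^sub>R x + s))"
    using assms frechet_derivative_works has_derivative_linear by blast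
  show ?thesis
    unfolding partial_deriv_eqI[OF affine_has_derivative[OF assms]]
    unfolding partial_deriv_def by (simp add: scale)
qed

lemma C_k_Suc_differentiable: "C_k (Suc k) f \<Longrightarrow> f differentiable (at x)"
  by simp

text \<open>\<open>C_k (Suc k)\<close> asks for differentiability and recurses into the derivatives,
  so monotonicity in \<open>k\<close> needs an induction; at the bottom, differentiability supplies
  continuity.\<close>

lemma C_k_SucD: "C_k (Suc k) f \<Longrightarrow> C_k k f"
proof (induction k arbitrary: f)
  case 0
  then show ?case
    by (simp add: continuous_at_imp_continuous_on differentiable_imp_continuous_within)
next
  case (Suc k)
  then show ?case by (metis C_k.simps(2))
qed

lemma C_k_const: "C_k k (\<lambda>_. c)"
  by (induction k arbitrary: c) auto

lemma C_k_add: "C_k k f \<Longrightarrow> C_k k g \<Longrightarrow> C_k k (\<lambda>x. f x + g x)"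
proof (induction k arbitrary: f g)
  case (Suc k)
  have "partial_deriv i (\<lambda>x. f x + g x) = (\<lambda>x. partial_deriv i f x + partial_deriv i g x)" for i
    using Suc.prems by (intro ext partial_deriv_add) auto
  then show ?case using Suc by auto
qed (auto intro: continuous_intros)

lemma C_k_mult: "C_k k f \<Longrightarrow> C_k k g \<Longrightarrow> C_k k (\<lambda>x. f x * g x)"
proof (induction k arbitrary: f g)
  case (Suc k)
  have 1: "partial_deriv i (\<lambda>x. f x * g x) = (\<lambda>x. f x * partial_deriv i g x + partial_deriv i f x * g x)" for i
    using Suc.prems by (intro ext partial_deriv_mult) auto
  have "C_k k f" "C_k k g" using Suc.prems C_k_SucD by blast+
  then show ?case using Suc unfolding C_k.simps 1 by (auto intro!: C_k_add)
qed (auto intro: continuous_intros)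

lemma C_k_affine:
  fixes f :: "real^'n \<Rightarrow> real"
  shows "C_k k f \<Longrightarrow> C_k k (\<lambda>x. f (c *\<^sub>R x + s))"
proof (induction k arbitrary: f)
  case 0
  have "continuous_on UNIV (f \<circ> (\<lambda>x. c *\<^sub>R x + s))"
    using 0 by (intro continuous_on_compose continuous_intros) (auto intro: continuous_on_subset)
  then show ?case by (simp add: o_def)
next
  case (Suc k)
  have 1: "partial_deriv i (\<lambda>x. f (c *\<^sub>R x + s)) = (\<lambda>x. c * partial_deriv i f (c *\<^sub>R x + s))" for i
    using Suc.prems by (intro ext partial_deriv_affine) auto
  have "(\<lambda>x. f (c *\<^sub>R x + s)) differentiable at x" for x
    using Suc.prems by (intro differentiableI[OF affine_has_derivative]) simp
  then show ?case using Suc unfolding C_k.simps 1 by (intro conjI allI C_k_mult C_k_const) auto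
qed

text \<open>The factor is a natural number, so \<open>real k *\<^sub>R z\<close> is again a lattice
  vector.\<close>

lemma periodic_dilate:
  fixes f :: "real^'n \<Rightarrow> 'b"
  shows "periodic f \<Longrightarrow> periodic (\<lambda>x. f (real k *\<^sub>R x + s))"
  unfolding periodic_def
proof (intro allI impI)
  fix q z :: "real^'n"
  assume f: "\<forall>q z. (\<forall>i. z $ i \<in> \<int>) \<longrightarrow> f (q + z) = f q" and z: "\<forall>i. z $ i \<in> \<int>"
  have "\<forall>i. (real k *\<^sub>R z) $ i \<in> \<int>" using z by auto
  then have "f ((real k *\<^sub>R q + s) + real k *\<^sub>R z) = f (real k *\<^sub>R q + s)"
    using f by blast
  then show "f (real k *\<^sub>R (q + z) + s) = f (real k *\<^sub>R q + s)"
    by (simp add: scaleR_add_right algebra_simps)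
qed

lemma periodic_comp: "periodic f \<Longrightarrow> periodic (\<lambda>q. h (f q))"
  by (simp add: periodic_def)

lemma periodic_comp2: "periodic f \<Longrightarrow> periodic g \<Longrightarrow> periodic (\<lambda>q. h (f q) (g q))"
  by (simp add: periodic_def)

lemma smooth_torus_periodic: "smooth_torus f \<Longrightarrow> periodic f"
  by (simp add: smooth_torus_def)

lemma smooth_torus_differentiable: "smooth_torus f \<Longrightarrow> f differentiable (at x)"
  using C_k_Suc_differentiable smooth_torus_def by blast

lemma smooth_torus_continuous: "smooth_torus f \<Longrightarrow> continuous_on S f"
  using C_k.simps(1) continuous_on_subset smooth_torus_def by blast

lemma smooth_torus_measurable: "smooth_torus f \<Longrightarrow> f \<in> borel_measurable lebesgue"
  by (intro measurable_completion) (simp add: borel_measurable_continuous_onI smooth_torus_continuous)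

lemma smooth_torus_partial_deriv:
  assumes f: "smooth_torus f" shows "smooth_torus (partial_deriv i f)"
proof -
  have "periodic (partial_deriv i f)"
    unfolding periodic_def
  proof (intro allI impI)
    fix q z :: "real^'a" assume z: "\<forall>i. z $ i \<in> \<int>"
    \<comment> \<open>Periodicity says that \<open>f\<close> equals its translate; writing the
      translate as an affine composition with factor 1 lets \<open>partial_deriv_affine\<close>
      differentiate this identity.\<close>
    have "f = (\<lambda>x. f (1 *\<^sub>R x + z))"
      using smooth_torus_periodic[OF f] z by (auto simp: periodic_def)
    then have "partial_deriv i f q = partial_deriv i (\<lambda>x. f (1 *\<^sub>R x + z)) q" by simp
    also have "\<dots> = 1 * partial_deriv i f (1 *\<^sub>R q + z)"
      by (rule partial_deriv_affine) (rule smooth_torus_differentiable[OF f])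
    finally show "partial_deriv i f (q + z) = partial_deriv i f q" by simp
  qed
  then show ?thesis using f unfolding smooth_torus_def by (metis C_k.simps(2))
qed

lemma smooth_torus_const: "smooth_torus (\<lambda>_. c)"
  by (simp add: smooth_torus_def periodic_def C_k_const)

lemma smooth_torus_add: "smooth_torus f \<Longrightarrow> smooth_torus g \<Longrightarrow> smooth_torus (\<lambda>x. f x + g x)"
  by (simp add: smooth_torus_def periodic_def C_k_add)

lemma smooth_torus_mult: "smooth_torus f \<Longrightarrow> smooth_torus g \<Longrightarrow> smooth_torus (\<lambda>x. f x * g x)"
  by (simp add: smooth_torus_def periodic_def C_k_mult)

lemma smooth_torus_cmult: "smooth_torus f \<Longrightarrow> smooth_torus (\<lambda>x. c * f x)"
  by (intro smooth_torus_mult smooth_torus_const)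

lemma smooth_torus_dilate: "smooth_torus f \<Longrightarrow> smooth_torus (\<lambda>x. f (real k *\<^sub>R x + s))"
  by (simp add: smooth_torus_def periodic_dilate C_k_affine)

lemma partial_deriv_smooth_mult:
  "smooth_torus f \<Longrightarrow> smooth_torus g \<Longrightarrow>
    partial_deriv i (\<lambda>x. f x * g x) x = f x * partial_deriv i g x + partial_deriv i f x * g x"
  by (intro partial_deriv_mult smooth_torus_differentiable)

section \<open>Integer vectors and the real characters of the torus\<close>

definition ivec :: "int^'n \<Rightarrow> real^'n" where
  "ivec m = (\<chi> i. real_of_int (m $ i))"

lemma ivec_nth [simp]: "ivec m $ i = real_of_int (m $ i)"
  by (simp add: ivec_def)

lemma ivec_add: "ivec (m + n) = ivec m + ivec n"
  and ivec_diff: "ivec (m - n) = ivec m - ivec n"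
  and ivec_minus: "ivec (- m) = - ivec m"
  and ivec_0 [simp]: "ivec 0 = 0"
  by (auto simp: vec_eq_iff)

lemma ivec_eq_iff [simp]: "ivec m = ivec n \<longleftrightarrow> m = n"
  by (auto simp: vec_eq_iff)

lemma integer_vector_eq_ivec:
  assumes "\<forall>i. z $ i \<in> \<int>" obtains m where "z = ivec m"
proof -
  have "z = ivec (\<chi> i. \<lfloor>z $ i\<rfloor>)" using assms by (auto simp: vec_eq_iff elim!: Ints_cases)
  then show ?thesis using that by blast
qed

lemma periodic_ivec_iff: "periodic f \<longleftrightarrow> (\<forall>q m. f (q + ivec m) = f q)"
proof
  assume f: "\<forall>q m. f (q + ivec m) = f q"
  show "periodic f" unfolding periodic_def
    by (metis f integer_vector_eq_ivec)
qed (simp add: periodic_def)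

text \<open>The real part of the character of frequency \<open>m\<close>, with \<open>sinm\<close>
  as imaginary part. Only real functions occur, so the pair replaces complex exponentials, at the
  price that \<open>m\<close> and \<open>- m\<close> give the same functions up to sign.\<close>

definition cosm :: "int^'n \<Rightarrow> real^'n \<Rightarrow> real" where
  "cosm m q = cos (2 * pi * (ivec m \<bullet> q))"

definition sinm :: "int^'n \<Rightarrow> real^'n \<Rightarrow> real" where
  "sinm m q = sin (2 * pi * (ivec m \<bullet> q))"

lemma cos_2pi_int: "cos (2 * pi * real_of_int j) = 1" and sin_2pi_int: "sin (2 * pi * real_of_int j) = 0"
  using cos_int_2pin[of j] sin_int_2pin[of j] by simp_all

lemma ivec_inner_Ints: "ivec m \<bullet> ivec n \<in> \<int>"
  by (auto simp: inner_vec_def)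

lemma periodic_cosm: "periodic (cosm m)"
  unfolding periodic_ivec_iff
proof (intro allI)
  fix q :: "real^'a" and n :: "int^'a"
  obtain j where "ivec m \<bullet> ivec n = of_int j" using ivec_inner_Ints Ints_cases by metis
  then show "cosm m (q + ivec n) = cosm m q"
    by (simp add: cosm_def inner_add_right distrib_left cos_add cos_2pi_int sin_2pi_int)
qed

lemma periodic_sinm: "periodic (sinm m)"
  unfolding periodic_ivec_iff
proof (intro allI)
  fix q :: "real^'a" and n :: "int^'a"
  obtain j where "ivec m \<bullet> ivec n = of_int j" using ivec_inner_Ints Ints_cases by metis
  then show "sinm m (q + ivec n) = sinm m q"
    by (simp add: sinm_def inner_add_right distrib_left sin_add cos_2pi_int sin_2pi_int)
qed

lemma cosm_has_derivative:
  "(cosm m has_derivative (\<lambda>h. - (2 * pi * (ivec m \<bullet> h)) * sinm m q)) (at q)"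
  unfolding cosm_def sinm_def by (auto intro!: derivative_eq_intros)

lemma sinm_has_derivative:
  "(sinm m has_derivative (\<lambda>h. 2 * pi * (ivec m \<bullet> h) * cosm m q)) (at q)"
  unfolding cosm_def sinm_def by (auto intro!: derivative_eq_intros)

lemma partial_deriv_cosm: "partial_deriv i (cosm m) = (\<lambda>q. - (2 * pi * real_of_int (m $ i)) * sinm m q)"
  by (rule ext, subst partial_deriv_eqI[OF cosm_has_derivative]) (simp add: inner_axis)

lemma partial_deriv_sinm: "partial_deriv i (sinm m) = (\<lambda>q. 2 * pi * real_of_int (m $ i) * cosm m q)"
  by (rule ext, subst partial_deriv_eqI[OF sinm_has_derivative]) (simp add: inner_axis)

text \<open>Both families are treated in one induction because differentiation exchanges
  them.\<close>

lemma C_k_cosm_sinm: "C_k k (cosm m) \<and> C_k k (sinm m)"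
proof (induction k)
  case 0
  show ?case
    unfolding C_k.simps cosm_def sinm_def by (intro conjI continuous_intros)
next
  case (Suc k)
  have "cosm m differentiable (at x)" "sinm m differentiable (at x)" for x
    by (rule differentiableI[OF cosm_has_derivative] differentiableI[OF sinm_has_derivative])+
  then show ?case
    using Suc unfolding C_k.simps partial_deriv_cosm partial_deriv_sinm
    by (intro conjI allI C_k_mult C_k_const) auto
qed

lemma smooth_torus_cosm: "smooth_torus (cosm m)" and smooth_torus_sinm: "smooth_torus (sinm m)"
  using C_k_cosm_sinm periodic_cosm periodic_sinm by (auto simp: smooth_torus_def)

section \<open>Integration over the torus\<close>

lemma nn_integral_lebesgue_affine:
  fixes f :: "'a::euclidean_space \<Rightarrow> ennreal"
  assumes f: "f \<in> borel_measurable lebesgue" and c: "c \<noteq> 0"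
  shows "(\<integral>\<^sup>+x. f x \<partial>lebesgue) = ennreal (\<bar>c\<bar> ^ DIM('a)) * (\<integral>\<^sup>+x. f (c *\<^sub>R x + t) \<partial>lebesgue)"
proof -
  let ?T = "\<lambda>x. t + (\<Sum>j\<in>Basis. (c * (x \<bullet> j)) *\<^sub>R j) :: 'a"
  \<comment> \<open>The change of variables is taken for diagonal maps written in coordinates; with
    all diagonal entries equal to \<open>c\<close> it is the affine map wanted here.\<close>
  have T: "?T x = c *\<^sub>R x + t" for x
    by (simp add: scaleR_scaleR[symmetric] scaleR_sum_right[symmetric] euclidean_representation del: scaleR_scaleR)
  have m: "?T \<in> lebesgue \<rightarrow>\<^sub>M lebesgue" using lebesgue_affine_measurable[of "\<lambda>_. c" t] c by simp
  have "(\<integral>\<^sup>+x. f x \<partial>lebesgue) = (\<integral>\<^sup>+x. f x \<partial>density (distr lebesgue lebesgue ?T) (\<lambda>_. (\<Prod>j\<in>(Basis::'a set). \<bar>c\<bar>)))"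
    using lebesgue_affine_euclidean[of "\<lambda>_. c" t] c by simp
  also have "\<dots> = (\<integral>\<^sup>+x. ennreal (\<bar>c\<bar> ^ DIM('a)) * f (?T x) \<partial>lebesgue)"
    using f m by (subst nn_integral_density) (auto simp: nn_integral_distr)
  also have "\<dots> = ennreal (\<bar>c\<bar> ^ DIM('a)) * (\<integral>\<^sup>+x. f (?T x) \<partial>lebesgue)"
    using f m by (intro nn_integral_cmult measurable_compose[OF m])
  finally show ?thesis by (simp only: T)
qed

text \<open>Completeness of the measure is the only issue: an invertible affine map pulls null sets
  back to null sets.\<close>

lemma measurable_lebesgue_affine:
  fixes f :: "'a::euclidean_space \<Rightarrow> 'b::topological_space"
  assumes f: "f \<in> borel_measurable lebesgue" and c: "c \<noteq> 0"
  shows "(\<lambda>x. f (c *\<^sub>R x + t)) \<in> borel_measurable lebesgue"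
proof -
  let ?T = "\<lambda>x. t + (\<Sum>j\<in>Basis. (c * (x \<bullet> j)) *\<^sub>R j) :: 'a"
  have T: "?T x = c *\<^sub>R x + t" for x
    by (simp add: scaleR_scaleR[symmetric] scaleR_sum_right[symmetric] euclidean_representation del: scaleR_scaleR)
  have m: "?T \<in> lebesgue \<rightarrow>\<^sub>M lebesgue" using lebesgue_affine_measurable[of "\<lambda>_. c" t] c by simp
  show ?thesis using measurable_compose[OF m f] by (simp only: T)
qed

lemma lebesgue_affine_vimage:
  fixes S :: "'a::euclidean_space set"
  assumes S: "S \<in> sets lebesgue" and c: "c \<noteq> 0"
  shows "{x. c *\<^sub>R x + t \<in> S} \<in> sets lebesgue"
proof -
  have "(\<lambda>x. indicator S (c *\<^sub>R x + t) :: real) \<in> borel_measurable lebesgue"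
    using S c by (intro measurable_lebesgue_affine) auto
  moreover have "(\<lambda>x. indicator S (c *\<^sub>R x + t) :: real) = indicator {x. c *\<^sub>R x + t \<in> S}"
    by (auto simp: indicator_def)
  ultimately show ?thesis by (simp add: borel_measurable_indicator_iff)
qed

text \<open>Half open, so that its integer translates are disjoint and cover the space exactly;
  translates of the closed cube used by \<open>torus\<close> overlap on faces.\<close>

definition unit_cell :: "(real^'n) set" where
  "unit_cell = {q. \<forall>i. 0 \<le> q $ i \<and> q $ i < 1}"

lemma unit_cell_lebesgue [measurable]: "unit_cell \<in> sets lebesgue"
proof -
  have eq: "unit_cell = (\<Inter>i. {q::real^'n. 0 \<le> q $ i} \<inter> {q. q $ i < 1})"
    by (auto simp: unit_cell_def)
  have "closed {q::real^'n. 0 \<le> q $ i}" "open {q::real^'n. q $ i < 1}" for i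
    by (rule closed_Collect_le open_Collect_less continuous_intros)+
  then have b: "{q::real^'n. 0 \<le> q $ i} \<inter> {q. q $ i < 1} \<in> sets lebesgue" for i
    using lborelD borel_closed borel_open by (blast intro: sets.Int)
  show ?thesis unfolding eq by (rule sets.finite_INT[OF finite_class.finite UNIV_not_empty b])
qed

lemma AE_unit_cell: "AE q in lebesgue. q \<in> unit_cell \<longleftrightarrow> q \<in> cbox (0::real^'n) 1"
proof -
  have "negligible (cbox (0::real^'n) 1 - box 0 1)" by (rule negligible_frontier_interval)
  then have "AE q in lebesgue. q \<notin> cbox (0::real^'n) 1 - box 0 1"
    using AE_not_in negligible_iff_null_sets by blast
  then show ?thesis
    by eventually_elim (force simp: unit_cell_def cbox_def box_def Basis_vec_def inner_axis mem_box_cart less_imp_le)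
qed

lemma nn_integral_torus:
  "(\<integral>\<^sup>+q. f q \<partial>torus) = (\<integral>\<^sup>+q. indicator unit_cell q * f q \<partial>lebesgue)"
proof -
  have "(\<integral>\<^sup>+q. f q \<partial>torus) = (\<integral>\<^sup>+q. f q * indicator (cbox 0 1) q \<partial>lebesgue)"
    by (subst nn_integral_restrict_space) auto
  also have "\<dots> = (\<integral>\<^sup>+q. indicator unit_cell q * f q \<partial>lebesgue)"
    using AE_unit_cell by (intro nn_integral_cong_AE) (auto simp: indicator_def mult.commute elim!: eventually_mono)
  finally show ?thesis .
qed

lemma emeasure_torus: "emeasure (torus::(real^'n) measure) (space torus) = 1"
proof -
  have "emeasure lebesgue (cbox (0::real^'n) 1) = 1"
  proof -
    have 1: "(1::real^'n) \<bullet> b = 1" if "b \<in> Basis" for b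
      using that by (auto simp: Basis_vec_def inner_axis)
    show ?thesis using emeasure_lborel_cbox[of "0::real^'n" 1] by (simp add: 1)
  qed
  then show ?thesis
    by (simp add: emeasure_restrict_space)
qed

lemma finite_measure_torus [simp]: "finite_measure (torus :: (real^'n) measure)"
  by (rule finite_measureI, subst emeasure_torus) simp

text \<open>The only \<open>m\<close> that counts is the componentwise floor of
  \<open>q\<close>.\<close>

lemma unit_cell_tiling: "(\<integral>\<^sup>+m. indicator unit_cell (q - ivec m) \<partial>count_space UNIV) = (1::ennreal)"
proof -
  have 1: "q - ivec m \<in> unit_cell \<longleftrightarrow> m = (\<chi> i. \<lfloor>q $ i\<rfloor>)" for m
  proof -
    have "m = (\<chi> i. \<lfloor>q $ i\<rfloor>) \<longleftrightarrow> (\<forall>i. \<lfloor>q $ i\<rfloor> = m $ i)" by (auto simp: vec_eq_iff)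
    then show ?thesis by (simp add: unit_cell_def floor_eq_iff algebra_simps)
  qed
  show ?thesis
    by (subst nn_integral_count_space'[where A = "{\<chi> i. \<lfloor>q $ i\<rfloor>}"]) (auto simp: 1 split: split_indicator)
qed

text \<open>Cut \<open>K\<close> along the lattice cells and move every piece into
  \<open>unit_cell\<close>; periodicity leaves \<open>f\<close> unchanged, so each point is counted
  as often as its lattice orbit meets \<open>K\<close>. Invariance under translation and dilation
  then becomes a counting problem.\<close>

lemma nn_integral_unfold:
  fixes f :: "real^'n \<Rightarrow> ennreal"
  assumes f: "f \<in> borel_measurable lebesgue" "periodic f" and K: "K \<in> sets lebesgue"
  shows "(\<integral>\<^sup>+q. indicator K q * f q \<partial>lebesgue) =
    (\<integral>\<^sup>+q. indicator unit_cell q * f q * (\<integral>\<^sup>+m. indicator K (q + ivec m) \<partial>count_space UNIV) \<partial>lebesgue)"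
proof -
  note measurable_lebesgue_affine[of _ 1, simplified, measurable]
  have uc: "(\<lambda>q. indicator unit_cell (q - ivec m) :: ennreal) \<in> borel_measurable lebesgue" for m :: "int^'n"
    using measurable_lebesgue_affine[of "indicator unit_cell :: real^'n \<Rightarrow> ennreal" 1 "- ivec m"] by simp
  have Kc: "(\<lambda>q. indicator K (q + ivec m) :: ennreal) \<in> borel_measurable lebesgue" for m :: "int^'n"
    using measurable_lebesgue_affine[of "indicator K :: real^'n \<Rightarrow> ennreal" 1 "ivec m"] K by simp
  note [measurable] = f(1) uc Kc K
  have "(\<integral>\<^sup>+q. indicator K q * f q \<partial>lebesgue) =
      (\<integral>\<^sup>+q. \<integral>\<^sup>+m. indicator unit_cell (q - ivec m) * (indicator K q * f q) \<partial>count_space UNIV \<partial>lebesgue)"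
    by (simp add: nn_integral_multc unit_cell_tiling)
  also have "\<dots> = (\<integral>\<^sup>+m. \<integral>\<^sup>+q. indicator unit_cell (q - ivec m) * (indicator K q * f q) \<partial>lebesgue \<partial>count_space UNIV)"
    by (rule nn_integral_count_space_nn_integral) auto
  also have "\<dots> = (\<integral>\<^sup>+m. \<integral>\<^sup>+q. indicator unit_cell q * f q * indicator K (q + ivec m) \<partial>lebesgue \<partial>count_space UNIV)"
  proof (rule nn_integral_cong)
    fix m :: "int^'n"
    have "(\<integral>\<^sup>+q. indicator unit_cell (q - ivec m) * (indicator K q * f q) \<partial>lebesgue) =
      (\<integral>\<^sup>+q. indicator unit_cell (q + ivec m - ivec m) * (indicator K (q + ivec m) * f (q + ivec m)) \<partial>lebesgue)"
      by (subst nn_integral_lebesgue_affine[where c = 1 and t = "ivec m"]) auto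
    also have "\<dots> = (\<integral>\<^sup>+q. indicator unit_cell q * f q * indicator K (q + ivec m) \<partial>lebesgue)"
      using f(2) by (simp add: periodic_ivec_iff mult_ac)
    finally show "(\<integral>\<^sup>+q. indicator unit_cell (q - ivec m) * (indicator K q * f q) \<partial>lebesgue) =
      (\<integral>\<^sup>+q. indicator unit_cell q * f q * indicator K (q + ivec m) \<partial>lebesgue)" .
  qed
  also have "\<dots> = (\<integral>\<^sup>+q. \<integral>\<^sup>+m. indicator unit_cell q * f q * indicator K (q + ivec m) \<partial>count_space UNIV \<partial>lebesgue)"
    by (rule nn_integral_count_space_nn_integral[symmetric]) auto
  also have "\<dots> = (\<integral>\<^sup>+q. indicator unit_cell q * f q * (\<integral>\<^sup>+m. indicator K (q + ivec m) \<partial>count_space UNIV) \<partial>lebesgue)"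
    by (simp add: nn_integral_cmult)
  finally show ?thesis .
qed

text \<open>The shifted cell contains exactly one point of every lattice orbit, so the counting
  factor in \<open>nn_integral_unfold\<close> is 1.\<close>

lemma nn_integral_torus_translate:
  fixes f :: "real^'n \<Rightarrow> ennreal"
  assumes f: "f \<in> borel_measurable lebesgue" "periodic f"
  shows "(\<integral>\<^sup>+q. f (q + s) \<partial>torus) = (\<integral>\<^sup>+q. f q \<partial>torus)"
proof -
  let ?K = "{q. q - s \<in> unit_cell}"
  have K: "?K \<in> sets lebesgue"
    using lebesgue_affine_vimage[of unit_cell 1 "- s"] by simp
  have ind: "indicator ?K q = (indicator unit_cell (q - s) :: ennreal)" for q
    by (simp add: indicator_def)
  have m: "(\<lambda>q. indicator unit_cell (q - s) * f q) \<in> borel_measurable lebesgue"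
    using K f(1) by (simp flip: ind)
  have tile: "(\<integral>\<^sup>+m. indicator unit_cell (q + ivec m - s) \<partial>count_space UNIV) = (1::ennreal)" for q :: "real^'n"
  proof -
    have "(\<integral>\<^sup>+m. indicator unit_cell (q + ivec m - s) \<partial>count_space (UNIV::(int^'n) set)) =
      (\<integral>\<^sup>+m. indicator unit_cell ((q - s) - ivec m) \<partial>count_space UNIV :: ennreal)"
      by (subst nn_integral_bij_count_space[where g = "uminus" and A = UNIV and B = UNIV, symmetric])
         (auto simp: ivec_minus algebra_simps bij_uminus)
    then show ?thesis by (simp add: unit_cell_tiling)
  qed
  have "(\<integral>\<^sup>+q. f (q + s) \<partial>torus) = (\<integral>\<^sup>+q. indicator unit_cell (q + s - s) * f (q + s) \<partial>lebesgue)"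
    by (simp add: nn_integral_torus)
  also have "\<dots> = (\<integral>\<^sup>+q. indicator unit_cell (q - s) * f q \<partial>lebesgue)"
    using nn_integral_lebesgue_affine[OF m, of 1 s] by simp
  also have "\<dots> = (\<integral>\<^sup>+q. indicator unit_cell q * f q * (\<integral>\<^sup>+m. indicator unit_cell (q + ivec m - s) \<partial>count_space UNIV) \<partial>lebesgue)"
    using nn_integral_unfold[OF f K] by (simp only: ind)
  finally show ?thesis by (simp add: nn_integral_torus tile)
qed

text \<open>Representatives of the lattice modulo \<open>k\<close>: the shifts by
  \<open>j / k\<close> with \<open>j\<close> in \<open>cells k\<close> move a point through its
  fibre under dilation by \<open>k\<close>.\<close>

definition cells :: "nat \<Rightarrow> (int^'n) set" where
  "cells k = {m. \<forall>i. 0 \<le> m $ i \<and> m $ i < int k}"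

lemma bij_betw_cells: "bij_betw (\<lambda>f. \<chi> i. int (f i)) (UNIV \<rightarrow>\<^sub>E {..<k}) (cells k :: (int^'n) set)"
  by (rule bij_betw_byWitness[where f' = "\<lambda>m i. nat (m $ i)"])
     (auto simp: cells_def PiE_def extensional_def vec_eq_iff fun_eq_iff nat_less_iff)

lemma finite_cells: "finite (cells k :: (int^'n) set)"
  using bij_betw_cells bij_betw_finite finite_PiE by (metis finite finite_lessThan)

lemma card_cells: "card (cells k :: (int^'n) set) = k ^ CARD('n)"
  using bij_betw_same_card[OF bij_betw_cells[where 'n = 'n]] by (simp add: card_PiE)

text \<open>The dilated cell contains \<open>k ^ CARD('n)\<close> points of every lattice orbit, and
  this number cancels the Jacobian of the dilation.\<close>

lemma nn_integral_torus_dilate: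
  fixes f :: "real^'n \<Rightarrow> ennreal"
  assumes f: "f \<in> borel_measurable lebesgue" "periodic f" and k: "k > 0"
  shows "(\<integral>\<^sup>+q. f (real k *\<^sub>R q) \<partial>torus) = (\<integral>\<^sup>+q. f q \<partial>torus)"
proof -
  let ?c = "inverse (real k)"
  let ?K = "{q. ?c *\<^sub>R q \<in> unit_cell}"
  have K: "?K \<in> sets lebesgue"
    using lebesgue_affine_vimage[of unit_cell ?c 0] k by simp
  have ind: "indicator ?K q = (indicator unit_cell (?c *\<^sub>R q) :: ennreal)" for q
    by (simp add: indicator_def)
  have m: "(\<lambda>q. indicator unit_cell (?c *\<^sub>R q) * f q) \<in> borel_measurable lebesgue"
    using K f(1) by (simp flip: ind)
  have tile: "(\<integral>\<^sup>+m. indicator ?K (q + ivec m) \<partial>count_space UNIV) = of_nat (k ^ CARD('n))"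
    if q: "q \<in> unit_cell" for q :: "real^'n"
  proof -
    have 1: "?c *\<^sub>R (q + ivec m) \<in> unit_cell \<longleftrightarrow> m \<in> cells k" for m
    proof -
      have "0 \<le> q $ i + real_of_int (m $ i) \<and> q $ i + real_of_int (m $ i) < real k \<longleftrightarrow> 0 \<le> m $ i \<and> m $ i < int k" for i
      proof -
        \<comment> \<open>With \<open>q\<close> in the unit cell, \<open>m $ i\<close> is this
          floor, which turns the real inequalities into integer ones.\<close>
        have "\<lfloor>q $ i + real_of_int (m $ i)\<rfloor> = m $ i"
          using q by (simp add: unit_cell_def floor_eq_iff)
        then show ?thesis
          using zero_le_floor[of "q $ i + real_of_int (m $ i)"] floor_less_iff[of "q $ i + real_of_int (m $ i)" "int k"] by simp
      qed
      then show ?thesis using k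
        by (simp add: unit_cell_def cells_def zero_le_mult_iff field_simps)
    qed
    show ?thesis
      using 1 by (subst nn_integral_count_space'[where A = "cells k"])
        (auto simp: indicator_def finite_cells card_cells)
  qed
  have "(\<integral>\<^sup>+q. f (real k *\<^sub>R q) \<partial>torus) =
      (\<integral>\<^sup>+q. indicator unit_cell (?c *\<^sub>R (real k *\<^sub>R q)) * f (real k *\<^sub>R q) \<partial>lebesgue)"
    using k by (simp add: nn_integral_torus)
  then have "of_nat (k ^ CARD('n)) * (\<integral>\<^sup>+q. f (real k *\<^sub>R q) \<partial>torus) =
      (\<integral>\<^sup>+q. indicator unit_cell (?c *\<^sub>R q) * f q \<partial>lebesgue)"
    using nn_integral_lebesgue_affine[OF m, of "real k" 0] k
    by (simp add: ennreal_of_nat_eq_real_of_nat)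
  also have "\<dots> = (\<integral>\<^sup>+q. indicator unit_cell q * f q * (\<integral>\<^sup>+m. indicator ?K (q + ivec m) \<partial>count_space UNIV) \<partial>lebesgue)"
    using nn_integral_unfold[OF f K] by (simp only: ind)
  also have "\<dots> = (\<integral>\<^sup>+q. of_nat (k ^ CARD('n)) * (indicator unit_cell q * f q) \<partial>lebesgue)"
    using tile by (intro nn_integral_cong) (auto simp: indicator_def mult_ac)
  also have "\<dots> = of_nat (k ^ CARD('n)) * (\<integral>\<^sup>+q. f q \<partial>torus)"
    using f(1) by (subst nn_integral_cmult) (auto simp: nn_integral_torus)
  finally show ?thesis
    using k by (subst (asm) ennreal_mult_cancel_left) (auto simp: of_nat_eq_0_iff ennreal_of_nat_eq_real_of_nat)
qed


section \<open>Translations and dilations under the Bochner integral\<close>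

lemma measurable_torusI: "f \<in> borel_measurable lebesgue \<Longrightarrow> f \<in> borel_measurable torus"
  by (rule measurable_restrict_space1)

text \<open>Both claims reduce to nonnegative integrals: integrability is tested on the norm, the
  integral on positive and negative parts. The map \<open>T\<close> is abstract so that translation
  and dilation share the argument.\<close>

lemma integral_torus_preserving:
  fixes f :: "real^'n \<Rightarrow> real"
  assumes nn: "\<And>h :: real^'n \<Rightarrow> ennreal. h \<in> borel_measurable lebesgue \<Longrightarrow> periodic h \<Longrightarrow>
      (\<integral>\<^sup>+q. h (T q) \<partial>torus) = (\<integral>\<^sup>+q. h q \<partial>torus)"
    and f: "f \<in> borel_measurable lebesgue" "periodic f" "(\<lambda>q. f (T q)) \<in> borel_measurable lebesgue"
  shows "integrable torus (\<lambda>q. f (T q)) \<longleftrightarrow> integrable torus f"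
    and "(\<integral>q. f (T q) \<partial>torus) = (\<integral>q. f q \<partial>torus)"
proof -
  have p: "periodic (\<lambda>q. ennreal (g (f q)))" "(\<lambda>q. ennreal (g (f q))) \<in> borel_measurable lebesgue"
    if [measurable]: "g \<in> borel_measurable borel" for g
    using f(1,2) by (auto simp: periodic_def)
  have nn': "(\<integral>\<^sup>+q. ennreal (g (f (T q))) \<partial>torus) = (\<integral>\<^sup>+q. ennreal (g (f q)) \<partial>torus)"
    if "g \<in> borel_measurable borel" for g
    using nn[OF p(2,1)[OF that]] .
  show int: "integrable torus (\<lambda>q. f (T q)) \<longleftrightarrow> integrable torus f"
    using f nn'[of norm] by (simp add: integrable_iff_bounded measurable_torusI)
  show "(\<integral>q. f (T q) \<partial>torus) = (\<integral>q. f q \<partial>torus)"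
  proof (cases "integrable torus f")
    case True
    then show ?thesis
      using int nn'[of "\<lambda>x. x"] nn'[of uminus] by (simp add: real_lebesgue_integral_def)
  next
    case False
    then show ?thesis using int by (simp add: not_integrable_integral_eq)
  qed
qed

lemma measurable_lebesgue_translate:
  fixes f :: "'a::euclidean_space \<Rightarrow> 'b::topological_space"
  shows "f \<in> borel_measurable lebesgue \<Longrightarrow> (\<lambda>x. f (x + t)) \<in> borel_measurable lebesgue"
  using measurable_lebesgue_affine[of f 1 t] by simp

lemma measurable_lebesgue_dilate:
  fixes f :: "'a::euclidean_space \<Rightarrow> 'b::topological_space"
  shows "f \<in> borel_measurable lebesgue \<Longrightarrow> c \<noteq> 0 \<Longrightarrow> (\<lambda>x. f (c *\<^sub>R x)) \<in> borel_measurable lebesgue"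
  using measurable_lebesgue_affine[of f c 0] by simp

lemma
  fixes f :: "real^'n \<Rightarrow> real"
  assumes f: "f \<in> borel_measurable lebesgue" "periodic f"
  shows integrable_torus_translate: "integrable torus (\<lambda>q. f (q + s)) \<longleftrightarrow> integrable torus f"
    and integral_torus_translate: "(\<integral>q. f (q + s) \<partial>torus) = (\<integral>q. f q \<partial>torus)"
  by (rule integral_torus_preserving nn_integral_torus_translate f measurable_lebesgue_translate; assumption?)+

lemma
  fixes f :: "real^'n \<Rightarrow> real"
  assumes f: "f \<in> borel_measurable lebesgue" "periodic f" and k: "k > 0"
  shows integrable_torus_dilate: "integrable torus (\<lambda>q. f (real k *\<^sub>R q)) \<longleftrightarrow> integrable torus f"
    and integral_torus_dilate: "(\<integral>q. f (real k *\<^sub>R q) \<partial>torus) = (\<integral>q. f q \<partial>torus)"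
proof -
  have "(\<lambda>q. f (real k *\<^sub>R q)) \<in> borel_measurable lebesgue"
    using f k by (intro measurable_lebesgue_dilate) auto
  note * = integral_torus_preserving[where T = "\<lambda>q. real k *\<^sub>R q", OF nn_integral_torus_dilate[OF _ _ k] f this]
  show "integrable torus (\<lambda>q. f (real k *\<^sub>R q)) \<longleftrightarrow> integrable torus f"
    "(\<integral>q. f (real k *\<^sub>R q) \<partial>torus) = (\<integral>q. f q \<partial>torus)"
    using * by simp_all
qed

lemma sub_floor_mem_cbox: "q - ivec (\<chi> i. \<lfloor>q $ i\<rfloor>) \<in> cbox 0 1"
proof -
  have "0 \<le> q $ i - real_of_int \<lfloor>q $ i\<rfloor> \<and> q $ i - real_of_int \<lfloor>q $ i\<rfloor> \<le> 1" for i
    by linarith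
  then show ?thesis by (simp add: mem_box_cart)
qed

section \<open>Almost everywhere statements for periodic properties\<close>

lemma AE_torus_iff: "(AE q in torus. P q) \<longleftrightarrow> (AE q in lebesgue. q \<in> cbox 0 1 \<longrightarrow> P q)"
  by (subst AE_restrict_space_iff) auto

lemma AE_torusI: "AE q in lebesgue. P q \<Longrightarrow> AE q in torus. P q"
  unfolding AE_torus_iff by auto

text \<open>The exceptional set in the cube has countably many lattice translates, whose union is
  still null and catches every exceptional point. The global form is what affine maps can
  transport.\<close>

lemma AE_torus_periodicD:
  fixes P :: "real^'n \<Rightarrow> bool"
  assumes P: "AE q in torus. P q" and per: "periodic P"
  shows "AE q in lebesgue. P q"
proof -
  have "AE q in lebesgue. q - ivec m \<in> cbox 0 1 \<longrightarrow> P (q - ivec m)" for m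
  proof -
    obtain S where S: "S \<in> null_sets lebesgue" "{q. \<not> (q \<in> cbox 0 1 \<longrightarrow> P q)} \<subseteq> S"
      using P[unfolded AE_torus_iff] unfolding eventually_ae_filter by auto
    then have "(+) (ivec m) ` S \<in> null_sets lebesgue"
      by (simp add: negligible_iff_null_sets[symmetric] negligible_translation)
    moreover have "{q. \<not> (q - ivec m \<in> cbox 0 1 \<longrightarrow> P (q - ivec m))} \<subseteq> (+) (ivec m) ` S"
    proof
      fix q assume "q \<in> {q. \<not> (q - ivec m \<in> cbox 0 1 \<longrightarrow> P (q - ivec m))}"
      then have "q - ivec m \<in> S" using S(2) by blast
      then show "q \<in> (+) (ivec m) ` S" by (metis add.commute diff_add_cancel imageI)
    qed
    ultimately show ?thesis by (auto simp: eventually_ae_filter)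
  qed
  then have "AE q in lebesgue. \<forall>m. q - ivec m \<in> cbox 0 1 \<longrightarrow> P (q - ivec m)"
    by (simp add: AE_all_countable)
  then show ?thesis
  proof eventually_elim
    case (elim q)
    have "q - ivec (\<chi> i. \<lfloor>q $ i\<rfloor>) \<in> cbox 0 1" by (rule sub_floor_mem_cbox)
    then have "P (q - ivec (\<chi> i. \<lfloor>q $ i\<rfloor>))" using elim by blast
    then show "P q" using per unfolding periodic_ivec_iff by (metis diff_add_cancel)
  qed
qed

text \<open>The new exceptional set lies in the image of the old one under the inverse affine map,
  and differentiable maps send null sets to null sets.\<close>

lemma AE_lebesgue_affine:
  fixes P :: "'a::euclidean_space \<Rightarrow> bool"
  assumes P: "AE q in lebesgue. P q" and c: "c \<noteq> 0"
  shows "AE q in lebesgue. P (c *\<^sub>R q + t)"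
proof -
  obtain S where S: "S \<in> null_sets lebesgue" "{q. \<not> P q} \<subseteq> S"
    using P unfolding eventually_ae_filter by auto
  have "((\<lambda>q. inverse c *\<^sub>R (q - t)) has_derivative (\<lambda>h. inverse c *\<^sub>R h)) (at x)" for x
    by (auto intro!: derivative_eq_intros)
  then have "(\<lambda>q. inverse c *\<^sub>R (q - t)) differentiable_on S"
    by (meson differentiableI differentiable_at_imp_differentiable_on)
  then have "negligible ((\<lambda>q. inverse c *\<^sub>R (q - t)) ` S)"
    using S(1) negligible_iff_null_sets[of S] by (intro negligible_differentiable_image_negligible) simp_all
  then have "(\<lambda>q. inverse c *\<^sub>R (q - t)) ` S \<in> null_sets lebesgue"
    by (simp add: negligible_iff_null_sets)
  moreover have "{q. \<not> P (c *\<^sub>R q + t)} \<subseteq> (\<lambda>q. inverse c *\<^sub>R (q - t)) ` S"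
  proof
    fix q assume "q \<in> {q. \<not> P (c *\<^sub>R q + t)}"
    then have "c *\<^sub>R q + t \<in> S" using S(2) by blast
    moreover have "q = inverse c *\<^sub>R (c *\<^sub>R q + t - t)" using c by simp
    ultimately show "q \<in> (\<lambda>q. inverse c *\<^sub>R (q - t)) ` S" by (rule rev_image_eqI)
  qed
  ultimately show ?thesis by (auto simp: eventually_ae_filter)
qed

lemma AE_torus_affine:
  fixes P :: "real^'n \<Rightarrow> bool"
  assumes "AE q in torus. P q" "periodic P" "c \<noteq> 0"
  shows "AE q in torus. P (c *\<^sub>R q + t)"
  by (rule AE_torusI[OF AE_lebesgue_affine[OF AE_torus_periodicD[OF assms(1,2)] assms(3)]])

section \<open>Averages over the fibres of dilation by \<open>k\<close>\<close>

lemma sum_cells_shift: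
  fixes G :: "int^'n \<Rightarrow> 'a::comm_monoid_add"
  assumes G: "\<And>j z. G (j + (\<chi> i. int k * z $ i)) = G j" and k: "k > 0"
  shows "(\<Sum>j\<in>cells k. G (j + m)) = (\<Sum>j\<in>cells k. G j)"
proof (rule sum.reindex_bij_witness[of _ "\<lambda>j. \<chi> i. (j $ i - m $ i) mod int k" "\<lambda>j. \<chi> i. (j $ i + m $ i) mod int k"])
  fix j :: "int^'n" assume j: "j \<in> cells k"
  show "(\<chi> i. ((\<chi> i. (j $ i + m $ i) mod int k) $ i - m $ i) mod int k) = j"
    "(\<chi> i. ((\<chi> i. (j $ i - m $ i) mod int k) $ i + m $ i) mod int k) = j"
    using j by (auto simp: vec_eq_iff cells_def mod_simps)
  show "(\<chi> i. (j $ i + m $ i) mod int k) \<in> cells k" "(\<chi> i. (j $ i - m $ i) mod int k) \<in> cells k"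
    using k by (auto simp: cells_def)
  have "j + m = (\<chi> i. (j $ i + m $ i) mod int k) + (\<chi> i. int k * (\<chi> i. (j $ i + m $ i) div int k) $ i)"
    by (auto simp: vec_eq_iff)
  then show "G (\<chi> i. (j $ i + m $ i) mod int k) = G (j + m)"
    using G by metis
qed

text \<open>The mean of \<open>F\<close> over the \<open>k ^ CARD('n)\<close> preimages of
  \<open>y\<close> under dilation by \<open>k\<close>, that is, the transfer operator of this map.
  It is adjoint to composition with the dilation, see \<open>integral_dilate_mult\<close>, and
  evaluated at \<open>k q\<close> it averages \<open>F\<close> over the translations by
  \<open>j / k\<close>.\<close>

definition fold_torus :: "nat \<Rightarrow> (real^'n \<Rightarrow> 'b::real_vector) \<Rightarrow> real^'n \<Rightarrow> 'b" where
  "fold_torus k F y = inverse (real (k ^ CARD('n))) *\<^sub>R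
     (\<Sum>j\<in>cells k. F (inverse (real k) *\<^sub>R y + inverse (real k) *\<^sub>R ivec j))"

lemma periodic_cells:
  assumes F: "periodic F" and k: "k > 0"
  shows "F (y + inverse (real k) *\<^sub>R ivec (j + (\<chi> i. int k * z $ i))) = F (y + inverse (real k) *\<^sub>R ivec j)"
proof -
  have "inverse (real k) *\<^sub>R ivec (j + (\<chi> i. int k * z $ i)) = inverse (real k) *\<^sub>R ivec j + ivec z"
    using k by (auto simp: vec_eq_iff field_simps)
  then show ?thesis using F unfolding periodic_ivec_iff by (metis add.assoc)
qed

lemma periodic_fold:
  fixes F :: "real^'n \<Rightarrow> 'b::real_vector"
  assumes F: "periodic F" and k: "k > 0" shows "periodic (fold_torus k F)"
  unfolding periodic_ivec_iff
proof (intro allI)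
  fix q :: "real^'n" and m :: "int^'n"
  let ?G = "\<lambda>j. F (inverse (real k) *\<^sub>R q + inverse (real k) *\<^sub>R ivec j)"
  have "(\<Sum>j\<in>cells k. ?G (j + m)) = (\<Sum>j\<in>cells k. ?G j)"
    by (rule sum_cells_shift[OF periodic_cells[OF F k] k])
  then show "fold_torus k F (q + ivec m) = fold_torus k F q"
    by (simp add: fold_torus_def ivec_add scaleR_add_right add_ac)
qed

lemma fold_measurable:
  fixes F :: "real^'n \<Rightarrow> 'b::euclidean_space"
  assumes "F \<in> borel_measurable lebesgue" "k > 0"
  shows "fold_torus k F \<in> borel_measurable lebesgue"
  unfolding fold_torus_def[abs_def]
  using assms by (intro borel_measurable_scaleR borel_measurable_const borel_measurable_sum measurable_lebesgue_affine) auto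

text \<open>A function of \<open>k q\<close> is constant on each fibre and therefore leaves the
  average.\<close>

lemma fold_scaleR_dilate:
  assumes G: "periodic G" and k: "k > 0"
  shows "fold_torus k (\<lambda>q. G (real k *\<^sub>R q) *\<^sub>R F q) y = G y *\<^sub>R fold_torus k F y"
proof -
  have "G (real k *\<^sub>R (inverse (real k) *\<^sub>R y + inverse (real k) *\<^sub>R ivec j)) = G y" for j
    using k G by (simp add: scaleR_add_right periodic_ivec_iff)
  then show ?thesis by (simp add: fold_torus_def scaleR_sum_right[symmetric] mult.commute)
qed

lemma fold_dilate_eq:
  fixes F :: "real^'n \<Rightarrow> 'b::real_vector"
  assumes F: "periodic F" and k: "k > 0"
  shows "fold_torus k F (real k *\<^sub>R q) = inverse (real (k ^ CARD('n))) *\<^sub>R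
     (\<Sum>j\<in>cells k. F (q + inverse (real k) *\<^sub>R ivec (j :: int^'n)))"
  using k by (simp add: fold_torus_def)

lemma
  fixes F :: "real^'n \<Rightarrow> real"
  assumes F: "periodic F" "F \<in> borel_measurable lebesgue" "integrable torus F" and k: "k > 0"
  shows integrable_fold: "integrable torus (fold_torus k F)"
    and integral_fold: "(\<integral>q. fold_torus k F q \<partial>torus) = (\<integral>q. F q \<partial>torus)"
proof -
  note P = periodic_fold[OF F(1) k] and M = fold_measurable[OF F(2) k]
  have i: "integrable torus (\<lambda>q. F (q + s))" for s
    using integrable_torus_translate[OF F(2,1)] F(3) by simp
  \<comment> \<open>After dilation the fold is a finite mean of translates of \<open>F\<close>, for
    which integrability and the integral are known; dilation invariance carries both back.\<close>
  have "integrable torus (\<lambda>q. fold_torus k F (real k *\<^sub>R q))"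
    unfolding fold_dilate_eq[OF F(1) k] using i by simp
  then show "integrable torus (fold_torus k F)"
    using integrable_torus_dilate[OF M P k] by simp
  have "(\<integral>q. fold_torus k F q \<partial>torus) = (\<integral>q. fold_torus k F (real k *\<^sub>R q) \<partial>torus)"
    using integral_torus_dilate[OF M P k] by simp
  also have "\<dots> = (\<integral>q. F q \<partial>torus)"
    unfolding fold_dilate_eq[OF F(1) k] using i k
    by (simp add: integral_sum integral_torus_translate[OF F(2,1)] card_cells)
  finally show "(\<integral>q. fold_torus k F q \<partial>torus) = (\<integral>q. F q \<partial>torus)" .
qed

text \<open>Folding preserves the integral and lets the factor \<open>f (k q)\<close> out: this is
  the adjointness of dilation and folding.\<close>

lemma integral_dilate_mult:
  fixes f h :: "real^'n \<Rightarrow> real"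
  assumes f: "periodic f" "f \<in> borel_measurable lebesgue" and h: "periodic h" "h \<in> borel_measurable lebesgue"
    and int: "integrable torus (\<lambda>q. f (real k *\<^sub>R q) * h q)" and k: "k > 0"
  shows "(\<integral>q. f (real k *\<^sub>R q) * h q \<partial>torus) = (\<integral>q. f q * fold_torus k h q \<partial>torus)"
proof -
  have p: "periodic (\<lambda>q. f (real k *\<^sub>R q) * h q)"
    using periodic_dilate[OF f(1), of k 0] h(1) by (simp add: periodic_def)
  have m: "(\<lambda>q. f (real k *\<^sub>R q) * h q) \<in> borel_measurable lebesgue"
    using f(2) h(2) k by (intro borel_measurable_times measurable_lebesgue_dilate) auto
  have "(\<integral>q. f (real k *\<^sub>R q) * h q \<partial>torus) = (\<integral>q. fold_torus k (\<lambda>q. f (real k *\<^sub>R q) *\<^sub>R h q) q \<partial>torus)"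
    using integral_fold[OF p m int k] by simp
  also have "\<dots> = (\<integral>q. f q * fold_torus k h q \<partial>torus)"
    by (subst fold_scaleR_dilate[OF f(1) k]) simp
  finally show ?thesis .
qed

text \<open>The fibre is invariant under a step \<open>1 / k\<close> along axis \<open>i\<close>,
  but this step rotates the pair of cosine and sine sums by \<open>\<alpha>\<close>. As
  \<open>k\<close> does not divide \<open>m $ i\<close>, the rotation is not the identity and its
  only fixed vector is zero.\<close>

lemma fold_cosm_sinm:
  assumes m: "\<not> int k dvd m $ i" and k: "k > 0"
  shows "fold_torus k (cosm m) y = 0 \<and> fold_torus k (sinm m) y = 0"
proof -
  let ?p = "\<lambda>j. inverse (real k) *\<^sub>R y + inverse (real k) *\<^sub>R ivec (j :: int^'a)"
  let ?e = "(\<chi> l. if l = i then 1 else 0) :: int^'a"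
  define \<alpha> where "\<alpha> = 2 * pi * (real_of_int (m $ i) / real k)"
  define C where "C = (\<Sum>j\<in>cells k. cosm m (?p j))"
  define S where "S = (\<Sum>j\<in>cells k. sinm m (?p j))"
  have "ivec m \<bullet> ivec ?e = real_of_int (m $ i)"
    by (simp add: inner_vec_def if_distrib cong: if_cong)
  then have e: "2 * pi * (ivec m \<bullet> ?p (j + ?e)) = 2 * pi * (ivec m \<bullet> ?p j) + \<alpha>" for j
  proof -
    have "ivec m \<bullet> ?p (j + ?e) = ivec m \<bullet> ?p j + real_of_int (m $ i) / real k"
      unfolding ivec_add scaleR_add_right inner_add_right inner_scaleR_right \<open>ivec m \<bullet> ivec ?e = _\<close>
      by (simp add: divide_inverse)
    then show ?thesis by (simp only: \<alpha>_def distrib_left)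
  qed
  have 1: "C = C * cos \<alpha> - S * sin \<alpha>"
  proof -
    have "C = (\<Sum>j\<in>cells k. cosm m (?p (j + ?e)))"
      unfolding C_def by (rule sum_cells_shift[symmetric, OF periodic_cells[OF periodic_cosm k] k])
    also have "\<dots> = C * cos \<alpha> - S * sin \<alpha>"
      unfolding cosm_def e by (simp add: cos_add C_def S_def cosm_def sinm_def sum_distrib_right sum_subtractf)
    finally show ?thesis .
  qed
  have 2: "S = S * cos \<alpha> + C * sin \<alpha>"
  proof -
    have "S = (\<Sum>j\<in>cells k. sinm m (?p (j + ?e)))"
      unfolding S_def by (rule sum_cells_shift[symmetric, OF periodic_cells[OF periodic_sinm k] k])
    also have "\<dots> = S * cos \<alpha> + C * sin \<alpha>"
      unfolding sinm_def e by (simp add: sin_add C_def S_def cosm_def sinm_def sum_distrib_right sum.distrib)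
    finally show ?thesis .
  qed
  have "cos \<alpha> \<noteq> 1"
  proof
    assume "cos \<alpha> = 1"
    then obtain n where "\<alpha> = of_int n * 2 * pi" using cos_one_2pi_int by auto
    then have "real_of_int (m $ i) = real_of_int (n * int k)" using k by (simp add: \<alpha>_def field_simps)
    then have "m $ i = n * int k" by linarith
    then show False using m by simp
  qed
  \<comment> \<open>The squared length of the pair, weighted by \<open>1 - cos \<alpha>\<close>,
    vanishes by the two fixed point equations.\<close>
  moreover have "(C\<^sup>2 + S\<^sup>2) * (1 - cos \<alpha>) = C * (C - C * cos \<alpha>) + S * (S - S * cos \<alpha>)"
    by (simp add: power2_eq_square algebra_simps)
  moreover have "C - C * cos \<alpha> = - (S * sin \<alpha>)" "S - S * cos \<alpha> = C * sin \<alpha>" using 1 2 by linarith+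
  ultimately have "C\<^sup>2 + S\<^sup>2 = 0" by simp
  then have "C = 0" "S = 0" by (simp_all add: sum_power2_eq_zero_iff)
  then show ?thesis by (simp add: fold_torus_def C_def S_def)
qed

section \<open>Square integrable functions on the torus\<close>

definition L2 :: "(real^'n \<Rightarrow> 'a::euclidean_space) \<Rightarrow> bool" where
  "L2 f \<longleftrightarrow> periodic f \<and> f \<in> borel_measurable lebesgue \<and> integrable torus (\<lambda>q. (norm (f q))\<^sup>2)"

abbreviation sqn :: "(real^'n \<Rightarrow> 'a::euclidean_space) \<Rightarrow> real" where
  "sqn f \<equiv> (\<integral>q. (norm (f q))\<^sup>2 \<partial>torus)"

lemma L2D:
  assumes "L2 f"
  shows "periodic f" "f \<in> borel_measurable lebesgue" "integrable torus (\<lambda>q. (norm (f q))\<^sup>2)"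
    "f \<in> borel_measurable torus"
  using assms by (auto simp: L2_def intro: measurable_torusI)

lemma sqn_nonneg: "0 \<le> sqn f"
  by (rule Bochner_Integration.integral_nonneg) simp

lemma L2_dominated:
  fixes f :: "real^'n \<Rightarrow> 'a::euclidean_space"
  assumes "periodic f" "f \<in> borel_measurable lebesgue" "integrable torus h"
    "\<And>q. (norm (f q))\<^sup>2 \<le> h q"
  shows "L2 f"
  using assms measurable_torusI[OF assms(2)] unfolding L2_def
  by (intro conjI Bochner_Integration.integrable_bound[OF assms(3)] borel_measurable_power borel_measurable_norm)
     (auto intro!: AE_I2 order_trans[OF _ abs_ge_self])

lemma norm_add_sq_le: "(norm (x + y))\<^sup>2 \<le> 2 * (norm x)\<^sup>2 + 2 * (norm (y::'a::real_inner))\<^sup>2"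
proof -
  have "0 \<le> (norm (x - y))\<^sup>2" by simp
  then show ?thesis by (simp add: power2_norm_eq_inner inner_simps inner_commute)
qed

lemma L2_add: "L2 f \<Longrightarrow> L2 g \<Longrightarrow> L2 (\<lambda>q. f q + g q)"
  by (rule L2_dominated[where h = "\<lambda>q. 2 * (norm (f q))\<^sup>2 + 2 * (norm (g q))\<^sup>2"])
     (auto simp: L2_def periodic_def norm_add_sq_le)

lemma L2_bounded_scaleR:
  fixes f :: "real^'n \<Rightarrow> 'a::euclidean_space" and h :: "real^'n \<Rightarrow> real"
  assumes "L2 f" "periodic h" "h \<in> borel_measurable lebesgue" "\<And>q. \<bar>h q\<bar> \<le> C"
  shows "L2 (\<lambda>q. h q *\<^sub>R f q)"
proof (rule L2_dominated[where h = "\<lambda>q. C\<^sup>2 * (norm (f q))\<^sup>2"])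
  show "(norm (h q *\<^sub>R f q))\<^sup>2 \<le> C\<^sup>2 * (norm (f q))\<^sup>2" for q
    using assms(4)[of q] by (auto simp: power_mult_distrib abs_le_square_iff[symmetric] intro!: mult_right_mono)
qed (use assms in \<open>auto simp: L2_def periodic_def\<close>)

lemma L2_scaleR: "L2 f \<Longrightarrow> L2 (\<lambda>q. c *\<^sub>R f q)"
  by (rule L2_bounded_scaleR[where h = "\<lambda>_. c" and C = "\<bar>c\<bar>"]) (auto simp: periodic_def)

lemma L2_cmult: "L2 f \<Longrightarrow> L2 (\<lambda>q. c * f q :: real)"
  using L2_scaleR[of f c] by simp

lemma L2_uminus: "L2 f \<Longrightarrow> L2 (\<lambda>q. - f q)"
  using L2_scaleR[of f "-1"] by simp

lemma L2_diff: "L2 f \<Longrightarrow> L2 g \<Longrightarrow> L2 (\<lambda>q. f q - g q)"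
  using L2_add[OF _ L2_uminus, of f g] by simp

lemma L2_const: "L2 (\<lambda>_. c)"
  by (auto simp: L2_def periodic_def finite_measure.integrable_const)

lemma L2_sum: "(\<And>j. j \<in> J \<Longrightarrow> L2 (f j)) \<Longrightarrow> L2 (\<lambda>q. \<Sum>j\<in>J. f j q)"
  by (induction J rule: infinite_finite_induct) (auto intro: L2_add L2_const)

lemma L2_inner:
  fixes f g :: "real^'n \<Rightarrow> 'a::euclidean_space"
  assumes "L2 f" "L2 g" shows "integrable torus (\<lambda>q. f q \<bullet> g q)"
proof (rule Bochner_Integration.integrable_bound)
  show "integrable torus (\<lambda>q. (norm (f q))\<^sup>2 + (norm (g q))\<^sup>2)"
    using assms L2D(3) by (intro Bochner_Integration.integrable_add) auto
  have "\<bar>f q \<bullet> g q\<bar> \<le> (norm (f q))\<^sup>2 + (norm (g q))\<^sup>2" for q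
  proof -
    have "\<bar>f q \<bullet> g q\<bar> \<le> norm (f q) * norm (g q)" by (rule Cauchy_Schwarz_ineq2)
    moreover have "0 \<le> (norm (f q) - norm (g q))\<^sup>2" by simp
    then have "2 * (norm (f q) * norm (g q)) \<le> (norm (f q))\<^sup>2 + (norm (g q))\<^sup>2"
      by (simp add: power2_diff algebra_simps)
    moreover have "0 \<le> norm (f q) * norm (g q)" by simp
    ultimately show ?thesis by linarith
  qed
  then show "AE q in torus. norm (f q \<bullet> g q) \<le> norm ((norm (f q))\<^sup>2 + (norm (g q))\<^sup>2)"
    by (auto intro: order_trans[OF _ abs_ge_self])
qed (use assms[THEN L2D(4)] in measurable)

lemma L2_mult:
  fixes f g :: "real^'n \<Rightarrow> real"
  shows "L2 f \<Longrightarrow> L2 g \<Longrightarrow> integrable torus (\<lambda>q. f q * g q)"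
  using L2_inner[of f g] by simp

lemma L2_integrable:
  fixes f :: "real^'n \<Rightarrow> real"
  shows "L2 f \<Longrightarrow> integrable torus f"
  using L2_mult[OF _ L2_const[of "1::real"], of f] by simp

lemma L2_component: "L2 g \<Longrightarrow> L2 (\<lambda>q. g q \<bullet> b)" if "norm b \<le> 1"
proof (rule L2_dominated[where h = "\<lambda>q. (norm (g q))\<^sup>2"])
  assume g: "L2 g"
  show "(norm (g q \<bullet> b))\<^sup>2 \<le> (norm (g q))\<^sup>2" for q
  proof -
    have "\<bar>g q \<bullet> b\<bar> \<le> norm (g q) * norm b" by (rule Cauchy_Schwarz_ineq2)
    also have "\<dots> \<le> norm (g q)" using that by (simp add: mult_left_le)
    finally show ?thesis by (simp add: abs_le_square_iff[symmetric])
  qed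
qed (auto simp: L2_def periodic_def)

lemma L2_nth: "L2 g \<Longrightarrow> L2 (\<lambda>q. g q $ i :: real)"
  using L2_component[of "axis i 1" g] by (simp add: inner_axis)

lemma smooth_torus_bounded:
  fixes h :: "real^'n \<Rightarrow> real"
  assumes "smooth_torus h" obtains C where "\<And>q. \<bar>h q\<bar> \<le> C"
proof -
  have "bounded (h ` cbox 0 1)"
    using smooth_torus_continuous[OF assms] compact_continuous_image compact_cbox compact_imp_bounded by blast
  then obtain C where C: "\<And>q. q \<in> cbox 0 1 \<Longrightarrow> \<bar>h q\<bar> \<le> C" by (auto simp: bounded_iff)
  have "\<bar>h q\<bar> \<le> C" for q
  proof -
    have "q - ivec (\<chi> i. \<lfloor>q $ i\<rfloor>) \<in> cbox 0 1" by (rule sub_floor_mem_cbox)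
    then have "\<bar>h (q - ivec (\<chi> i. \<lfloor>q $ i\<rfloor>))\<bar> \<le> C" by (rule C)
    then show ?thesis using smooth_torus_periodic[OF assms] unfolding periodic_ivec_iff by (metis diff_add_cancel)
  qed
  then show ?thesis using that by blast
qed

lemma L2_mult_smooth:
  fixes h :: "real^'n \<Rightarrow> real"
  assumes "L2 f" "smooth_torus h" shows "L2 (\<lambda>q. h q *\<^sub>R f q)"
proof -
  obtain C where "\<And>q. \<bar>h q\<bar> \<le> C" using smooth_torus_bounded[OF assms(2)] by blast
  then show ?thesis
    using assms by (intro L2_bounded_scaleR[where C = C] smooth_torus_periodic smooth_torus_measurable)
qed

lemma integrable_mult_smooth:
  fixes f h :: "real^'n \<Rightarrow> real"
  assumes f: "integrable torus f" and h: "smooth_torus h"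
  shows "integrable torus (\<lambda>q. f q * h q)"
proof -
  obtain C where C: "\<And>q. \<bar>h q\<bar> \<le> C" using smooth_torus_bounded[OF h] by blast
  show ?thesis
  proof (rule Bochner_Integration.integrable_bound[where f = "\<lambda>q. C * f q"])
    show "(\<lambda>q. f q * h q) \<in> borel_measurable torus"
      using f measurable_torusI[OF smooth_torus_measurable[OF h]] by measurable
    have "\<bar>f q\<bar> * \<bar>h q\<bar> \<le> \<bar>C\<bar> * \<bar>f q\<bar>" for q
      using C[of q] by (subst mult.commute) (intro mult_right_mono, auto)
    then show "AE q in torus. norm (f q * h q) \<le> norm (C * f q)" by (simp add: abs_mult)
  qed (use f in simp)
qed

lemma L2_smooth: "smooth_torus h \<Longrightarrow> L2 h"
  using L2_mult_smooth[OF L2_const[of "1::real"], of h] by simp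

lemma norm_periodic_sq:
  assumes "L2 f"
  shows "periodic (\<lambda>q. (norm (f q))\<^sup>2)" "(\<lambda>q. (norm (f q))\<^sup>2) \<in> borel_measurable lebesgue"
  using assms by (auto simp: L2_def periodic_def)

lemma
  assumes f: "L2 f"
  shows L2_translate: "L2 (\<lambda>q. f (q + s))" and sqn_translate: "sqn (\<lambda>q. f (q + s)) = sqn f"
proof -
  have "periodic (\<lambda>q. f (q + s))" using periodic_dilate[of f 1 s] f by (simp add: L2_def)
  then show "L2 (\<lambda>q. f (q + s))"
    using f integrable_torus_translate[OF norm_periodic_sq(2,1)[OF f]]
    by (auto simp: L2_def measurable_lebesgue_translate)
qed (rule integral_torus_translate[OF norm_periodic_sq(2,1)[OF f]])

lemma
  assumes f: "L2 f" and k: "k > 0"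
  shows L2_dilate: "L2 (\<lambda>q. f (real k *\<^sub>R q))" and sqn_dilate: "sqn (\<lambda>q. f (real k *\<^sub>R q)) = sqn f"
proof -
  have "periodic (\<lambda>q. f (real k *\<^sub>R q))" using periodic_dilate[of f k 0] f by (simp add: L2_def)
  then show "L2 (\<lambda>q. f (real k *\<^sub>R q))"
    using f k integrable_torus_dilate[OF norm_periodic_sq(2,1)[OF f] k]
    by (auto simp: L2_def measurable_lebesgue_dilate)
qed (rule integral_torus_dilate[OF norm_periodic_sq(2,1)[OF f] k])

lemma L2_fold:
  fixes f :: "real^'n \<Rightarrow> 'a::euclidean_space"
  assumes f: "L2 f" and k: "k > 0"
  shows "L2 (fold_torus k f)"
proof -
  note M = fold_measurable[OF L2D(2)[OF f] k] and P = periodic_fold[OF L2D(1)[OF f] k]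
  have "L2 (\<lambda>q. fold_torus k f (real k *\<^sub>R q))"
    unfolding fold_dilate_eq[OF L2D(1)[OF f] k] by (intro L2_scaleR L2_sum L2_translate f)
  then have "integrable torus (\<lambda>q. (norm (fold_torus k f (real k *\<^sub>R q)))\<^sup>2)" by (rule L2D)
  then show ?thesis
    using M P integrable_torus_dilate[OF _ periodic_comp[OF P, of "\<lambda>x. (norm x)\<^sup>2"] k]
    by (auto simp: L2_def)
qed

text \<open>The common source of Cauchy-Schwarz for L2, of Cauchy-Schwarz for psd matrices and of
  the first variation bound in \<open>corrector_exists\<close>. The inequality is read off at the
  vertex; a negative leading coefficient is excluded by a large \<open>t\<close>.\<close>

lemma quadratic_nonneg_discriminant:
  fixes a b c :: real
  assumes "\<And>t. 0 \<le> a + 2 * t * b + t\<^sup>2 * c"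
  shows "b\<^sup>2 \<le> a * c"
proof (cases "c = 0")
  case True
  have "b = 0"
  proof (rule ccontr)
    assume "b \<noteq> 0"
    then show False using assms[of "- (a + 1) / (2 * b)"] True by (simp add: field_simps)
  qed
  then show ?thesis using True by simp
next
  case False
  have "c > 0"
  proof (rule ccontr)
    assume "\<not> c > 0"
    then have c: "c < 0" using False by simp
    \<comment> \<open>Large enough that \<open>- c * t\<close> exceeds
      \<open>\<bar>a\<bar> + 2 * \<bar>b\<bar>\<close>, and at least 1 so that
      \<open>t * \<bar>a\<bar>\<close> dominates \<open>a\<close>; the quadratic is then
      negative.\<close>
    define t where "t = (\<bar>a\<bar> + 2 * \<bar>b\<bar> + 1) / (- c) + 1"
    have "(\<bar>a\<bar> + 2 * \<bar>b\<bar> + 1) / (- c) \<ge> 0" using c by (intro divide_nonneg_pos) auto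
    then have t1: "t \<ge> 1" by (simp add: t_def)
    have "- c * t = \<bar>a\<bar> + 2 * \<bar>b\<bar> + 1 + - c" using c by (simp add: t_def field_simps)
    then have "t * (- c * t) > t * (\<bar>a\<bar> + 2 * \<bar>b\<bar>)" using t1 c by (intro mult_strict_left_mono) auto
    moreover have "t * \<bar>a\<bar> \<ge> 1 * \<bar>a\<bar>" using t1 by (intro mult_right_mono) auto
    then have "t * \<bar>a\<bar> \<ge> a" by linarith
    moreover have "t * \<bar>b\<bar> \<ge> t * b" using t1 by (intro mult_left_mono) auto
    ultimately show False using assms[of t] by (simp add: power2_eq_square algebra_simps)
  qed
  then have "0 \<le> (a + 2 * (- b / c) * b + (- b / c)\<^sup>2 * c) * c" using assms[of "- b / c"] by simp
  also have "\<dots> = a * c - b\<^sup>2" using False by (simp add: field_simps power2_eq_square)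
  finally show ?thesis by simp
qed

lemma sqn_add_scaleR:
  fixes f g :: "real^'n \<Rightarrow> 'a::euclidean_space"
  assumes "L2 f" "L2 g"
  shows "sqn (\<lambda>q. f q + t *\<^sub>R g q) = sqn f + 2 * t * (\<integral>q. f q \<bullet> g q \<partial>torus) + t\<^sup>2 * sqn g"
proof -
  have "(norm (f q + t *\<^sub>R g q))\<^sup>2 = (norm (f q))\<^sup>2 + 2 * t * (f q \<bullet> g q) + t\<^sup>2 * (norm (g q))\<^sup>2" for q
    unfolding power2_norm_eq_inner by (simp add: inner_simps inner_commute power2_eq_square algebra_simps)
  then show ?thesis using L2_inner[OF assms] assms[THEN L2D(3)] by simp
qed

lemma L2_Cauchy_Schwarz:
  fixes f g :: "real^'n \<Rightarrow> 'a::euclidean_space"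
  assumes "L2 f" "L2 g"
  shows "(\<integral>q. f q \<bullet> g q \<partial>torus)\<^sup>2 \<le> sqn f * sqn g"
proof (rule quadratic_nonneg_discriminant)
  fix t show "0 \<le> sqn f + 2 * t * (\<integral>q. f q \<bullet> g q \<partial>torus) + t\<^sup>2 * sqn g"
    using sqn_nonneg[of "\<lambda>q. f q + t *\<^sub>R g q"] unfolding sqn_add_scaleR[OF assms] .
qed

lemma L2_Cauchy_Schwarz_abs:
  fixes f g :: "real^'n \<Rightarrow> 'a::euclidean_space"
  assumes "L2 f" "L2 g"
  shows "\<bar>\<integral>q. f q \<bullet> g q \<partial>torus\<bar> \<le> sqrt (sqn f) * sqrt (sqn g)"
  using real_sqrt_le_mono[OF L2_Cauchy_Schwarz[OF assms]] by (simp add: real_sqrt_mult)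

lemma sqn_add_le:
  fixes f g :: "real^'n \<Rightarrow> 'a::euclidean_space"
  assumes "L2 f" "L2 g"
  shows "sqn (\<lambda>q. f q + g q) \<le> 2 * sqn f + 2 * sqn g"
proof -
  have "sqn (\<lambda>q. f q + g q) \<le> (\<integral>q. 2 * (norm (f q))\<^sup>2 + 2 * (norm (g q))\<^sup>2 \<partial>torus)"
    using assms[THEN L2D(3)] L2D(3)[OF L2_add[OF assms]]
    by (intro Bochner_Integration.integral_mono norm_add_sq_le) auto
  then show ?thesis using assms[THEN L2D(3)] by simp
qed

lemma sqn_AE_eq_0:
  assumes "L2 f" "sqn f = 0" shows "AE q in torus. f q = 0"
  using integral_nonneg_eq_0_iff_AE[OF L2D(3)[OF assms(1)]] assms(2) by simp

text \<open>Cauchy-Schwarz against 1, as the torus has total mass 1.\<close>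

lemma L2_integral_sq_le:
  fixes f :: "real^'n \<Rightarrow> real"
  assumes "L2 f" shows "(\<integral>q. f q \<partial>torus)\<^sup>2 \<le> (\<integral>q. (f q)\<^sup>2 \<partial>torus)"
proof -
  have "measure torus (space (torus :: (real^'n) measure)) = 1"
    unfolding measure_def emeasure_torus by simp
  then show ?thesis
    using L2_Cauchy_Schwarz[OF assms L2_const[of "1::real"]] by simp
qed

text \<open>Completeness in the form needed for minimizing sequences chosen with a rate: increments
  with L1 norm at most \<open>(1/2)^n\<close> are summable almost everywhere, which gives a
  pointwise limit, and Fatou's lemma makes it a limit in L2.\<close>

lemma L2_complete:
  fixes f :: "nat \<Rightarrow> real^'n \<Rightarrow> 'a::euclidean_space"
  assumes f: "\<And>n. L2 (f n)" and Cauchy: "\<And>n. sqn (\<lambda>q. f (Suc n) q - f n q) \<le> (1 / 4) ^ n"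
  shows "\<exists>g. L2 g \<and> (\<lambda>n. sqn (\<lambda>q. f n q - g q)) \<longlonglongrightarrow> 0"
proof -
  note Ld = L2_diff[OF f f]
  note mm [measurable] = L2D(4)[OF f]
  \<comment> \<open>The constant 4 reproduces itself:
    \<open>2 * 4 * (1/4)^(n+1) + 2 * (1/4)^n = 4 * (1/4)^n\<close>.\<close>
  have bound: "sqn (\<lambda>q. f (n + j) q - f n q) \<le> 4 * (1 / 4) ^ n" for n j
  proof (induction j arbitrary: n)
    case 0 then show ?case by simp
  next
    case (Suc j)
    have "sqn (\<lambda>q. f (n + Suc j) q - f n q) = sqn (\<lambda>q. (f (Suc n + j) q - f (Suc n) q) + (f (Suc n) q - f n q))"
      by simp
    also have "\<dots> \<le> 2 * sqn (\<lambda>q. f (Suc n + j) q - f (Suc n) q) + 2 * sqn (\<lambda>q. f (Suc n) q - f n q)"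
      by (rule sqn_add_le[OF Ld Ld])
    also have "\<dots> \<le> 2 * (4 * (1/4) ^ Suc n) + 2 * (1/4) ^ n"
      using Suc.IH[of "Suc n"] Cauchy[of n] by linarith
    finally show ?case by simp
  qed
  define h where "h = (\<lambda>n q. norm (f (Suc n) q - f n q))"
  have hint: "integrable torus (h n)" "(\<integral>q. h n q \<partial>torus) \<le> (1 / 2) ^ n" for n
  proof -
    have L: "L2 (h n)"
      using Ld[of "Suc n" n] unfolding h_def by (auto simp: L2_def periodic_def)
    then show "integrable torus (h n)" by (rule L2_integrable)
    have e: "((1 / 2 :: real) ^ n)\<^sup>2 = (1 / 4) ^ n"
      by (simp add: power2_eq_square flip: power_mult_distrib)
    have "(\<integral>q. h n q \<partial>torus)\<^sup>2 \<le> ((1 / 2) ^ n)\<^sup>2"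
      using L2_integral_sq_le[OF L] Cauchy[of n] e
      unfolding h_def by simp
    then show "(\<integral>q. h n q \<partial>torus) \<le> (1 / 2) ^ n"
      by (rule power2_le_imp_le) simp
  qed
  have "(\<integral>\<^sup>+q. (\<Sum>n. ennreal (h n q)) \<partial>torus) = (\<Sum>n. \<integral>\<^sup>+q. ennreal (h n q) \<partial>torus)"
    unfolding h_def by (rule nn_integral_suminf) measurable
  also have "\<dots> = (\<Sum>n. ennreal (\<integral>q. h n q \<partial>torus))"
    using hint(1) by (intro suminf_cong nn_integral_eq_integral) (auto simp: h_def)
  also have "\<dots> \<le> (\<Sum>n. ennreal ((1/2) ^ n))"
    using hint(2) by (intro suminf_le ennreal_leI) auto
  also have "\<dots> = ennreal (\<Sum>n. (1/2) ^ n)"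
    by (rule suminf_ennreal2) (auto intro: summable_geometric)
  finally have "(\<integral>\<^sup>+q. (\<Sum>n. ennreal (h n q)) \<partial>torus) \<noteq> \<infinity>"
    by (auto simp: top_unique)
  moreover have "(\<lambda>q. (\<Sum>n. ennreal (h n q))) \<in> borel_measurable torus"
    unfolding h_def by measurable
  ultimately have "AE q in torus. (\<Sum>n. ennreal (h n q)) \<noteq> \<infinity>"
    by (intro nn_integral_noteq_infinite)
  then have conv: "AE q in torus. convergent (\<lambda>n. f n q)"
  proof eventually_elim
    case (elim q)
    have "summable (\<lambda>n. h n q)"
      using elim by (intro summable_suminf_not_top) (auto simp: h_def)
    then have "summable (\<lambda>n. f (Suc n) q - f n q)"
      unfolding h_def by (rule summable_norm_cancel)
    then have "convergent (\<lambda>n. \<Sum>i<n. f (Suc i) q - f i q)" by (simp add: summable_iff_convergent)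
    then have "convergent (\<lambda>n. f 0 q + (\<Sum>i<n. f (Suc i) q - f i q))" by (intro convergent_add convergent_const)
    moreover have "f 0 q + (\<Sum>i<n. f (Suc i) q - f i q) = f n q" for n
      using sum_lessThan_telescope[of "\<lambda>i. f i q" n] by simp
    ultimately show ?case by (simp only:)
  qed
  \<comment> \<open>Where the sequence diverges, \<open>lim\<close> is an unspecified value, but it
    depends only on the sequence at \<open>q\<close>; so \<open>g\<close> is periodic everywhere,
    not just almost everywhere.\<close>
  define g where "g = (\<lambda>q. lim (\<lambda>n. f n q))"
  have gm: "g \<in> borel_measurable lebesgue"
    unfolding g_def using f by (intro borel_measurable_lim_metric) (auto simp: L2_def)
  note [measurable] = measurable_torusI[OF gm]
  have gp: "periodic g" using f by (simp add: g_def L2_def periodic_def)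
  have Fatou: "(\<integral>\<^sup>+q. ennreal ((norm (f n q - g q))\<^sup>2) \<partial>torus) \<le> ennreal (4 * (1/4) ^ n)" for n
  proof -
    have "(\<integral>\<^sup>+q. ennreal ((norm (f n q - g q))\<^sup>2) \<partial>torus) =
      (\<integral>\<^sup>+q. liminf (\<lambda>j. ennreal ((norm (f (n + j) q - f n q))\<^sup>2)) \<partial>torus)"
    proof (rule nn_integral_cong_AE, use conv in eventually_elim)
      case (elim q)
      then have "(\<lambda>j. f j q) \<longlonglongrightarrow> g q" unfolding g_def by (simp add: convergent_LIMSEQ_iff)
      then have "(\<lambda>j. f (n + j) q) \<longlonglongrightarrow> g q"
        using LIMSEQ_ignore_initial_segment[of "\<lambda>j. f j q" "g q" n] by (simp add: add.commute)
      then have "(\<lambda>j. ennreal ((norm (f (n + j) q - f n q))\<^sup>2)) \<longlonglongrightarrow> ennreal ((norm (g q - f n q))\<^sup>2)"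
        by (intro tendsto_intros)
      from lim_imp_Liminf[OF trivial_limit_sequentially this] show ?case
        unfolding norm_minus_commute[of "f n q" "g q"] by (rule sym)
    qed
    also have "\<dots> \<le> liminf (\<lambda>j. \<integral>\<^sup>+q. ennreal ((norm (f (n + j) q - f n q))\<^sup>2) \<partial>torus)"
      by (rule nn_integral_liminf) measurable
    also have "\<dots> = liminf (\<lambda>j. ennreal (sqn (\<lambda>q. f (n + j) q - f n q)))"
      using Ld L2D(3) by (subst nn_integral_eq_integral) auto
    also have "\<dots> \<le> ennreal (4 * (1/4) ^ n)"
    proof -
      have "liminf (\<lambda>j. ennreal (sqn (\<lambda>q. f (n + j) q - f n q))) \<le> liminf (\<lambda>j. ennreal (4 * (1/4) ^ n))"
        using bound by (intro Liminf_mono always_eventually allI ennreal_leI) auto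
      then show ?thesis by (simp add: Liminf_const)
    qed
    finally show ?thesis .
  qed
  have dL: "L2 (\<lambda>q. f n q - g q)" for n
  proof -
    have "integrable torus (\<lambda>q. (norm (f n q - g q))\<^sup>2)"
      unfolding integrable_iff_bounded using Fatou[of n] by (auto intro: le_less_trans)
    then show ?thesis
      using gm gp f[of n] by (auto simp: L2_def intro: periodic_comp2)
  qed
  have "L2 (\<lambda>q. f 0 q - (f 0 q - g q))" by (rule L2_diff[OF f dL])
  then have "L2 g" by simp
  moreover have "(\<lambda>n. sqn (\<lambda>q. f n q - g q)) \<longlonglongrightarrow> 0"
  proof (rule tendsto_sandwich[OF _ _ tendsto_const])
    show "\<forall>\<^sub>F n in sequentially. sqn (\<lambda>q. f n q - g q) \<le> 4 * (1/4) ^ n"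
    proof (intro always_eventually allI)
      fix n show "sqn (\<lambda>q. f n q - g q) \<le> 4 * (1/4) ^ n"
        using Fatou[of n] nn_integral_eq_integral[OF L2D(3)[OF dL[of n]]] by simp
    qed
    show "(\<lambda>n. 4 * (1/4) ^ n) \<longlonglongrightarrow> (0::real)"
      by (intro tendsto_mult_right_zero LIMSEQ_power_zero) simp
  qed (simp add: sqn_nonneg)
  ultimately show ?thesis by blast
qed

section \<open>Fourier analysis on the torus\<close>

text \<open>Difference quotients along axis \<open>i\<close> have mean zero by translation
  invariance; the mean value theorem bounds them by a bound of the derivative, so dominated
  convergence passes to the limit.\<close>

lemma integral_partial_deriv:
  fixes f :: "real^'n \<Rightarrow> real"
  assumes f: "smooth_torus f" shows "(\<integral>q. partial_deriv i f q \<partial>torus) = 0"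
proof -
  note pf = smooth_torus_partial_deriv[OF f, of i]
  obtain C where C: "\<And>q. \<bar>partial_deriv i f q\<bar> \<le> C" using smooth_torus_bounded[OF pf] by blast
  define g where "g = (\<lambda>n q. real (Suc n) * (f (q + (1 / real (Suc n)) *\<^sub>R axis i 1) - f q))"
  have d: "((\<lambda>t. f (q + t *\<^sub>R axis i 1)) has_real_derivative partial_deriv i f (q + t *\<^sub>R axis i 1)) (at t)" for q t
  proof -
    interpret linear "frechet_derivative f (at (q + t *\<^sub>R axis i 1))"
      using smooth_torus_differentiable[OF f] frechet_derivative_works has_derivative_linear by blast
    have "((\<lambda>t. q + t *\<^sub>R axis i 1) has_derivative (\<lambda>h. h *\<^sub>R axis i 1)) (at t)"
      by (auto intro!: derivative_eq_intros)
    from diff_chain_at[OF this smooth_torus_differentiable[OF f, unfolded frechet_derivative_works]]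
    show ?thesis
      by (simp add: o_def scale has_field_derivative_def partial_deriv_def mult.commute)
         (simp add: mult_commute_abs)
  qed
  have g0: "(\<integral>q. g n q \<partial>torus) = 0" for n
  proof -
    have "integrable torus (\<lambda>q. f (q + s))" for s
      using integrable_torus_translate[of f s] L2_integrable[OF L2_smooth[OF f]]
        smooth_torus_measurable[OF f] smooth_torus_periodic[OF f] by simp
    from this this[of 0] show ?thesis
      using integral_torus_translate[of f] smooth_torus_measurable[OF f] smooth_torus_periodic[OF f]
      by (simp add: g_def)
  qed
  have lim: "(\<lambda>n. g n q) \<longlonglongrightarrow> partial_deriv i f q" for q
  proof -
    have "(\<lambda>t. (f (q + t *\<^sub>R axis i 1) - f q) / t) \<midarrow>0\<rightarrow> partial_deriv i f q"
      using d[of q 0] by (simp add: has_field_derivative_iff)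
    moreover have "filterlim (\<lambda>n. 1 / real (Suc n)) (at 0) sequentially"
    proof (rule filterlim_atI)
      show "(\<lambda>n. 1 / real (Suc n)) \<longlonglongrightarrow> 0"
        using LIMSEQ_inverse_real_of_nat by (simp only: inverse_eq_divide)
    qed simp
    ultimately show ?thesis
      unfolding g_def by (auto dest: filterlim_compose simp: mult.commute)
  qed
  have bound: "\<bar>g n q\<bar> \<le> C" for n q
  proof -
    obtain z where "f (q + (1 / real (Suc n)) *\<^sub>R axis i 1) - f (q + 0 *\<^sub>R axis i 1) =
       (1 / real (Suc n) - 0) * partial_deriv i f (q + z *\<^sub>R axis i 1)"
      using MVT2[of 0 "1 / real (Suc n)", OF _ d] by auto
    then have "g n q = partial_deriv i f (q + z *\<^sub>R axis i 1)" by (simp add: g_def)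
    then show ?thesis using C by simp
  qed
  have m: "g n \<in> borel_measurable torus" for n
    unfolding g_def using smooth_torus_measurable[OF f]
    by (intro borel_measurable_times borel_measurable_diff borel_measurable_const measurable_torusI measurable_lebesgue_translate)
  have "(\<lambda>n. \<integral>q. g n q \<partial>torus) \<longlonglongrightarrow> (\<integral>q. partial_deriv i f q \<partial>torus)"
    using m lim bound L2D(4)[OF L2_smooth[OF pf]] finite_measure.integrable_const[OF finite_measure_torus, of C]
    by (intro integral_dominated_convergence[where w = "\<lambda>_. C"]) auto
  then show ?thesis unfolding g0 by (simp add: LIMSEQ_const_iff)
qed

lemma integral_by_parts_smooth:
  fixes f h :: "real^'n \<Rightarrow> real"
  assumes f: "smooth_torus f" and h: "smooth_torus h"
  shows "(\<integral>q. f q * partial_deriv i h q \<partial>torus) = - (\<integral>q. partial_deriv i f q * h q \<partial>torus)"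
proof -
  have "integrable torus (\<lambda>q. f q * partial_deriv i h q)" "integrable torus (\<lambda>q. partial_deriv i f q * h q)"
    using f h by (auto intro!: L2_mult L2_smooth smooth_torus_partial_deriv)
  then show ?thesis
    using integral_partial_deriv[OF smooth_torus_mult[OF f h], of i]
    by (simp add: partial_deriv_smooth_mult[OF f h])
qed

section \<open>Characters and trigonometric polynomials\<close>

lemma measure_torus_1 [simp]: "Sigma_Algebra.measure torus (cbox 0 1 :: (real^'n) set) = 1"
  using emeasure_torus[where 'n='n] by (simp add: measure_def)

lemma integral_torus_const [simp]: "(\<integral>q. c \<partial>(torus :: (real^'n) measure)) = (c :: real)"
  by simp

lemma cosm_0 [simp]: "cosm 0 q = 1" and sinm_0 [simp]: "sinm 0 q = 0"
  by (simp_all add: cosm_def sinm_def)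

lemma cosm_minus [simp]: "cosm (- m) = cosm m" and sinm_minus [simp]: "sinm (- m) q = - sinm m q"
  by (auto simp: cosm_def sinm_def ivec_minus)

lemma abs_cosm_le [simp]: "\<bar>cosm m q\<bar> \<le> 1" and abs_sinm_le [simp]: "\<bar>sinm m q\<bar> \<le> 1"
  by (simp_all add: cosm_def sinm_def)

lemma integral_cosm: "(\<integral>q. cosm m q \<partial>torus) = (if m = 0 then 1 else 0)"
proof (cases "m = 0")
  case False
  then obtain i where i: "m $ i \<noteq> 0" by (auto simp: vec_eq_iff)
  have "(\<integral>q. 2 * pi * real_of_int (m $ i) * cosm m q \<partial>torus) = 0"
    using integral_partial_deriv[OF smooth_torus_sinm, of i m] by (simp add: partial_deriv_sinm)
  then show ?thesis using i False by simp
qed simp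

lemma integral_sinm: "(\<integral>q. sinm m q \<partial>torus) = 0"
proof (cases "m = 0")
  case False
  then obtain i where i: "m $ i \<noteq> 0" by (auto simp: vec_eq_iff)
  have "(\<integral>q. 2 * pi * real_of_int (m $ i) * sinm m q \<partial>torus) = 0"
    using integral_partial_deriv[OF smooth_torus_cosm, of i m] by (simp add: partial_deriv_cosm)
  then show ?thesis using i False by simp
qed simp

text \<open>Factors stand on the left and differences are sums with \<open>(-1/2)\<close>, so that
  each right-hand side has the shape built by \<open>trig.add\<close> and
  \<open>trig.cmult\<close>.\<close>

lemma cosm_cosm: "cosm m q * cosm n q = 1/2 * cosm (m - n) q + 1/2 * cosm (m + n) q"
  and sinm_sinm: "sinm m q * sinm n q = 1/2 * cosm (m - n) q + (-1/2) * cosm (m + n) q"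
  and sinm_cosm: "sinm m q * cosm n q = 1/2 * sinm (m + n) q + 1/2 * sinm (m - n) q"
  and cosm_sinm: "cosm m q * sinm n q = 1/2 * sinm (m + n) q + (-1/2) * sinm (m - n) q"
  by (simp_all add: cosm_def sinm_def ivec_add ivec_diff inner_add_left inner_diff_left distrib_left
      right_diff_distrib cos_add cos_diff sin_add sin_diff)

text \<open>The maximum norm makes these sets finite, symmetric and additive in the radius;
  frequencies outside are bounded from below by \<open>ivec_norm_ge\<close>.\<close>

definition fbox :: "nat \<Rightarrow> (int^'n) set" where
  "fbox R = {m. \<forall>i. \<bar>m $ i\<bar> \<le> int R}"

lemma finite_fbox [simp]: "finite (fbox R :: (int^'n) set)"
proof -
  have "fbox R \<subseteq> (\<lambda>f. \<chi> i. f i) ` (UNIV \<rightarrow>\<^sub>E {- int R..int R} :: ('n \<Rightarrow> int) set)"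
  proof
    fix m :: "int^'n" assume "m \<in> fbox R"
    then have "- int R \<le> m $ i \<and> m $ i \<le> int R" for i
      unfolding fbox_def by (simp add: abs_le_iff) (metis minus_le_iff)
    then have "(\<lambda>i. m $ i) \<in> UNIV \<rightarrow>\<^sub>E {- int R..int R}" by auto
    moreover have "m = (\<chi> i. m $ i)" by (simp add: vec_eq_iff)
    ultimately show "m \<in> (\<lambda>f. \<chi> i. f i) ` (UNIV \<rightarrow>\<^sub>E {- int R..int R} :: ('n \<Rightarrow> int) set)"
      by (metis (mono_tags, lifting) image_eqI)
  qed
  then show ?thesis by (rule finite_subset) (intro finite_imageI finite_PiE, auto)
qed

lemma fbox_mono: "R \<le> S \<Longrightarrow> fbox R \<subseteq> fbox S"
  unfolding fbox_def by (auto intro: order_trans)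

lemma fbox_minus: "- m \<in> fbox R \<longleftrightarrow> m \<in> fbox R"
  by (simp add: fbox_def)

lemma fbox_add: "m \<in> fbox R \<Longrightarrow> n \<in> fbox S \<Longrightarrow> m + n \<in> fbox (R + S)"
  unfolding fbox_def by (auto intro: order_trans[OF abs_triangle_ineq] add_mono)

lemma fbox_diff: "m \<in> fbox R \<Longrightarrow> n \<in> fbox S \<Longrightarrow> m - n \<in> fbox (R + S)"
  unfolding fbox_def by (auto intro: order_trans[OF abs_triangle_ineq4] add_mono)

text \<open>The index bounds the frequencies, so that it is additive under products.\<close>

inductive trig :: "nat \<Rightarrow> (real^'n \<Rightarrow> real) \<Rightarrow> bool" where
  cosm: "m \<in> fbox R \<Longrightarrow> trig R (cosm m)"
| sinm: "m \<in> fbox R \<Longrightarrow> trig R (sinm m)"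
| add: "trig R f \<Longrightarrow> trig R g \<Longrightarrow> trig R (\<lambda>q. f q + g q)"
| cmult: "trig R f \<Longrightarrow> trig R (\<lambda>q. c * f q)"

lemma trig_smooth: "trig R f \<Longrightarrow> smooth_torus f"
  by (induction rule: trig.induct)
    (auto intro: smooth_torus_cosm smooth_torus_sinm smooth_torus_add smooth_torus_cmult)

lemma trig_mono: "trig R f \<Longrightarrow> R \<le> S \<Longrightarrow> trig S f"
  by (induction rule: trig.induct) (use fbox_mono in \<open>blast intro: trig.intros\<close>)+

lemma trig_const: "trig R (\<lambda>_. c)"
  using trig.cmult[OF trig.cosm[of 0 R], of c] by (simp add: fbox_def)

lemma trig_sum: "(\<And>j. j \<in> J \<Longrightarrow> trig R (f j)) \<Longrightarrow> trig R (\<lambda>q. \<Sum>j\<in>J. f j q)"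
  by (induction J rule: infinite_finite_induct) (auto intro: trig.add trig_const)

lemma trig_mult_cosm_sinm:
  assumes f: "trig R f" and m: "m \<in> fbox S"
  shows "trig (R + S) (\<lambda>q. f q * cosm m q) \<and> trig (R + S) (\<lambda>q. f q * sinm m q)"
  using f m
proof (induction rule: trig.induct)
  case (cosm n R)
  then show ?case unfolding cosm_cosm cosm_sinm
    by (intro conjI trig.add trig.cmult trig.cosm trig.sinm fbox_add fbox_diff)
next
  case (sinm n R)
  then show ?case unfolding sinm_cosm sinm_sinm
    by (intro conjI trig.add trig.cmult trig.cosm trig.sinm fbox_add fbox_diff)
next
  case (add R f g)
  then show ?case unfolding distrib_right by (intro conjI trig.add) auto
next
  case (cmult R f c)
  then show ?case unfolding mult.assoc by (intro conjI trig.cmult) auto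
qed

lemma trig_mult:
  assumes f: "trig R f" and g: "trig S g" shows "trig (R + S) (\<lambda>q. f q * g q)"
  using g f
proof (induction rule: trig.induct)
  case (add S g h)
  then show ?case unfolding distrib_left by (intro trig.add) auto
next
  case (cmult S g c)
  then show ?case unfolding mult.left_commute[of _ c] by (intro trig.cmult) auto
qed (use trig_mult_cosm_sinm in blast)+

text \<open>Exact averaging: no error term, because the frequencies of \<open>P\<close> are too small to be
  multiples of \<open>k\<close>.\<close>

lemma integral_dilate_mult_trig:
  fixes f :: "real^'n \<Rightarrow> real"
  assumes f: "periodic f" "f \<in> borel_measurable lebesgue" "integrable torus f"
    and P: "trig R P" and k: "R < k"
  shows "(\<integral>q. f (real k *\<^sub>R q) * P q \<partial>torus) = (\<integral>q. f q \<partial>torus) * (\<integral>q. P q \<partial>torus)"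
proof -
  have k0: "k > 0" using k by simp
  have int: "integrable torus (\<lambda>q. f (real k *\<^sub>R q) * P q)" if "smooth_torus P" for P
    using integrable_torus_dilate[OF f(2,1) k0] f(3) that by (intro integrable_mult_smooth) auto
  have red: "(\<integral>q. f (real k *\<^sub>R q) * P q \<partial>torus) = (\<integral>q. f q * fold_torus k P q \<partial>torus)"
    if P: "smooth_torus P" for P
    by (rule integral_dilate_mult[OF f(1,2) smooth_torus_periodic[OF P] smooth_torus_measurable[OF P] int[OF P] k0])
  have nd: "\<exists>i. \<not> int k dvd m $ i" if m: "m \<in> fbox R" "m \<noteq> 0" for m :: "int^'n"
  proof -
    obtain i where i: "m $ i \<noteq> 0" using m(2) by (auto simp: vec_eq_iff)
    have "\<bar>m $ i\<bar> \<le> int R" using m(1) by (simp add: fbox_def)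
    then have "\<bar>m $ i\<bar> < int k" using k by linarith
    then have "\<not> int k dvd m $ i" using i dvd_imp_le_int[of "m $ i" "int k"] by auto
    then show ?thesis by blast
  qed
  show ?thesis using P nd
  proof (induction rule: trig.induct)
    case (cosm m R)
    show ?case
    proof (cases "m = 0")
      case True
      then show ?thesis using integral_torus_dilate[OF f(2,1) k0] by simp
    next
      case False
      then obtain i where "\<not> int k dvd m $ i" using cosm by blast
      then show ?thesis using red[OF smooth_torus_cosm, of m] fold_cosm_sinm[of k m i] k0 False
        by (simp add: integral_cosm)
    qed
  next
    case (sinm m R)
    show ?case
    proof (cases "m = 0")
      case False
      then obtain i where "\<not> int k dvd m $ i" using sinm by blast
      then show ?thesis using red[OF smooth_torus_sinm, of m] fold_cosm_sinm[of k m i] k0 False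
        by (simp add: integral_sinm)
    qed simp
  next
    case (add R g h)
    note s = trig_smooth[OF add.hyps(1)] trig_smooth[OF add.hyps(2)]
    show ?case
      using add.IH add.prems int[OF s(1)] int[OF s(2)] s[THEN L2_smooth, THEN L2_integrable]
      by (simp add: distrib_left)
  next
    case (cmult R g c)
    then show ?case by (simp add: mult.left_commute[of _ c])
  qed
qed

subsection \<open>Density of trigonometric polynomials\<close>

text \<open>Stated with the nonnegative integral, so that no integrability has to be carried along,
  and without periodicity, so that indicators of subsets of the cube qualify.\<close>

definition trig_approx :: "(real^'n \<Rightarrow> real) \<Rightarrow> bool" where
  "trig_approx u \<longleftrightarrow> u \<in> borel_measurable torus \<and>
     (\<forall>\<epsilon>>0. \<exists>R P. trig R P \<and> (\<integral>\<^sup>+q. ennreal ((u q - P q)\<^sup>2) \<partial>torus) < ennreal \<epsilon>)"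

lemma trig_approxD:
  "trig_approx u \<Longrightarrow> \<epsilon> > 0 \<Longrightarrow> \<exists>R P. trig R P \<and> (\<integral>\<^sup>+q. ennreal ((u q - P q)\<^sup>2) \<partial>torus) < ennreal \<epsilon>"
  by (simp add: trig_approx_def)

lemma trig_measurable: "trig R P \<Longrightarrow> P \<in> borel_measurable torus"
  by (intro measurable_torusI smooth_torus_measurable trig_smooth)

lemma square_add_le: "((x::real) + y)\<^sup>2 \<le> 2 * x\<^sup>2 + 2 * y\<^sup>2"
  using norm_add_sq_le[of x y] by simp

text \<open>The share \<open>\<epsilon> / 4\<close> is dictated by
  \<open>(x + y)^2 \<le> 2 * x^2 + 2 * y^2\<close>.\<close>

lemma nn_integral_square_add:
  fixes f g :: "real^'n \<Rightarrow> real"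
  assumes [measurable]: "f \<in> borel_measurable torus" "g \<in> borel_measurable torus"
    and "(\<integral>\<^sup>+q. ennreal ((f q)\<^sup>2) \<partial>torus) < ennreal (\<epsilon> / 4)" "(\<integral>\<^sup>+q. ennreal ((g q)\<^sup>2) \<partial>torus) < ennreal (\<epsilon> / 4)"
    and "\<epsilon> > 0"
  shows "(\<integral>\<^sup>+q. ennreal ((f q + g q)\<^sup>2) \<partial>torus) < ennreal \<epsilon>"
proof -
  have two: "2 * ennreal x = ennreal (2 * x)" for x
    using ennreal_mult'[of 2 x] by simp
  have "(\<integral>\<^sup>+q. ennreal ((f q + g q)\<^sup>2) \<partial>torus) \<le>
      (\<integral>\<^sup>+q. 2 * ennreal ((f q)\<^sup>2) + 2 * ennreal ((g q)\<^sup>2) \<partial>torus)"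
  proof (rule nn_integral_mono)
    fix q show "ennreal ((f q + g q)\<^sup>2) \<le> 2 * ennreal ((f q)\<^sup>2) + 2 * ennreal ((g q)\<^sup>2)"
      using ennreal_leI[OF square_add_le[of "f q" "g q"]] unfolding two by simp
  qed
  also have "\<dots> = 2 * (\<integral>\<^sup>+q. ennreal ((f q)\<^sup>2) \<partial>torus) + 2 * (\<integral>\<^sup>+q. ennreal ((g q)\<^sup>2) \<partial>torus)"
    by (subst nn_integral_add) (auto simp: nn_integral_cmult)
  also have "\<dots> < 2 * ennreal (\<epsilon> / 4) + 2 * ennreal (\<epsilon> / 4)"
    using assms(3,4) by (intro add_strict_mono ennreal_mult_strict_left_mono) auto
  also have "\<dots> = ennreal \<epsilon>"
    using assms(5) unfolding two by (subst ennreal_plus[symmetric]) auto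
  finally show ?thesis .
qed

lemma trig_approx_trig: "trig R P \<Longrightarrow> trig_approx P"
  unfolding trig_approx_def
  by (intro conjI allI impI exI[of _ R] exI[of _ P]) (simp_all add: trig_measurable)

lemma trig_approx_add:
  assumes "trig_approx f" "trig_approx g" shows "trig_approx (\<lambda>q. f q + g q)"
  unfolding trig_approx_def
proof (intro conjI allI impI)
  fix \<epsilon> :: real assume e: "\<epsilon> > 0"
  note [measurable] = assms[unfolded trig_approx_def, THEN conjunct1]
  have e4: "\<epsilon> / 4 > 0" using e by simp
  obtain R P where P: "trig R P" "(\<integral>\<^sup>+q. ennreal ((f q - P q)\<^sup>2) \<partial>torus) < ennreal (\<epsilon> / 4)"
    using trig_approxD[OF assms(1) e4] by blast
  obtain S Q where Q: "trig S Q" "(\<integral>\<^sup>+q. ennreal ((g q - Q q)\<^sup>2) \<partial>torus) < ennreal (\<epsilon> / 4)"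
    using trig_approxD[OF assms(2) e4] by blast
  note [measurable] = trig_measurable[OF P(1)] trig_measurable[OF Q(1)]
  have "(\<integral>\<^sup>+q. ennreal (((f q - P q) + (g q - Q q))\<^sup>2) \<partial>torus) < ennreal \<epsilon>"
    by (rule nn_integral_square_add) (use P Q e in auto)
  moreover have "trig (max R S) (\<lambda>q. P q + Q q)"
    using P(1) Q(1) by (intro trig.add) (auto intro: trig_mono)
  ultimately show "\<exists>R P. trig R P \<and> (\<integral>\<^sup>+q. ennreal ((f q + g q - P q)\<^sup>2) \<partial>torus) < ennreal \<epsilon>"
    by (intro exI[of _ "max R S"] exI[of _ "\<lambda>q. P q + Q q"]) (simp add: algebra_simps)
qed (use assms in \<open>auto simp: trig_approx_def\<close>)

lemma trig_approx_cmult: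
  assumes "trig_approx f" shows "trig_approx (\<lambda>q. c * f q)"
  unfolding trig_approx_def
proof (intro conjI allI impI)
  fix \<epsilon> :: real assume e: "\<epsilon> > 0"
  note [measurable] = assms[unfolded trig_approx_def, THEN conjunct1]
  \<comment> \<open>The summand 1 keeps the denominator positive when \<open>c = 0\<close>.\<close>
  have e4: "\<epsilon> / (c\<^sup>2 + 1) > 0" using e by (simp add: add_nonneg_pos)
  obtain R P where P: "trig R P" "(\<integral>\<^sup>+q. ennreal ((f q - P q)\<^sup>2) \<partial>torus) < ennreal (\<epsilon> / (c\<^sup>2 + 1))"
    using trig_approxD[OF assms e4] by blast
  note [measurable] = trig_measurable[OF P(1)]
  have "(\<integral>\<^sup>+q. ennreal ((c * f q - c * P q)\<^sup>2) \<partial>torus) = (\<integral>\<^sup>+q. ennreal (c\<^sup>2) * ennreal ((f q - P q)\<^sup>2) \<partial>torus)"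
    by (intro nn_integral_cong) (simp add: power_mult_distrib flip: ennreal_mult right_diff_distrib)
  also have "\<dots> = ennreal (c\<^sup>2) * (\<integral>\<^sup>+q. ennreal ((f q - P q)\<^sup>2) \<partial>torus)"
    by (rule nn_integral_cmult) measurable
  also have "\<dots> \<le> ennreal (c\<^sup>2) * ennreal (\<epsilon> / (c\<^sup>2 + 1))"
    using P(2) by (intro mult_left_mono) auto
  also have "\<dots> = ennreal (c\<^sup>2 * (\<epsilon> / (c\<^sup>2 + 1)))"
    using e by (simp flip: ennreal_mult)
  also have "\<dots> < ennreal \<epsilon>"
  proof (rule ennreal_lessI)
    have "0 < c\<^sup>2 + 1" by (simp add: add_nonneg_pos)
    then show "c\<^sup>2 * (\<epsilon> / (c\<^sup>2 + 1)) < \<epsilon>" using e by (simp add: field_simps)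
  qed (rule e)
  finally show "\<exists>R P. trig R P \<and> (\<integral>\<^sup>+q. ennreal ((c * f q - P q)\<^sup>2) \<partial>torus) < ennreal \<epsilon>"
    using trig.cmult[OF P(1), of c] by blast
qed (use assms in \<open>auto simp: trig_approx_def\<close>)

lemma trig_approx_sum:
  "(\<And>j. j \<in> J \<Longrightarrow> trig_approx (f j)) \<Longrightarrow> trig_approx (\<lambda>q. \<Sum>j\<in>J. f j q)"
  by (induction J rule: infinite_finite_induct)
    (auto intro: trig_approx_add trig_approx_trig[OF trig_const])

lemma trig_approx_limit:
  assumes u: "u \<in> borel_measurable torus"
    and v: "\<And>\<epsilon>. \<epsilon> > 0 \<Longrightarrow> \<exists>v. trig_approx v \<and> (\<integral>\<^sup>+q. ennreal ((u q - v q)\<^sup>2) \<partial>torus) < ennreal \<epsilon>"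
  shows "trig_approx u"
  unfolding trig_approx_def
proof (intro conjI allI impI u)
  fix \<epsilon> :: real assume e: "\<epsilon> > 0"
  then obtain v where v: "trig_approx v" "(\<integral>\<^sup>+q. ennreal ((u q - v q)\<^sup>2) \<partial>torus) < ennreal (\<epsilon> / 4)"
    using v[of "\<epsilon> / 4"] by auto
  obtain R P where P: "trig R P" "(\<integral>\<^sup>+q. ennreal ((v q - P q)\<^sup>2) \<partial>torus) < ennreal (\<epsilon> / 4)"
    using trig_approxD[OF v(1), of "\<epsilon> / 4"] e by auto
  note [measurable] = u trig_measurable[OF P(1)] v(1)[unfolded trig_approx_def, THEN conjunct1]
  have "(\<integral>\<^sup>+q. ennreal (((u q - v q) + (v q - P q))\<^sup>2) \<partial>torus) < ennreal \<epsilon>"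
    by (rule nn_integral_square_add) (use v P e in auto)
  then show "\<exists>R P. trig R P \<and> (\<integral>\<^sup>+q. ennreal ((u q - P q)\<^sup>2) \<partial>torus) < ennreal \<epsilon>"
    using P(1) by auto
qed

lemma trig_approx_LIMSEQ:
  fixes u :: "real^'n \<Rightarrow> real"
  assumes u: "u \<in> borel_measurable torus" and v: "\<And>n. trig_approx (v n)"
    and w: "(\<integral>\<^sup>+q. ennreal (w q) \<partial>torus) < \<infinity>" "w \<in> borel_measurable torus"
    and lim: "\<And>q. q \<in> cbox 0 1 \<Longrightarrow> (\<lambda>n. v n q) \<longlonglongrightarrow> u q"
    and bound: "\<And>n q. q \<in> cbox 0 1 \<Longrightarrow> (u q - v n q)\<^sup>2 \<le> w q"
  shows "trig_approx u"
proof (rule trig_approx_limit[OF u])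
  fix \<epsilon> :: real assume e: "\<epsilon> > 0"
  have [measurable]: "v n \<in> borel_measurable torus" for n using v by (simp add: trig_approx_def)
  note [measurable] = u w(2)
  have "(\<lambda>n. \<integral>\<^sup>+q. ennreal ((u q - v n q)\<^sup>2) \<partial>torus) \<longlonglongrightarrow> (\<integral>\<^sup>+q. 0 \<partial>(torus :: (real^'n) measure))"
  proof (rule nn_integral_dominated_convergence[where w = "\<lambda>q. ennreal (w q)" and u' = "\<lambda>_. 0"])
    show "AE q in torus. ennreal ((u q - v n q)\<^sup>2) \<le> ennreal (w q)" for n
      using bound by (auto intro!: AE_I2 ennreal_leI)
    show "AE q in torus. (\<lambda>n. ennreal ((u q - v n q)\<^sup>2)) \<longlonglongrightarrow> 0"
    proof (rule AE_I2)
      fix q :: "real^'n" assume "q \<in> space torus"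
      then have "(\<lambda>n. ennreal ((u q - v n q)\<^sup>2)) \<longlonglongrightarrow> ennreal ((u q - u q)\<^sup>2)"
        by (intro tendsto_intros lim) simp
      then show "(\<lambda>n. ennreal ((u q - v n q)\<^sup>2)) \<longlonglongrightarrow> 0" by simp
    qed
  qed (use w in auto)
  then have "(\<lambda>n. \<integral>\<^sup>+q. ennreal ((u q - v n q)\<^sup>2) \<partial>torus) \<longlonglongrightarrow> 0" by simp
  then have "\<forall>\<^sub>F n in sequentially. (\<integral>\<^sup>+q. ennreal ((u q - v n q)\<^sup>2) \<partial>torus) < ennreal \<epsilon>"
    by (rule order_tendstoD(2)) (use e in simp)
  then show "\<exists>v. trig_approx v \<and> (\<integral>\<^sup>+q. ennreal ((u q - v q)\<^sup>2) \<partial>torus) < ennreal \<epsilon>"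
    using v by (auto simp: eventually_sequentially)
qed

text \<open>Maps the cube onto a compact torus in complex space. Real polynomials in these
  coordinates are trigonometric polynomials, so Stone-Weierstrass on the image gives
  density.\<close>

definition circle_map :: "real^'n \<Rightarrow> complex^'n" where
  "circle_map q = (\<chi> i. cis (2 * pi * q $ i))"

lemma continuous_circle_map: "continuous_on S circle_map"
  unfolding circle_map_def by (intro continuous_intros)

lemma axis_cis: "axis i (cis t) = cos t *\<^sub>R axis i 1 + sin t *\<^sub>R axis i \<i>"
  by (auto simp: vec_eq_iff axis_def complex_eq_iff)

text \<open>A real linear functional sees each coordinate through its values at
  \<open>axis i 1\<close> and \<open>axis i \<i>\<close>, hence through cosine and sine; products
  only enlarge the frequency radius.\<close>

lemma polynomial_circle_map_trig:
  fixes p :: "complex^'n \<Rightarrow> real"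
  assumes "real_polynomial_function p"
  shows "\<exists>R. trig R (\<lambda>q. p (circle_map q))"
  using assms
proof (induction rule: real_polynomial_function.induct)
  case (linear f)
  interpret bounded_linear f by fact
  have c: "cos (2 * pi * q $ i) = cosm (axis i 1) q" "sin (2 * pi * q $ i) = sinm (axis i 1) q" for q :: "real^'n" and i
  proof -
    have "ivec (axis i 1) = (axis i 1 :: real^'n)" by (simp add: vec_eq_iff axis_def)
    then show "cos (2 * pi * q $ i) = cosm (axis i 1) q" "sin (2 * pi * q $ i) = sinm (axis i 1) q"
      by (simp_all add: cosm_def sinm_def inner_axis')
  qed
  have "circle_map q = (\<Sum>i\<in>UNIV. axis i (cis (2 * pi * q $ i)))" for q :: "real^'n"
    by (simp add: vec_eq_iff circle_map_def axis_def if_distrib cong: if_cong)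
  then have "f (circle_map q) = (\<Sum>i\<in>UNIV. f (axis i 1) * cosm (axis i 1) q + f (axis i \<i>) * sinm (axis i 1) q)" for q
    by (simp add: axis_cis add sum scaleR c mult.commute[of _ "f _"])
  moreover have "(axis i 1 :: int^'n) \<in> fbox 1" for i by (simp add: fbox_def axis_def)
  then have "trig 1 (\<lambda>q. \<Sum>i\<in>UNIV. f (axis i 1) * cosm (axis i 1) q + f (axis i \<i>) * sinm (axis i 1) q)"
    by (intro trig_sum trig.add trig.cmult trig.cosm trig.sinm)
  ultimately show ?case by auto
next
  case (const c) then show ?case using trig_const by blast
next
  case (add f g)
  then obtain R S where "trig R (\<lambda>q. f (circle_map q))" "trig S (\<lambda>q. g (circle_map q))" by blast
  then have "trig (max R S) (\<lambda>q. f (circle_map q))" "trig (max R S) (\<lambda>q. g (circle_map q))"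
    by (auto intro: trig_mono)
  then show ?case using trig.add by fastforce
next
  case (mult f g) then show ?case using trig_mult by fastforce
qed

lemma trig_approx_continuous:
  fixes F :: "complex^'n \<Rightarrow> real"
  assumes F: "continuous_on UNIV F"
  shows "trig_approx (\<lambda>q. F (circle_map q))"
proof (rule trig_approx_limit)
  have "continuous_on UNIV (F \<circ> circle_map)"
    by (intro continuous_on_compose continuous_circle_map continuous_on_subset[OF F]) auto
  then show "(\<lambda>q. F (circle_map q)) \<in> borel_measurable torus"
    by (intro measurable_torusI measurable_completion) (simp add: borel_measurable_continuous_onI o_def)
next
  fix \<epsilon> :: real assume e: "\<epsilon> > 0"
  let ?K = "circle_map ` cbox 0 1 :: (complex^'n) set"
  define d where "d = sqrt (\<epsilon> / 2)"
  have d: "d > 0" "d\<^sup>2 = \<epsilon> / 2" using e by (simp_all add: d_def)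
  have "compact ?K" by (intro compact_continuous_image continuous_circle_map compact_cbox)
  then obtain p where p: "real_polynomial_function p" "\<And>x. x \<in> ?K \<Longrightarrow> \<bar>F x - p x\<bar> < d"
    using Stone_Weierstrass_real_polynomial_function[of ?K F d] continuous_on_subset[OF F] d(1) by auto
  obtain R where R: "trig R (\<lambda>q. p (circle_map q))" using polynomial_circle_map_trig[OF p(1)] by blast
  have "(\<integral>\<^sup>+q. ennreal ((F (circle_map q) - p (circle_map q))\<^sup>2) \<partial>(torus::(real^'n) measure)) \<le> (\<integral>\<^sup>+q. ennreal (\<epsilon> / 2) \<partial>(torus::(real^'n) measure))"
  proof (rule nn_integral_mono)
    fix q :: "real^'n" assume "q \<in> space torus"
    then have "\<bar>F (circle_map q) - p (circle_map q)\<bar> \<le> d" using p(2)[of "circle_map q"] by auto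
    then have "(F (circle_map q) - p (circle_map q))\<^sup>2 \<le> d\<^sup>2" using d(1) by (simp add: abs_le_square_iff[symmetric])
    then show "ennreal ((F (circle_map q) - p (circle_map q))\<^sup>2) \<le> ennreal (\<epsilon> / 2)" using d(2) by (simp add: ennreal_leI)
  qed
  also have "\<dots> = ennreal (\<epsilon> / 2)" using emeasure_torus[where 'n='n] by simp
  also have "\<dots> < ennreal \<epsilon>" using e by (simp add: ennreal_lessI)
  finally show "\<exists>v. trig_approx v \<and> (\<integral>\<^sup>+q. ennreal ((F (circle_map q) - v q)\<^sup>2) \<partial>(torus::(real^'n) measure)) < ennreal \<epsilon>"
    using trig_approx_trig[OF R] by blast
qed

text \<open>Only opposite faces are identified: two points of the cube with the same image differ by
  integers, and if one of them is interior these integers lie strictly between -1 and 1.\<close>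

lemma circle_map_eq_interior:
  assumes q: "q \<in> box 0 (1 :: real^'n)" and q': "q' \<in> cbox 0 1" and eq: "circle_map q = circle_map q'"
  shows "q = q'"
proof -
  have "q $ i = q' $ i" for i
  proof -
    have "cis (2 * pi * q $ i) = cis (2 * pi * q' $ i)" using eq by (simp add: circle_map_def vec_eq_iff)
    then have "cos (2 * pi * (q $ i - q' $ i)) = 1"
      by (simp add: complex_eq_iff right_diff_distrib cos_diff flip: power2_eq_square)
    then obtain n where n: "2 * pi * (q $ i - q' $ i) = of_int n * 2 * pi" using cos_one_2pi_int by auto
    then have "q $ i - q' $ i = of_int n" by simp
    moreover have "0 < q $ i" "q $ i < 1" "0 \<le> q' $ i" "q' $ i \<le> 1"
      using q q' by (auto simp: mem_box_cart)
    ultimately have "real_of_int n < 1" "real_of_int n > -1" by linarith+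
    then have "n = 0" by linarith
    then show ?thesis using \<open>q $ i - q' $ i = of_int n\<close> by simp
  qed
  then show ?thesis by (simp add: vec_eq_iff)
qed

text \<open>Truncated multiples of the distance to the image of the complement are continuous and
  converge to the indicator; injectivity on the interior keeps points of \<open>U\<close> away from
  that image.\<close>

lemma trig_approx_open:
  fixes U :: "(real^'n) set"
  assumes U: "open U" "U \<subseteq> box 0 1"
  shows "trig_approx (indicator U)"
proof -
  let ?C = "circle_map ` (cbox 0 1 - U)"
  have C: "closed ?C" "?C \<noteq> {}"
  proof -
    show "closed ?C"
      using U(1) by (intro compact_imp_closed compact_continuous_image continuous_circle_map compact_diff compact_cbox)
    \<comment> \<open>The corner 0 lies outside \<open>U\<close>. Nonemptiness matters, as
      \<open>infdist\<close> to the empty set is 0.\<close>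
    have "0 \<in> cbox 0 (1::real^'n)" "0 \<notin> box 0 (1::real^'n)" by (auto simp: mem_box_cart)
    then show "?C \<noteq> {}" using U(2) by blast
  qed
  define F where "F = (\<lambda>n z. min 1 (real n * infdist z ?C))"
  have F: "trig_approx (\<lambda>q. F n (circle_map q))" for n
    unfolding F_def by (rule trig_approx_continuous) (intro continuous_intros)
  have F01: "0 \<le> F n z" "F n z \<le> 1" for n z by (auto simp: F_def infdist_nonneg)
  show ?thesis
  proof (rule trig_approx_LIMSEQ[OF _ F, where w = "\<lambda>_. 1"])
    show "indicator U \<in> borel_measurable torus"
    proof (intro measurable_torusI borel_measurable_indicator)
      show "U \<in> sets lebesgue" using lborelD borel_open U(1) by blast
    qed
    show "(\<integral>\<^sup>+q. ennreal 1 \<partial>(torus::(real^'n) measure)) < \<infinity>" using emeasure_torus[where 'n='n] by simp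
    show "(indicator U q - F n (circle_map q))\<^sup>2 \<le> 1" for n q
      using F01[of n "circle_map q"] by (auto simp: indicator_def power2_eq_square intro!: mult_le_one)
    fix q :: "real^'n" assume q: "q \<in> cbox 0 1"
    show "(\<lambda>n. F n (circle_map q)) \<longlonglongrightarrow> indicator U q"
    proof (cases "q \<in> U")
      case False
      then have "circle_map q \<in> ?C" using q by auto
      then have "F n (circle_map q) = 0" for n by (simp add: F_def)
      then show ?thesis using False by simp
    next
      case True
      have "circle_map q \<notin> ?C"
        using circle_map_eq_interior[of q] True U(2) by auto
      then have pos: "infdist (circle_map q) ?C > 0"
        using C by (metis in_closed_iff_infdist_zero infdist_nonneg less_le)
      obtain N where N: "1 < real N * infdist (circle_map q) ?C" using reals_Archimedean3[OF pos] by blast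
      have "F n (circle_map q) = 1" if "n \<ge> N" for n
      proof -
        have "real N * infdist (circle_map q) ?C \<le> real n * infdist (circle_map q) ?C"
          using that pos by (intro mult_right_mono) auto
        then show ?thesis using N by (simp add: F_def)
      qed
      then show ?thesis using True
        by (intro tendsto_eventually) (auto simp: eventually_sequentially)
    qed
  qed simp
qed

text \<open>Outer regularity gives an open superset of nearly the same measure; intersecting it with
  the open cube costs only the boundary, a null set.\<close>

lemma trig_approx_indicator:
  fixes A :: "(real^'n) set"
  assumes A: "A \<in> sets lebesgue" "A \<subseteq> cbox 0 1"
  shows "trig_approx (indicator A)"
proof (rule trig_approx_limit)
  show Am: "indicator A \<in> borel_measurable torus" using A by (intro measurable_torusI) auto
  fix \<epsilon> :: real assume e: "\<epsilon> > 0"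
  obtain G where G: "open G" "A \<subseteq> G" "G - A \<in> lmeasurable" "emeasure lebesgue (G - A) < ennreal \<epsilon>"
    using sets_lebesgue_outer_open[OF A(1) e] by metis
  let ?U = "G \<inter> box 0 1"
  have U: "trig_approx (indicator ?U)" using G(1) by (intro trig_approx_open) auto
  have "AE q in lebesgue. q \<notin> cbox (0::real^'n) 1 - box 0 1"
    using negligible_frontier_interval[of "0::real^'n" 1] AE_not_in negligible_iff_null_sets by blast
  then have "AE q in torus. q \<notin> cbox (0::real^'n) 1 - box 0 1" by (rule AE_torusI)
  then have "(\<integral>\<^sup>+q. ennreal ((indicator A q - indicator ?U q)\<^sup>2) \<partial>torus) \<le> (\<integral>\<^sup>+q. indicator (G - A) q \<partial>torus)"
    using A(2) G(2) by (intro nn_integral_mono_AE) (auto elim!: eventually_mono simp: indicator_def)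
  also have "\<dots> \<le> (\<integral>\<^sup>+q. indicator (G - A) q \<partial>lebesgue)"
    by (subst nn_integral_restrict_space) (auto intro!: nn_integral_mono simp: indicator_def)
  also have "\<dots> = emeasure lebesgue (G - A)" using G(3) by (intro nn_integral_indicator) auto
  also note G(4)
  finally show "\<exists>v. trig_approx v \<and> (\<integral>\<^sup>+q. ennreal ((indicator A q - v q)\<^sup>2) \<partial>torus) < ennreal \<epsilon>"
    using U by blast
qed

lemma trig_approx_simple:
  fixes s :: "real^'n \<Rightarrow> real"
  assumes s: "simple_function torus s" shows "trig_approx s"
proof -
  have cb: "cbox (0::real^'n) 1 \<in> sets lebesgue" by simp
  have "trig_approx (\<lambda>q. \<Sum>y\<in>s ` cbox 0 1. y * indicator (s -` {y} \<inter> cbox 0 1) q)"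
  proof (intro trig_approx_sum trig_approx_cmult trig_approx_indicator)
    fix y assume "y \<in> s ` cbox 0 1"
    then have "s -` {y} \<inter> cbox 0 1 \<in> sets torus" using s by (auto simp: simple_function_def)
    then obtain B where "B \<in> sets lebesgue" "s -` {y} \<inter> cbox 0 1 = cbox 0 1 \<inter> B"
      by (auto simp: sets_restrict_space)
    then show "s -` {y} \<inter> cbox 0 1 \<in> sets lebesgue" using cb by (simp only: sets.Int)
  qed auto
  then have *: "trig_approx (\<lambda>q. \<Sum>y\<in>s ` cbox 0 1. y * indicator (s -` {y} \<inter> cbox 0 1) q)" .
  have fin: "finite (s ` cbox 0 1)" using s by (simp add: simple_function_def)
  have eq: "(\<Sum>y\<in>s ` cbox 0 1. y * indicator (s -` {y} \<inter> cbox 0 1) q) = s q" if "q \<in> cbox 0 1" for q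
  proof -
    have "(\<Sum>y\<in>s ` cbox 0 1. y * indicator (s -` {y} \<inter> cbox 0 1) q) = (\<Sum>y\<in>s ` cbox 0 1. if y = s q then y else 0)"
      using that by (intro sum.cong) (auto simp: indicator_def)
    then show ?thesis using fin that by simp
  qed
  show ?thesis
  proof (rule trig_approx_limit)
    show "s \<in> borel_measurable torus" using s by (rule borel_measurable_simple_function)
    fix \<epsilon> :: real assume "\<epsilon> > 0"
    have "(\<integral>\<^sup>+q. ennreal ((s q - (\<Sum>y\<in>s ` cbox 0 1. y * indicator (s -` {y} \<inter> cbox 0 1) q))\<^sup>2) \<partial>torus) =
        (\<integral>\<^sup>+q. 0 \<partial>(torus :: (real^'n) measure))"
      by (rule nn_integral_cong) (simp add: eq)
    then show "\<exists>v. trig_approx v \<and> (\<integral>\<^sup>+q. ennreal ((s q - v q)\<^sup>2) \<partial>torus) < ennreal \<epsilon>"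
      using * \<open>\<epsilon> > 0\<close> by (intro exI conjI) auto
  qed
qed

lemma trig_approx_L2:
  fixes u :: "real^'n \<Rightarrow> real"
  assumes u: "L2 u" shows "trig_approx u"
proof -
  note [measurable] = L2D(4)[OF u]
  obtain s where s0: "\<forall>i. simple_function torus (s i)" "\<forall>q\<in>space torus. (\<lambda>i. s i q) \<longlonglongrightarrow> u q"
    "\<forall>i. \<forall>q\<in>space torus. dist (s i q) 0 \<le> 2 * dist (u q) 0"
    using borel_measurable_implies_sequence_metric[OF L2D(4)[OF u], of 0] by blast
  then have s: "\<And>i. simple_function torus (s i)" "\<And>q. q \<in> cbox 0 1 \<Longrightarrow> (\<lambda>i. s i q) \<longlonglongrightarrow> u q"
    "\<And>i q. q \<in> cbox 0 1 \<Longrightarrow> \<bar>s i q\<bar> \<le> 2 * \<bar>u q\<bar>"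
    by simp_all
  show ?thesis
  proof (rule trig_approx_LIMSEQ[where v = s and w = "\<lambda>q. 9 * (u q)\<^sup>2"])
    show "(\<integral>\<^sup>+q. ennreal (9 * (u q)\<^sup>2) \<partial>torus) < \<infinity>"
      using L2D(3)[OF u] by (subst nn_integral_eq_integral) auto
    \<comment> \<open>From \<open>\<bar>s i q\<bar> \<le> 2 * \<bar>u q\<bar>\<close> the difference
      is at most \<open>3 * \<bar>u q\<bar>\<close>, whence the factor 9.\<close>
    show "(u q - s i q)\<^sup>2 \<le> 9 * (u q)\<^sup>2" if "q \<in> cbox 0 1" for i q
    proof -
      have "\<bar>u q - s i q\<bar> \<le> \<bar>3 * u q\<bar>" using s(3)[OF that, of i] by linarith
      then have "(u q - s i q)\<^sup>2 \<le> (3 * u q)\<^sup>2" by (simp add: abs_le_square_iff)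
      then show ?thesis by (simp add: power_mult_distrib)
    qed
  qed (use s(2) trig_approx_simple[OF s(1)] in auto)
qed

lemma trig_dense_L2:
  fixes u :: "real^'n \<Rightarrow> real"
  assumes u: "L2 u" and e: "\<epsilon> > 0"
  shows "\<exists>R P. trig R P \<and> (\<integral>q. (u q - P q)\<^sup>2 \<partial>torus) < \<epsilon>"
proof -
  obtain R P where P: "trig R P" "(\<integral>\<^sup>+q. ennreal ((u q - P q)\<^sup>2) \<partial>torus) < ennreal \<epsilon>"
    using trig_approx_L2[OF u] e unfolding trig_approx_def by blast
  have "integrable torus (\<lambda>q. (u q - P q)\<^sup>2)"
    using L2D(3)[OF L2_diff[OF u L2_smooth[OF trig_smooth[OF P(1)]]]] by simp
  then have "(\<integral>q. (u q - P q)\<^sup>2 \<partial>torus) < \<epsilon>"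
    using P(2) e by (subst (asm) nn_integral_eq_integral) (auto simp: ennreal_less_iff)
  then show ?thesis using P(1) by blast
qed

subsection \<open>Fourier projections and Parseval's identity\<close>

definition cos_coeff :: "(real^'n \<Rightarrow> real) \<Rightarrow> int^'n \<Rightarrow> real" where
  "cos_coeff u m = (\<integral>q. u q * cosm m q \<partial>torus)"

definition sin_coeff :: "(real^'n \<Rightarrow> real) \<Rightarrow> int^'n \<Rightarrow> real" where
  "sin_coeff u m = (\<integral>q. u q * sinm m q \<partial>torus)"

text \<open>Every frequency occurs together with its negative, which accounts for the missing factor 2.\<close>

definition proj :: "nat \<Rightarrow> (real^'n \<Rightarrow> real) \<Rightarrow> real^'n \<Rightarrow> real" where
  "proj R u q = (\<Sum>m\<in>fbox R. cos_coeff u m * cosm m q + sin_coeff u m * sinm m q)"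

text \<open>Bilinear rather than quadratic, since a matrix energy pairs different components of a
  gradient.\<close>

definition parseval_sum :: "nat \<Rightarrow> (real^'n \<Rightarrow> real) \<Rightarrow> (real^'n \<Rightarrow> real) \<Rightarrow> real" where
  "parseval_sum R u v = (\<Sum>m\<in>fbox R. cos_coeff u m * cos_coeff v m + sin_coeff u m * sin_coeff v m)"

lemma L2_trig: "trig R P \<Longrightarrow> L2 P"
  by (intro L2_smooth trig_smooth)

lemma L2_cosm: "L2 (cosm m)" and L2_sinm: "L2 (sinm m)"
  by (intro L2_smooth smooth_torus_cosm smooth_torus_sinm)+

lemma trig_proj: "trig R (proj R u)"
  unfolding proj_def[abs_def] by (intro trig_sum trig.add trig.cmult trig.cosm trig.sinm)

lemma L2_proj: "L2 (proj R u)"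
  by (rule L2_trig[OF trig_proj])

lemma
  fixes u :: "real^'n \<Rightarrow> real"
  assumes "L2 u" "L2 v"
  shows cos_coeff_add: "cos_coeff (\<lambda>q. u q + v q) m = cos_coeff u m + cos_coeff v m"
    and sin_coeff_add: "sin_coeff (\<lambda>q. u q + v q) m = sin_coeff u m + sin_coeff v m"
    and cos_coeff_diff: "cos_coeff (\<lambda>q. u q - v q) m = cos_coeff u m - cos_coeff v m"
    and sin_coeff_diff: "sin_coeff (\<lambda>q. u q - v q) m = sin_coeff u m - sin_coeff v m"
  using L2_mult[OF assms(1) L2_cosm[of m]] L2_mult[OF assms(1) L2_sinm[of m]]
    L2_mult[OF assms(2) L2_cosm[of m]] L2_mult[OF assms(2) L2_sinm[of m]]
  by (simp_all add: cos_coeff_def sin_coeff_def distrib_right left_diff_distrib)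

lemma cos_coeff_cmult: "cos_coeff (\<lambda>q. c * u q) m = c * cos_coeff u m"
  and sin_coeff_cmult: "sin_coeff (\<lambda>q. c * u q) m = c * sin_coeff u m"
  by (simp_all add: cos_coeff_def sin_coeff_def mult.assoc)

lemma integral_proj_mult:
  fixes u v :: "real^'n \<Rightarrow> real"
  assumes v: "L2 v"
  shows "(\<integral>q. proj R u q * v q \<partial>torus) = parseval_sum R u v"
proof -
  have c: "integrable torus (\<lambda>q. v q * cosm m q)" "integrable torus (\<lambda>q. v q * sinm m q)" for m
    using v by (auto intro!: L2_mult L2_cosm L2_sinm)
  have "(\<integral>q. proj R u q * v q \<partial>torus) =
      (\<integral>q. (\<Sum>m\<in>fbox R. cos_coeff u m * (v q * cosm m q) + sin_coeff u m * (v q * sinm m q)) \<partial>torus)"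
    unfolding proj_def by (intro Bochner_Integration.integral_cong) (auto simp: sum_distrib_right sum_distrib_left algebra_simps)
  also have "\<dots> = parseval_sum R u v"
    using c by (simp add: parseval_sum_def cos_coeff_def sin_coeff_def)
  finally show ?thesis .
qed

lemma parseval_sum_commute: "parseval_sum R u v = parseval_sum R v u"
  by (simp add: parseval_sum_def mult.commute)

lemma integral_smooth [simp]: "integrable torus (cosm m)" "integrable torus (sinm m)"
  by (intro L2_integrable L2_cosm L2_sinm)+

text \<open>The two conditions are separate summands because they coincide for \<open>n = 0\<close>:
  the cosine coefficient is then 1 and the sine coefficient 0.\<close>

lemma coeff_cosm_sinm:
  shows "cos_coeff (cosm n) m = (if m = n then 1/2 else 0) + (if m = - n then 1/2 else 0)"
    "sin_coeff (cosm n) m = 0" "cos_coeff (sinm n) m = 0"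
    "sin_coeff (sinm n) m = (if m = n then 1/2 else 0) - (if m = - n then 1/2 else 0)"
proof -
  have 1: "n - m = 0 \<longleftrightarrow> m = n" "n + m = 0 \<longleftrightarrow> m = - n" by (auto simp: eq_neg_iff_add_eq_0 add.commute)
  show "cos_coeff (cosm n) m = (if m = n then 1/2 else 0) + (if m = - n then 1/2 else 0)"
    by (simp add: cos_coeff_def cosm_cosm integral_cosm 1 del: times_divide_eq_left)
  show "sin_coeff (cosm n) m = 0"
    by (simp add: sin_coeff_def cosm_sinm integral_sinm del: times_divide_eq_left)
  show "cos_coeff (sinm n) m = 0"
    by (simp add: cos_coeff_def sinm_cosm integral_sinm del: times_divide_eq_left)
  show "sin_coeff (sinm n) m = (if m = n then 1/2 else 0) - (if m = - n then 1/2 else 0)"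
    by (simp add: sin_coeff_def sinm_sinm integral_cosm 1 del: times_divide_eq_left)
qed

text \<open>The frequencies \<open>m\<close> and \<open>- m\<close> contribute one half each and add
  up to the whole character.\<close>

lemma proj_trig: "trig R P \<Longrightarrow> proj R P = P"
proof (induction rule: trig.induct)
  case (cosm m R)
  have "- m \<in> fbox R" using cosm by (simp add: fbox_minus)
  then show ?case using cosm
    by (intro ext) (simp add: proj_def coeff_cosm_sinm distrib_right sum.distrib 
        if_distrib[of "\<lambda>x. x * _"] cong: if_cong)
next
  case (sinm m R)
  have "- m \<in> fbox R" using sinm by (simp add: fbox_minus)
  then show ?case using sinm
    by (intro ext) (simp add: proj_def coeff_cosm_sinm left_diff_distrib sum_subtractf
        if_distrib[of "\<lambda>x. x * _"] cong: if_cong)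
next
  case (add R f g)
  have "proj R (\<lambda>q. f q + g q) q = proj R f q + proj R g q" for q
    using add.hyps[THEN L2_trig]
    by (simp add: proj_def cos_coeff_add sin_coeff_add distrib_right sum.distrib)
  then show ?case using add.IH by auto
next
  case (cmult R f c)
  have "proj R (\<lambda>q. c * f q) q = c * proj R f q" for q
    by (simp add: proj_def cos_coeff_cmult sin_coeff_cmult sum_distrib_left distrib_left mult.assoc)
  then show ?case using cmult.IH by auto
qed

lemma integral_proj_proj:
  fixes u v :: "real^'n \<Rightarrow> real"
  assumes "L2 u" "L2 v"
  shows "(\<integral>q. proj R u q * proj R v q \<partial>torus) = parseval_sum R u v"
proof -
  have "(\<integral>q. proj R u q * proj R v q \<partial>torus) = parseval_sum R u (proj R v)"
    by (rule integral_proj_mult[OF L2_proj])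
  also have "\<dots> = parseval_sum R (proj R v) u" by (rule parseval_sum_commute)
  also have "\<dots> = (\<integral>q. proj R (proj R v) q * u q \<partial>torus)" by (rule integral_proj_mult[OF assms(1), symmetric])
  also have "\<dots> = parseval_sum R v u"
    by (simp add: proj_trig[OF trig_proj] integral_proj_mult[OF assms(1)])
  finally show ?thesis by (simp add: parseval_sum_commute)
qed

lemma integral_sub_proj_sq:
  fixes u :: "real^'n \<Rightarrow> real"
  assumes u: "L2 u"
  shows "(\<integral>q. (u q - proj R u q)\<^sup>2 \<partial>torus) = (\<integral>q. (u q)\<^sup>2 \<partial>torus) - parseval_sum R u u"
proof -
  have "(u q - proj R u q)\<^sup>2 = (u q)\<^sup>2 - 2 * (proj R u q * u q) + proj R u q * proj R u q" for q
    by (simp add: power2_eq_square algebra_simps)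
  moreover have "integrable torus (\<lambda>q. (u q)\<^sup>2)" using L2D(3)[OF u] by simp
  ultimately show ?thesis
    using L2_mult[OF L2_proj u, of R u] L2_mult[OF L2_proj L2_proj, of R u R u]
    by (simp add: integral_proj_mult[OF u] integral_proj_proj[OF u u])
qed

text \<open>\<open>P\<close> is fixed by the projection, so replacing \<open>u\<close> by
  \<open>u - P\<close> leaves the left side unchanged, and Bessel's inequality bounds it.\<close>

lemma proj_best_approx:
  fixes u :: "real^'n \<Rightarrow> real"
  assumes u: "L2 u" and P: "trig R P"
  shows "(\<integral>q. (u q - proj R u q)\<^sup>2 \<partial>torus) \<le> (\<integral>q. (u q - P q)\<^sup>2 \<partial>torus)"
proof -
  let ?w = "\<lambda>q. u q - P q"
  have w: "L2 ?w" using u L2_trig[OF P] by (rule L2_diff)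
  have "proj R ?w q = proj R u q - P q" for q
  proof -
    have "proj R ?w q = proj R u q - proj R P q"
      using u L2_trig[OF P] by (simp add: proj_def cos_coeff_diff sin_coeff_diff left_diff_distrib sum_subtractf[symmetric] algebra_simps)
    then show ?thesis by (simp add: proj_trig[OF P])
  qed
  then have "(\<integral>q. (u q - proj R u q)\<^sup>2 \<partial>torus) = (\<integral>q. (?w q - proj R ?w q)\<^sup>2 \<partial>torus)"
    by simp
  also have "\<dots> \<le> (\<integral>q. (?w q)\<^sup>2 \<partial>torus)"
  proof -
    have "parseval_sum R ?w ?w \<ge> 0" unfolding parseval_sum_def by (intro sum_nonneg) simp
    then show ?thesis using integral_sub_proj_sq[OF w, of R] by simp
  qed
  finally show ?thesis .
qed

lemma proj_LIMSEQ:
  fixes u :: "real^'n \<Rightarrow> real"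
  assumes u: "L2 u"
  shows "(\<lambda>R. \<integral>q. (u q - proj R u q)\<^sup>2 \<partial>torus) \<longlonglongrightarrow> 0"
proof (rule LIMSEQ_I)
  fix \<epsilon> :: real assume "\<epsilon> > 0"
  then obtain R P where P: "trig R P" "(\<integral>q. (u q - P q)\<^sup>2 \<partial>torus) < \<epsilon>"
    using trig_dense_L2[OF u] by blast
  have "norm ((\<integral>q. (u q - proj S u q)\<^sup>2 \<partial>torus) - 0) < \<epsilon>" if "S \<ge> R" for S
    using proj_best_approx[OF u trig_mono[OF P(1) that]] P(2)
      Bochner_Integration.integral_nonneg[of torus "\<lambda>q. (u q - proj S u q)\<^sup>2"] by simp
  then show "\<exists>R. \<forall>S\<ge>R. norm ((\<integral>q. (u q - proj S u q)\<^sup>2 \<partial>torus) - 0) < \<epsilon>" by blast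
qed

text \<open>Projecting one factor costs an error controlled by \<open>u - proj R u\<close> through
  Cauchy-Schwarz, and this tends to 0 by density and best approximation.\<close>

theorem Parseval:
  fixes u v :: "real^'n \<Rightarrow> real"
  assumes u: "L2 u" and v: "L2 v"
  shows "(\<lambda>R. parseval_sum R u v) \<longlonglongrightarrow> (\<integral>q. u q * v q \<partial>torus)"
proof -
  have "(\<lambda>R. (\<integral>q. u q * v q \<partial>torus) - parseval_sum R u v) \<longlonglongrightarrow> 0"
  proof (rule Lim_null_comparison)
    have "\<bar>(\<integral>q. u q * v q \<partial>torus) - parseval_sum R u v\<bar> \<le>
        sqrt (\<integral>q. (u q - proj R u q)\<^sup>2 \<partial>torus) * sqrt (\<integral>q. (v q)\<^sup>2 \<partial>torus)" for R
    proof -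
      have "(\<integral>q. (u q - proj R u q) * v q \<partial>torus) = (\<integral>q. u q * v q \<partial>torus) - parseval_sum R u v"
        using L2_mult[OF u v] L2_mult[OF L2_proj v, of R u]
        by (simp add: left_diff_distrib integral_proj_mult[OF v])
      then show ?thesis
        using L2_Cauchy_Schwarz_abs[OF L2_diff[OF u L2_proj] v, of R u] by simp
    qed
    then show "\<forall>\<^sub>F R in sequentially. norm ((\<integral>q. u q * v q \<partial>torus) - parseval_sum R u v) \<le>
        sqrt (\<integral>q. (u q - proj R u q)\<^sup>2 \<partial>torus) * sqrt (\<integral>q. (v q)\<^sup>2 \<partial>torus)" by simp
    have "(\<lambda>R. sqrt (\<integral>q. (u q - proj R u q)\<^sup>2 \<partial>torus)) \<longlonglongrightarrow> 0"
      using tendsto_real_sqrt[OF proj_LIMSEQ[OF u]] by simp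
    then show "(\<lambda>R. sqrt (\<integral>q. (u q - proj R u q)\<^sup>2 \<partial>torus) * sqrt (\<integral>q. (v q)\<^sup>2 \<partial>torus)) \<longlonglongrightarrow> 0"
      by (rule tendsto_mult_left_zero)
  qed
  then have "(\<lambda>R. (\<integral>q. u q * v q \<partial>torus) - ((\<integral>q. u q * v q \<partial>torus) - parseval_sum R u v)) \<longlonglongrightarrow> (\<integral>q. u q * v q \<partial>torus) - 0"
    by (intro tendsto_intros)
  then show ?thesis by simp
qed

section \<open>Weak gradients\<close>

text \<open>A function with one explicit weak gradient. Statements about pairs avoid the choice
  inside \<open>grad\<close>; \<open>H1g_grad\<close> and \<open>grad_AE\<close> lead back to
  it.\<close>

definition H1g :: "(real^'n \<Rightarrow> real) \<Rightarrow> (real^'n \<Rightarrow> real^'n) \<Rightarrow> bool" where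
  "H1g u g \<longleftrightarrow> L2 u \<and> weak_gradient u g"

lemma H1g_iff:
  "H1g u g \<longleftrightarrow> L2 u \<and> L2 g \<and> (\<forall>\<phi> i. smooth_torus \<phi> \<longrightarrow>
     (\<integral>q. u q * partial_deriv i \<phi> q \<partial>torus) = - (\<integral>q. g q $ i * \<phi> q \<partial>torus))"
  by (auto simp: H1g_def weak_gradient_def L2_def)

lemma H1gD:
  assumes "H1g u g" shows "L2 u" "L2 g"
  using assms by (auto simp: H1g_iff)

lemma H1g_by_parts:
  "H1g u g \<Longrightarrow> smooth_torus \<phi> \<Longrightarrow>
    (\<integral>q. u q * partial_deriv i \<phi> q \<partial>torus) = - (\<integral>q. g q $ i * \<phi> q \<partial>torus)"
  by (simp add: H1g_iff)

lemma H1_iff: "u \<in> H1 \<longleftrightarrow> (\<exists>g. H1g u g)"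
  by (auto simp: H1_def H1g_def L2_def)

lemma H1g_grad: "u \<in> H1 \<Longrightarrow> H1g u (grad u)"
  unfolding H1_iff H1g_def grad_def by (metis someI)

text \<open>Characters are test functions, so the Fourier coefficients of a weak gradient are
  determined by those of \<open>u\<close>; uniqueness and the spectral estimates rest on
  this.\<close>

lemma H1g_coeff:
  assumes "H1g u g"
  shows "cos_coeff (\<lambda>q. g q $ i) m = 2 * pi * real_of_int (m $ i) * sin_coeff u m"
    and "sin_coeff (\<lambda>q. g q $ i) m = - (2 * pi * real_of_int (m $ i) * cos_coeff u m)"
  using H1g_by_parts[OF assms smooth_torus_cosm, of i m] H1g_by_parts[OF assms smooth_torus_sinm, of i m]
  by (simp_all add: cos_coeff_def sin_coeff_def partial_deriv_cosm partial_deriv_sinm mult.left_commute[of "u _"])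

lemma zero_coeff_AE:
  fixes u :: "real^'n \<Rightarrow> real"
  assumes u: "L2 u" and "\<And>m. cos_coeff u m = 0" "\<And>m. sin_coeff u m = 0"
  shows "AE q in torus. u q = 0"
proof -
  have "(\<lambda>R. parseval_sum R u u) \<longlonglongrightarrow> (\<integral>q. u q * u q \<partial>torus)" by (rule Parseval[OF u u])
  moreover have "parseval_sum R u u = 0" for R using assms by (simp add: parseval_sum_def)
  ultimately have "(\<integral>q. u q * u q \<partial>torus) = 0" by (simp add: LIMSEQ_const_iff)
  then show ?thesis using sqn_AE_eq_0[OF u] by (simp add: power2_eq_square)
qed

text \<open>The components of both gradients have equal Fourier coefficients, and by Parseval a
  function with vanishing coefficients is zero.\<close>

lemma H1g_unique:
  fixes u :: "real^'n \<Rightarrow> real"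
  assumes g: "H1g u g" and h: "H1g u h"
  shows "AE q in torus. g q = h q"
proof -
  have "AE q in torus. g q $ i - h q $ i = 0" for i
  proof (rule zero_coeff_AE)
    show "L2 (\<lambda>q. g q $ i - h q $ i)" using g h by (intro L2_diff L2_nth) (auto dest: H1gD)
    show "cos_coeff (\<lambda>q. g q $ i - h q $ i) m = 0" "sin_coeff (\<lambda>q. g q $ i - h q $ i) m = 0" for m
      using g h by (simp_all add: cos_coeff_diff sin_coeff_diff L2_nth H1gD H1g_coeff[OF g] H1g_coeff[OF h])
  qed
  then have "AE q in torus. \<forall>i. g q $ i - h q $ i = 0" by (simp add: AE_all_countable)
  then show ?thesis by eventually_elim (simp add: vec_eq_iff)
qed

lemma grad_AE: "H1g u g \<Longrightarrow> AE q in torus. grad u q = g q"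
  using H1g_unique H1g_grad H1_iff by blast

section \<open>Constant-coefficient energies in Fourier variables and Poincare inequalities\<close>

definition coeff_sq :: "(real^'n \<Rightarrow> real) \<Rightarrow> int^'n \<Rightarrow> real" where
  "coeff_sq u m = (cos_coeff u m)\<^sup>2 + (sin_coeff u m)\<^sup>2"

lemma coeff_sq_nonneg [simp]: "0 \<le> coeff_sq u m"
  by (simp add: coeff_sq_def)

lemma parseval_sum_self: "parseval_sum R u u = (\<Sum>m\<in>fbox R. coeff_sq u m)"
  by (simp add: parseval_sum_def coeff_sq_def power2_eq_square)

lemma inner_matrix_expand:
  fixes B :: "real^'n^'n"
  shows "x \<bullet> (B *v y) = (\<Sum>i\<in>UNIV. \<Sum>j\<in>UNIV. B $ i $ j * (x $ i * y $ j))"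
  by (simp add: inner_vec_def matrix_vector_mult_def sum_distrib_left mult.left_commute)

text \<open>Constant coefficients act diagonally in frequency, with symbol
  \<open>4 * pi^2 * (m \<bullet> B m)\<close>.\<close>

lemma parseval_sum_grad:
  assumes "H1g u g"
  shows "(\<Sum>i\<in>UNIV. \<Sum>j\<in>UNIV. B $ i $ j * parseval_sum R (\<lambda>q. g q $ i) (\<lambda>q. g q $ j)) =
    (\<Sum>m\<in>fbox R. 4 * pi\<^sup>2 * (ivec m \<bullet> (B *v ivec m)) * coeff_sq u m)"
proof -
  have "(\<Sum>i\<in>UNIV. \<Sum>j\<in>UNIV. B $ i $ j * parseval_sum R (\<lambda>q. g q $ i) (\<lambda>q. g q $ j)) =
    (\<Sum>i\<in>UNIV. \<Sum>j\<in>UNIV. \<Sum>m\<in>fbox R. 4 * pi\<^sup>2 * (B $ i $ j * (real_of_int (m $ i) * real_of_int (m $ j))) * coeff_sq u m)"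
    unfolding parseval_sum_def H1g_coeff[OF assms] sum_distrib_left
    by (intro sum.cong refl) (simp add: coeff_sq_def power2_eq_square algebra_simps)
  also have "\<dots> = (\<Sum>m\<in>fbox R. \<Sum>i\<in>UNIV. \<Sum>j\<in>UNIV. 4 * pi\<^sup>2 * (B $ i $ j * (real_of_int (m $ i) * real_of_int (m $ j))) * coeff_sq u m)"
    by (subst sum.swap, subst (2) sum.swap, subst sum.swap) (intro sum.cong refl sum.swap)
  also have "\<dots> = (\<Sum>m\<in>fbox R. 4 * pi\<^sup>2 * (ivec m \<bullet> (B *v ivec m)) * coeff_sq u m)"
    by (simp add: inner_matrix_expand sum_distrib_left sum_distrib_right)
  finally show ?thesis .
qed

lemma integral_matrix_expand:
  fixes g h :: "real^'n \<Rightarrow> real^'n"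
  assumes "L2 g" "L2 h"
  shows "(\<integral>q. g q \<bullet> (B *v h q) \<partial>torus) = (\<Sum>i\<in>UNIV. \<Sum>j\<in>UNIV. B $ i $ j * (\<integral>q. g q $ i * h q $ j \<partial>torus))"
proof -
  have "integrable torus (\<lambda>q. g q $ i * h q $ j)" for i j
    using assms by (intro L2_mult L2_nth)
  then show ?thesis by (simp add: inner_matrix_expand)
qed

lemma Parseval_grad:
  assumes "H1g u g"
  shows "(\<lambda>R. \<Sum>m\<in>fbox R. 4 * pi\<^sup>2 * (ivec m \<bullet> (B *v ivec m)) * coeff_sq u m)
     \<longlonglongrightarrow> (\<integral>q. g q \<bullet> (B *v g q) \<partial>torus)"
  unfolding parseval_sum_grad[OF assms, symmetric] integral_matrix_expand[OF H1gD(2)[OF assms] H1gD(2)[OF assms]]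
  using H1gD(2)[OF assms] by (intro tendsto_intros Parseval L2_nth)

lemma coeff_sq_0_mean_zero:
  "(\<integral>q. u q \<partial>torus) = 0 \<Longrightarrow> coeff_sq u 0 = 0"
  by (simp add: coeff_sq_def cos_coeff_def sin_coeff_def)

lemma ivec_norm_ge:
  assumes "m \<notin> fbox R" shows "(real R + 1)\<^sup>2 \<le> (norm (ivec m))\<^sup>2"
proof -
  obtain i where "\<bar>m $ i\<bar> > int R" using assms by (auto simp: fbox_def not_le)
  then have "int R + 1 \<le> \<bar>m $ i\<bar>" by linarith
  then have "real_of_int (int R + 1) \<le> real_of_int \<bar>m $ i\<bar>" by (rule of_int_le_iff[THEN iffD2])
  then have "real R + 1 \<le> \<bar>ivec m $ i\<bar>" by simp
  also have "\<dots> \<le> norm (ivec m)" by (rule component_le_norm_cart)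
  finally show ?thesis by (intro power_mono) auto
qed

text \<open>Outside \<open>fbox R\<close> every frequency has norm at least \<open>R + 1\<close>, so
  the tail of the square norm is dominated term by term by the gradient.\<close>

lemma Poincare_tail:
  fixes u :: "real^'n \<Rightarrow> real"
  assumes ug: "H1g u g"
  shows "4 * pi\<^sup>2 * (real R + 1)\<^sup>2 * (\<integral>q. (u q - proj R u q)\<^sup>2 \<partial>torus) \<le> sqn g"
proof (rule LIMSEQ_le)
  note u = H1gD(1)[OF ug]
  have "(\<lambda>S. parseval_sum S u u) \<longlonglongrightarrow> (\<integral>q. (u q)\<^sup>2 \<partial>torus)"
    using Parseval[OF u u] by (simp add: power2_eq_square)
  then show "(\<lambda>S. 4 * pi\<^sup>2 * (real R + 1)\<^sup>2 * (parseval_sum S u u - parseval_sum R u u)) \<longlonglongrightarrow>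
      4 * pi\<^sup>2 * (real R + 1)\<^sup>2 * (\<integral>q. (u q - proj R u q)\<^sup>2 \<partial>torus)"
    unfolding integral_sub_proj_sq[OF u] by (intro tendsto_intros)
  show "(\<lambda>S. \<Sum>m\<in>fbox S. 4 * pi\<^sup>2 * (ivec m \<bullet> (mat 1 *v ivec m)) * coeff_sq u m) \<longlonglongrightarrow> sqn g"
    using Parseval_grad[OF ug, of "mat 1"] by (simp add: power2_norm_eq_inner)
  show "\<exists>N. \<forall>S\<ge>N. 4 * pi\<^sup>2 * (real R + 1)\<^sup>2 * (parseval_sum S u u - parseval_sum R u u)
      \<le> (\<Sum>m\<in>fbox S. 4 * pi\<^sup>2 * (ivec m \<bullet> (mat 1 *v ivec m)) * coeff_sq u m)"
  proof (intro exI allI impI)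
    fix S assume "R \<le> S"
    then have sub: "fbox R \<subseteq> (fbox S :: (int^'n) set)" by (rule fbox_mono)
    have "4 * pi\<^sup>2 * (real R + 1)\<^sup>2 * (parseval_sum S u u - parseval_sum R u u) =
        (\<Sum>m\<in>fbox S - fbox R. 4 * pi\<^sup>2 * (real R + 1)\<^sup>2 * coeff_sq u m)"
      unfolding parseval_sum_self sum_diff[OF finite_fbox sub, symmetric] sum_distrib_left ..
    also have "\<dots> \<le> (\<Sum>m\<in>fbox S - fbox R. 4 * pi\<^sup>2 * (ivec m \<bullet> (mat 1 *v ivec m)) * coeff_sq u m)"
    proof (intro sum_mono mult_right_mono mult_left_mono)
      fix m :: "int^'n" assume "m \<in> fbox S - fbox R"
      then show "(real R + 1)\<^sup>2 \<le> ivec m \<bullet> (mat 1 *v ivec m)"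
        unfolding matrix_vector_mul_lid power2_norm_eq_inner[symmetric] by (intro ivec_norm_ge) simp
    qed auto
    also have "\<dots> \<le> (\<Sum>m\<in>fbox S. 4 * pi\<^sup>2 * (ivec m \<bullet> (mat 1 *v ivec m)) * coeff_sq u m)"
      by (intro sum_mono2) (auto intro!: mult_nonneg_nonneg)
    finally show "4 * pi\<^sup>2 * (real R + 1)\<^sup>2 * (parseval_sum S u u - parseval_sum R u u)
      \<le> (\<Sum>m\<in>fbox S. 4 * pi\<^sup>2 * (ivec m \<bullet> (mat 1 *v ivec m)) * coeff_sq u m)" .
  qed
qed

text \<open>The tail estimate for \<open>R = 0\<close>, where the projection is the mean; of its
  factor \<open>4 * pi^2\<close> only the lower bound 1 is kept.\<close>

lemma Poincare:
  fixes u :: "real^'n \<Rightarrow> real"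
  assumes ug: "H1g u g" and mean: "(\<integral>q. u q \<partial>torus) = 0"
  shows "(\<integral>q. (u q)\<^sup>2 \<partial>torus) \<le> sqn g"
proof -
  have "(fbox 0 :: (int^'n) set) = {0}" by (auto simp: fbox_def vec_eq_iff)
  then have "proj 0 u q = 0" for q using mean by (simp add: proj_def cos_coeff_def)
  then have 1: "4 * pi\<^sup>2 * (\<integral>q. (u q)\<^sup>2 \<partial>torus) \<le> sqn g" using Poincare_tail[OF ug, of 0] by simp
  have "1 \<le> pi" using pi_ge_two by linarith
  then have "1 \<le> pi\<^sup>2" using power_mono[of 1 pi 2] by simp
  then have "1 * (\<integral>q. (u q)\<^sup>2 \<partial>torus) \<le> 4 * pi\<^sup>2 * (\<integral>q. (u q)\<^sup>2 \<partial>torus)"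
    by (intro mult_right_mono) auto
  then show ?thesis using 1 by simp
qed

section \<open>Rules for weak gradients\<close>

lemma H1g_of_by_parts:
  assumes "L2 u" "L2 g" "\<And>\<phi> i. smooth_torus \<phi> \<Longrightarrow>
     (\<integral>q. u q * partial_deriv i \<phi> q \<partial>torus) = - (\<integral>q. g q $ i * \<phi> q \<partial>torus)"
  shows "H1g u g"
  using assms by (simp add: H1g_iff)

lemma H1g_integrable:
  assumes "H1g u g" "smooth_torus \<phi>"
  shows "integrable torus (\<lambda>q. u q * partial_deriv i \<phi> q)" "integrable torus (\<lambda>q. g q $ i * \<phi> q)"
  using L2_mult[OF H1gD(1)[OF assms(1)] L2_smooth[OF smooth_torus_partial_deriv[OF assms(2)]]]
    L2_mult[OF L2_nth[OF H1gD(2)[OF assms(1)]] L2_smooth[OF assms(2)]] by auto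

lemma H1g_add:
  assumes "H1g u g" "H1g v h" shows "H1g (\<lambda>q. u q + v q) (\<lambda>q. g q + h q)"
proof (rule H1g_of_by_parts)
  show "L2 (\<lambda>q. u q + v q)" "L2 (\<lambda>q. g q + h q)" using assms by (auto intro: L2_add dest: H1gD)
  fix \<phi> :: "real^'a \<Rightarrow> real" and i assume \<phi>: "smooth_torus \<phi>"
  show "(\<integral>q. (u q + v q) * partial_deriv i \<phi> q \<partial>torus) = - (\<integral>q. (g q + h q) $ i * \<phi> q \<partial>torus)"
    using H1g_integrable[OF assms(1) \<phi>, of i] H1g_integrable[OF assms(2) \<phi>, of i]
      H1g_by_parts[OF assms(1) \<phi>, of i] H1g_by_parts[OF assms(2) \<phi>, of i]
    by (simp add: distrib_right)
qed

lemma H1g_cmult: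
  assumes "H1g u g" shows "H1g (\<lambda>q. c * u q) (\<lambda>q. c *\<^sub>R g q)"
proof (rule H1g_of_by_parts)
  show "L2 (\<lambda>q. c * u q)" "L2 (\<lambda>q. c *\<^sub>R g q)" using assms by (auto intro: L2_cmult L2_scaleR dest: H1gD)
  fix \<phi> :: "real^'a \<Rightarrow> real" and i assume \<phi>: "smooth_torus \<phi>"
  show "(\<integral>q. (c * u q) * partial_deriv i \<phi> q \<partial>torus) = - (\<integral>q. (c *\<^sub>R g q) $ i * \<phi> q \<partial>torus)"
    using H1g_by_parts[OF assms \<phi>, of i] by (simp add: mult.assoc)
qed

lemma H1g_smooth:
  assumes u: "smooth_torus u" shows "H1g u (\<lambda>q. \<chi> i. partial_deriv i u q)"
proof (rule H1g_of_by_parts)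
  show "L2 u" by (rule L2_smooth[OF u])
  have "(\<lambda>q. \<chi> i. partial_deriv i u q) = (\<lambda>q. \<Sum>i\<in>UNIV. partial_deriv i u q *\<^sub>R axis i 1)"
    by (auto simp: fun_eq_iff vec_eq_iff axis_def if_distrib cong: if_cong)
  then show "L2 (\<lambda>q. \<chi> i. partial_deriv i u q)"
    using u by (auto intro!: L2_sum L2_mult_smooth L2_const smooth_torus_partial_deriv)
  fix \<phi> :: "real^'a \<Rightarrow> real" and i assume \<phi>: "smooth_torus \<phi>"
  show "(\<integral>q. u q * partial_deriv i \<phi> q \<partial>torus) = - (\<integral>q. (\<chi> i. partial_deriv i u q) $ i * \<phi> q \<partial>torus)"
    using integral_by_parts_smooth[OF u \<phi>] by simp
qed

lemma H1g_const: "H1g (\<lambda>_. c) (\<lambda>_. 0)"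
proof -
  have "(\<lambda>_. \<chi> i. partial_deriv i (\<lambda>_. c) q) = (\<lambda>_. 0 :: real^'n)" for q :: "real^'n"
    by (auto simp: fun_eq_iff vec_eq_iff)
  then show ?thesis using H1g_smooth[OF smooth_torus_const[of c]] by (simp add: zero_vec_def)
qed

lemma H1g_sub_const: "H1g u g \<Longrightarrow> H1g (\<lambda>q. u q - c) g"
  using H1g_add[OF _ H1g_const[of "- c"], of u g] by simp

lemma H1g_sum:
  assumes "\<And>j. j \<in> J \<Longrightarrow> H1g (u j) (g j)"
  shows "H1g (\<lambda>q. \<Sum>j\<in>J. u j q) (\<lambda>q. \<Sum>j\<in>J. g j q)"
  using assms by (induction J rule: infinite_finite_induct) (auto intro: H1g_add H1g_const)

lemma H1g_mult_smooth:
  assumes ug: "H1g u g" and h: "smooth_torus h"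
  shows "H1g (\<lambda>q. h q * u q) (\<lambda>q. h q *\<^sub>R g q + u q *\<^sub>R (\<chi> i. partial_deriv i h q))"
proof (rule H1g_of_by_parts)
  note u = H1gD(1)[OF ug] and g = H1gD(2)[OF ug]
  show "L2 (\<lambda>q. h q * u q)" using L2_mult_smooth[OF u h] by simp
  have "(\<lambda>q. u q *\<^sub>R (\<chi> i. partial_deriv i h q)) = (\<lambda>q. \<Sum>i\<in>UNIV. partial_deriv i h q *\<^sub>R (u q *\<^sub>R axis i 1))"
    by (auto simp: fun_eq_iff vec_eq_iff axis_def if_distrib cong: if_cong)
  moreover have "L2 (\<lambda>q. u q *\<^sub>R (axis i 1 :: real^'a))" for i
    using u by (intro L2_dominated[where h = "\<lambda>q. (norm (u q))\<^sup>2"])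
      (auto simp: L2_def periodic_def norm_axis_1 power_mult_distrib)
  then have "L2 (\<lambda>q. partial_deriv i h q *\<^sub>R (u q *\<^sub>R (axis i 1 :: real^'a)))" for i
    using smooth_torus_partial_deriv[OF h] by (rule L2_mult_smooth)
  then have "L2 (\<lambda>q. \<Sum>i\<in>UNIV. partial_deriv i h q *\<^sub>R (u q *\<^sub>R (axis i 1 :: real^'a)))"
    by (rule L2_sum)
  ultimately have "L2 (\<lambda>q. u q *\<^sub>R (\<chi> i. partial_deriv i h q))"
    by (simp only:)
  then show "L2 (\<lambda>q. h q *\<^sub>R g q + u q *\<^sub>R (\<chi> i. partial_deriv i h q))"
    by (intro L2_add L2_mult_smooth[OF g h])
  fix \<phi> :: "real^'a \<Rightarrow> real" and i assume \<phi>: "smooth_torus \<phi>"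
  \<comment> \<open>The factor \<open>h\<close> is absorbed into the test function; the product rule
    for \<open>h * \<phi>\<close> then separates the two gradient terms.\<close>
  have s: "smooth_torus (\<lambda>q. h q * \<phi> q)" using h \<phi> by (rule smooth_torus_mult)
  have i1: "integrable torus (\<lambda>q. u q * (partial_deriv i h q * \<phi> q))"
    "integrable torus (\<lambda>q. u q * (h q * partial_deriv i \<phi> q))"
    using h \<phi> by (auto intro!: L2_mult[OF u] L2_smooth smooth_torus_mult smooth_torus_partial_deriv)
  have "(\<integral>q. u q * (h q * partial_deriv i \<phi> q) \<partial>torus) + (\<integral>q. u q * (partial_deriv i h q * \<phi> q) \<partial>torus) =
      - (\<integral>q. g q $ i * (h q * \<phi> q) \<partial>torus)"
    using H1g_by_parts[OF ug s, of i] i1 unfolding partial_deriv_smooth_mult[OF h \<phi>] by (simp add: distrib_left)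
  moreover have "(\<integral>q. (h q *\<^sub>R g q + u q *\<^sub>R (\<chi> i. partial_deriv i h q)) $ i * \<phi> q \<partial>torus) =
     (\<integral>q. g q $ i * (h q * \<phi> q) + u q * (partial_deriv i h q * \<phi> q) \<partial>torus)"
    by (intro Bochner_Integration.integral_cong) (auto simp: algebra_simps)
  ultimately show "(\<integral>q. (h q * u q) * partial_deriv i \<phi> q \<partial>torus) =
      - (\<integral>q. (h q *\<^sub>R g q + u q *\<^sub>R (\<chi> i. partial_deriv i h q)) $ i * \<phi> q \<partial>torus)"
    using i1 H1g_integrable(2)[OF ug s, of i] by (simp add: mult_ac)
qed

lemma H1g_translate:
  assumes ug: "H1g u g" shows "H1g (\<lambda>q. u (q + s)) (\<lambda>q. g (q + s))"
proof (rule H1g_of_by_parts)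
  note u = H1gD(1)[OF ug] and g = H1gD(2)[OF ug]
  show "L2 (\<lambda>q. u (q + s))" "L2 (\<lambda>q. g (q + s))" by (intro L2_translate u g)+
  fix \<phi> :: "real^'a \<Rightarrow> real" and i assume \<phi>: "smooth_torus \<phi>"
  define \<psi> where "\<psi> = (\<lambda>q. \<phi> (q - s))"
  have \<psi>: "smooth_torus \<psi>" using smooth_torus_dilate[OF \<phi>, of 1 "- s"] by (simp add: \<psi>_def)
  have d: "partial_deriv i \<psi> q = partial_deriv i \<phi> (q - s)" for q
    using partial_deriv_affine[of \<phi> 1 q "- s" i] smooth_torus_differentiable[OF \<phi>] by (simp add: \<psi>_def)
  have shift: "(\<integral>q. f (q + s) \<partial>torus) = (\<integral>q. f q \<partial>torus)"
    if "f \<in> borel_measurable lebesgue" "periodic f" for f :: "real^'a \<Rightarrow> real"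
    using that by (rule integral_torus_translate)
  have "(\<integral>q. u (q + s) * partial_deriv i \<phi> q \<partial>torus) = (\<integral>q. u q * partial_deriv i \<psi> q \<partial>torus)"
  proof -
    have "periodic (\<lambda>q. u q * partial_deriv i \<psi> q)"
      using L2D(1)[OF u] smooth_torus_periodic[OF smooth_torus_partial_deriv[OF \<psi>]] by (rule periodic_comp2)
    moreover have "(\<lambda>q. u q * partial_deriv i \<psi> q) \<in> borel_measurable lebesgue"
      using L2D(2)[OF u] smooth_torus_measurable[OF smooth_torus_partial_deriv[OF \<psi>]] by measurable
    ultimately show ?thesis
      using shift[of "\<lambda>q. u q * partial_deriv i \<psi> q"] by (simp add: d)
  qed
  also have "\<dots> = - (\<integral>q. g q $ i * \<psi> q \<partial>torus)" by (rule H1g_by_parts[OF ug \<psi>])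
  also have "(\<integral>q. g q $ i * \<psi> q \<partial>torus) = (\<integral>q. g (q + s) $ i * \<phi> q \<partial>torus)"
  proof -
    have "periodic (\<lambda>q. g q $ i * \<psi> q)"
      using L2D(1)[OF L2_nth[OF g]] smooth_torus_periodic[OF \<psi>] by (rule periodic_comp2)
    moreover have "(\<lambda>q. g q $ i * \<psi> q) \<in> borel_measurable lebesgue"
      using L2D(2)[OF L2_nth[OF g]] smooth_torus_measurable[OF \<psi>] by (intro borel_measurable_times)
    ultimately show ?thesis
      using shift[of "\<lambda>q. g q $ i * \<psi> q"] by (simp add: \<psi>_def)
  qed
  finally show "(\<integral>q. u (q + s) * partial_deriv i \<phi> q \<partial>torus) = - (\<integral>q. g (q + s) $ i * \<phi> q \<partial>torus)" .
qed

lemma L2_integral_dilate_mult: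
  fixes f h :: "real^'n \<Rightarrow> real"
  assumes f: "L2 f" and h: "L2 h" and k: "k > 0"
  shows "(\<integral>q. f (real k *\<^sub>R q) * h q \<partial>torus) = (\<integral>q. f q * fold_torus k h q \<partial>torus)"
  by (rule integral_dilate_mult[OF L2D(1,2)[OF f] L2D(1,2)[OF h] L2_mult[OF L2_dilate[OF f k] h] k])

text \<open>A folded test function is again a test function, and its derivative carries a factor
  \<open>1 / k\<close>; this allows dilations to be transposed onto test functions.\<close>

lemma
  assumes \<phi>: "smooth_torus \<phi>" and k: "k > 0"
  shows smooth_torus_fold: "smooth_torus (fold_torus k \<phi>)"
    and partial_deriv_fold: "partial_deriv i (fold_torus k \<phi>) q = inverse (real k) * fold_torus k (partial_deriv i \<phi>) q"
proof -
  have eq: "fold_torus k \<phi> = (\<lambda>y. \<Sum>j\<in>cells k. inverse (real (k ^ CARD('a))) *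
      \<phi> (inverse (real k) *\<^sub>R y + inverse (real k) *\<^sub>R ivec j))"
    by (simp add: fold_torus_def fun_eq_iff sum_distrib_left)
  have "C_k l \<phi>" for l using \<phi> by (simp add: smooth_torus_def)
  then have C: "C_k l (\<lambda>y. inverse (real (k ^ CARD('a))) * \<phi> (inverse (real k) *\<^sub>R y + s))" for l s
    by (intro C_k_mult C_k_const C_k_affine)
  have Csum: "C_k l (\<lambda>y. \<Sum>j\<in>J. f j y)" if "\<And>j. C_k l (f j)" for l J and f :: "int^'a \<Rightarrow> real^'a \<Rightarrow> real"
    by (induction J rule: infinite_finite_induct) (auto intro: C_k_const C_k_add that)
  show "smooth_torus (fold_torus k \<phi>)"
    unfolding smooth_torus_def
  proof (intro conjI allI)
    show "periodic (fold_torus k \<phi>)" by (rule periodic_fold[OF smooth_torus_periodic[OF \<phi>] k])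
    show "C_k l (fold_torus k \<phi>)" for l unfolding eq by (rule Csum) (rule C)
  qed
  have diff: "(\<lambda>y. inverse (real (k ^ CARD('a))) * \<phi> (inverse (real k) *\<^sub>R y + s)) differentiable (at q)" for s q
    using C by (rule C_k_Suc_differentiable)
  have diffsum: "(\<lambda>y. \<Sum>j\<in>J. f j y) differentiable (at q) \<and>
      partial_deriv i (\<lambda>y. \<Sum>j\<in>J. f j y) q = (\<Sum>j\<in>J. partial_deriv i (f j) q)"
    if "\<And>j. f j differentiable (at q)" for J and f :: "int^'a \<Rightarrow> real^'a \<Rightarrow> real"
    using that by (induction J rule: infinite_finite_induct) (auto simp: partial_deriv_add intro: differentiable_add)
  have pd: "partial_deriv i (\<lambda>y. inverse (real (k ^ CARD('a))) * \<phi> (inverse (real k) *\<^sub>R y + s)) q =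
     inverse (real (k ^ CARD('a))) * (inverse (real k) * partial_deriv i \<phi> (inverse (real k) *\<^sub>R q + s))" for s
  proof -
    have "(\<lambda>y. \<phi> (inverse (real k) *\<^sub>R y + s)) differentiable (at q)"
      by (rule differentiableI[OF affine_has_derivative]) (rule smooth_torus_differentiable[OF \<phi>])
    then show ?thesis
      by (simp add: partial_deriv_mult partial_deriv_affine smooth_torus_differentiable[OF \<phi>])
  qed
  show "partial_deriv i (fold_torus k \<phi>) q = inverse (real k) * fold_torus k (partial_deriv i \<phi>) q"
    unfolding eq diffsum[OF diff, THEN conjunct2] pd
    by (simp add: fold_torus_def sum_distrib_left mult.left_commute)
qed

text \<open>The dilation is transposed onto the test function, whose fold is differentiated instead;
  the factor \<open>1 / k\<close> arising there reappears as \<open>real k\<close> on the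
  gradient.\<close>

lemma H1g_dilate:
  assumes ug: "H1g u g" and k: "k > 0"
  shows "H1g (\<lambda>q. u (real k *\<^sub>R q)) (\<lambda>q. real k *\<^sub>R g (real k *\<^sub>R q))"
proof (rule H1g_of_by_parts)
  note u = H1gD(1)[OF ug] and g = H1gD(2)[OF ug]
  show "L2 (\<lambda>q. u (real k *\<^sub>R q))" "L2 (\<lambda>q. real k *\<^sub>R g (real k *\<^sub>R q))"
    by (intro L2_scaleR L2_dilate u g k)+
  fix \<phi> :: "real^'a \<Rightarrow> real" and i assume \<phi>: "smooth_torus \<phi>"
  have "(\<integral>q. u (real k *\<^sub>R q) * partial_deriv i \<phi> q \<partial>torus) = (\<integral>q. u q * fold_torus k (partial_deriv i \<phi>) q \<partial>torus)"
    by (rule L2_integral_dilate_mult[OF u L2_smooth[OF smooth_torus_partial_deriv[OF \<phi>]] k])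
  also have "\<dots> = (\<integral>q. real k * (u q * partial_deriv i (fold_torus k \<phi>) q) \<partial>torus)"
    using k by (intro Bochner_Integration.integral_cong) (auto simp: partial_deriv_fold[OF \<phi> k])
  also have "\<dots> = - (real k * (\<integral>q. g q $ i * fold_torus k \<phi> q \<partial>torus))"
    using H1g_by_parts[OF ug smooth_torus_fold[OF \<phi> k], of i] by simp
  also have "(\<integral>q. g q $ i * fold_torus k \<phi> q \<partial>torus) = (\<integral>q. g (real k *\<^sub>R q) $ i * \<phi> q \<partial>torus)"
    by (rule L2_integral_dilate_mult[OF L2_nth[OF g] L2_smooth[OF \<phi>] k, symmetric])
  finally show "(\<integral>q. u (real k *\<^sub>R q) * partial_deriv i \<phi> q \<partial>torus) =
     - (\<integral>q. (real k *\<^sub>R g (real k *\<^sub>R q)) $ i * \<phi> q \<partial>torus)"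
    by (simp add: mult.assoc)
qed

text \<open>The transpose of the argument for dilations, with test function
  \<open>\<phi> (k q)\<close>. In other words the fold of a gradient is \<open>k\<close> times a
  gradient, which later transports the corrector equation to scale \<open>1 / k\<close>.\<close>

lemma H1g_fold:
  assumes ug: "H1g u g" and k: "k > 0"
  shows "H1g (fold_torus k u) (\<lambda>q. inverse (real k) *\<^sub>R fold_torus k g q)"
proof (rule H1g_of_by_parts)
  note u = H1gD(1)[OF ug] and g = H1gD(2)[OF ug]
  show "L2 (fold_torus k u)" "L2 (\<lambda>q. inverse (real k) *\<^sub>R fold_torus k g q)"
    by (intro L2_scaleR L2_fold u g k)+
  fix \<phi> :: "real^'a \<Rightarrow> real" and i assume \<phi>: "smooth_torus \<phi>"
  define \<psi> where "\<psi> = (\<lambda>q. \<phi> (real k *\<^sub>R q))"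
  have \<psi>: "smooth_torus \<psi>" using smooth_torus_dilate[OF \<phi>, of k 0] by (simp add: \<psi>_def)
  have d: "partial_deriv i \<psi> q = real k * partial_deriv i \<phi> (real k *\<^sub>R q)" for q
    using partial_deriv_affine[of \<phi> "real k" q 0 i] smooth_torus_differentiable[OF \<phi>] by (simp add: \<psi>_def)
  have "(\<integral>q. fold_torus k u q * partial_deriv i \<phi> q \<partial>torus) = (\<integral>q. partial_deriv i \<phi> (real k *\<^sub>R q) * u q \<partial>torus)"
    using L2_integral_dilate_mult[OF L2_smooth[OF smooth_torus_partial_deriv[OF \<phi>]] u k, of i] by (simp add: mult.commute)
  also have "\<dots> = (\<integral>q. inverse (real k) * (u q * partial_deriv i \<psi> q) \<partial>torus)"
    using k by (intro Bochner_Integration.integral_cong) (auto simp: d)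
  also have "\<dots> = - (inverse (real k) * (\<integral>q. g q $ i * \<psi> q \<partial>torus))"
    using H1g_by_parts[OF ug \<psi>, of i] by simp
  also have "(\<integral>q. g q $ i * \<psi> q \<partial>torus) = (\<integral>q. \<phi> q * fold_torus k (\<lambda>q. g q $ i) q \<partial>torus)"
    using L2_integral_dilate_mult[OF L2_smooth[OF \<phi>] L2_nth[OF g] k, of i] by (simp add: \<psi>_def mult.commute)
  also have "fold_torus k (\<lambda>q. g q $ i) = (\<lambda>q. fold_torus k g q $ i)"
    by (simp add: fold_torus_def fun_eq_iff)
  finally show "(\<integral>q. fold_torus k u q * partial_deriv i \<phi> q \<partial>torus) =
     - (\<integral>q. (inverse (real k) *\<^sub>R fold_torus k g q) $ i * \<phi> q \<partial>torus)"
    by (simp add: mult.assoc mult.commute[of "\<phi> _"])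
qed

section \<open>Limits and means of weak gradients\<close>

lemma L2_inner_tendsto:
  fixes f :: "nat \<Rightarrow> real^'n \<Rightarrow> 'a::euclidean_space"
  assumes f: "\<And>n. L2 (f n)" and l: "L2 l" and h: "L2 h" and lim: "(\<lambda>n. sqn (\<lambda>q. f n q - l q)) \<longlonglongrightarrow> 0"
  shows "(\<lambda>n. \<integral>q. f n q \<bullet> h q \<partial>torus) \<longlonglongrightarrow> (\<integral>q. l q \<bullet> h q \<partial>torus)"
proof -
  have "(\<lambda>n. (\<integral>q. f n q \<bullet> h q \<partial>torus) - (\<integral>q. l q \<bullet> h q \<partial>torus)) \<longlonglongrightarrow> 0"
  proof (rule Lim_null_comparison)
    have "\<bar>(\<integral>q. f n q \<bullet> h q \<partial>torus) - (\<integral>q. l q \<bullet> h q \<partial>torus)\<bar> \<le> sqrt (sqn (\<lambda>q. f n q - l q)) * sqrt (sqn h)" for n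
      using L2_Cauchy_Schwarz_abs[OF L2_diff[OF f l] h, of n] L2_inner[OF f h] L2_inner[OF l h]
      by (simp add: inner_diff_left)
    then show "\<forall>\<^sub>F n in sequentially. norm ((\<integral>q. f n q \<bullet> h q \<partial>torus) - (\<integral>q. l q \<bullet> h q \<partial>torus)) \<le> sqrt (sqn (\<lambda>q. f n q - l q)) * sqrt (sqn h)"
      by simp
    have "(\<lambda>n. sqrt (sqn (\<lambda>q. f n q - l q))) \<longlonglongrightarrow> 0" using tendsto_real_sqrt[OF lim] by simp
    then show "(\<lambda>n. sqrt (sqn (\<lambda>q. f n q - l q)) * sqrt (sqn h)) \<longlonglongrightarrow> 0" by (rule tendsto_mult_left_zero)
  qed
  then show ?thesis by (rule LIM_zero_cancel)
qed

lemma sqn_nth_le: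
  fixes g :: "real^'n \<Rightarrow> real^'n"
  assumes "L2 g" shows "sqn (\<lambda>q. g q $ i) \<le> sqn g"
proof (rule Bochner_Integration.integral_mono)
  show "(norm (g q $ i))\<^sup>2 \<le> (norm (g q))\<^sup>2" for q
    using component_le_norm_cart[of "g q" i] by (simp add: abs_le_square_iff[symmetric])
qed (use assms L2_nth[OF assms] L2D(3) in blast)+

lemma H1g_limit:
  fixes u :: "nat \<Rightarrow> real^'n \<Rightarrow> real"
  assumes ug: "\<And>n. H1g (u n) (g n)" and v: "L2 v" and h: "L2 h"
    and ulim: "(\<lambda>n. sqn (\<lambda>q. u n q - v q)) \<longlonglongrightarrow> 0" and glim: "(\<lambda>n. sqn (\<lambda>q. g n q - h q)) \<longlonglongrightarrow> 0"
  shows "H1g v h"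
proof (rule H1g_of_by_parts[OF v h])
  fix \<phi> :: "real^'n \<Rightarrow> real" and i assume \<phi>: "smooth_torus \<phi>"
  have 1: "(\<lambda>n. \<integral>q. u n q * partial_deriv i \<phi> q \<partial>torus) \<longlonglongrightarrow> (\<integral>q. v q * partial_deriv i \<phi> q \<partial>torus)"
    using L2_inner_tendsto[OF H1gD(1)[OF ug] v L2_smooth[OF smooth_torus_partial_deriv[OF \<phi>]] ulim] by simp
  have "(\<lambda>n. sqn (\<lambda>q. g n q $ i - h q $ i)) \<longlonglongrightarrow> 0"
  proof (rule tendsto_sandwich[OF _ _ tendsto_const glim])
    show "\<forall>\<^sub>F n in sequentially. sqn (\<lambda>q. g n q $ i - h q $ i) \<le> sqn (\<lambda>q. g n q - h q)"
      using sqn_nth_le[OF L2_diff[OF H1gD(2)[OF ug] h], of _ i] by simp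
  qed (auto intro: always_eventually)
  then have 2: "(\<lambda>n. \<integral>q. g n q $ i * \<phi> q \<partial>torus) \<longlonglongrightarrow> (\<integral>q. h q $ i * \<phi> q \<partial>torus)"
    using L2_inner_tendsto[OF L2_nth[OF H1gD(2)[OF ug]] L2_nth[OF h] L2_smooth[OF \<phi>]] by simp
  have "(\<lambda>n. \<integral>q. u n q * partial_deriv i \<phi> q \<partial>torus) \<longlonglongrightarrow> - (\<integral>q. h q $ i * \<phi> q \<partial>torus)"
    unfolding H1g_by_parts[OF ug \<phi>] by (rule tendsto_minus[OF 2])
  then show "(\<integral>q. v q * partial_deriv i \<phi> q \<partial>torus) = - (\<integral>q. h q $ i * \<phi> q \<partial>torus)"
    using 1 LIMSEQ_unique by blast
qed

lemma H1g_integral_grad: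
  assumes "H1g u g" shows "(\<integral>q. g q $ i \<partial>torus) = 0"
  using H1g_by_parts[OF assms smooth_torus_const[of 1], of i] by simp

lemma H1g_integral_inner_const:
  assumes "H1g u g" shows "(\<integral>q. x \<bullet> g q \<partial>torus) = 0"
proof -
  have "integrable torus (\<lambda>q. g q $ i)" for i using H1gD(2)[OF assms] by (intro L2_integrable L2_nth)
  then show ?thesis by (simp add: inner_vec_def H1g_integral_grad[OF assms])
qed

section \<open>Coefficient fields and correctors\<close>

lemma psd_symmetric: "M \<in> psd \<Longrightarrow> x \<bullet> (M *v y) = y \<bullet> (M *v x)"
  unfolding psd_def by (metis (mono_tags, lifting) dot_lmul_matrix inner_commute mem_Collect_eq transpose_matrix_vector)

lemma M_ab_psd: "M \<in> M_ab a b \<Longrightarrow> M \<in> psd"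
  by (simp add: M_ab_def)

lemma M_ab_lower: "M \<in> M_ab a b \<Longrightarrow> a * (norm x)\<^sup>2 \<le> x \<bullet> (M *v x)"
  and M_ab_upper: "M \<in> M_ab a b \<Longrightarrow> x \<bullet> (M *v x) \<le> (1 / b) * (norm x)\<^sup>2"
  by (simp_all add: M_ab_def)

lemma psd_Cauchy_Schwarz:
  assumes M: "M \<in> psd" shows "(x \<bullet> (M *v y))\<^sup>2 \<le> (x \<bullet> (M *v x)) * (y \<bullet> (M *v y))"
proof (rule quadratic_nonneg_discriminant)
  fix t :: real
  have "0 \<le> (x + t *\<^sub>R y) \<bullet> (M *v (x + t *\<^sub>R y))" using M by (simp add: psd_def)
  also have "\<dots> = x \<bullet> (M *v x) + 2 * t * (x \<bullet> (M *v y)) + t\<^sup>2 * (y \<bullet> (M *v y))"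
    using psd_symmetric[OF M, of y x]
    by (simp add: matrix_vector_right_distrib matrix_vector_mult_scaleR inner_simps power2_eq_square algebra_simps)
  finally show "0 \<le> x \<bullet> (M *v x) + 2 * t * (x \<bullet> (M *v y)) + t\<^sup>2 * (y \<bullet> (M *v y))" .
qed

text \<open>Cauchy-Schwarz for the form of \<open>M\<close> with the vectors \<open>M x\<close> and
  \<open>x\<close> bounds the fourth power of \<open>norm (M x)\<close>; one square cancels.\<close>

lemma M_ab_norm_mult:
  assumes M: "M \<in> M_ab a b" and b: "b > 0" shows "(norm (M *v x))\<^sup>2 \<le> (1 / b)\<^sup>2 * (norm x)\<^sup>2"
proof -
  let ?y = "M *v x"
  have "((norm ?y)\<^sup>2)\<^sup>2 = (?y \<bullet> (M *v x))\<^sup>2" by (simp add: power2_norm_eq_inner)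
  also have "\<dots> \<le> (?y \<bullet> (M *v ?y)) * (x \<bullet> (M *v x))" by (rule psd_Cauchy_Schwarz[OF M_ab_psd[OF M]])
  also have "\<dots> \<le> ((1 / b) * (norm ?y)\<^sup>2) * ((1 / b) * (norm x)\<^sup>2)"
    using M b by (intro mult_mono M_ab_upper) (auto simp: M_ab_def psd_def)
  finally have *: "(norm ?y)\<^sup>2 * (norm ?y)\<^sup>2 \<le> (norm ?y)\<^sup>2 * ((1 / b)\<^sup>2 * (norm x)\<^sup>2)"
    by (simp add: power2_eq_square mult_ac)
  show ?thesis
  proof (cases "norm ?y = 0")
    case False
    then have "(norm ?y)\<^sup>2 > 0" by simp
    then show ?thesis using * mult_le_cancel_left_pos by blast
  qed simp
qed

text \<open>The ellipticity of \<open>exp (- V) D\<close>, which is what the homogenization argument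
  keeps of a diffusion. It holds almost everywhere, and so do the symmetry and positivity derived
  from it.\<close>

definition coeff :: "real \<Rightarrow> real \<Rightarrow> (real^'n \<Rightarrow> real^'n^'n) \<Rightarrow> bool" where
  "coeff a b A \<longleftrightarrow> periodic A \<and> A \<in> borel_measurable lebesgue \<and> (AE q in torus. A q \<in> M_ab a b)"

lemma borel_measurable_nth:
  fixes f :: "'a \<Rightarrow> 'b::euclidean_space^'n"
  shows "f \<in> borel_measurable M \<Longrightarrow> (\<lambda>x. f x $ i) \<in> borel_measurable M"
  by (rule measurable_compose[OF _ borel_measurable_continuous_onI]) (auto intro: continuous_intros)

lemma borel_measurable_mult_vec:
  fixes A :: "'a \<Rightarrow> real^'n^'n" and g :: "'a \<Rightarrow> real^'n"
  assumes "A \<in> borel_measurable M" "g \<in> borel_measurable M"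
  shows "(\<lambda>x. A x *v g x) \<in> borel_measurable M"
  unfolding borel_measurable_euclidean_space[of "\<lambda>x. A x *v g x"]
proof
  fix b :: "real^'n" assume "b \<in> Basis"
  then obtain i where b: "b = axis i 1" by (auto simp: Basis_vec_def)
  have "(\<lambda>x. \<Sum>j\<in>UNIV. A x $ i $ j * g x $ j) \<in> borel_measurable M"
    using assms by (intro borel_measurable_sum borel_measurable_times borel_measurable_nth)
  then show "(\<lambda>x. (A x *v g x) \<bullet> b) \<in> borel_measurable M"
    by (simp add: b inner_axis matrix_vector_mult_def)
qed

lemma L2_coeff:
  assumes A: "coeff a b A" and b: "b > 0" and g: "L2 g"
  shows "L2 (\<lambda>q. A q *v g q)"
  unfolding L2_def
proof (intro conjI)
  show "periodic (\<lambda>q. A q *v g q)" using A g by (auto simp: coeff_def L2_def periodic_def)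
  show m: "(\<lambda>q. A q *v g q) \<in> borel_measurable lebesgue"
    using A g by (intro borel_measurable_mult_vec) (auto simp: coeff_def L2_def)
  show "integrable torus (\<lambda>q. (norm (A q *v g q))\<^sup>2)"
  proof (rule Bochner_Integration.integrable_bound)
    show "integrable torus (\<lambda>q. (1 / b)\<^sup>2 * (norm (g q))\<^sup>2)" using L2D(3)[OF g] by simp
    show "(\<lambda>q. (norm (A q *v g q))\<^sup>2) \<in> borel_measurable torus"
      using measurable_torusI[OF m] by measurable
    show "AE q in torus. norm ((norm (A q *v g q))\<^sup>2) \<le> norm ((1 / b)\<^sup>2 * (norm (g q))\<^sup>2)"
      using A unfolding coeff_def by (auto elim!: eventually_mono dest: M_ab_norm_mult[OF _ b])
  qed
qed

definition energy :: "(real^'n \<Rightarrow> real^'n^'n) \<Rightarrow> (real^'n \<Rightarrow> real^'n) \<Rightarrow> (real^'n \<Rightarrow> real^'n) \<Rightarrow> real" where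
  "energy A g h = (\<integral>q. g q \<bullet> (A q *v h q) \<partial>torus)"

lemma energy_cong_AE:
  assumes "AE q in torus. g q = g' q" "AE q in torus. h q = h' q"
    and "coeff a b A" "L2 g" "L2 g'" "L2 h" "L2 h'"
  shows "energy A g h = energy A g' h'"
proof -
  note m = borel_measurable_mult_vec[OF measurable_torusI]
  have A: "A \<in> borel_measurable lebesgue" using assms(3) by (simp add: coeff_def)
  show ?thesis unfolding energy_def
    using assms(1,2) assms(4-7)[THEN L2D(4)]
    by (intro integral_cong_AE borel_measurable_inner m[OF A]) (auto elim: eventually_elim2)
qed

context
  fixes a b :: real and A :: "real^'n \<Rightarrow> real^'n^'n"
  assumes A: "coeff a b A" and a: "a > 0" and b: "b > 0"
begin

lemma integrable_energy: "L2 g \<Longrightarrow> L2 h \<Longrightarrow> integrable torus (\<lambda>q. g q \<bullet> (A q *v h q))"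
  by (intro L2_inner L2_coeff[OF A b])

lemma energy_sym: "L2 g \<Longrightarrow> L2 h \<Longrightarrow> energy A g h = energy A h g"
proof -
  assume g: "L2 g" and h: "L2 h"
  have "AE q in torus. g q \<bullet> (A q *v h q) = h q \<bullet> (A q *v g q)"
    using A unfolding coeff_def by (auto elim!: eventually_mono intro: psd_symmetric[OF M_ab_psd])
  then show ?thesis unfolding energy_def
    using integrable_energy[OF g h] integrable_energy[OF h g] by (intro integral_cong_AE) auto
qed

lemma energy_add_right: "L2 g \<Longrightarrow> L2 h \<Longrightarrow> L2 k \<Longrightarrow> energy A g (\<lambda>q. h q + k q) = energy A g h + energy A g k"
  using integrable_energy[of g h] integrable_energy[of g k]
  by (simp add: energy_def matrix_vector_right_distrib inner_add_right)

lemma energy_add_left: "L2 g \<Longrightarrow> L2 h \<Longrightarrow> L2 k \<Longrightarrow> energy A (\<lambda>q. h q + k q) g = energy A h g + energy A k g"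
  using integrable_energy[of h g] integrable_energy[of k g]
  by (simp add: energy_def inner_add_left)

lemma energy_scale_right: "energy A g (\<lambda>q. c *\<^sub>R h q) = c * energy A g h"
  by (simp add: energy_def matrix_vector_mult_scaleR)

lemma energy_scale_left: "energy A (\<lambda>q. c *\<^sub>R g q) h = c * energy A g h"
  by (simp add: energy_def)

lemma energy_add_scale_sq:
  assumes "L2 g" "L2 h"
  shows "energy A (\<lambda>q. g q + t *\<^sub>R h q) (\<lambda>q. g q + t *\<^sub>R h q) =
    energy A g g + 2 * t * energy A g h + t\<^sup>2 * energy A h h"
  using assms by (simp add: energy_add_left energy_add_right energy_scale_left energy_scale_right L2_add L2_scaleR
      energy_sym[of h g] power2_eq_square algebra_simps)

lemma energy_lower: "L2 g \<Longrightarrow> a * sqn g \<le> energy A g g"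
proof -
  assume g: "L2 g"
  have "(\<integral>q. a * (norm (g q))\<^sup>2 \<partial>torus) \<le> energy A g g"
    unfolding energy_def using A L2D(3)[OF g] integrable_energy[OF g g] unfolding coeff_def
    by (intro integral_mono_AE) (auto elim!: eventually_mono intro: M_ab_lower)
  then show ?thesis by simp
qed

lemma energy_upper: "L2 g \<Longrightarrow> energy A g g \<le> (1 / b) * sqn g"
proof -
  assume g: "L2 g"
  have "energy A g g \<le> (\<integral>q. (1 / b) * (norm (g q))\<^sup>2 \<partial>torus)"
    unfolding energy_def using A L2D(3)[OF g] integrable_energy[OF g g] unfolding coeff_def
    by (intro integral_mono_AE) (auto elim!: eventually_mono dest: M_ab_upper)
  then show ?thesis by simp
qed

lemma energy_nonneg: "L2 g \<Longrightarrow> 0 \<le> energy A g g"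
  using energy_lower[of g] sqn_nonneg[of g] a by (meson less_imp_le mult_nonneg_nonneg order_trans)

lemma energy_tendsto:
  assumes f: "\<And>n. L2 (f n)" and l: "L2 l" and h: "L2 h" and lim: "(\<lambda>n. sqn (\<lambda>q. f n q - l q)) \<longlonglongrightarrow> 0"
  shows "(\<lambda>n. energy A h (f n)) \<longlonglongrightarrow> energy A h l"
proof -
  have "energy A h k = (\<integral>q. k q \<bullet> (A q *v h q) \<partial>torus)" if "L2 k" for k
    using energy_sym[OF h that] by (simp add: energy_def)
  then show ?thesis using L2_inner_tendsto[OF f l L2_coeff[OF A b h] lim] f l by simp
qed

text \<open>Direct method: among gradients of mean-zero functions minimize the energy of
  \<open>e + g\<close>. Uniform convexity makes a minimizing sequence Cauchy, and the vanishing
  first variation at its limit is the corrector equation.\<close>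

lemma corrector_exists:
  "\<exists>w g. H1g w g \<and> (\<integral>q. w q \<partial>torus) = 0 \<and>
     (\<forall>\<phi> h. H1g \<phi> h \<longrightarrow> energy A h (\<lambda>q. e + g q) = 0)"
proof -
  define X where "X = {g :: real^'n \<Rightarrow> real^'n. \<exists>w. H1g w g \<and> (\<integral>q. w q \<partial>torus) = 0}"
  define J where "J = (\<lambda>g. energy A (\<lambda>q. e + g q) (\<lambda>q. e + g q))"
  define I where "I = Inf (J ` X)"
  have XL: "L2 g" if "g \<in> X" for g using that by (auto simp: X_def dest: H1gD)
  have X0: "(\<lambda>_. 0) \<in> X" using H1g_const[of 0] unfolding X_def by force
  have Xadd: "(\<lambda>q. g q + t *\<^sub>R h q) \<in> X" if gh: "g \<in> X" "h \<in> X" for g h t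
  proof -
    obtain w v where w: "H1g w g" "(\<integral>q. w q \<partial>torus) = 0" and v: "H1g v h" "(\<integral>q. v q \<partial>torus) = 0"
      using gh by (auto simp: X_def)
    have "H1g (\<lambda>q. w q + t * v q) (\<lambda>q. g q + t *\<^sub>R h q)"
      by (intro H1g_add H1g_cmult w v)
    moreover have "(\<integral>q. w q + t * v q \<partial>torus) = 0"
      using w v by (simp add: H1gD L2_integrable)
    ultimately show ?thesis by (auto simp: X_def)
  qed
  have eL: "L2 (\<lambda>q. e + g q)" if "g \<in> X" for g
    using XL[OF that] by (intro L2_add L2_const)
  have J0: "0 \<le> J g" if "g \<in> X" for g unfolding J_def using eL[OF that] by (rule energy_nonneg)
  have bdd: "bdd_below (J ` X)" using J0 by (auto simp: bdd_below_def)
  have IJ: "I \<le> J g" if "g \<in> X" for g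
    unfolding I_def using that bdd by (intro cInf_lower) auto
  \<comment> \<open>The tolerance is chosen backwards: it yields energy at most
    \<open>a / 2 * (1/4)^n\<close> for consecutive differences, and after division by
    \<open>a\<close> the rate required by \<open>L2_complete\<close>.\<close>
  have "\<exists>g. g \<in> X \<and> J g < I + a / 8 * (1/4) ^ n" for n
  proof -
    have "I < I + a / 8 * (1/4) ^ n" using a by simp
    then have "\<exists>y\<in>J ` X. y < I + a / 8 * (1/4) ^ n"
      unfolding I_def using X0 bdd by (subst cInf_less_iff[symmetric]) auto
    then show ?thesis by auto
  qed
  then obtain g where g: "\<And>n. g n \<in> X" "\<And>n. J (g n) < I + a / 8 * (1/4) ^ n" by metis
  have Jt: "J (\<lambda>q. f q + t *\<^sub>R h q) = J f + 2 * t * energy A (\<lambda>q. e + f q) h + t\<^sup>2 * energy A h h"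
    if "f \<in> X" "h \<in> X" for f h t
    unfolding J_def using energy_add_scale_sq[OF eL[OF that(1)] XL[OF that(2)], of t] by (simp add: add.assoc)
  \<comment> \<open>Moving from \<open>g n\<close> in direction \<open>h\<close> cannot go below
    \<open>I\<close>; nonnegativity of this quadratic in the step bounds the first variation by the
    distance to the infimum.\<close>
  have disc: "(energy A (\<lambda>q. e + g n q) h)\<^sup>2 \<le> (J (g n) - I) * energy A h h" if h: "h \<in> X" for n h
  proof (rule quadratic_nonneg_discriminant)
    fix t show "0 \<le> J (g n) - I + 2 * t * energy A (\<lambda>q. e + g n q) h + t\<^sup>2 * energy A h h"
      using IJ[OF Xadd[OF g(1) h, of n t]] Jt[OF g(1) h, of n t] by simp
  qed
  have Cauchy: "sqn (\<lambda>q. g (Suc n) q - g n q) \<le> (1/4) ^ n" for n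
  proof -
    let ?h = "\<lambda>q. g (Suc n) q + (-1) *\<^sub>R g n q"
    have hX: "?h \<in> X" using Xadd[OF g(1) g(1), of "Suc n" "-1" n] by simp
    let ?E = "energy A ?h ?h" and ?B = "energy A (\<lambda>q. e + g n q) ?h"
    have "J (\<lambda>q. g n q + 1 *\<^sub>R ?h q) = J (g n) + 2 * 1 * ?B + 1\<^sup>2 * ?E" by (rule Jt[OF g(1) hX])
    then have 1: "J (g (Suc n)) = J (g n) + 2 * ?B + ?E" by simp
    \<comment> \<open>The midpoint of consecutive members is admissible, which bounds the energy of
      their difference as in the parallelogram law.\<close>
    have "I \<le> J (\<lambda>q. g n q + (1/2) *\<^sub>R ?h q)" by (rule IJ[OF Xadd[OF g(1) hX]])
    also have "\<dots> = J (g n) + 2 * (1/2) * ?B + (1/2)\<^sup>2 * ?E" by (rule Jt[OF g(1) hX])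
    finally have 2: "I \<le> J (g n) + ?B + ?E / 4" by (simp add: power2_eq_square)
    have "?E / 4 \<le> (J (g n) - I) / 2 + (J (g (Suc n)) - I) / 2" using 1 2 by argo
    also have "\<dots> \<le> a / 8 * (1/4) ^ n"
    proof -
      have "a / 8 * (1/4) ^ Suc n \<le> a / 8 * (1/4) ^ n" using a by simp
      moreover have "x < I + d \<Longrightarrow> y < I + d' \<Longrightarrow> d' \<le> d \<Longrightarrow> (x - I) / 2 + (y - I) / 2 \<le> d" for x y d d' :: real
        by argo
      ultimately show ?thesis using g(2)[of n] g(2)[of "Suc n"] by blast
    qed
    finally have 3: "?E / 4 \<le> a / 8 * (1/4) ^ n" .
    have "s \<le> a * c" if "E / 4 \<le> a / 8 * c" "0 \<le> E" "s \<le> E" for E s c :: real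
      using that by simp
    from this[OF 3 energy_nonneg[OF XL[OF hX]] energy_lower[OF XL[OF hX]]]
    show ?thesis using a by simp
  qed
  obtain w where w: "\<And>n. H1g (w n) (g n)" "\<And>n. (\<integral>q. w n q \<partial>torus) = 0"
    using g(1) unfolding X_def by (auto simp: choice_iff) metis
  \<comment> \<open>Poincare transfers the rate from gradients to potentials, so the limit is again
    the gradient of a mean-zero function.\<close>
  have wCauchy: "sqn (\<lambda>q. w (Suc n) q - w n q) \<le> (1/4) ^ n" for n
  proof -
    have 1: "H1g (\<lambda>q. w (Suc n) q + (-1) * w n q) (\<lambda>q. g (Suc n) q + (-1) *\<^sub>R g n q)"
      by (intro H1g_add H1g_cmult w)
    have "(\<integral>q. w (Suc n) q + (-1) * w n q \<partial>torus) = 0"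
      using w by (simp add: H1gD[OF w(1)] L2_integrable)
    from Poincare[OF 1 this] show ?thesis using Cauchy[of n] by simp
  qed
  obtain G where G: "L2 G" "(\<lambda>n. sqn (\<lambda>q. g n q - G q)) \<longlonglongrightarrow> 0"
    using L2_complete[of g, OF H1gD(2)[OF w(1)] Cauchy] by blast
  obtain W where W: "L2 W" "(\<lambda>n. sqn (\<lambda>q. w n q - W q)) \<longlonglongrightarrow> 0"
    using L2_complete[of w, OF H1gD(1)[OF w(1)] wCauchy] by blast
  have WG: "H1g W G" by (rule H1g_limit[OF w(1) W(1) G(1) W(2) G(2)])
  have "(\<lambda>n. \<integral>q. w n q \<bullet> 1 \<partial>torus) \<longlonglongrightarrow> (\<integral>q. W q \<bullet> 1 \<partial>torus)"
    by (rule L2_inner_tendsto[OF H1gD(1)[OF w(1)] W(1) L2_const W(2)])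
  then have W0: "(\<integral>q. W q \<partial>torus) = 0" using w(2) by (simp add: LIMSEQ_const_iff)
  have main: "energy A h (\<lambda>q. e + G q) = 0" if h: "h \<in> X" for h
  proof -
    have "(\<lambda>n. sqn (\<lambda>q. (e + g n q) - (e + G q))) \<longlonglongrightarrow> 0" using G(2) by simp
    then have "(\<lambda>n. energy A h (\<lambda>q. e + g n q)) \<longlonglongrightarrow> energy A h (\<lambda>q. e + G q)"
      by (intro energy_tendsto eL g(1) L2_add L2_const G(1) XL[OF h])
    then have "(\<lambda>n. (energy A h (\<lambda>q. e + g n q))\<^sup>2) \<longlonglongrightarrow> (energy A h (\<lambda>q. e + G q))\<^sup>2"
      by (rule tendsto_power)
    moreover have "(\<lambda>n. (energy A h (\<lambda>q. e + g n q))\<^sup>2) \<longlonglongrightarrow> 0"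
    proof (rule tendsto_sandwich[OF _ _ tendsto_const])
      show "\<forall>\<^sub>F n in sequentially. (energy A h (\<lambda>q. e + g n q))\<^sup>2 \<le> (a / 8 * (1/4) ^ n) * energy A h h"
      proof (intro always_eventually allI)
        fix n
        have "(energy A h (\<lambda>q. e + g n q))\<^sup>2 \<le> (J (g n) - I) * energy A h h"
          using disc[OF h, of n] energy_sym[OF eL[OF g(1)] XL[OF h], of n] by simp
        also have "\<dots> \<le> (a / 8 * (1/4) ^ n) * energy A h h"
          using g(2)[of n] energy_nonneg[OF XL[OF h]] by (intro mult_right_mono) auto
        finally show "(energy A h (\<lambda>q. e + g n q))\<^sup>2 \<le> (a / 8 * (1/4) ^ n) * energy A h h" .
      qed
      show "(\<lambda>n. (a / 8 * (1/4) ^ n) * energy A h h) \<longlonglongrightarrow> 0"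
        by (intro tendsto_mult_left_zero tendsto_mult_right_zero LIMSEQ_power_zero) simp
    qed simp
    ultimately have "(energy A h (\<lambda>q. e + G q))\<^sup>2 = 0" by (rule LIMSEQ_unique)
    then show ?thesis by simp
  qed
  \<comment> \<open>Subtracting the mean of \<open>\<phi>\<close> does not change its gradient, so
    the restriction to \<open>X\<close> disappears.\<close>
  have "energy A h (\<lambda>q. e + G q) = 0" if \<phi>: "H1g \<phi> h" for \<phi> h
  proof (rule main)
    have "(\<integral>q. \<phi> q - (\<integral>q. \<phi> q \<partial>torus) \<partial>torus) = 0"
      using L2_integrable[OF H1gD(1)[OF \<phi>]] by (simp add: finite_measure.integrable_const)
    then show "h \<in> X" using H1g_sub_const[OF \<phi>] unfolding X_def by blast
  qed
  then show ?thesis using WG W0 by blast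
qed

text \<open>The equation is stated with \<open>grad\<close>, so the gradient found above is
  exchanged almost everywhere before the choice in \<open>corrector\<close> is resolved.\<close>

lemma corrector_spec: "corrector A i \<in> H10 \<and> corrector_eq A i (corrector A i)"
proof -
  obtain w g where w: "H1g w g" "(\<integral>q. w q \<partial>torus) = 0"
    "\<And>\<phi> h. H1g \<phi> h \<Longrightarrow> energy A h (\<lambda>q. axis i 1 + g q) = 0"
    using corrector_exists by blast
  have wH: "w \<in> H1" using w(1) H1_iff by blast
  have "corrector_eq A i w"
    unfolding corrector_eq_def
  proof
    fix \<phi> :: "real^'n \<Rightarrow> real" assume "\<phi> \<in> H1"
    then have \<phi>: "H1g \<phi> (grad \<phi>)" by (rule H1g_grad)
    have "energy A (grad \<phi>) (\<lambda>q. axis i 1 + grad w q) = energy A (grad \<phi>) (\<lambda>q. axis i 1 + g q)"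
      by (rule energy_cong_AE[OF _ _ A])
        (use grad_AE[OF w(1)] H1gD(2)[OF \<phi>] H1gD(2)[OF w(1)] H1gD(2)[OF H1g_grad[OF wH]] in
          \<open>auto intro: L2_add L2_const\<close>)
    then show "(\<integral>q. grad \<phi> q \<bullet> (A q *v (axis i 1 + grad w q)) \<partial>torus) = 0"
      using w(3)[OF \<phi>] by (simp add: energy_def)
  qed
  then have "w \<in> H10 \<and> corrector_eq A i w" using wH w(2) by (simp add: H10_def)
  then show ?thesis unfolding corrector_def by (rule someI[of "\<lambda>w. w \<in> H10 \<and> corrector_eq A i w"])
qed

section \<open>Correctors in an arbitrary direction and bounds for the homogenized matrix\<close>

definition corr_grad :: "real^'n \<Rightarrow> real^'n \<Rightarrow> real^'n" where
  "corr_grad x q = (\<Sum>i\<in>UNIV. (x $ i) *\<^sub>R grad (corrector A i) q)"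

definition corr :: "real^'n \<Rightarrow> real^'n \<Rightarrow> real" where
  "corr x q = (\<Sum>i\<in>UNIV. (x $ i) * corrector A i q)"

definition corr_field :: "real^'n \<Rightarrow> real^'n \<Rightarrow> real^'n" where
  "corr_field x q = x + corr_grad x q"

lemma corrector_H1g: "H1g (corrector A i) (grad (corrector A i))"
  using corrector_spec[of i] by (intro H1g_grad) (simp add: H10_def)

lemma corr_H1g: "H1g (corr x) (corr_grad x)"
  unfolding corr_def[abs_def] corr_grad_def[abs_def] by (intro H1g_sum H1g_cmult corrector_H1g)

lemma corr_mean: "(\<integral>q. corr x q \<partial>torus) = 0"
  using corrector_spec L2_integrable[OF H1gD(1)[OF corrector_H1g]]
  by (simp add: corr_def H10_def)

lemma L2_corr_field: "L2 (corr_field x)"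
  unfolding corr_field_def[abs_def] by (intro L2_add L2_const H1gD(2)[OF corr_H1g])

lemma corr_field_expand:
  "corr_field x q = (\<Sum>i\<in>UNIV. (x $ i) *\<^sub>R (axis i 1 + grad (corrector A i) q))"
proof -
  have "x = (\<Sum>i\<in>UNIV. (x $ i) *\<^sub>R axis i 1)"
    by (simp add: vec_eq_iff axis_def if_distrib cong: if_cong)
  then show ?thesis by (simp add: corr_field_def corr_grad_def scaleR_add_right sum.distrib)
qed

lemma L2_axis_grad: "L2 (\<lambda>q. axis i 1 + grad (corrector A i) q)"
  by (intro L2_add L2_const H1gD(2)[OF corrector_H1g])

lemma energy_sum_right:
  assumes "L2 g" "\<And>j. j \<in> J \<Longrightarrow> L2 (h j)"
  shows "energy A g (\<lambda>q. \<Sum>j\<in>J. h j q) = (\<Sum>j\<in>J. energy A g (h j))"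
  using assms
proof (induction J rule: infinite_finite_induct)
  case (insert x F)
  then show ?case by (simp add: energy_add_right L2_sum)
qed (simp_all add: energy_def)

lemma energy_corr_field:
  assumes \<phi>: "H1g \<phi> h" shows "energy A h (corr_field x) = 0"
proof -
  have "\<phi> \<in> H1" using \<phi> H1_iff by blast
  note gp = H1g_grad[OF this]
  have "energy A h (\<lambda>q. axis i 1 + grad (corrector A i) q) = 0" for i
  proof -
    have "energy A (grad \<phi>) (\<lambda>q. axis i 1 + grad (corrector A i) q) = 0"
      using corrector_spec[of i] \<open>\<phi> \<in> H1\<close> by (simp add: corrector_eq_def energy_def)
    moreover have "energy A (grad \<phi>) (\<lambda>q. axis i 1 + grad (corrector A i) q) = energy A h (\<lambda>q. axis i 1 + grad (corrector A i) q)"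
      by (rule energy_cong_AE[OF grad_AE[OF \<phi>] _ A H1gD(2)[OF gp] H1gD(2)[OF \<phi>] L2_axis_grad L2_axis_grad]) simp
    ultimately show ?thesis by simp
  qed
  then show ?thesis
    unfolding corr_field_expand[abs_def] using H1gD(2)[OF \<phi>] L2_axis_grad
    by (subst energy_sum_right) (auto simp: energy_scale_right intro: L2_scaleR)
qed

text \<open>Expanding one argument after the other in basis vectors reproduces the entries of
  \<open>A_bar\<close>; symmetry of the energy exchanges the arguments in between.\<close>

lemma A_bar_form: "y \<bullet> (A_bar A *v x) = energy A (corr_field y) (corr_field x)"
proof -
  have *: "energy A g (corr_field x) = (\<Sum>j\<in>UNIV. x $ j * energy A g (\<lambda>q. axis j 1 + grad (corrector A j) q))"
    if "L2 g" for g x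
    unfolding corr_field_expand[abs_def] using that L2_axis_grad
    by (subst energy_sum_right) (auto simp: energy_scale_right intro: L2_scaleR)
  have "energy A (corr_field y) (corr_field x) =
      (\<Sum>j\<in>UNIV. x $ j * energy A (\<lambda>q. axis j 1 + grad (corrector A j) q) (corr_field y))"
    using *[OF L2_corr_field] energy_sym[OF L2_corr_field L2_axis_grad] by simp
  also have "\<dots> = (\<Sum>j\<in>UNIV. \<Sum>i\<in>UNIV. x $ j * (y $ i * A_bar A $ j $ i))"
    using *[OF L2_axis_grad] by (simp add: sum_distrib_left A_bar_def energy_def)
  also have "\<dots> = (\<Sum>i\<in>UNIV. \<Sum>j\<in>UNIV. A_bar A $ i $ j * (y $ i * x $ j))"
  proof -
    have "A_bar A $ j $ i = A_bar A $ i $ j" for i j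
      using energy_sym[OF L2_axis_grad L2_axis_grad, of i j] by (simp add: A_bar_def energy_def)
    then show ?thesis by (subst sum.swap) (simp add: mult_ac)
  qed
  finally show ?thesis by (simp add: inner_matrix_expand)
qed

text \<open>The gradient part of \<open>corr_field y\<close> is orthogonal to corrected fields; what
  remains says that \<open>A_bar x\<close> is the mean flux.\<close>

lemma energy_const_corr_field: "energy A (\<lambda>_. y) (corr_field x) = y \<bullet> (A_bar A *v x)"
proof -
  have "energy A (corr_field y) (corr_field x) = energy A (\<lambda>_. y) (corr_field x) + energy A (corr_grad y) (corr_field x)"
    unfolding corr_field_def[of y, abs_def]
    by (rule energy_add_left[OF L2_corr_field L2_const H1gD(2)[OF corr_H1g]])
  then show ?thesis by (simp add: A_bar_form energy_corr_field[OF corr_H1g])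
qed

lemma sqn_const: "sqn (\<lambda>_::real^'n. x) = (norm x)\<^sup>2"
  by simp

text \<open>The constant field is the corrected field minus a gradient orthogonal to it in energy,
  so correcting can only lower the energy of \<open>x\<close>.\<close>

lemma A_bar_upper: "x \<bullet> (A_bar A *v x) \<le> (1 / b) * (norm x)\<^sup>2"
proof -
  let ?P = "corr_field x" and ?G = "corr_grad x"
  have "energy A (\<lambda>q. ?P q + (-1) *\<^sub>R ?G q) (\<lambda>q. ?P q + (-1) *\<^sub>R ?G q) =
      energy A ?P ?P + 2 * (-1) * energy A ?P ?G + (-1)\<^sup>2 * energy A ?G ?G"
    by (rule energy_add_scale_sq[OF L2_corr_field H1gD(2)[OF corr_H1g]])
  moreover have "energy A ?P ?G = 0"
    using energy_corr_field[OF corr_H1g] energy_sym[OF L2_corr_field H1gD(2)[OF corr_H1g]] by simp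
  moreover have "0 \<le> energy A ?G ?G" by (rule energy_nonneg[OF H1gD(2)[OF corr_H1g]])
  moreover have "(\<lambda>q. ?P q + (-1) *\<^sub>R ?G q) = (\<lambda>_. x)" by (simp add: corr_field_def)
  ultimately have "energy A ?P ?P \<le> energy A (\<lambda>_. x) (\<lambda>_. x)" by simp
  also have "\<dots> \<le> (1 / b) * (norm x)\<^sup>2"
    using energy_upper[OF L2_const[of x]] unfolding sqn_const .
  finally show ?thesis by (simp add: A_bar_form)
qed

lemma sqn_corr_field: "sqn (corr_field x) = (norm x)\<^sup>2 + sqn (corr_grad x)"
proof -
  have "sqn (\<lambda>q. x + 1 *\<^sub>R corr_grad x q) = sqn (\<lambda>_::real^'n. x) + 2 * 1 * (\<integral>q. x \<bullet> corr_grad x q \<partial>torus) + 1\<^sup>2 * sqn (corr_grad x)"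
    by (rule sqn_add_scaleR[OF L2_const H1gD(2)[OF corr_H1g]])
  then show ?thesis by (simp add: corr_field_def H1g_integral_inner_const[OF corr_H1g])
qed

lemma corr_field_bound: "a * sqn (corr_field x) \<le> (1 / b) * (norm x)\<^sup>2"
  using energy_lower[OF L2_corr_field, of x] A_bar_upper[of x] by (simp add: A_bar_form)

text \<open>Constants are orthogonal to gradients in L2, so correcting cannot decrease the square
  norm.\<close>

lemma A_bar_lower: "a * (norm x)\<^sup>2 \<le> x \<bullet> (A_bar A *v x)"
proof -
  have "a * (norm x)\<^sup>2 \<le> a * sqn (corr_field x)"
    using a sqn_nonneg[of "corr_grad x"] by (simp add: sqn_corr_field)
  also have "\<dots> \<le> x \<bullet> (A_bar A *v x)"
    using energy_lower[OF L2_corr_field, of x] by (simp add: A_bar_form)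
  finally show ?thesis .
qed

text \<open>A bound through \<open>a\<close> and \<open>b\<close> alone; the upper estimate needs it
  uniformly over all averaged diffusions.\<close>

lemma corr_bound: "a * (\<integral>q. (corr x q)\<^sup>2 \<partial>torus) \<le> (1 / b) * (norm x)\<^sup>2"
proof -
  have "(\<integral>q. (corr x q)\<^sup>2 \<partial>torus) \<le> sqn (corr_grad x)"
    by (rule Poincare[OF corr_H1g corr_mean])
  also have "\<dots> \<le> sqn (corr_field x)" by (simp add: sqn_corr_field)
  finally have "a * (\<integral>q. (corr x q)\<^sup>2 \<partial>torus) \<le> a * sqn (corr_field x)" using a by simp
  then show ?thesis using corr_field_bound[of x] by simp
qed

end

section \<open>The homogenized eigenvalue\<close>

lemma integral_cosm_sq: "m \<noteq> 0 \<Longrightarrow> (\<integral>q. (cosm m q)\<^sup>2 \<partial>torus) = 1/2"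
  and integral_sinm_sq: "m \<noteq> 0 \<Longrightarrow> (\<integral>q. (sinm m q)\<^sup>2 \<partial>torus) = 1/2"
proof -
  assume m: "m \<noteq> 0"
  have "m + m \<noteq> 0" using m by (auto simp: vec_eq_iff)
  then show "(\<integral>q. (cosm m q)\<^sup>2 \<partial>torus) = 1/2" "(\<integral>q. (sinm m q)\<^sup>2 \<partial>torus) = 1/2"
    unfolding power2_eq_square cosm_cosm sinm_sinm
    by (simp_all add: integral_cosm finite_measure.integrable_const)
qed

lemma cosm_grad: "H1g (cosm m) (\<lambda>q. (- (2 * pi) * sinm m q) *\<^sub>R ivec m)"
proof -
  have "(\<chi> i. partial_deriv i (cosm m) q) = (- (2 * pi) * sinm m q) *\<^sub>R ivec m" for q
    by (simp add: vec_eq_iff partial_deriv_cosm)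
  then show ?thesis using H1g_smooth[OF smooth_torus_cosm[of m]] by simp
qed

lemma nonzero_integral_pos:
  fixes u :: "real^'n \<Rightarrow> real"
  assumes "L2 u" "nonzero u" shows "0 < (\<integral>q. (u q)\<^sup>2 \<partial>torus)"
proof -
  have "(\<integral>q. (u q)\<^sup>2 \<partial>torus) \<noteq> 0" using sqn_AE_eq_0[OF assms(1)] assms(2) by (auto simp: nonzero_def)
  moreover have "0 \<le> (\<integral>q. (u q)\<^sup>2 \<partial>torus)" by (rule Bochner_Integration.integral_nonneg) simp
  ultimately show ?thesis by linarith
qed

lemma not_nonzero_integral:
  assumes "\<not> nonzero u" shows "(\<integral>q. (u q)\<^sup>2 * W q \<partial>torus) = 0"
  by (rule integral_eq_zero_AE) (use assms in \<open>auto simp: nonzero_def elim: eventually_mono\<close>)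

text \<open>For \<open>m \<noteq> 0\<close> the square norm is \<open>1/2 + c^2\<close>.\<close>

lemma nonzero_cosm: "m \<noteq> 0 \<Longrightarrow> nonzero (\<lambda>q. cosm m q - c)"
proof (rule ccontr)
  assume m: "m \<noteq> 0" and "\<not> nonzero (\<lambda>q. cosm m q - c)"
  then have "(\<integral>q. (cosm m q - c)\<^sup>2 \<partial>torus) = 0"
    using not_nonzero_integral[of "\<lambda>q. cosm m q - c" "\<lambda>_. 1"] by simp
  moreover have "(cosm m q - c)\<^sup>2 = (cosm m q)\<^sup>2 + (- 2 * c) * cosm m q + c\<^sup>2" for q
    by (simp add: power2_eq_square algebra_simps)
  moreover have "integrable torus (\<lambda>q. (cosm m q)\<^sup>2)" using L2D(3)[OF L2_cosm[of m]] by simp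
  ultimately have "1/2 + c\<^sup>2 = 0"
    using m by (simp add: integral_cosm_sq integral_cosm finite_measure.integrable_const)
  moreover have "0 \<le> c\<^sup>2" by simp
  ultimately show False by linarith
qed

text \<open>In Fourier variables the quotient is a weighted mean of the symbol over nonzero
  frequencies. Coercivity leaves finitely many candidates for its smallest value, and a cosine
  attains it, so the infimum is computed exactly.\<close>

lemma homogeneous_eigenvalue:
  fixes B :: "real^'n^'n"
  assumes lower: "\<And>x. a * (norm x)\<^sup>2 \<le> x \<bullet> (B *v x)" and upper: "\<And>x. x \<bullet> (B *v x) \<le> c * (norm x)\<^sup>2"
    and a: "a > 0"
  defines "\<Lambda> \<equiv> Inf {(\<integral>q. grad u q \<bullet> (B *v grad u q) \<partial>torus) / (\<integral>q. (u q)\<^sup>2 \<partial>torus) | u. u \<in> H10 \<and> nonzero u}"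
  shows "\<exists>m. m \<noteq> 0 \<and> a * (norm (ivec m))\<^sup>2 \<le> c \<and> \<Lambda> = 4 * pi\<^sup>2 * (ivec m \<bullet> (B *v ivec m)) \<and>
    (\<forall>n. n \<noteq> 0 \<longrightarrow> ivec m \<bullet> (B *v ivec m) \<le> ivec n \<bullet> (B *v ivec n))"
proof -
  let ?f = "\<lambda>m. ivec m \<bullet> (B *v ivec m)"
  let ?S = "{(\<integral>q. grad u q \<bullet> (B *v grad u q) \<partial>torus) / (\<integral>q. (u q)\<^sup>2 \<partial>torus) | u. u \<in> H10 \<and> nonzero u}"
  \<comment> \<open>The candidates: outside this set the symbol exceeds \<open>c\<close>, which
    already bounds its value at the unit vector \<open>e\<close>. The axis of \<open>e\<close> is
    arbitrary.\<close>
  define M where "M = {m :: int^'n. m \<noteq> 0 \<and> a * (norm (ivec m))\<^sup>2 \<le> c}"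
  define e where "e = (axis undefined 1 :: int^'n)"
  have ne: "norm (ivec e) = 1"
  proof -
    have "ivec e = (axis undefined 1 :: real^'n)" by (simp add: e_def vec_eq_iff axis_def)
    then show ?thesis by (simp add: norm_axis_1)
  qed
  have e0: "e \<noteq> 0" using ne by auto
  have ac: "a \<le> c" using order_trans[OF lower upper, of "ivec e"] ne by simp
  have eM: "e \<in> M" using e0 ne ac by (simp add: M_def)
  have "finite M"
  proof -
    obtain R :: nat where R: "c / a \<le> real R" using real_arch_simple by blast
    have "M \<subseteq> fbox R"
    proof
      fix m assume m: "m \<in> M"
      show "m \<in> fbox R"
      proof (rule ccontr)
        assume "m \<notin> fbox R"
        then have "(real R + 1)\<^sup>2 \<le> (norm (ivec m))\<^sup>2" by (rule ivec_norm_ge)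
        also have "\<dots> \<le> c / a" using m a by (simp add: M_def field_simps)
        also note R
        finally have "(real R + 1)\<^sup>2 \<le> real R" .
        moreover have "(real R + 1)\<^sup>2 = real R * real R + 2 * real R + 1" by (simp add: power2_eq_square algebra_simps)
        moreover have "0 \<le> real R * real R" by simp
        ultimately show False by linarith
      qed
    qed
    then show ?thesis by (rule finite_subset) simp
  qed
  then obtain m where m: "m \<in> M" "\<And>n. n \<in> M \<Longrightarrow> ?f m \<le> ?f n"
    using eM finite_has_minimal[of "?f ` M"] by (metis (no_types, lifting) arg_min_if_finite(1) arg_min_least empty_iff)
  have min: "?f m \<le> ?f n" if "n \<noteq> 0" for n
  proof (cases "n \<in> M")
    case False
    then have "c < a * (norm (ivec n))\<^sup>2" using that by (simp add: M_def)
    then show ?thesis using lower[of "ivec n"] m(2)[OF eM] upper[of "ivec e"] ne by simp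
  qed (rule m(2))
  have m0: "m \<noteq> 0" using m(1) by (simp add: M_def)
  have fnn: "0 \<le> ?f n" for n using lower[of "ivec n"] a by (meson less_imp_le mult_nonneg_nonneg order_trans zero_le_power2)
  have val: "4 * pi\<^sup>2 * ?f n \<in> ?S" if n: "n \<noteq> 0" for n
  proof -
    have H: "cosm n \<in> H10" using cosm_grad[of n] n by (auto simp: H10_def H1_iff integral_cosm)
    have "(\<integral>q. grad (cosm n) q \<bullet> (B *v grad (cosm n) q) \<partial>torus) = (\<integral>q. (4 * pi\<^sup>2 * ?f n) * (sinm n q)\<^sup>2 \<partial>torus)"
    proof (rule integral_cong_AE)
      note G = H1gD(2)[OF H1g_grad[of "cosm n"]]
      show "(\<lambda>q. grad (cosm n) q \<bullet> (B *v grad (cosm n) q)) \<in> borel_measurable torus"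
        using H by (intro borel_measurable_inner borel_measurable_mult_vec borel_measurable_const L2D(4) G) (auto simp: H10_def)
      show "(\<lambda>q. (4 * pi\<^sup>2 * ?f n) * (sinm n q)\<^sup>2) \<in> borel_measurable torus"
        using L2D(4)[OF L2_sinm[of n]] by measurable
      show "AE q in torus. grad (cosm n) q \<bullet> (B *v grad (cosm n) q) = (4 * pi\<^sup>2 * ?f n) * (sinm n q)\<^sup>2"
        using grad_AE[OF cosm_grad[of n]]
      proof eventually_elim
        case (elim q)
        have key: "(c *\<^sub>R x) \<bullet> (B *v (c *\<^sub>R x)) = c\<^sup>2 * (x \<bullet> (B *v x))" for c and x :: "real^'n"
          by (simp add: matrix_vector_mult_scaleR power2_eq_square)
        then show ?case unfolding elim key by (simp add: power_mult_distrib)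
      qed
    qed
    also have "\<dots> = 4 * pi\<^sup>2 * ?f n * (1/2)" by (simp add: integral_sinm_sq[OF n])
    finally have "4 * pi\<^sup>2 * ?f n = (\<integral>q. grad (cosm n) q \<bullet> (B *v grad (cosm n) q) \<partial>torus) / (\<integral>q. (cosm n q)\<^sup>2 \<partial>torus)"
      by (simp add: integral_cosm_sq[OF n])
    then show ?thesis using H nonzero_cosm[OF n, of 0] by auto
  qed
  have low: "4 * pi\<^sup>2 * ?f m \<le> s" if s: "s \<in> ?S" for s
  proof -
    obtain u where u: "u \<in> H10" "nonzero u" and s: "s = (\<integral>q. grad u q \<bullet> (B *v grad u q) \<partial>torus) / (\<integral>q. (u q)\<^sup>2 \<partial>torus)"
      using s by blast
    have ug: "H1g u (grad u)" and u0: "(\<integral>q. u q \<partial>torus) = 0" using u(1) by (auto simp: H10_def H1g_grad)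
    note uL = H1gD(1)[OF ug]
    have "4 * pi\<^sup>2 * ?f m * (\<integral>q. u q * u q \<partial>torus) \<le> (\<integral>q. grad u q \<bullet> (B *v grad u q) \<partial>torus)"
    proof (rule LIMSEQ_le)
      show "(\<lambda>R. 4 * pi\<^sup>2 * ?f m * parseval_sum R u u) \<longlonglongrightarrow> 4 * pi\<^sup>2 * ?f m * (\<integral>q. u q * u q \<partial>torus)"
        by (intro tendsto_intros Parseval uL)
      show "(\<lambda>R. \<Sum>n\<in>fbox R. 4 * pi\<^sup>2 * ?f n * coeff_sq u n) \<longlonglongrightarrow> (\<integral>q. grad u q \<bullet> (B *v grad u q) \<partial>torus)"
        by (rule Parseval_grad[OF ug])
      show "\<exists>N. \<forall>R\<ge>N. 4 * pi\<^sup>2 * ?f m * parseval_sum R u u \<le> (\<Sum>n\<in>fbox R. 4 * pi\<^sup>2 * ?f n * coeff_sq u n)"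
      proof (intro exI allI impI)
        fix R
        show "4 * pi\<^sup>2 * ?f m * parseval_sum R u u \<le> (\<Sum>n\<in>fbox R. 4 * pi\<^sup>2 * ?f n * coeff_sq u n)"
          unfolding parseval_sum_self sum_distrib_left
        proof (rule sum_mono)
          fix n show "4 * pi\<^sup>2 * ?f m * coeff_sq u n \<le> 4 * pi\<^sup>2 * ?f n * coeff_sq u n"
          proof (cases "n = 0")
            case True then show ?thesis using coeff_sq_0_mean_zero[OF u0] by simp
          next
            case False
            then show ?thesis using min by (intro mult_right_mono mult_left_mono) auto
          qed
        qed
      qed
    qed
    then show ?thesis using nonzero_integral_pos[OF uL u(2)] by (simp add: s pos_le_divide_eq power2_eq_square)
  qed
  have "\<Lambda> = 4 * pi\<^sup>2 * ?f m"
    unfolding \<Lambda>_def using val[OF m0] low by (intro cInf_eq_minimum) auto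
  then show ?thesis using m(1) m0 min by (auto simp: M_def)
qed

text \<open>Multiplied by \<open>Z\<close>, the homogenized eigenvalue speaks of
  \<open>A_bar\<close> alone, and the frequency bound no longer contains \<open>Z\<close>.\<close>

lemma Lambda_hom_eq:
  fixes V :: "real^'n \<Rightarrow> real"
  assumes A: "coeff a b (\<lambda>q. exp (- V q) *\<^sub>R D q)" and a: "a > 0" and b: "b > 0"
    and Z: "(\<integral>q. exp (- V q) \<partial>torus) = Z" "Z > 0"
  shows "\<exists>m. m \<noteq> 0 \<and> a * (norm (ivec m))\<^sup>2 \<le> 1 / b \<and>
    Z * Lambda_hom V D = 4 * pi\<^sup>2 * (ivec m \<bullet> (A_bar (\<lambda>q. exp (- V q) *\<^sub>R D q) *v ivec m)) \<and>
    (\<forall>n. n \<noteq> 0 \<longrightarrow> Z * Lambda_hom V D \<le> 4 * pi\<^sup>2 * (ivec n \<bullet> (A_bar (\<lambda>q. exp (- V q) *\<^sub>R D q) *v ivec n)))"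
proof -
  let ?A = "A_bar (\<lambda>q. exp (- V q) *\<^sub>R D q)"
  have B: "x \<bullet> (D_bar V D *v x) = (x \<bullet> (?A *v x)) / Z" for x
    by (simp add: D_bar_def Z(1) scaleR_matrix_vector_assoc[symmetric] divide_inverse mult.commute)
  have lower: "(a / Z) * (norm x)\<^sup>2 \<le> x \<bullet> (D_bar V D *v x)" for x
    using A_bar_lower[OF A a b, of x] Z(2) by (simp add: B divide_right_mono)
  have upper: "x \<bullet> (D_bar V D *v x) \<le> (1 / b / Z) * (norm x)\<^sup>2" for x
    using divide_right_mono[OF A_bar_upper[OF A a b, of x], of Z] Z(2) by (simp add: B)
  obtain m where m: "m \<noteq> 0" "(a / Z) * (norm (ivec m))\<^sup>2 \<le> 1 / b / Z"
    "Lambda_hom V D = 4 * pi\<^sup>2 * (ivec m \<bullet> (D_bar V D *v ivec m))"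
    "\<And>n. n \<noteq> 0 \<Longrightarrow> ivec m \<bullet> (D_bar V D *v ivec m) \<le> ivec n \<bullet> (D_bar V D *v ivec n)"
    using homogeneous_eigenvalue[OF lower upper] a Z(2) unfolding Lambda_hom_def[symmetric] by auto
  have "a * (norm (ivec m))\<^sup>2 \<le> 1 / b" using mult_right_mono[OF m(2), of Z] Z(2) by simp
  moreover have eq: "Z * Lambda_hom V D = 4 * pi\<^sup>2 * (ivec m \<bullet> (?A *v ivec m))"
    using m(3) Z(2) by (simp add: B)
  moreover have "Z * Lambda_hom V D \<le> 4 * pi\<^sup>2 * (ivec n \<bullet> (?A *v ivec n))" if "n \<noteq> 0" for n
    using m(4)[OF that] Z(2) unfolding eq by (simp add: B divide_le_cancel mult_left_mono)
  ultimately show ?thesis using m(1) by blast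
qed

section \<open>Bounds for the spectral gap\<close>

text \<open>The properties of \<open>exp (- V)\<close> that survive dilation with the same constant
  \<open>C\<close>, which keeps the estimates uniform in \<open>k\<close>.\<close>

definition weight :: "real \<Rightarrow> (real^'n \<Rightarrow> real) \<Rightarrow> bool" where
  "weight C W \<longleftrightarrow> periodic W \<and> W \<in> borel_measurable lebesgue \<and> (\<forall>q. 0 < W q \<and> W q \<le> C)"

lemma weight_exp:
  fixes V :: "real^'n \<Rightarrow> real"
  assumes V: "smooth_torus V" obtains C where "weight C (\<lambda>q. exp (- V q))"
proof -
  obtain c where c: "\<And>q. \<bar>V q\<bar> \<le> c" using smooth_torus_bounded[OF V] by blast
  have "exp (- V q) \<le> exp c" for q using c[of q] by simp
  then have "weight (exp c) (\<lambda>q. exp (- V q))"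
    using smooth_torus_periodic[OF V] smooth_torus_measurable[OF V] by (auto simp: weight_def periodic_def)
  then show ?thesis using that by blast
qed

lemma weight_dilate: "weight C W \<Longrightarrow> k > 0 \<Longrightarrow> weight C (\<lambda>q. W (real k *\<^sub>R q))"
  using periodic_dilate[of W k 0] by (auto simp: weight_def measurable_lebesgue_dilate)

context
  fixes C :: real and W :: "real^'n \<Rightarrow> real"
  assumes W: "weight C W"
begin

lemma weight_pos: "0 < W q" and weight_le: "W q \<le> C" and weight_abs: "\<bar>W q\<bar> \<le> C"
  using W by (auto simp: weight_def abs_of_pos)

lemma weight_const_nonneg: "0 \<le> C"
  using weight_pos[of 0] weight_le[of 0] by linarith

lemma L2_weight_mult: "L2 u \<Longrightarrow> L2 (\<lambda>q. W q * u q)" for u :: "real^'n \<Rightarrow> real"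
  using L2_bounded_scaleR[of u W C] W weight_abs by (auto simp: weight_def)

lemma L2_weight: "L2 W"
  using L2_weight_mult[OF L2_const[of 1]] by simp

lemma integrable_weight_mult: "L2 u \<Longrightarrow> integrable torus (\<lambda>q. u q * W q)" for u :: "real^'n \<Rightarrow> real"
  using L2_integrable[OF L2_weight_mult[of u]] by (simp add: mult.commute[of "u _"])

lemma integrable_weight_sq: "L2 u \<Longrightarrow> L2 v \<Longrightarrow> integrable torus (\<lambda>q. u q * v q * W q)" for u :: "real^'n \<Rightarrow> real"
  using L2_mult[OF L2_weight_mult[of u], of v] by (simp add: mult_ac)

lemma integrable_weight_square: "L2 u \<Longrightarrow> integrable torus (\<lambda>q. (u q)\<^sup>2 * W q)" for u :: "real^'n \<Rightarrow> real"
  using integrable_weight_sq[of u u] by (simp add: power2_eq_square)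

lemma integral_weight_sq_le: "L2 u \<Longrightarrow> (\<integral>q. (u q)\<^sup>2 * W q \<partial>torus) \<le> C * (\<integral>q. (u q)\<^sup>2 \<partial>torus)" for u :: "real^'n \<Rightarrow> real"
proof -
  assume u: "L2 u"
  have "(\<integral>q. (u q)\<^sup>2 * W q \<partial>torus) \<le> (\<integral>q. (u q)\<^sup>2 * C \<partial>torus)"
    using u L2D(3)[OF u] weight_le
    by (intro Bochner_Integration.integral_mono integrable_weight_square mult_left_mono) auto
  then show ?thesis by (simp add: mult.commute)
qed

lemma integral_weight_pos:
  fixes u :: "real^'n \<Rightarrow> real"
  assumes "L2 u" "nonzero u" shows "0 < (\<integral>q. (u q)\<^sup>2 * W q \<partial>torus)"
proof -
  have nn: "0 \<le> (u q)\<^sup>2 * W q" for q using weight_pos[of q] by simp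
  have "(\<integral>q. (u q)\<^sup>2 * W q \<partial>torus) \<noteq> 0"
  proof
    assume "(\<integral>q. (u q)\<^sup>2 * W q \<partial>torus) = 0"
    then have "AE q in torus. (u q)\<^sup>2 * W q = 0"
      using integral_nonneg_eq_0_iff_AE[OF integrable_weight_square[OF assms(1)]] nn by simp
    then have "AE q in torus. u q = 0"
      by eventually_elim (use weight_pos in \<open>auto simp: less_le\<close>)
    then show False using assms(2) by (simp add: nonzero_def)
  qed
  moreover have "0 \<le> (\<integral>q. (u q)\<^sup>2 * W q \<partial>torus)" by (rule Bochner_Integration.integral_nonneg) (rule nn)
  ultimately show ?thesis by linarith
qed

lemma weight_integral_pos: "0 < (\<integral>q. W q \<partial>torus)"
proof -
  have "nonzero (\<lambda>_::real^'n. 1)"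
  proof (rule ccontr)
    assume "\<not> nonzero (\<lambda>_::real^'n. 1)"
    then show False using not_nonzero_integral[of "\<lambda>_::real^'n. 1" "\<lambda>_. 1"] by simp
  qed
  then show ?thesis using integral_weight_pos[OF L2_const[of 1]] by simp
qed

lemma integral_weight_sub_const:
  fixes u :: "real^'n \<Rightarrow> real"
  assumes u: "L2 u"
  shows "(\<integral>q. (u q - c)\<^sup>2 * W q \<partial>torus) =
    (\<integral>q. (u q)\<^sup>2 * W q \<partial>torus) - 2 * c * (\<integral>q. u q * W q \<partial>torus) + c\<^sup>2 * (\<integral>q. W q \<partial>torus)"
proof -
  have "(u q - c)\<^sup>2 * W q = (u q)\<^sup>2 * W q - 2 * c * (u q * W q) + c\<^sup>2 * W q" for q
    by (simp add: power2_eq_square algebra_simps)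
  then show ?thesis
    using integrable_weight_square[OF u] integrable_weight_mult[OF u] L2_integrable[OF L2_weight] by simp
qed

end

context
  fixes a b C :: real and V :: "real^'n \<Rightarrow> real" and D :: "real^'n \<Rightarrow> real^'n^'n"
  assumes W: "weight C (\<lambda>q. exp (- V q))"
    and A: "coeff a b (\<lambda>q. exp (- V q) *\<^sub>R D q)" and a: "a > 0" and b: "b > 0"
begin

abbreviation (input) "coeff_field \<equiv> \<lambda>q. exp (- V q) *\<^sub>R D q"

lemma spectral_gap_eq:
  "spectral_gap V D = Inf {energy coeff_field (grad u) (grad u) / (\<integral>q. (u q)\<^sup>2 * exp (- V q) \<partial>torus) | u.
      u \<in> H1 \<and> nonzero u \<and> (\<integral>q. u q * exp (- V q) \<partial>torus) = 0}"
  unfolding spectral_gap_def energy_def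
  by (simp add: scaleR_matrix_vector_assoc[symmetric] mult.commute)

text \<open>The Rayleigh bound for \<open>u\<close> minus its weighted mean, rewritten with the
  variance. Test functions then need not be centred with respect to the oscillating weight.\<close>

lemma spectral_gap_variance:
  assumes ug: "H1g u g"
  shows "spectral_gap V D * ((\<integral>q. (u q)\<^sup>2 * exp (- V q) \<partial>torus) -
      (\<integral>q. u q * exp (- V q) \<partial>torus)\<^sup>2 / (\<integral>q. exp (- V q) \<partial>torus)) \<le> energy coeff_field g g"
proof -
  let ?Z = "\<integral>q. exp (- V q) \<partial>torus" and ?I = "\<integral>q. u q * exp (- V q) \<partial>torus"
  note u = H1gD(1)[OF ug]
  have Z: "?Z > 0" by (rule weight_integral_pos[OF W])
  define c where "c = ?I / ?Z"
  define v where "v = (\<lambda>q. u q - c)"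
  have vg: "H1g v g" unfolding v_def by (rule H1g_sub_const[OF ug])
  have v0: "(\<integral>q. v q * exp (- V q) \<partial>torus) = 0"
  proof -
    have "(\<integral>q. v q * exp (- V q) \<partial>torus) = ?I - c * ?Z"
      using integrable_weight_mult[OF W u] L2_integrable[OF L2_weight[OF W]] by (simp add: v_def left_diff_distrib)
    then show ?thesis using Z by (simp add: c_def)
  qed
  have "(\<integral>q. (v q)\<^sup>2 * exp (- V q) \<partial>torus) = (\<integral>q. (u q)\<^sup>2 * exp (- V q) \<partial>torus) - 2 * c * ?I + c\<^sup>2 * ?Z"
    unfolding v_def by (rule integral_weight_sub_const[OF W u])
  moreover have "2 * c * ?I - c\<^sup>2 * ?Z = ?I\<^sup>2 / ?Z"
    using Z by (simp add: c_def field_simps power2_eq_square)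
  ultimately have var: "(\<integral>q. (v q)\<^sup>2 * exp (- V q) \<partial>torus) = (\<integral>q. (u q)\<^sup>2 * exp (- V q) \<partial>torus) - ?I\<^sup>2 / ?Z"
    by simp
  have "v \<in> H1" using vg H1_iff by blast
  note gv = H1g_grad[OF this]
  have E: "energy coeff_field (grad v) (grad v) = energy coeff_field g g"
    using grad_AE[OF vg] by (intro energy_cong_AE[OF _ _ A] H1gD(2)[OF gv] H1gD(2)[OF vg])
  show ?thesis
  \<comment> \<open>A function that equals its weighted mean almost everywhere is excluded from the
    infimum, but its variance is 0.\<close>
  proof (cases "nonzero v")
    case True
    have "spectral_gap V D \<le> energy coeff_field (grad v) (grad v) / (\<integral>q. (v q)\<^sup>2 * exp (- V q) \<partial>torus)"
      unfolding spectral_gap_eq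
    proof (rule cInf_lower)
      show "bdd_below {energy coeff_field (grad u) (grad u) / (\<integral>q. (u q)\<^sup>2 * exp (- V q) \<partial>torus) | u.
        u \<in> H1 \<and> nonzero u \<and> (\<integral>q. u q * exp (- V q) \<partial>torus) = 0}"
        unfolding bdd_below_def
        using energy_nonneg[OF A a b H1gD(2)[OF H1g_grad]] integral_weight_pos[OF W H1gD(1)[OF H1g_grad]]
        by (intro exI[of _ 0]) (auto intro!: divide_nonneg_pos)
    qed (use \<open>v \<in> H1\<close> True v0 in blast)
    then show ?thesis
      unfolding E var using integral_weight_pos[OF W H1gD(1)[OF vg] True] by (simp add: var pos_le_divide_eq)
  next
    case False
    then have "(\<integral>q. (u q)\<^sup>2 * exp (- V q) \<partial>torus) - ?I\<^sup>2 / ?Z = 0"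
      using not_nonzero_integral[OF False, of "\<lambda>q. exp (- V q)"] var by simp
    then show ?thesis using energy_nonneg[OF A a b H1gD(2)[OF ug]] by simp
  qed
qed

text \<open>Testing on functions of plain mean zero, as Poincare needs, is enough: if the weighted
  mean of \<open>u\<close> vanishes, subtracting the plain mean leaves the energy unchanged and can
  only increase the weighted square norm.\<close>

lemma spectral_gap_geI:
  assumes L: "0 \<le> L"
    and le: "\<And>u g. H1g u g \<Longrightarrow> (\<integral>q. u q \<partial>torus) = 0 \<Longrightarrow>
      L * (\<integral>q. (u q)\<^sup>2 * exp (- V q) \<partial>torus) \<le> energy coeff_field g g"
  shows "L \<le> spectral_gap V D"
  unfolding spectral_gap_eq
proof (rule cInf_greatest)
  \<comment> \<open>\<open>cInf_greatest\<close> needs a member of the set: a cosine minus its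
    weighted mean.\<close>
  define e where "e = (axis undefined 1 :: int^'n)"
  have e: "e \<noteq> 0" by (auto simp: e_def vec_eq_iff axis_def)
  let ?Z = "\<integral>q. exp (- V q) \<partial>torus" and ?I = "\<integral>q. cosm e q * exp (- V q) \<partial>torus"
  have Z: "?Z > 0" by (rule weight_integral_pos[OF W])
  have "(\<integral>q. (cosm e q - ?I / ?Z) * exp (- V q) \<partial>torus) = ?I - ?I / ?Z * ?Z"
    using integrable_weight_mult[OF W L2_cosm] L2_integrable[OF L2_weight[OF W]] by (simp add: left_diff_distrib)
  then have "(\<integral>q. (cosm e q - ?I / ?Z) * exp (- V q) \<partial>torus) = 0" using Z by simp
  moreover have "(\<lambda>q. cosm e q - ?I / ?Z) \<in> H1" using H1g_sub_const[OF cosm_grad] H1_iff by blast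
  ultimately show "{energy coeff_field (grad u) (grad u) / (\<integral>q. (u q)\<^sup>2 * exp (- V q) \<partial>torus) | u.
      u \<in> H1 \<and> nonzero u \<and> (\<integral>q. u q * exp (- V q) \<partial>torus) = 0} \<noteq> {}"
    using nonzero_cosm[OF e] by blast
next
  fix x assume "x \<in> {energy coeff_field (grad u) (grad u) / (\<integral>q. (u q)\<^sup>2 * exp (- V q) \<partial>torus) | u.
      u \<in> H1 \<and> nonzero u \<and> (\<integral>q. u q * exp (- V q) \<partial>torus) = 0}"
  then obtain u where u: "u \<in> H1" "nonzero u" "(\<integral>q. u q * exp (- V q) \<partial>torus) = 0"
    and x: "x = energy coeff_field (grad u) (grad u) / (\<integral>q. (u q)\<^sup>2 * exp (- V q) \<partial>torus)" by blast
  note ug = H1g_grad[OF u(1)]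
  define c where "c = (\<integral>q. u q \<partial>torus)"
  have "(\<integral>q. u q - c \<partial>torus) = 0"
    using L2_integrable[OF H1gD(1)[OF ug]] by (simp add: c_def finite_measure.integrable_const)
  then have 1: "L * (\<integral>q. (u q - c)\<^sup>2 * exp (- V q) \<partial>torus) \<le> energy coeff_field (grad u) (grad u)"
    using le[OF H1g_sub_const[OF ug]] by simp
  have "(\<integral>q. (u q)\<^sup>2 * exp (- V q) \<partial>torus) \<le> (\<integral>q. (u q - c)\<^sup>2 * exp (- V q) \<partial>torus)"
    using integral_weight_sub_const[OF W H1gD(1)[OF ug], of c] u(3) weight_integral_pos[OF W] by simp
  then have "L * (\<integral>q. (u q)\<^sup>2 * exp (- V q) \<partial>torus) \<le> energy coeff_field (grad u) (grad u)"
    using mult_left_mono[OF _ L] 1 by fastforce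
  then show "L \<le> x" using integral_weight_pos[OF W H1gD(1)[OF ug] u(2)] by (simp add: x pos_le_divide_eq)
qed

end

subsection \<open>Symmetrization\<close>

lemma sum_matrix_vector_mult: "(\<Sum>j\<in>J. M j) *v x = (\<Sum>j\<in>J. M j *v (x :: real^'n))"
  by (induction J rule: infinite_finite_induct) (auto simp: matrix_vector_mult_add_rdistrib)

lemma transpose_scaleR_sum: "transpose (c *\<^sub>R (\<Sum>j\<in>J. M j)) = c *\<^sub>R (\<Sum>j\<in>J. transpose (M j :: real^'n^'n))"
  by (simp add: vec_eq_iff transpose_def)

lemma psd_average:
  fixes M :: "'j \<Rightarrow> real^'n^'n"
  assumes "\<And>j. j \<in> J \<Longrightarrow> M j \<in> psd" "0 \<le> c"
  shows "c *\<^sub>R (\<Sum>j\<in>J. M j) \<in> psd"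
  using assms unfolding psd_def
  by (auto simp: transpose_scaleR_sum scaleR_matrix_vector_assoc[symmetric] sum_matrix_vector_mult inner_sum_right
      intro!: sum_nonneg mult_nonneg_nonneg)

lemma M_ab_average:
  fixes M :: "'j \<Rightarrow> real^'n^'n"
  assumes M: "\<And>j. j \<in> J \<Longrightarrow> M j \<in> M_ab a b" and J: "finite J" "J \<noteq> {}"
  shows "inverse (real (card J)) *\<^sub>R (\<Sum>j\<in>J. M j) \<in> M_ab a b"
proof -
  let ?c = "inverse (real (card J))"
  have c: "?c > 0" using J by (simp add: card_gt_0_iff)
  have form: "x \<bullet> ((?c *\<^sub>R (\<Sum>j\<in>J. M j)) *v x) = ?c * (\<Sum>j\<in>J. x \<bullet> (M j *v x))" for x
    by (simp add: scaleR_matrix_vector_assoc[symmetric] sum_matrix_vector_mult inner_sum_right)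
  have const: "?c * (\<Sum>j\<in>J. t) = t" for t using J by simp
  have "a * (norm x)\<^sup>2 \<le> ?c * (\<Sum>j\<in>J. x \<bullet> (M j *v x))" for x
  proof -
    have "?c * (\<Sum>j\<in>J. a * (norm x)\<^sup>2) \<le> ?c * (\<Sum>j\<in>J. x \<bullet> (M j *v x))"
      using c M by (intro mult_left_mono sum_mono M_ab_lower) auto
    then show ?thesis by (simp only: const)
  qed
  moreover have "?c * (\<Sum>j\<in>J. x \<bullet> (M j *v x)) \<le> (1 / b) * (norm x)\<^sup>2" for x
  proof -
    have "?c * (\<Sum>j\<in>J. x \<bullet> (M j *v x)) \<le> ?c * (\<Sum>j\<in>J. (1 / b) * (norm x)\<^sup>2)"
      using c M by (intro mult_left_mono sum_mono M_ab_upper) auto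
    then show ?thesis by (simp only: const)
  qed
  moreover have "?c *\<^sub>R (\<Sum>j\<in>J. M j) \<in> psd" using c M by (intro psd_average) (auto intro: M_ab_psd)
  ultimately show ?thesis unfolding M_ab_def mem_Collect_eq form by blast
qed

lemma coeff_AE_affine:
  fixes A :: "real^'n \<Rightarrow> real^'n^'n"
  assumes "coeff a b A" "c \<noteq> 0"
  shows "AE q in torus. A (c *\<^sub>R q + t) \<in> M_ab a b"
  using assms unfolding coeff_def
  by (intro AE_torus_affine[of "\<lambda>q. A q \<in> M_ab a b"] periodic_comp[of A "\<lambda>M. M \<in> M_ab a b"]) auto

lemma coeff_translate: "coeff a b A \<Longrightarrow> coeff a b (\<lambda>q. A (q + s))"
  using periodic_dilate[of A 1 s] coeff_AE_affine[of a b A 1 s]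
  by (simp add: coeff_def measurable_lebesgue_translate)

lemma coeff_dilate: "coeff a b A \<Longrightarrow> k > 0 \<Longrightarrow> coeff a b (\<lambda>q. A (real k *\<^sub>R q))"
  using periodic_dilate[of A k 0] coeff_AE_affine[of a b A "real k" 0]
  by (simp add: coeff_def measurable_lebesgue_dilate)

lemma cells_nonempty: "k > 0 \<Longrightarrow> (cells k :: (int^'n) set) \<noteq> {}"
proof
  assume "k > 0" and "(cells k :: (int^'n) set) = {}"
  then show False using card_cells[of k, where 'n = 'n] by simp
qed

text \<open>The exceptional sets of the shifted coefficients are finitely many and can be removed
  together; elsewhere \<open>M_ab\<close> is convex.\<close>

lemma coeff_fold:
  fixes A :: "real^'n \<Rightarrow> real^'n^'n"
  assumes A: "coeff a b A" and k: "k > 0" shows "coeff a b (fold_torus k A)"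
  unfolding coeff_def
proof (intro conjI)
  show "periodic (fold_torus k A)" "fold_torus k A \<in> borel_measurable lebesgue"
    using A k by (auto simp: coeff_def periodic_fold fold_measurable)
  have "AE q in torus. A (inverse (real k) *\<^sub>R q + s) \<in> M_ab a b" for s
    using k by (intro coeff_AE_affine[OF A]) simp
  then have "AE q in torus. \<forall>j\<in>cells k. A (inverse (real k) *\<^sub>R q + inverse (real k) *\<^sub>R ivec j) \<in> M_ab a b"
    by (intro AE_finite_allI finite_cells)
  then show "AE q in torus. fold_torus k A q \<in> M_ab a b"
  proof eventually_elim
    case (elim q)
    then show ?case unfolding fold_torus_def card_cells[symmetric]
      using k by (intro M_ab_average finite_cells cells_nonempty) auto
  qed
qed

lemma energy_translate:
  fixes g :: "real^'n \<Rightarrow> real^'n"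
  assumes A: "coeff a b A" and g: "L2 g"
  shows "energy A (\<lambda>q. g (q - s)) (\<lambda>q. g (q - s)) = energy (\<lambda>q. A (q + s)) g g"
proof -
  let ?f = "\<lambda>q. g q \<bullet> (A (q + s) *v g q)"
  have As: "coeff a b (\<lambda>q. A (q + s))" by (rule coeff_translate[OF A])
  have "?f \<in> borel_measurable lebesgue"
    using As g by (intro borel_measurable_inner borel_measurable_mult_vec) (auto simp: coeff_def L2_def)
  moreover have "periodic ?f" using As g by (auto simp: coeff_def L2_def periodic_def)
  ultimately have "(\<integral>q. ?f (q + (- s)) \<partial>torus) = (\<integral>q. ?f q \<partial>torus)" by (rule integral_torus_translate)
  then show ?thesis by (simp add: energy_def)
qed

lemma energy_sum_coeff:
  assumes A: "\<And>j. j \<in> J \<Longrightarrow> coeff a b (A j)" and a: "a > 0" and b: "b > 0" and g: "L2 g"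
  shows "energy (\<lambda>q. c *\<^sub>R (\<Sum>j\<in>J. A j q)) g g = c * (\<Sum>j\<in>J. energy (A j) g g)"
  using integrable_energy[OF A a b g g]
  by (simp add: energy_def scaleR_matrix_vector_assoc[symmetric] sum_matrix_vector_mult inner_sum_right)

text \<open>The spectral gap is concave in the diffusion and invariant under translations by \<open>j / k\<close>,
  so averaging over these translations does not decrease it.\<close>

lemma spectral_gap_fold:
  fixes V :: "real^'n \<Rightarrow> real"
  assumes W: "weight C (\<lambda>q. exp (- V q))" and k: "k > 0"
    and A: "coeff a b (\<lambda>q. exp (- oscillating V k q) *\<^sub>R D q)" and a: "a > 0" and b: "b > 0"
    and ug: "H1g u g"
  shows "spectral_gap (oscillating V k) D * ((\<integral>q. (u q)\<^sup>2 * exp (- V (real k *\<^sub>R q)) \<partial>torus) -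
      (\<integral>q. u q * exp (- V (real k *\<^sub>R q)) \<partial>torus)\<^sup>2 / (\<integral>q. exp (- V q) \<partial>torus))
     \<le> energy (\<lambda>q. fold_torus k (\<lambda>q. exp (- oscillating V k q) *\<^sub>R D q) (real k *\<^sub>R q)) g g"
proof -
  let ?A = "\<lambda>q. exp (- oscillating V k q) *\<^sub>R D q" and ?W = "\<lambda>q. exp (- oscillating V k q)"
  let ?Z = "\<integral>q. exp (- V q) \<partial>torus"
  have Wp: "periodic (\<lambda>q. exp (- V q))" "(\<lambda>q. exp (- V q)) \<in> borel_measurable lebesgue"
    using W by (auto simp: weight_def)
  have Wk: "weight C ?W" using weight_dilate[OF W k] by (simp add: oscillating_def)
  have Z: "(\<integral>q. ?W q \<partial>torus) = ?Z"
    using integral_torus_dilate[OF Wp(2,1) k] by (simp add: oscillating_def)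
  let ?var = "(\<integral>q. (u q)\<^sup>2 * ?W q \<partial>torus) - (\<integral>q. u q * ?W q \<partial>torus)\<^sup>2 / ?Z"
  note u = H1gD(1)[OF ug] and g = H1gD(2)[OF ug]
  let ?s = "\<lambda>j. inverse (real k) *\<^sub>R ivec (j :: int^'n)"
  have Winv: "?W (q + ?s j) = ?W q" for q j
    using Wp(1) k by (simp add: oscillating_def scaleR_add_right periodic_ivec_iff)
  \<comment> \<open>The weight is invariant under the shift \<open>?s j\<close>, so translating
    \<open>u\<close> changes no term of the variance, while the energy sees the coefficient
    translated the other way.\<close>
  have each: "spectral_gap (oscillating V k) D * ?var \<le> energy (\<lambda>q. ?A (q + ?s j)) g g" for j
  proof -
    have ug': "H1g (\<lambda>q. u (q - ?s j)) (\<lambda>q. g (q - ?s j))"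
      using H1g_translate[OF ug, of "- ?s j"] by simp
    have inv: "(\<integral>q. f (u (q - ?s j)) * ?W q \<partial>torus) = (\<integral>q. f (u q) * ?W q \<partial>torus)"
      if [measurable]: "f \<in> borel_measurable borel" for f :: "real \<Rightarrow> real"
    proof -
      let ?h = "\<lambda>q. f (u (q - ?s j)) * ?W q"
      have 1: "L2 (\<lambda>q. u (q - ?s j))" by (rule H1gD(1)[OF ug'])
      have "?h \<in> borel_measurable lebesgue"
        using Wk unfolding weight_def
        by (intro borel_measurable_times measurable_compose[OF L2D(2)[OF 1]]) auto
      moreover have "periodic ?h" using L2D(1)[OF 1] Wk by (auto simp: weight_def periodic_def)
      ultimately have "(\<integral>q. ?h (q + ?s j) \<partial>torus) = (\<integral>q. ?h q \<partial>torus)" by (rule integral_torus_translate)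
      then show ?thesis by (simp add: Winv)
    qed
    show ?thesis
      using spectral_gap_variance[OF Wk A a b ug'] inv[of "\<lambda>x. x\<^sup>2"] inv[of "\<lambda>x. x"]
      by (simp add: Z energy_translate[OF A g])
  qed
  have c: "real (k ^ CARD('n)) > 0" using k by simp
  have "spectral_gap (oscillating V k) D * ?var =
      inverse (real (k ^ CARD('n))) * (\<Sum>j\<in>(cells k :: (int^'n) set). spectral_gap (oscillating V k) D * ?var)"
    using k by (simp add: card_cells)
  also have "\<dots> \<le> inverse (real (k ^ CARD('n))) * (\<Sum>j\<in>cells k. energy (\<lambda>q. ?A (q + ?s j)) g g)"
    using c each by (intro mult_left_mono sum_mono) auto
  also have "\<dots> = energy (\<lambda>q. inverse (real (k ^ CARD('n))) *\<^sub>R (\<Sum>j\<in>cells k. ?A (q + ?s j))) g g"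
    by (rule energy_sum_coeff[symmetric, OF coeff_translate[OF A] a b g])
  also have "\<dots> = energy (\<lambda>q. fold_torus k ?A (real k *\<^sub>R q)) g g"
    using A k by (subst fold_dilate_eq) (auto simp: coeff_def)
  finally show ?thesis by (simp add: oscillating_def)
qed

subsection \<open>Upper bound\<close>

text \<open>The mixed term is absorbed by nonnegativity of the energy of
  \<open>g - t h\<close>.\<close>

lemma energy_young:
  assumes A: "coeff a b A" and a: "a > 0" and b: "b > 0" and g: "L2 g" "L2 h" and t: "t > 0"
  shows "energy A (\<lambda>q. g q + h q) (\<lambda>q. g q + h q) \<le> (1 + 1 / t) * energy A g g + (1 + t) * energy A h h"
proof -
  have "0 \<le> energy A (\<lambda>q. g q + (- t) *\<^sub>R h q) (\<lambda>q. g q + (- t) *\<^sub>R h q)"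
    using g by (intro energy_nonneg[OF A a b] L2_add L2_scaleR)
  also have "\<dots> = energy A g g + 2 * (- t) * energy A g h + (- t)\<^sup>2 * energy A h h"
    by (rule energy_add_scale_sq[OF A a b g])
  finally have "(2 * energy A g h) * t \<le> (1 / t * energy A g g + t * energy A h h) * t"
    using t by (simp add: power2_eq_square algebra_simps)
  then have "2 * energy A g h \<le> 1 / t * energy A g g + t * energy A h h"
    using t by (simp only: mult_le_cancel_right)
  then show ?thesis
    using energy_add_scale_sq[OF A a b g, of 1] by (simp add: algebra_simps)
qed

lemma integral_abs_le_1_mult_sq:
  fixes f h :: "real^'n \<Rightarrow> real"
  assumes f: "L2 f" and h: "smooth_torus h" "\<And>q. \<bar>h q\<bar> \<le> 1"
  shows "(\<integral>q. (h q * f q)\<^sup>2 \<partial>torus) \<le> (\<integral>q. (f q)\<^sup>2 \<partial>torus)"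
proof (rule Bochner_Integration.integral_mono)
  show "(h q * f q)\<^sup>2 \<le> (f q)\<^sup>2" for q
    using h(2)[of q] by (simp add: power_mult_distrib abs_square_le_1 mult_left_le_one_le)
  show "integrable torus (\<lambda>q. (h q * f q)\<^sup>2)" using L2D(3)[OF L2_mult_smooth[OF f h(1)]] by simp
  show "integrable torus (\<lambda>q. (f q)\<^sup>2)" using L2D(3)[OF f] by simp
qed

text \<open>The test function is the two-scale expansion of \<open>cosm m\<close> with the first-order corrector.\<close>

lemma spectral_gap_two_scale_upper:
  fixes W :: "real^'n \<Rightarrow> real" and B :: "real^'n \<Rightarrow> real^'n^'n"
  assumes W: "weight C W" and Z: "Z = (\<integral>q. W q \<partial>torus)"
    and B: "coeff a b B" and a: "a > 0" and b: "b > 0"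
    and m: "m \<noteq> 0" "m \<in> fbox R" "(norm (ivec m))\<^sup>2 \<le> S" and k: "k > R + R"
    and S: "S = 1 / (a * b)" and L: "0 \<le> L"
    and le: "\<And>u g. H1g u g \<Longrightarrow> L * ((\<integral>q. (u q)\<^sup>2 * W (real k *\<^sub>R q) \<partial>torus) -
        (\<integral>q. u q * W (real k *\<^sub>R q) \<partial>torus)\<^sup>2 / Z) \<le> energy (\<lambda>q. B (real k *\<^sub>R q)) g g"
  shows "L * (Z / 2 - (Z / 2 + 4 * pi\<^sup>2 * C * S\<^sup>2 + 4 * pi\<^sup>2 * S\<^sup>2 * C\<^sup>2 / Z) / k)
     \<le> 2 * pi\<^sup>2 * (ivec m \<bullet> (A_bar B *v ivec m)) + (2 * pi\<^sup>2 * S / b + 32 * pi^4 * S^3 / b) / k"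
proof -
  have k0: "k > 0" using k by simp
  have k1: "real k \<ge> 1" using k0 by simp
  have S0: "0 \<le> S" using a b by (simp add: S)
  have Z0: "Z > 0" unfolding Z by (rule weight_integral_pos[OF W])
  have C0: "0 \<le> C" by (rule weight_const_nonneg[OF W])
  define x where "x = ivec m"
  define w where "w = corr B x"
  define Q where "Q = (\<integral>q. (w q)\<^sup>2 \<partial>torus)"
  let ?P = "corr_field B x" and ?G = "corr_grad B x"
  have xS: "(norm x)\<^sup>2 \<le> S" using m(3) by (simp add: x_def)
  have wG: "H1g w ?G" unfolding w_def by (rule corr_H1g[OF B a b])
  note wL = H1gD(1)[OF wG] and GL = H1gD(2)[OF wG] and PL = L2_corr_field[OF B a b, of x]
  have Q0: "0 \<le> Q" unfolding Q_def by (rule Bochner_Integration.integral_nonneg) simp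
  \<comment> \<open>Uniform in \<open>B\<close>: the corrector bound with
    \<open>(norm x)^2 \<le> S\<close> gives \<open>S / (a * b)\<close>, which is
    \<open>S^2\<close>.\<close>
  have Q: "Q \<le> S\<^sup>2"
  proof -
    have "a * Q \<le> (1 / b) * (norm x)\<^sup>2" using corr_bound[OF B a b, of x] by (simp add: Q_def w_def)
    also have "\<dots> \<le> (1 / b) * S" using b xS by (intro mult_left_mono) auto
    finally have "a * Q \<le> a * S\<^sup>2" using a b by (simp add: S power2_eq_square field_simps)
    then show ?thesis using a by simp
  qed
  define wk where "wk = (\<lambda>q. w (real k *\<^sub>R q))"
  have wkL: "L2 wk" and wkQ: "(\<integral>q. (wk q)\<^sup>2 \<partial>torus) = Q"
    unfolding wk_def Q_def using L2_dilate[OF wL k0] sqn_dilate[OF wL k0] by simp_all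
  \<comment> \<open>The corrector term \<open>(1 / k) * w (k q)\<close> times the amplitude
    \<open>- 2 * pi * sinm m\<close> of the gradient of \<open>cosm m\<close>; its direction
    \<open>x\<close> is built into \<open>w\<close>.\<close>
  define \<rho> where "\<rho> = (\<lambda>q. (- (2 * pi / k)) * (sinm m q * wk q))"
  define u where "u = (\<lambda>q. cosm m q + \<rho> q)"
  \<comment> \<open>The derivative falling on \<open>w (k q)\<close> loses the factor
    \<open>1 / k\<close> and completes the corrected field in \<open>g1\<close>; the derivative
    falling on \<open>sinm m\<close> keeps it and forms \<open>g2\<close>.\<close>
  define g1 where "g1 = (\<lambda>q. (- (2 * pi) * sinm m q) *\<^sub>R ?P (real k *\<^sub>R q))"
  define g2 where "g2 = (\<lambda>q. (- (4 * pi\<^sup>2 / k)) *\<^sub>R ((cosm m q * wk q) *\<^sub>R x))"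
  have ug: "H1g u (\<lambda>q. g1 q + g2 q)"
  proof -
    have chi: "(\<chi> i. partial_deriv i (sinm m) q) = (2 * pi * cosm m q) *\<^sub>R x" for q
      by (simp add: vec_eq_iff partial_deriv_sinm x_def)
    have "H1g u (\<lambda>q. (- (2 * pi) * sinm m q) *\<^sub>R ivec m + (- (2 * pi / k)) *\<^sub>R
       (sinm m q *\<^sub>R (real k *\<^sub>R ?G (real k *\<^sub>R q)) + wk q *\<^sub>R (\<chi> i. partial_deriv i (sinm m) q)))"
      unfolding u_def \<rho>_def wk_def
      by (intro H1g_add cosm_grad H1g_cmult H1g_mult_smooth H1g_dilate wG smooth_torus_sinm k0)
    moreover have "(- (2 * pi) * sinm m q) *\<^sub>R ivec m + (- (2 * pi / k)) *\<^sub>R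
       (sinm m q *\<^sub>R (real k *\<^sub>R ?G (real k *\<^sub>R q)) + wk q *\<^sub>R (\<chi> i. partial_deriv i (sinm m) q)) = g1 q + g2 q" for q
      unfolding chi g1_def g2_def corr_field_def[OF B a b] x_def[symmetric] using k0
      by (simp add: scaleR_add_right power2_eq_square mult_ac)
    ultimately show ?thesis by simp
  qed
  have g1L: "L2 g1" unfolding g1_def
    by (intro L2_mult_smooth L2_dilate PL k0 smooth_torus_cmult smooth_torus_sinm)
  have cwL: "L2 (\<lambda>q. cosm m q * wk q)" using L2_mult_smooth[OF wkL smooth_torus_cosm] by simp
  have g2L: "L2 g2"
  proof -
    have "L2 (\<lambda>q. (cosm m q * wk q) *\<^sub>R x)"
      by (rule L2_dominated[where h = "\<lambda>q. (cosm m q * wk q)\<^sup>2 * (norm x)\<^sup>2"])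
        (use cwL in \<open>auto simp: L2_def periodic_def power_mult_distrib\<close>)
    then show ?thesis unfolding g2_def by (rule L2_scaleR)
  qed
  have Bk: "coeff a b (\<lambda>q. B (real k *\<^sub>R q))" by (rule coeff_dilate[OF B k0])
  let ?Bk = "\<lambda>q. B (real k *\<^sub>R q)" and ?h = "x \<bullet> (A_bar B *v x)"
  \<comment> \<open>No error term: the square of \<open>sinm m\<close> has frequencies in
    \<open>fbox (R + R)\<close>, and \<open>k\<close> exceeds \<open>R + R\<close>.\<close>
  have E11: "energy ?Bk g1 g1 = 2 * pi\<^sup>2 * ?h"
  proof -
    let ?f = "\<lambda>q. ?P q \<bullet> (B q *v ?P q)"
    have "energy ?Bk g1 g1 = (\<integral>q. 4 * pi\<^sup>2 * (?f (real k *\<^sub>R q) * (sinm m q * sinm m q)) \<partial>torus)"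
    proof -
      have "(c *\<^sub>R y) \<bullet> (M *v (c *\<^sub>R y)) = c\<^sup>2 * (y \<bullet> (M *v y))" for c and y :: "real^'n" and M
        by (simp add: matrix_vector_mult_scaleR power2_eq_square)
      then show ?thesis unfolding energy_def g1_def
        by (simp only:) (simp add: power_mult_distrib power2_eq_square[of "sinm m _"] mult_ac)
    qed
    also have "\<dots> = 4 * pi\<^sup>2 * ((\<integral>q. ?f q \<partial>torus) * (\<integral>q. sinm m q * sinm m q \<partial>torus))"
    proof -
      have "periodic ?f" "?f \<in> borel_measurable lebesgue"
        using B PL by (auto simp: coeff_def L2_def periodic_def intro!: borel_measurable_inner borel_measurable_mult_vec)
      then have "(\<integral>q. ?f (real k *\<^sub>R q) * (sinm m q * sinm m q) \<partial>torus) = (\<integral>q. ?f q \<partial>torus) * (\<integral>q. sinm m q * sinm m q \<partial>torus)"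
        using integrable_energy[OF B a b PL PL] trig_mult[OF trig.sinm[OF m(2)] trig.sinm[OF m(2)]] k
        by (rule integral_dilate_mult_trig)
      then show ?thesis by simp
    qed
    also have "(\<integral>q. ?f q \<partial>torus) = ?h" using A_bar_form[OF B a b, of x x] by (simp add: energy_def)
    also have "(\<integral>q. sinm m q * sinm m q \<partial>torus) = 1/2" using integral_sinm_sq[OF m(1)] by (simp add: power2_eq_square)
    finally show ?thesis by simp
  qed
  have hS: "?h \<le> S / b"
  proof -
    have "?h \<le> (1 / b) * (norm x)\<^sup>2" by (rule A_bar_upper[OF B a b])
    also have "\<dots> \<le> (1 / b) * S" using b xS by (intro mult_left_mono) auto
    finally show ?thesis by simp
  qed
  have E22: "energy ?Bk g2 g2 \<le> 16 * pi^4 * S^3 / b / k\<^sup>2"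
  proof -
    have "energy ?Bk g2 g2 \<le> (1 / b) * sqn g2" by (rule energy_upper[OF Bk a b g2L])
    also have "sqn g2 = (4 * pi\<^sup>2 / k)\<^sup>2 * (norm x)\<^sup>2 * (\<integral>q. (cosm m q * wk q)\<^sup>2 \<partial>torus)"
      unfolding g2_def by (simp add: power_mult_distrib power_divide mult_ac)
    also have "(1 / b) * \<dots> \<le> (1 / b) * ((4 * pi\<^sup>2 / k)\<^sup>2 * S * S\<^sup>2)"
    proof (intro mult_left_mono mult_mono)
      show "(\<integral>q. (cosm m q * wk q)\<^sup>2 \<partial>torus) \<le> S\<^sup>2"
        using integral_abs_le_1_mult_sq[OF wkL smooth_torus_cosm, of m] Q wkQ by simp
    qed (use b xS S0 in auto)
    also have "\<dots> = 16 * pi^4 * S^3 / b / k\<^sup>2"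
      by (simp add: power2_eq_square power3_eq_cube power4_eq_xxxx)
    finally show ?thesis .
  qed
  have E: "energy ?Bk (\<lambda>q. g1 q + g2 q) (\<lambda>q. g1 q + g2 q) \<le> 2 * pi\<^sup>2 * ?h + (2 * pi\<^sup>2 * S / b + 32 * pi^4 * S^3 / b) / k"
  proof -
    \<comment> \<open>Young with \<open>t = k\<close> balances the orders: \<open>1 / k\<close>
      times the bounded energy of \<open>g1\<close> against \<open>k\<close> times that of
      \<open>g2\<close>, which is of order \<open>1 / k^2\<close>.\<close>
    have "energy ?Bk (\<lambda>q. g1 q + g2 q) (\<lambda>q. g1 q + g2 q) \<le> (1 + 1 / real k) * energy ?Bk g1 g1 + (1 + real k) * energy ?Bk g2 g2"
      using k0 by (intro energy_young[OF Bk a b g1L g2L]) auto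
    also have "\<dots> \<le> (1 + 1 / real k) * (2 * pi\<^sup>2 * ?h) + (2 * real k) * (16 * pi^4 * S^3 / b / k\<^sup>2)"
      unfolding E11 using k1 energy_nonneg[OF Bk a b g2L] by (intro add_left_mono mult_mono E22) auto
    also have "\<dots> = 2 * pi\<^sup>2 * ?h + (2 * pi\<^sup>2 * ?h + 32 * pi^4 * S^3 / b) / k"
      using k0 by (simp add: power2_eq_square field_simps)
    also have "\<dots> \<le> 2 * pi\<^sup>2 * ?h + (2 * pi\<^sup>2 * (S / b) + 32 * pi^4 * S^3 / b) / k"
      using hS k0 by (intro add_left_mono divide_right_mono add_right_mono mult_left_mono) auto
    finally show ?thesis by simp
  qed
  let ?Wk = "\<lambda>q. W (real k *\<^sub>R q)"
  have Wk: "weight C ?Wk" by (rule weight_dilate[OF W k0])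
  have avg: "(\<integral>q. ?Wk q * P q \<partial>torus) = Z * (\<integral>q. P q \<partial>torus)" if "trig (R + R) P" for P
    unfolding Z using W L2_integrable[OF L2_weight[OF W]] that k
    by (intro integral_dilate_mult_trig) (auto simp: weight_def)
  have \<rho>L: "L2 \<rho>" unfolding \<rho>_def
    by (rule L2_cmult) (use L2_mult_smooth[OF wkL smooth_torus_sinm[of m]] in simp)
  have \<rho>Q: "(\<integral>q. (\<rho> q)\<^sup>2 \<partial>torus) \<le> 4 * pi\<^sup>2 * S\<^sup>2 / k\<^sup>2"
  proof -
    have "(\<integral>q. (\<rho> q)\<^sup>2 \<partial>torus) = 4 * pi\<^sup>2 / k\<^sup>2 * (\<integral>q. (sinm m q * wk q)\<^sup>2 \<partial>torus)"
      unfolding \<rho>_def by (simp add: power_mult_distrib power_divide)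
    also have "\<dots> \<le> 4 * pi\<^sup>2 / k\<^sup>2 * S\<^sup>2"
      using integral_abs_le_1_mult_sq[OF wkL smooth_torus_sinm, of m] Q wkQ by (intro mult_left_mono) auto
    finally show ?thesis by simp
  qed
  have v2: "(\<integral>q. (cosm m q)\<^sup>2 * ?Wk q \<partial>torus) = Z / 2"
    using avg[OF trig_mult[OF trig.cosm[OF m(2)] trig.cosm[OF m(2)]]] integral_cosm_sq[OF m(1)]
    by (simp add: power2_eq_square mult_ac)
  \<comment> \<open>Exact again, so only \<open>\<rho>\<close> contributes to the weighted mean of
    \<open>u\<close>.\<close>
  have v1: "(\<integral>q. cosm m q * ?Wk q \<partial>torus) = 0"
    using avg[OF trig_mono[OF trig.cosm[OF m(2)]]] m(1) by (simp add: integral_cosm mult.commute)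
  have lowsq: "Z / 2 - (Z / 2 + 4 * pi\<^sup>2 * C * S\<^sup>2) / k \<le> (\<integral>q. (u q)\<^sup>2 * ?Wk q \<partial>torus)"
  proof -
    \<comment> \<open>Young's inequality with parameter \<open>k\<close> once more, now bounding a
      square from below.\<close>
    have "(1 - 1 / real k) * (cosm m q)\<^sup>2 - real k * (\<rho> q)\<^sup>2 \<le> (u q)\<^sup>2" for q
    proof -
      have "0 \<le> (cosm m q + real k * \<rho> q)\<^sup>2 / real k" using k0 by simp
      also have "\<dots> = (cosm m q)\<^sup>2 / k + 2 * (cosm m q * \<rho> q) + real k * (\<rho> q)\<^sup>2"
        using k0 by (simp add: power2_eq_square field_simps)
      finally have "0 \<le> (cosm m q)\<^sup>2 / k + 2 * (cosm m q * \<rho> q) + real k * (\<rho> q)\<^sup>2" .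
      moreover have "0 \<le> (\<rho> q)\<^sup>2" by simp
      moreover have "(u q)\<^sup>2 = (cosm m q)\<^sup>2 + 2 * (cosm m q * \<rho> q) + (\<rho> q)\<^sup>2"
        by (simp add: u_def power2_sum)
      moreover have "(1 - 1 / real k) * (cosm m q)\<^sup>2 = (cosm m q)\<^sup>2 - (cosm m q)\<^sup>2 / k"
        by (simp add: left_diff_distrib)
      ultimately show ?thesis by linarith
    qed
    then have pw: "(1 - 1 / real k) * ((cosm m q)\<^sup>2 * ?Wk q) - real k * ((\<rho> q)\<^sup>2 * ?Wk q) \<le> (u q)\<^sup>2 * ?Wk q" for q
      using mult_right_mono[of _ _ "?Wk q"] weight_pos[OF Wk, of q] by (fastforce simp: left_diff_distrib mult.assoc)
    have "(1 - 1 / real k) * (Z / 2) - real k * (\<integral>q. (\<rho> q)\<^sup>2 * ?Wk q \<partial>torus) =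
        (\<integral>q. (1 - 1 / real k) * ((cosm m q)\<^sup>2 * ?Wk q) - real k * ((\<rho> q)\<^sup>2 * ?Wk q) \<partial>torus)"
      using integrable_weight_square[OF Wk L2_cosm[of m]] integrable_weight_square[OF Wk \<rho>L] by (simp add: v2)
    also have "\<dots> \<le> (\<integral>q. (u q)\<^sup>2 * ?Wk q \<partial>torus)"
      using integrable_weight_square[OF Wk L2_cosm[of m]] integrable_weight_square[OF Wk \<rho>L]
        integrable_weight_square[OF Wk H1gD(1)[OF ug]]
      by (intro Bochner_Integration.integral_mono pw) auto
    finally have 1: "(1 - 1 / real k) * (Z / 2) - real k * (\<integral>q. (\<rho> q)\<^sup>2 * ?Wk q \<partial>torus) \<le> (\<integral>q. (u q)\<^sup>2 * ?Wk q \<partial>torus)" .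
    have "real k * (\<integral>q. (\<rho> q)\<^sup>2 * ?Wk q \<partial>torus) \<le> real k * (C * (4 * pi\<^sup>2 * S\<^sup>2 / k\<^sup>2))"
      using integral_weight_sq_le[OF Wk \<rho>L] mult_left_mono[OF \<rho>Q C0] by (intro mult_left_mono) auto
    also have "\<dots> = 4 * pi\<^sup>2 * C * S\<^sup>2 / k" using k0 by (simp add: power2_eq_square field_simps)
    finally have "real k * (\<integral>q. (\<rho> q)\<^sup>2 * ?Wk q \<partial>torus) \<le> 4 * pi\<^sup>2 * C * S\<^sup>2 / k" .
    moreover have "(1 - 1 / real k) * (Z / 2) = Z / 2 - Z / 2 / k" by (simp add: field_simps)
    moreover have "(Z / 2 + 4 * pi\<^sup>2 * C * S\<^sup>2) / real k = Z / 2 / k + 4 * pi\<^sup>2 * C * S\<^sup>2 / k"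
      by (rule add_divide_distrib)
    ultimately show ?thesis using 1 by linarith
  qed
  have mean: "(\<integral>q. u q * ?Wk q \<partial>torus)\<^sup>2 / Z \<le> (4 * pi\<^sup>2 * S\<^sup>2 * C\<^sup>2 / Z) / k"
  proof -
    have "(\<integral>q. u q * ?Wk q \<partial>torus) = (\<integral>q. \<rho> q * ?Wk q \<partial>torus)"
      using integrable_weight_mult[OF Wk L2_cosm[of m]] integrable_weight_mult[OF Wk \<rho>L] v1
      by (simp add: u_def distrib_right)
    then have "(\<integral>q. u q * ?Wk q \<partial>torus)\<^sup>2 \<le> (\<integral>q. (\<rho> q * ?Wk q)\<^sup>2 \<partial>torus)"
      using L2_integral_sq_le[OF L2_weight_mult[OF Wk \<rho>L]] by (simp add: mult.commute[of "\<rho> _"])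
    also have "\<dots> = (\<integral>q. (\<rho> q)\<^sup>2 * (?Wk q)\<^sup>2 \<partial>torus)" by (simp add: power_mult_distrib)
    also have "\<dots> \<le> (\<integral>q. (\<rho> q)\<^sup>2 * C\<^sup>2 \<partial>torus)"
    proof (rule Bochner_Integration.integral_mono)
      show "integrable torus (\<lambda>q. (\<rho> q)\<^sup>2 * (?Wk q)\<^sup>2)"
        using L2D(3)[OF L2_weight_mult[OF Wk \<rho>L]] by (simp add: power_mult_distrib mult.commute)
      show "integrable torus (\<lambda>q. (\<rho> q)\<^sup>2 * C\<^sup>2)" using L2D(3)[OF \<rho>L] by simp
      show "(\<rho> q)\<^sup>2 * (?Wk q)\<^sup>2 \<le> (\<rho> q)\<^sup>2 * C\<^sup>2" for q
        using weight_pos[OF Wk, of q] weight_le[OF Wk, of q] by (intro mult_left_mono power_mono) auto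
    qed
    also have "\<dots> \<le> 4 * pi\<^sup>2 * S\<^sup>2 / k\<^sup>2 * C\<^sup>2" using mult_right_mono[OF \<rho>Q, of "C\<^sup>2"] by simp
    \<comment> \<open>The order \<open>1 / k^2\<close> is weakened to \<open>1 / k\<close> to share
      a denominator with the other errors.\<close>
    also have "\<dots> \<le> 4 * pi\<^sup>2 * S\<^sup>2 * C\<^sup>2 / k"
    proof -
      have "real k * 1 \<le> real k * real k" using k1 by (intro mult_left_mono) auto
      then have "4 * pi\<^sup>2 * S\<^sup>2 * C\<^sup>2 / (real k)\<^sup>2 \<le> 4 * pi\<^sup>2 * S\<^sup>2 * C\<^sup>2 / real k"
        using k0 by (intro divide_left_mono) (auto simp: power2_eq_square)
      then show ?thesis by simp
    qed
    finally have "(\<integral>q. u q * ?Wk q \<partial>torus)\<^sup>2 / Z \<le> (4 * pi\<^sup>2 * S\<^sup>2 * C\<^sup>2 / k) / Z"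
      using Z0 by (intro divide_right_mono) auto
    then show ?thesis by (simp add: mult.commute)
  qed
  have "L * (Z / 2 - (Z / 2 + 4 * pi\<^sup>2 * C * S\<^sup>2 + 4 * pi\<^sup>2 * S\<^sup>2 * C\<^sup>2 / Z) / k) \<le>
      L * ((\<integral>q. (u q)\<^sup>2 * ?Wk q \<partial>torus) - (\<integral>q. u q * ?Wk q \<partial>torus)\<^sup>2 / Z)"
    using lowsq mean L by (intro mult_left_mono) (auto simp: add_divide_distrib)
  also note le[OF ug]
  also note E
  finally show ?thesis by (simp add: x_def)
qed

subsection \<open>Lower bound\<close>

lemma integral_mult_bounded:
  fixes f s :: "real^'n \<Rightarrow> real"
  assumes f: "L2 f" and s: "smooth_torus s" "\<And>q. \<bar>s q\<bar> \<le> c"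
  shows "\<bar>\<integral>q. f q * s q \<partial>torus\<bar> \<le> c * sqrt (\<integral>q. (f q)\<^sup>2 \<partial>torus)"
proof -
  have c: "0 \<le> c" using s(2)[of 0] by linarith
  have "(\<integral>q. (s q)\<^sup>2 \<partial>torus) \<le> (\<integral>q. c\<^sup>2 \<partial>(torus :: (real^'n) measure))"
  proof (rule Bochner_Integration.integral_mono)
    show "integrable torus (\<lambda>q. (s q)\<^sup>2)" using L2D(3)[OF L2_smooth[OF s(1)]] by simp
    show "integrable torus (\<lambda>q::real^'n. c\<^sup>2)" by (simp add: finite_measure.integrable_const)
    show "(s q)\<^sup>2 \<le> c\<^sup>2" for q using s(2)[of q] c by (simp add: abs_le_square_iff[symmetric])
  qed
  then have "sqrt (\<integral>q. (s q)\<^sup>2 \<partial>torus) \<le> c" using c by (intro real_le_lsqrt) auto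
  then have "sqrt (\<integral>q. (f q)\<^sup>2 \<partial>torus) * sqrt (\<integral>q. (s q)\<^sup>2 \<partial>torus) \<le> sqrt (\<integral>q. (f q)\<^sup>2 \<partial>torus) * c"
    by (intro mult_left_mono) auto
  then show ?thesis using L2_Cauchy_Schwarz_abs[OF f L2_smooth[OF s(1)]] by (simp add: mult.commute)
qed

lemma sqrt_Poincare:
  fixes u :: "real^'n \<Rightarrow> real"
  assumes "H1g u g" "(\<integral>q. u q \<partial>torus) = 0"
  shows "sqrt (\<integral>q. (u q)\<^sup>2 \<partial>torus) \<le> sqrt (sqn g)"
  using Poincare[OF assms] by simp

lemma sqrt_sqn_nth_le:
  fixes g :: "real^'n \<Rightarrow> real^'n"
  assumes "L2 g" shows "sqrt (\<integral>q. (g q $ i)\<^sup>2 \<partial>torus) \<le> sqrt (sqn g)"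
  using sqn_nth_le[OF assms, of i] by simp

text \<open>One integration by parts along axis \<open>i\<close> gains the factor
  \<open>1 / (M $ i)\<close>, with the derivative landing on \<open>u\<close> or on
  \<open>h\<close>. \<open>K\<close> depends on \<open>h\<close> alone, which gives uniformity in
  \<open>u\<close> and in the frequency.\<close>

lemma high_frequency_bound:
  fixes h :: "real^'n \<Rightarrow> real"
  assumes h: "smooth_torus h"
  shows "\<exists>K\<ge>0. \<forall>M i u g. H1g u g \<longrightarrow> (\<integral>q. u q \<partial>torus) = 0 \<longrightarrow>
    \<bar>\<integral>q. u q * (h q * cosm M q) \<partial>torus\<bar> * \<bar>real_of_int (M $ i)\<bar> \<le> K * sqrt (sqn g) \<and>
    \<bar>\<integral>q. u q * (h q * sinm M q) \<partial>torus\<bar> * \<bar>real_of_int (M $ i)\<bar> \<le> K * sqrt (sqn g)"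
proof -
  obtain C1 where C1: "\<And>q. \<bar>h q\<bar> \<le> C1" using smooth_torus_bounded[OF h] by blast
  have "\<exists>c. \<forall>q. \<bar>partial_deriv i h q\<bar> \<le> c" for i
    using smooth_torus_bounded[OF smooth_torus_partial_deriv[OF h]] by metis
  then obtain C2 where C2: "\<And>i q. \<bar>partial_deriv i h q\<bar> \<le> C2 i" by metis
  have C10: "0 \<le> C1" using C1[of 0] by linarith
  have C20: "0 \<le> C2 i" for i using C2[of i 0] by linarith
  define K where "K = C1 + (\<Sum>i\<in>UNIV. C2 i)"
  \<comment> \<open>\<open>r * c\<close> is the derivative of \<open>s\<close>; sine with cosine and
    cosine with sine are the two instances.\<close>
  have key: "\<bar>\<integral>q. u q * (h q * c q) \<partial>torus\<bar> * \<bar>real_of_int (M $ i)\<bar> \<le> K * sqrt (sqn g)"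
    if ug: "H1g u g" "(\<integral>q. u q \<partial>torus) = 0" and s: "smooth_torus s" "\<And>q. \<bar>s q\<bar> \<le> 1" and c: "smooth_torus c"
      and d: "\<And>q. partial_deriv i s q = r * c q" and r: "\<bar>r\<bar> \<ge> \<bar>real_of_int (M $ i)\<bar>"
    for u g M i c s r
  proof -
    note u = H1gD(1)[OF ug(1)] and gi = L2_nth[OF H1gD(2)[OF ug(1)], of i]
    have hs: "smooth_torus (\<lambda>q. h q * s q)" and hc: "smooth_torus (\<lambda>q. h q * c q)"
      and dhs: "smooth_torus (\<lambda>q. partial_deriv i h q * s q)"
      using h s c by (auto intro: smooth_torus_mult smooth_torus_partial_deriv)
    have "(\<integral>q. u q * (h q * (r * c q) + partial_deriv i h q * s q) \<partial>torus) = - (\<integral>q. g q $ i * (h q * s q) \<partial>torus)"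
      using H1g_by_parts[OF ug(1) hs, of i] by (simp add: partial_deriv_smooth_mult[OF h s(1)] d)
    moreover have "(\<integral>q. u q * (h q * (r * c q) + partial_deriv i h q * s q) \<partial>torus) =
        r * (\<integral>q. u q * (h q * c q) \<partial>torus) + (\<integral>q. u q * (partial_deriv i h q * s q) \<partial>torus)"
      using L2_mult[OF u L2_smooth[OF hc]] L2_mult[OF u L2_smooth[OF dhs]]
      by (simp add: distrib_left mult.left_commute[of _ r])
    ultimately have eq: "r * (\<integral>q. u q * (h q * c q) \<partial>torus) =
        - (\<integral>q. g q $ i * (h q * s q) \<partial>torus) - (\<integral>q. u q * (partial_deriv i h q * s q) \<partial>torus)"
      by linarith
    have "\<bar>h q * s q\<bar> \<le> C1" for q
      using mult_mono[OF C1[of q] s(2)[of q]] C10 by (simp add: abs_mult)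
    then have "\<bar>\<integral>q. g q $ i * (h q * s q) \<partial>torus\<bar> \<le> C1 * sqrt (\<integral>q. (g q $ i)\<^sup>2 \<partial>torus)"
      by (intro integral_mult_bounded gi hs)
    also have "\<dots> \<le> C1 * sqrt (sqn g)"
      using sqrt_sqn_nth_le[OF H1gD(2)[OF ug(1)]] C10 by (intro mult_left_mono) auto
    finally have 1: "\<bar>\<integral>q. g q $ i * (h q * s q) \<partial>torus\<bar> \<le> C1 * sqrt (sqn g)" .
    have "\<bar>partial_deriv i h q * s q\<bar> \<le> C2 i" for q
      using mult_mono[OF C2[of i q] s(2)[of q]] C20[of i] by (simp add: abs_mult)
    then have "\<bar>\<integral>q. u q * (partial_deriv i h q * s q) \<partial>torus\<bar> \<le> C2 i * sqrt (\<integral>q. (u q)\<^sup>2 \<partial>torus)"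
      by (intro integral_mult_bounded u dhs)
    also have "\<dots> \<le> (\<Sum>i\<in>UNIV. C2 i) * sqrt (sqn g)"
      using sqrt_Poincare[OF ug] C20 by (intro mult_mono member_le_sum sum_nonneg) auto
    finally have 2: "\<bar>\<integral>q. u q * (partial_deriv i h q * s q) \<partial>torus\<bar> \<le> (\<Sum>i\<in>UNIV. C2 i) * sqrt (sqn g)" .
    have "\<bar>\<integral>q. u q * (h q * c q) \<partial>torus\<bar> * \<bar>real_of_int (M $ i)\<bar> \<le> \<bar>\<integral>q. u q * (h q * c q) \<partial>torus\<bar> * \<bar>r\<bar>"
      using r by (intro mult_left_mono) auto
    also have "\<dots> = \<bar>r * (\<integral>q. u q * (h q * c q) \<partial>torus)\<bar>" by (simp add: abs_mult)
    also have "\<dots> \<le> C1 * sqrt (sqn g) + (\<Sum>i\<in>UNIV. C2 i) * sqrt (sqn g)"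
      unfolding eq using 1 2 by linarith
    finally show ?thesis by (simp add: K_def distrib_right)
  qed
  have pi1: "\<bar>2 * pi * t\<bar> \<ge> \<bar>t\<bar>" for t :: real
    using pi_ge_two mult_right_mono[of 1 "2 * pi" "\<bar>t\<bar>"] by (simp add: abs_mult)
  have "K \<ge> 0" unfolding K_def using C10 C20 by (intro add_nonneg_nonneg sum_nonneg)
  moreover have "\<bar>\<integral>q. u q * (h q * cosm M q) \<partial>torus\<bar> * \<bar>real_of_int (M $ i)\<bar> \<le> K * sqrt (sqn g)"
    if "H1g u g" "(\<integral>q. u q \<partial>torus) = 0" for M i u g
    using key[OF that smooth_torus_sinm abs_sinm_le smooth_torus_cosm, of i M "2 * pi * real_of_int (M $ i)" M] pi1
    by (simp add: partial_deriv_sinm)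
  moreover have "\<bar>\<integral>q. u q * (h q * sinm M q) \<partial>torus\<bar> * \<bar>real_of_int (M $ i)\<bar> \<le> K * sqrt (sqn g)"
    if "H1g u g" "(\<integral>q. u q \<partial>torus) = 0" for M i u g
    using key[OF that smooth_torus_cosm abs_cosm_le smooth_torus_sinm, of i M "- (2 * pi * real_of_int (M $ i))" M] pi1
    by (simp add: partial_deriv_cosm)
  ultimately show ?thesis by blast
qed

text \<open>\<open>h\<close> times \<open>f (k q)\<close> tends to zero in the dual of the mean-zero
  \<open>H1\<close> functions: the threshold is independent of \<open>u\<close>. This uniformity
  stands in for a convergent subsequence of test functions.\<close>

definition osc_vanishing :: "(real^'n \<Rightarrow> real) \<Rightarrow> (real^'n \<Rightarrow> real) \<Rightarrow> bool" where
  "osc_vanishing h f \<longleftrightarrow> (\<forall>\<epsilon>>0. \<exists>k0>0. \<forall>k\<ge>k0. \<forall>u g. H1g u g \<longrightarrow> (\<integral>q. u q \<partial>torus) = 0 \<longrightarrow>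
     \<bar>\<integral>q. u q * h q * f (real k *\<^sub>R q) \<partial>torus\<bar> \<le> \<epsilon> * sqrt (sqn g))"

lemma osc_vanishingE:
  fixes h f :: "real^'n \<Rightarrow> real"
  assumes "osc_vanishing h f" "\<epsilon> > 0"
  obtains k0 where "k0 > 0" "\<And>k u g. k \<ge> k0 \<Longrightarrow> H1g u g \<Longrightarrow> (\<integral>q. u q \<partial>torus) = 0 \<Longrightarrow>
     \<bar>\<integral>q. u q * h q * f (real k *\<^sub>R q) \<partial>torus\<bar> \<le> \<epsilon> * sqrt (sqn g)"
proof -
  obtain k0 where "k0 > 0" and k0: "\<forall>k\<ge>k0. \<forall>u g. H1g u g \<longrightarrow> (\<integral>q. u q \<partial>torus) = 0 \<longrightarrow>
     \<bar>\<integral>q. u q * h q * f (real k *\<^sub>R q) \<partial>torus\<bar> \<le> \<epsilon> * sqrt (sqn g)"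
    using assms unfolding osc_vanishing_def by meson
  then show ?thesis using that by simp
qed

lemma cosm_dilate: "cosm n (real k *\<^sub>R q) = cosm (\<chi> i. int k * n $ i) q"
  and sinm_dilate: "sinm n (real k *\<^sub>R q) = sinm (\<chi> i. int k * n $ i) q"
proof -
  have "ivec (\<chi> i. int k * n $ i) = real k *\<^sub>R ivec n" by (simp add: vec_eq_iff)
  then show "cosm n (real k *\<^sub>R q) = cosm (\<chi> i. int k * n $ i) q" "sinm n (real k *\<^sub>R q) = sinm (\<chi> i. int k * n $ i) q"
    by (simp_all add: cosm_def sinm_def)
qed

text \<open>Dilation by \<open>k\<close> multiplies the frequency of a character by
  \<open>k\<close>, so \<open>high_frequency_bound\<close> decays like \<open>1 / k\<close>.\<close>

lemma osc_vanishing_trig: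
  fixes h :: "real^'n \<Rightarrow> real"
  assumes h: "smooth_torus h" and n: "n \<noteq> 0"
  shows "osc_vanishing h (cosm n)" "osc_vanishing h (sinm n)"
proof -
  obtain i where i: "n $ i \<noteq> 0" using n by (auto simp: vec_eq_iff)
  obtain K where K: "K \<ge> 0" "\<And>M i u g. H1g u g \<Longrightarrow> (\<integral>q. u q \<partial>torus) = 0 \<Longrightarrow>
    \<bar>\<integral>q. u q * (h q * cosm M q) \<partial>torus\<bar> * \<bar>real_of_int (M $ i)\<bar> \<le> K * sqrt (sqn g) \<and>
    \<bar>\<integral>q. u q * (h q * sinm M q) \<partial>torus\<bar> * \<bar>real_of_int (M $ i)\<bar> \<le> K * sqrt (sqn g)"
    using high_frequency_bound[OF h] by blast
  have fin: "t \<le> \<epsilon> * r" if "t * \<bar>real_of_int ((\<chi> i. int k * n $ i) $ i)\<bar> \<le> K * r" "0 \<le> t" "K \<le> \<epsilon> * real k" "0 \<le> r" "k > 0"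
    for t r \<epsilon> and k :: nat
  proof -
    have "real k \<le> \<bar>real_of_int ((\<chi> i. int k * n $ i) $ i)\<bar>"
    proof -
      have "1 \<le> \<bar>real_of_int (n $ i)\<bar>" using i by linarith
      then have "real k * 1 \<le> real k * \<bar>real_of_int (n $ i)\<bar>" by (intro mult_left_mono) auto
      then show ?thesis by (simp add: abs_mult)
    qed
    then have "t * real k \<le> t * \<bar>real_of_int ((\<chi> i. int k * n $ i) $ i)\<bar>" using that(2) by (intro mult_left_mono)
    also note that(1)
    also have "K * r \<le> \<epsilon> * real k * r" using that by (intro mult_right_mono) auto
    finally have "t * real k \<le> (\<epsilon> * r) * real k" by (simp add: mult_ac)
    then show ?thesis using that(5) by simp
  qed
  have ex_k0: "\<exists>k0>0. \<forall>k\<ge>k0. k > 0 \<and> K \<le> \<epsilon> * real k" if e: "\<epsilon> > 0" for \<epsilon>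
  proof -
    obtain k1 :: nat where k1: "K / \<epsilon> \<le> real k1" using real_arch_simple by blast
    have "K \<le> \<epsilon> * real k" if "k \<ge> Suc k1" for k
    proof -
      have "K / \<epsilon> \<le> real k" using k1 that by linarith
      then show ?thesis using e by (simp add: field_simps)
    qed
    then show ?thesis by (intro exI[of _ "Suc k1"]) auto
  qed
  have main: "osc_vanishing h f"
    if f: "\<And>k q. f (real k *\<^sub>R q) = c (\<chi> i. int k * n $ i) q"
      and c: "\<And>M u g. H1g u g \<Longrightarrow> (\<integral>q. u q \<partial>torus) = 0 \<Longrightarrow>
        \<bar>\<integral>q. u q * (h q * c M q) \<partial>torus\<bar> * \<bar>real_of_int (M $ i)\<bar> \<le> K * sqrt (sqn g)" for f c
    unfolding osc_vanishing_def f mult.assoc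
  proof (intro allI impI)
    fix \<epsilon> :: real assume e: "\<epsilon> > 0"
    obtain k0 where k0: "k0 > 0" "\<forall>k\<ge>k0. k > 0 \<and> K \<le> \<epsilon> * real k"
      using ex_k0[OF e] by blast
    show "\<exists>k0>0. \<forall>k\<ge>k0. \<forall>u g. H1g u g \<longrightarrow> (\<integral>q. u q \<partial>torus) = 0 \<longrightarrow>
     \<bar>\<integral>q. u q * (h q * c (\<chi> i. int k * n $ i) q) \<partial>torus\<bar> \<le> \<epsilon> * sqrt (sqn g)"
    proof (intro exI[of _ k0] conjI allI impI k0(1))
      fix k and u :: "real^'n \<Rightarrow> real" and g assume k: "k0 \<le> k" and ug: "H1g u g" "(\<integral>q. u q \<partial>torus) = 0"
      show "\<bar>\<integral>q. u q * (h q * c (\<chi> i. int k * n $ i) q) \<partial>torus\<bar> \<le> \<epsilon> * sqrt (sqn g)"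
        using k0(2)[rule_format, OF k] by (intro fin[OF c[OF ug], of k]) (simp_all add: sqn_nonneg)
    qed
  qed
  show "osc_vanishing h (cosm n)" "osc_vanishing h (sinm n)"
    using K(2) by (blast intro: main[of "cosm n" cosm, OF cosm_dilate] main[of "sinm n" sinm, OF sinm_dilate])+
qed

lemma osc_vanishing_integrable:
  assumes h: "smooth_torus h" and "L2 u" "L2 f" "k > 0"
  shows "integrable torus (\<lambda>q. u q * h q * f (real k *\<^sub>R q :: real^'n))"
  using L2_mult[OF L2_mult_smooth[OF assms(2) h] L2_dilate[OF assms(3,4)]] by (simp add: mult_ac)

lemma osc_vanishing_add:
  fixes h :: "real^'n \<Rightarrow> real"
  assumes h: "smooth_torus h" and f: "osc_vanishing h f" "L2 f" and f': "osc_vanishing h f'" "L2 f'"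
  shows "osc_vanishing h (\<lambda>q. f q + f' q)"
  unfolding osc_vanishing_def
proof (intro allI impI)
  fix \<epsilon> :: real assume "\<epsilon> > 0"
  then have e2: "\<epsilon> / 2 > 0" by simp
  obtain k1 where k1: "k1 > 0" "\<And>k u g. k \<ge> k1 \<Longrightarrow> H1g u g \<Longrightarrow> (\<integral>q. u q \<partial>torus) = 0 \<Longrightarrow>
     \<bar>\<integral>q. u q * h q * f (real k *\<^sub>R q) \<partial>torus\<bar> \<le> \<epsilon> / 2 * sqrt (sqn g)"
    by (rule osc_vanishingE[OF f(1) e2]) blast
  obtain k2 where k2: "k2 > 0" "\<And>k u g. k \<ge> k2 \<Longrightarrow> H1g u g \<Longrightarrow> (\<integral>q. u q \<partial>torus) = 0 \<Longrightarrow>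
     \<bar>\<integral>q. u q * h q * f' (real k *\<^sub>R q) \<partial>torus\<bar> \<le> \<epsilon> / 2 * sqrt (sqn g)"
    by (rule osc_vanishingE[OF f'(1) e2]) blast
  show "\<exists>k0>0. \<forall>k\<ge>k0. \<forall>u g. H1g u g \<longrightarrow> (\<integral>q. u q \<partial>torus) = 0 \<longrightarrow>
     \<bar>\<integral>q. u q * h q * (f (real k *\<^sub>R q) + f' (real k *\<^sub>R q)) \<partial>torus\<bar> \<le> \<epsilon> * sqrt (sqn g)"
  proof (intro exI[of _ "max k1 k2"] conjI allI impI)
    fix k and u :: "real^'n \<Rightarrow> real" and g
    assume k: "max k1 k2 \<le> k" and ug: "H1g u g" "(\<integral>q. u q \<partial>torus) = 0"
    have k0: "k > 0" using k k1(1) by simp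
    have "(\<integral>q. u q * h q * (f (real k *\<^sub>R q) + f' (real k *\<^sub>R q)) \<partial>torus) =
        (\<integral>q. u q * h q * f (real k *\<^sub>R q) \<partial>torus) + (\<integral>q. u q * h q * f' (real k *\<^sub>R q) \<partial>torus)"
      unfolding distrib_left
      by (intro Bochner_Integration.integral_add osc_vanishing_integrable h H1gD(1)[OF ug(1)] f(2) f'(2) k0)
    moreover have "\<bar>\<integral>q. u q * h q * f (real k *\<^sub>R q) \<partial>torus\<bar> \<le> \<epsilon> / 2 * sqrt (sqn g)"
      using k by (intro k1(2) ug) simp
    moreover have "\<bar>\<integral>q. u q * h q * f' (real k *\<^sub>R q) \<partial>torus\<bar> \<le> \<epsilon> / 2 * sqrt (sqn g)"
      using k by (intro k2(2) ug) simp
    moreover have "\<epsilon> * sqrt (sqn g) = \<epsilon> / 2 * sqrt (sqn g) + \<epsilon> / 2 * sqrt (sqn g)" by simp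
    ultimately show "\<bar>\<integral>q. u q * h q * (f (real k *\<^sub>R q) + f' (real k *\<^sub>R q)) \<partial>torus\<bar> \<le> \<epsilon> * sqrt (sqn g)"
      by linarith
  qed (use k1 in simp)
qed

lemma osc_vanishing_zero: "osc_vanishing h (\<lambda>_. 0)"
  unfolding osc_vanishing_def by (auto simp: sqn_nonneg intro!: exI[of _ 1])

lemma osc_vanishing_cmult:
  fixes h :: "real^'n \<Rightarrow> real"
  assumes f: "osc_vanishing h f" shows "osc_vanishing h (\<lambda>q. c * f q)"
  unfolding osc_vanishing_def
proof (intro allI impI)
  fix \<epsilon> :: real assume "\<epsilon> > 0"
  then have e2: "\<epsilon> / (\<bar>c\<bar> + 1) > 0" by simp
  obtain k1 where k1: "k1 > 0" "\<And>k u g. k \<ge> k1 \<Longrightarrow> H1g u g \<Longrightarrow> (\<integral>q. u q \<partial>torus) = 0 \<Longrightarrow>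
     \<bar>\<integral>q. u q * h q * f (real k *\<^sub>R q) \<partial>torus\<bar> \<le> \<epsilon> / (\<bar>c\<bar> + 1) * sqrt (sqn g)"
    by (rule osc_vanishingE[OF f e2]) blast
  show "\<exists>k0>0. \<forall>k\<ge>k0. \<forall>u g. H1g u g \<longrightarrow> (\<integral>q. u q \<partial>torus) = 0 \<longrightarrow>
     \<bar>\<integral>q. u q * h q * (c * f (real k *\<^sub>R q)) \<partial>torus\<bar> \<le> \<epsilon> * sqrt (sqn g)"
  proof (intro exI[of _ k1] conjI allI impI k1(1))
    fix k and u :: "real^'n \<Rightarrow> real" and g
    assume k: "k1 \<le> k" and ug: "H1g u g" "(\<integral>q. u q \<partial>torus) = 0"
    let ?I = "\<integral>q. u q * h q * f (real k *\<^sub>R q) \<partial>torus"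
    have "\<bar>\<integral>q. u q * h q * (c * f (real k *\<^sub>R q)) \<partial>torus\<bar> = \<bar>c\<bar> * \<bar>?I\<bar>"
      by (simp add: mult.left_commute[of _ c] abs_mult)
    also have "\<dots> \<le> (\<bar>c\<bar> + 1) * (\<epsilon> / (\<bar>c\<bar> + 1) * sqrt (sqn g))"
      using k1(2)[OF k ug] by (intro mult_mono) auto
    also have "\<dots> = \<epsilon> * sqrt (sqn g)"
    proof -
      have "\<bar>c\<bar> + 1 \<noteq> 0" by (simp add: add_nonneg_eq_0_iff)
      then show ?thesis by simp
    qed
    finally show "\<bar>\<integral>q. u q * h q * (c * f (real k *\<^sub>R q)) \<partial>torus\<bar> \<le> \<epsilon> * sqrt (sqn g)" .
  qed
qed

lemma osc_vanishing_sum: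
  fixes h :: "real^'n \<Rightarrow> real"
  assumes h: "smooth_torus h" and f: "\<And>j. j \<in> J \<Longrightarrow> osc_vanishing h (f j) \<and> L2 (f j)"
  shows "osc_vanishing h (\<lambda>q. \<Sum>j\<in>J. f j q)"
  using f
proof (induction J rule: infinite_finite_induct)
  case (insert x F)
  then show ?case by (simp add: osc_vanishing_add[OF h] L2_sum)
qed (simp_all add: osc_vanishing_zero)

text \<open>The projection of \<open>f\<close> is a finite sum over nonzero frequencies because the
  mean vanishes. The remainder is small in L2 and dilation preserves its norm, so it is small for
  all \<open>k\<close> at once.\<close>

lemma osc_vanishing_L2:
  fixes h :: "real^'n \<Rightarrow> real"
  assumes h: "smooth_torus h" and f: "L2 f" and mean: "(\<integral>q. f q \<partial>torus) = 0"
  shows "osc_vanishing h f"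
  unfolding osc_vanishing_def
proof (intro allI impI)
  fix \<epsilon> :: real assume e: "\<epsilon> > 0"
  obtain C where C: "\<And>q. \<bar>h q\<bar> \<le> C" using smooth_torus_bounded[OF h] by blast
  have C0: "0 \<le> C" using C[of 0] by linarith
  \<comment> \<open>\<open>C * d\<close> must be at most \<open>\<epsilon> / 2\<close>; the
    denominator \<open>C + 1\<close> also covers \<open>C = 0\<close>.\<close>
  define d where "d = \<epsilon> / 2 / (C + 1)"
  have d: "d > 0" using e C0 by (simp add: d_def)
  have "(\<lambda>R. \<integral>q. (f q - proj R f q)\<^sup>2 \<partial>torus) \<longlonglongrightarrow> 0" by (rule proj_LIMSEQ[OF f])
  then have "\<forall>\<^sub>F R in sequentially. (\<integral>q. (f q - proj R f q)\<^sup>2 \<partial>torus) < d\<^sup>2"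
    by (rule order_tendstoD(2)) (use d in simp)
  then obtain R where R: "(\<integral>q. (f q - proj R f q)\<^sup>2 \<partial>torus) < d\<^sup>2" by (auto simp: eventually_sequentially)
  have "osc_vanishing h (\<lambda>q. \<Sum>m\<in>fbox R. cos_coeff f m * cosm m q + sin_coeff f m * sinm m q)"
  proof (intro osc_vanishing_sum[OF h] conjI)
    fix m :: "int^'n"
    show "L2 (\<lambda>q. cos_coeff f m * cosm m q + sin_coeff f m * sinm m q)" by (intro L2_add L2_cmult L2_cosm L2_sinm)
    show "osc_vanishing h (\<lambda>q. cos_coeff f m * cosm m q + sin_coeff f m * sinm m q)"
    proof (cases "m = 0")
      case True
      then show ?thesis using mean by (simp add: cos_coeff_def osc_vanishing_zero)
    next
      case False
      then show ?thesis
        by (intro osc_vanishing_add osc_vanishing_cmult osc_vanishing_trig h L2_cmult L2_cosm L2_sinm)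
    qed
  qed
  then have van: "osc_vanishing h (proj R f)" by (simp add: proj_def[abs_def])
  have e2: "\<epsilon> / 2 > 0" using e by simp
  obtain k1 where k1: "k1 > 0" "\<And>k u g. k \<ge> k1 \<Longrightarrow> H1g u g \<Longrightarrow> (\<integral>q. u q \<partial>torus) = 0 \<Longrightarrow>
     \<bar>\<integral>q. u q * h q * proj R f (real k *\<^sub>R q) \<partial>torus\<bar> \<le> \<epsilon> / 2 * sqrt (sqn g)"
    by (rule osc_vanishingE[OF van e2]) blast
  show "\<exists>k0>0. \<forall>k\<ge>k0. \<forall>u g. H1g u g \<longrightarrow> (\<integral>q. u q \<partial>torus) = 0 \<longrightarrow>
     \<bar>\<integral>q. u q * h q * f (real k *\<^sub>R q) \<partial>torus\<bar> \<le> \<epsilon> * sqrt (sqn g)"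
  proof (intro exI[of _ k1] conjI allI impI k1(1))
    fix k and u :: "real^'n \<Rightarrow> real" and g
    assume k: "k1 \<le> k" and ug: "H1g u g" "(\<integral>q. u q \<partial>torus) = 0"
    have k0: "k > 0" using k k1(1) by simp
    note u = H1gD(1)[OF ug(1)]
    define r where "r = (\<lambda>q. f q - proj R f q)"
    have r: "L2 r" unfolding r_def by (intro L2_diff f L2_proj)
    have rk: "L2 (\<lambda>q. r (real k *\<^sub>R q))" by (rule L2_dilate[OF r k0])
    have hr: "L2 (\<lambda>q. h q * r (real k *\<^sub>R q))" using L2_mult_smooth[OF rk h] by simp
    have "(\<integral>q. (h q * r (real k *\<^sub>R q))\<^sup>2 \<partial>torus) \<le> (\<integral>q. C\<^sup>2 * (r (real k *\<^sub>R q))\<^sup>2 \<partial>torus)"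
    proof (rule Bochner_Integration.integral_mono)
      show "integrable torus (\<lambda>q. (h q * r (real k *\<^sub>R q))\<^sup>2)" using L2D(3)[OF hr] by simp
      show "integrable torus (\<lambda>q. C\<^sup>2 * (r (real k *\<^sub>R q))\<^sup>2)" using L2D(3)[OF rk] by simp
      show "(h q * r (real k *\<^sub>R q))\<^sup>2 \<le> C\<^sup>2 * (r (real k *\<^sub>R q))\<^sup>2" for q
        using C[of q] C0 unfolding power_mult_distrib
        by (intro mult_right_mono) (auto simp: abs_le_square_iff[symmetric])
    qed
    also have "\<dots> = C\<^sup>2 * (\<integral>q. (r q)\<^sup>2 \<partial>torus)" using sqn_dilate[OF r k0] by simp
    also have "\<dots> \<le> C\<^sup>2 * d\<^sup>2" using R by (intro mult_left_mono) (auto simp: r_def)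
    finally have "sqrt (\<integral>q. (h q * r (real k *\<^sub>R q))\<^sup>2 \<partial>torus) \<le> C * d"
      using C0 d by (intro real_le_lsqrt) (auto simp: power_mult_distrib)
    also have "\<dots> \<le> \<epsilon> / 2"
    proof -
      have "C * d \<le> (C + 1) * d" using d by (intro mult_right_mono) auto
      also have "\<dots> = \<epsilon> / 2"
      proof -
        have "C + 1 \<noteq> 0" using C0 by simp
        then show ?thesis by (simp add: d_def del: divide_divide_eq_left)
      qed
      finally show ?thesis .
    qed
    finally have "sqrt (\<integral>q. (u q)\<^sup>2 \<partial>torus) * sqrt (\<integral>q. (h q * r (real k *\<^sub>R q))\<^sup>2 \<partial>torus) \<le> sqrt (sqn g) * (\<epsilon> / 2)"
      using sqrt_Poincare[OF ug] sqn_nonneg[of g] by (intro mult_mono) auto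
    then have 1: "\<bar>\<integral>q. u q * (h q * r (real k *\<^sub>R q)) \<partial>torus\<bar> \<le> \<epsilon> / 2 * sqrt (sqn g)"
      using L2_Cauchy_Schwarz_abs[OF u hr] by (simp add: mult.commute)
    have "(\<integral>q. u q * h q * f (real k *\<^sub>R q) \<partial>torus) =
        (\<integral>q. u q * h q * proj R f (real k *\<^sub>R q) + u q * (h q * r (real k *\<^sub>R q)) \<partial>torus)"
      by (intro Bochner_Integration.integral_cong) (auto simp: r_def algebra_simps)
    also have "\<dots> = (\<integral>q. u q * h q * proj R f (real k *\<^sub>R q) \<partial>torus) + (\<integral>q. u q * (h q * r (real k *\<^sub>R q)) \<partial>torus)"
      by (intro Bochner_Integration.integral_add osc_vanishing_integrable h u L2_proj k0 L2_mult hr)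
    moreover have "\<epsilon> * sqrt (sqn g) = \<epsilon> / 2 * sqrt (sqn g) + \<epsilon> / 2 * sqrt (sqn g)" by simp
    ultimately show "\<bar>\<integral>q. u q * h q * f (real k *\<^sub>R q) \<partial>torus\<bar> \<le> \<epsilon> * sqrt (sqn g)"
      using 1 k1(2)[OF k ug] by linarith
  qed
qed

section \<open>Oscillating fluxes and the homogenized lower bound\<close>

context
  fixes a b :: real and A :: "real^'n \<Rightarrow> real^'n^'n"
  assumes A: "coeff a b A" and a: "a > 0" and b: "b > 0"
begin

definition flux :: "'n \<Rightarrow> real^'n \<Rightarrow> real^'n" where
  "flux j q = A q *v corr_field A (axis j 1) q"

lemma L2_flux: "L2 (flux j)"
  unfolding flux_def[abs_def] by (intro L2_coeff[OF A b] L2_corr_field[OF A a b])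

lemma integral_flux: "(\<integral>q. flux j q $ l \<partial>torus) = A_bar A $ l $ j"
proof -
  have "(\<integral>q. flux j q $ l \<partial>torus) = energy A (\<lambda>_. axis l 1) (corr_field A (axis j 1))"
    by (simp add: energy_def flux_def inner_axis')
  also have "\<dots> = axis l 1 \<bullet> (A_bar A *v axis j 1)" by (rule energy_const_corr_field[OF A a b])
  also have "\<dots> = A_bar A $ l $ j"
    by (simp add: inner_axis' matrix_vector_mult_basis column_def)
  finally show ?thesis .
qed

text \<open>The dilation is transposed onto \<open>G\<close>; the fold of a gradient is
  \<open>k\<close> times a gradient, and the corrector equation annihilates it.\<close>

lemma flux_divergence_free:
  assumes \<phi>: "H1g \<phi> G" and k: "k > 0"
  shows "(\<integral>q. G q \<bullet> flux j (real k *\<^sub>R q) \<partial>torus) = 0"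
proof -
  note GL = H1gD(2)[OF \<phi>]
  have fn: "fold_torus k G q $ l = fold_torus k (\<lambda>q. G q $ l) q" for q l
    by (simp add: fold_torus_def)
  have "(\<integral>q. G q \<bullet> flux j (real k *\<^sub>R q) \<partial>torus) = (\<Sum>l\<in>UNIV. \<integral>q. flux j (real k *\<^sub>R q) $ l * G q $ l \<partial>torus)"
    unfolding inner_vec_def using L2_mult[OF L2_nth[OF L2_dilate[OF L2_flux k]] L2_nth[OF GL]]
    by (subst Bochner_Integration.integral_sum[symmetric]) (auto simp: mult.commute)
  also have "\<dots> = (\<Sum>l\<in>UNIV. \<integral>q. flux j q $ l * fold_torus k (\<lambda>q. G q $ l) q \<partial>torus)"
    by (intro sum.cong refl L2_integral_dilate_mult[OF L2_nth[OF L2_flux] L2_nth[OF GL] k])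
  also have "\<dots> = (\<integral>q. fold_torus k G q \<bullet> flux j q \<partial>torus)"
    unfolding inner_vec_def fn[symmetric] using L2_mult[OF L2_nth[OF L2_flux] L2_nth[OF L2_fold[OF GL k]]]
    by (subst Bochner_Integration.integral_sum[symmetric]) (auto simp: mult.commute)
  also have "\<dots> = real k * energy A (\<lambda>q. inverse (real k) *\<^sub>R fold_torus k G q) (corr_field A (axis j 1))"
    using k by (simp add: energy_def flux_def)
  also have "\<dots> = 0" using energy_corr_field[OF A a b H1g_fold[OF \<phi> k]] by simp
  finally show ?thesis .
qed

text \<open>The mean flux is removed so that each component satisfies the mean-zero hypothesis of
  \<open>osc_vanishing_L2\<close>.\<close>

definition flux_osc :: "'n \<Rightarrow> real^'n \<Rightarrow> real^'n" where
  "flux_osc j q = flux j q - A_bar A *v axis j 1"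

lemma L2_flux_osc: "L2 (flux_osc j)"
  unfolding flux_osc_def[abs_def] by (intro L2_diff L2_flux L2_const)

text \<open>Since \<open>flux_osc\<close> is divergence free, \<open>u\<close> can be moved out of the gradient.\<close>

lemma flux_osc_by_parts:
  fixes h :: "real^'n \<Rightarrow> real"
  assumes h: "smooth_torus h" and ug: "H1g u g" and k: "k > 0"
  shows "(\<integral>q. h q * (g q \<bullet> flux_osc j (real k *\<^sub>R q)) \<partial>torus) =
    - (\<Sum>l\<in>UNIV. \<integral>q. u q * partial_deriv l h q * flux_osc j (real k *\<^sub>R q) $ l \<partial>torus)"
proof -
  let ?c = "A_bar A *v axis j 1" and ?f = "\<lambda>q. flux_osc j (real k *\<^sub>R q)"
  let ?G = "\<lambda>q. h q *\<^sub>R g q + u q *\<^sub>R (\<chi> i. partial_deriv i h q)"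
  \<comment> \<open>The gradient of \<open>h * u\<close> is orthogonal to the flux and, having mean
    zero, to the constant \<open>?c\<close>. Its two Leibniz terms therefore cancel against
    \<open>?f\<close>, as in the div-curl lemma.\<close>
  have G: "H1g (\<lambda>q. h q * u q) ?G" by (rule H1g_mult_smooth[OF ug h])
  note GL = H1gD(2)[OF G] and gL = H1gD(2)[OF ug] and u = H1gD(1)[OF ug]
  have fL: "L2 ?f" by (rule L2_dilate[OF L2_flux_osc k])
  have hg: "L2 (\<lambda>q. h q *\<^sub>R g q)" by (rule L2_mult_smooth[OF gL h])
  have "(\<integral>q. ?G q \<bullet> ?f q \<partial>torus) = (\<integral>q. ?G q \<bullet> flux j (real k *\<^sub>R q) \<partial>torus) - (\<integral>q. ?G q \<bullet> ?c \<partial>torus)"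
    using L2_inner[OF GL L2_dilate[OF L2_flux k], of j] L2_inner[OF GL L2_const[of ?c]]
    by (simp add: flux_osc_def inner_diff_right)
  also have "(\<integral>q. ?G q \<bullet> ?c \<partial>torus) = 0"
    using H1g_integral_inner_const[OF G, of ?c] by (simp add: inner_commute)
  finally have z: "(\<integral>q. ?G q \<bullet> ?f q \<partial>torus) = 0" using flux_divergence_free[OF G k] by simp
  have i2: "integrable torus (\<lambda>q. u q * partial_deriv l h q * ?f q $ l)" for l
    using L2_mult[OF L2_mult_smooth[OF u smooth_torus_partial_deriv[OF h]] L2_nth[OF fL]]
    by (simp add: mult_ac)
  have "?G q \<bullet> ?f q = h q * (g q \<bullet> ?f q) + (\<Sum>l\<in>UNIV. u q * partial_deriv l h q * ?f q $ l)" for q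
    by (simp add: inner_add_left) (simp add: inner_vec_def sum_distrib_left mult_ac)
  then have "(\<integral>q. ?G q \<bullet> ?f q \<partial>torus) = (\<integral>q. h q * (g q \<bullet> ?f q) \<partial>torus) +
      (\<Sum>l\<in>UNIV. \<integral>q. u q * partial_deriv l h q * ?f q $ l \<partial>torus)"
    using L2_inner[OF hg fL] i2 by simp
  then show ?thesis using z by simp
qed

text \<open>After the integration by parts only \<open>u\<close> without derivative remains,
  multiplied by oscillations of mean zero.\<close>

lemma flux_osc_vanishing:
  fixes h :: "real^'n \<Rightarrow> real"
  assumes h: "smooth_torus h" and e: "\<epsilon> > 0"
  shows "\<exists>k0>0. \<forall>k\<ge>k0. \<forall>u g. H1g u g \<longrightarrow> (\<integral>q. u q \<partial>torus) = 0 \<longrightarrow>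
    \<bar>\<integral>q. h q * (g q \<bullet> flux_osc j (real k *\<^sub>R q)) \<partial>torus\<bar> \<le> \<epsilon> * sqrt (sqn g)"
proof -
  have van: "osc_vanishing (partial_deriv l h) (\<lambda>q. flux_osc j q $ l)" for l
  proof (rule osc_vanishing_L2[OF smooth_torus_partial_deriv[OF h] L2_nth[OF L2_flux_osc]])
    have "integrable torus (\<lambda>q. flux j q $ l)" by (intro L2_integrable L2_nth L2_flux)
    then show "(\<integral>q. flux_osc j q $ l \<partial>torus) = 0"
      by (simp add: flux_osc_def integral_flux finite_measure.integrable_const matrix_vector_mult_basis column_def)
  qed
  define d where "d = \<epsilon> / real CARD('n)"
  have d: "d > 0" using e by (simp add: d_def)
  define good where "good = (\<lambda>l k0. k0 > 0 \<and> (\<forall>k\<ge>k0. \<forall>u g. H1g u g \<longrightarrow> (\<integral>q. u q \<partial>torus) = 0 \<longrightarrow>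
    \<bar>\<integral>q. u q * partial_deriv l h q * flux_osc j (real k *\<^sub>R q) $ l \<partial>torus\<bar> \<le> d * sqrt (sqn g)))"
  have "\<exists>k0. good l k0" for l
    using van[of l] d unfolding osc_vanishing_def good_def by simp
  then obtain kk where good: "\<And>l. good l (kk l)" by metis
  then have kk: "\<And>l. kk l > 0" "\<And>l. \<forall>k\<ge>kk l. \<forall>u g. H1g u g \<longrightarrow> (\<integral>q. u q \<partial>torus) = 0 \<longrightarrow>
    \<bar>\<integral>q. u q * partial_deriv l h q * flux_osc j (real k *\<^sub>R q) $ l \<partial>torus\<bar> \<le> d * sqrt (sqn g)"
    unfolding good_def by simp_all
  \<comment> \<open>The sum serves as an upper bound of finitely many thresholds.\<close>
  define k0 where "k0 = (\<Sum>l\<in>UNIV. kk l)"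
  have le: "kk l \<le> k0" for l unfolding k0_def by (intro member_le_sum) auto
  show ?thesis
  proof (intro exI[of _ k0] conjI allI impI)
    show "k0 > 0" using le[of undefined] kk(1)[of undefined] by linarith
    fix k and u :: "real^'n \<Rightarrow> real" and g :: "real^'n \<Rightarrow> real^'n" assume k: "k0 \<le> k" and ug: "H1g u g" "(\<integral>q. u q \<partial>torus) = 0"
    have kl: "kk l \<le> k" for l using le[of l] k by simp
    have "k > 0" using kl[of undefined] kk(1)[of undefined] by linarith
    from flux_osc_by_parts[OF h ug(1) this, of j]
    have "\<bar>\<integral>q. h q * (g q \<bullet> flux_osc j (real k *\<^sub>R q)) \<partial>torus\<bar> \<le>
        (\<Sum>l\<in>UNIV. \<bar>\<integral>q. u q * partial_deriv l h q * flux_osc j (real k *\<^sub>R q) $ l \<partial>torus\<bar>)"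
      by simp
    also have "\<dots> \<le> (\<Sum>l\<in>(UNIV :: 'n set). d * sqrt (sqn g))"
      using kk(2) kl ug by (intro sum_mono) blast
    also have "\<dots> = \<epsilon> * sqrt (sqn g)" by (simp add: d_def)
    finally show "\<bar>\<integral>q. h q * (g q \<bullet> flux_osc j (real k *\<^sub>R q)) \<partial>torus\<bar> \<le> \<epsilon> * sqrt (sqn g)" .
  qed
qed

text \<open>The projection depends on \<open>g\<close>, but it combines finitely many fixed
  characters with coefficients at most \<open>sqrt (sqn g)\<close>. Thresholds for these characters
  suffice, and the second factor \<open>sqrt (sqn g)\<close> comes from
  \<open>flux_osc_vanishing\<close>.\<close>

lemma flux_osc_proj_vanishing:
  assumes \<delta>: "\<delta> > 0"
  shows "\<exists>k0>0. \<forall>k\<ge>k0. \<forall>u g. H1g u g \<longrightarrow> (\<integral>q. u q \<partial>torus) = 0 \<longrightarrow>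
    \<bar>\<Sum>j\<in>UNIV. \<integral>q. proj R (\<lambda>q. g q $ j) q * (g q \<bullet> flux_osc j (real k *\<^sub>R q)) \<partial>torus\<bar> \<le> \<delta> * sqn g"
proof -
  let ?F = "fbox R :: (int^'n) set"
  \<comment> \<open>The number of terms: components, frequencies, and two characters for
    each.\<close>
  define N where "N = real CARD('n) * (real (card ?F) * 2)"
  have N0: "N \<ge> 0" by (simp add: N_def)
  define e where "e = \<delta> / (N + 1)"
  have e: "e > 0" using \<delta> N0 by (simp add: e_def)
  define good where "good = (\<lambda>h j k0. k0 > 0 \<and> (\<forall>k\<ge>k0. \<forall>u g. H1g u g \<longrightarrow> (\<integral>q. u q \<partial>torus) = 0 \<longrightarrow>
    \<bar>\<integral>q. h q * (g q \<bullet> flux_osc j (real k *\<^sub>R q)) \<partial>torus\<bar> \<le> e * sqrt (sqn g)))"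
  have ex: "\<exists>k0. good h j k0" if "smooth_torus h" for h j
    using flux_osc_vanishing[OF that e, of j] unfolding good_def .
  have "\<forall>j m. \<exists>k0. good (cosm m) j k0" "\<forall>j m. \<exists>k0. good (sinm m) j k0"
    using ex[OF smooth_torus_cosm] ex[OF smooth_torus_sinm] by blast+
  then obtain k1 k2 where good: "\<And>j m. good (cosm m) j (k1 j m)" "\<And>j m. good (sinm m) j (k2 j m)"
    by metis
  have k1: "\<forall>k\<ge>k1 j m. \<forall>u g. H1g u g \<longrightarrow> (\<integral>q. u q \<partial>torus) = 0 \<longrightarrow>
    \<bar>\<integral>q. cosm m q * (g q \<bullet> flux_osc j (real k *\<^sub>R q)) \<partial>torus\<bar> \<le> e * sqrt (sqn g)" for j m
    using good(1)[of m j] unfolding good_def by (rule conjunct2)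
  have k2: "\<forall>k\<ge>k2 j m. \<forall>u g. H1g u g \<longrightarrow> (\<integral>q. u q \<partial>torus) = 0 \<longrightarrow>
    \<bar>\<integral>q. sinm m q * (g q \<bullet> flux_osc j (real k *\<^sub>R q)) \<partial>torus\<bar> \<le> e * sqrt (sqn g)" for j m
    using good(2)[of m j] unfolding good_def by (rule conjunct2)
  define k0 where "k0 = 1 + (\<Sum>j\<in>UNIV. \<Sum>m\<in>?F. k1 j m + k2 j m)"
  have le: "k1 j m + k2 j m \<le> k0" if "m \<in> ?F" for j m
  proof -
    have "k1 j m + k2 j m \<le> (\<Sum>m\<in>?F. k1 j m + k2 j m)"
      using that by (intro member_le_sum) auto
    also have "\<dots> \<le> (\<Sum>j\<in>UNIV. \<Sum>m\<in>?F. k1 j m + k2 j m)"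
      using member_le_sum[of j UNIV "\<lambda>j. \<Sum>m\<in>?F. k1 j m + k2 j m"] by simp
    finally show ?thesis by (simp add: k0_def)
  qed
  show ?thesis
  proof (intro exI[of _ k0] conjI allI impI)
    show "k0 > 0" by (simp add: k0_def)
    fix k and u :: "real^'n \<Rightarrow> real" and g :: "real^'n \<Rightarrow> real^'n" assume k: "k0 \<le> k" and ug: "H1g u g" "(\<integral>q. u q \<partial>torus) = 0"
    have kpos: "k > 0" using k by (simp add: k0_def)
    note gL = H1gD(2)[OF ug(1)]
    let ?f = "\<lambda>j q. g q \<bullet> flux_osc j (real k *\<^sub>R q)" and ?s = "sqrt (sqn g)"
    have fint: "integrable torus (?f j)" for j by (rule L2_inner[OF gL L2_dilate[OF L2_flux_osc kpos]])
    have ci: "integrable torus (\<lambda>q. cosm m q * ?f j q)" "integrable torus (\<lambda>q. sinm m q * ?f j q)" for m j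
      using integrable_mult_smooth[OF fint smooth_torus_cosm] integrable_mult_smooth[OF fint smooth_torus_sinm]
      by (simp_all add: mult.commute)
    have ccb: "\<bar>cos_coeff (\<lambda>q. g q $ j) m\<bar> \<le> ?s" "\<bar>sin_coeff (\<lambda>q. g q $ j) m\<bar> \<le> ?s" for j m
    proof -
      have "\<bar>cos_coeff (\<lambda>q. g q $ j) m\<bar> \<le> 1 * sqrt (\<integral>q. (g q $ j)\<^sup>2 \<partial>torus)"
        unfolding cos_coeff_def by (rule integral_mult_bounded[OF L2_nth[OF gL] smooth_torus_cosm abs_cosm_le])
      then show "\<bar>cos_coeff (\<lambda>q. g q $ j) m\<bar> \<le> ?s" using sqrt_sqn_nth_le[OF gL, of j] by linarith
      have "\<bar>sin_coeff (\<lambda>q. g q $ j) m\<bar> \<le> 1 * sqrt (\<integral>q. (g q $ j)\<^sup>2 \<partial>torus)"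
        unfolding sin_coeff_def by (rule integral_mult_bounded[OF L2_nth[OF gL] smooth_torus_sinm abs_sinm_le])
      then show "\<bar>sin_coeff (\<lambda>q. g q $ j) m\<bar> \<le> ?s" using sqrt_sqn_nth_le[OF gL, of j] by linarith
    qed
    have each: "\<bar>\<integral>q. proj R (\<lambda>q. g q $ j) q * ?f j q \<partial>torus\<bar> \<le> real (card ?F) * 2 * (e * sqn g)" for j
    proof -
      have "(\<integral>q. proj R (\<lambda>q. g q $ j) q * ?f j q \<partial>torus) = (\<integral>q. (\<Sum>m\<in>?F. cos_coeff (\<lambda>q. g q $ j) m * (cosm m q * ?f j q) +
          sin_coeff (\<lambda>q. g q $ j) m * (sinm m q * ?f j q)) \<partial>torus)"
        unfolding proj_def sum_distrib_right by (simp only: distrib_right mult.assoc)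
      also have "\<dots> = (\<Sum>m\<in>?F. cos_coeff (\<lambda>q. g q $ j) m * (\<integral>q. cosm m q * ?f j q \<partial>torus) +
          sin_coeff (\<lambda>q. g q $ j) m * (\<integral>q. sinm m q * ?f j q \<partial>torus))"
        using ci by simp
      finally have eq: "(\<integral>q. proj R (\<lambda>q. g q $ j) q * ?f j q \<partial>torus) =
        (\<Sum>m\<in>?F. cos_coeff (\<lambda>q. g q $ j) m * (\<integral>q. cosm m q * ?f j q \<partial>torus) +
          sin_coeff (\<lambda>q. g q $ j) m * (\<integral>q. sinm m q * ?f j q \<partial>torus))" .
      have "\<bar>\<integral>q. proj R (\<lambda>q. g q $ j) q * ?f j q \<partial>torus\<bar> \<le> (\<Sum>m\<in>?F. ?s * (e * ?s) + ?s * (e * ?s))"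
        unfolding eq
      proof (rule order_trans[OF sum_abs], rule sum_mono)
        fix m assume m: "m \<in> ?F"
        have "k \<ge> k1 j m" "k \<ge> k2 j m" using le[OF m, of j] k by linarith+
        then have "\<bar>\<integral>q. cosm m q * ?f j q \<partial>torus\<bar> \<le> e * ?s" "\<bar>\<integral>q. sinm m q * ?f j q \<partial>torus\<bar> \<le> e * ?s"
          using k1[of j m] k2[of j m] ug by simp_all
        then have "\<bar>cos_coeff (\<lambda>q. g q $ j) m * (\<integral>q. cosm m q * ?f j q \<partial>torus)\<bar> \<le> ?s * (e * ?s)"
          "\<bar>sin_coeff (\<lambda>q. g q $ j) m * (\<integral>q. sinm m q * ?f j q \<partial>torus)\<bar> \<le> ?s * (e * ?s)"
          unfolding abs_mult using ccb[of j m] sqn_nonneg[of g] by (intro mult_mono; simp)+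
        then show "\<bar>cos_coeff (\<lambda>q. g q $ j) m * (\<integral>q. cosm m q * ?f j q \<partial>torus) +
          sin_coeff (\<lambda>q. g q $ j) m * (\<integral>q. sinm m q * ?f j q \<partial>torus)\<bar> \<le> ?s * (e * ?s) + ?s * (e * ?s)"
          by linarith
      qed
      also have "\<dots> = real (card ?F) * (?s * (e * ?s) + ?s * (e * ?s))" by (rule sum_constant)
      also have "\<dots> = real (card ?F) * 2 * (e * (?s * ?s))" by algebra
      also have "?s * ?s = sqn g" by (rule real_sqrt_mult_self[THEN trans, OF abs_of_nonneg[OF sqn_nonneg]])
      finally show ?thesis .
    qed
    have "\<bar>\<Sum>j\<in>UNIV. \<integral>q. proj R (\<lambda>q. g q $ j) q * ?f j q \<partial>torus\<bar> \<le> (\<Sum>j\<in>(UNIV :: 'n set). real (card ?F) * 2 * (e * sqn g))"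
      by (rule order_trans[OF sum_abs]) (intro sum_mono each)
    also have "\<dots> = N * e * sqn g" by (simp add: N_def)
    also have "\<dots> \<le> (N + 1) * e * sqn g"
      using e sqn_nonneg[of g] by (intro mult_right_mono) auto
    also have "(N + 1) * e = \<delta>" using N0 by (simp add: e_def)
    finally show "\<bar>\<Sum>j\<in>UNIV. \<integral>q. proj R (\<lambda>q. g q $ j) q * ?f j q \<partial>torus\<bar> \<le> \<delta> * sqn g" .
  qed
qed

text \<open>The energy of the ansatz field \<open>\<eta>\<close> is exactly the homogenized
  low-frequency sum \<open>T\<close>, and its energy with \<open>g\<close> is
  \<open>T + err\<close>. The square of \<open>g - \<eta>\<close> then gives
  \<open>T + 2 * err\<close> as lower bound, which is why the error is prepared with
  \<open>\<delta> / 2\<close>.\<close>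

lemma energy_ge_homogenized:
  assumes \<delta>: "\<delta> > 0"
  shows "\<exists>k0. \<forall>k\<ge>k0. \<forall>u g. H1g u g \<longrightarrow> (\<integral>q. u q \<partial>torus) = 0 \<longrightarrow>
    (\<Sum>m\<in>fbox R. 4 * pi\<^sup>2 * (ivec m \<bullet> (A_bar A *v ivec m)) * coeff_sq u m)
      \<le> energy (\<lambda>q. A (real k *\<^sub>R q)) g g + \<delta> * sqn g"
proof -
  have "\<delta> / 2 > 0" using \<delta> by simp
  then obtain k1 where k1: "k1 > 0" "\<forall>k\<ge>k1. \<forall>u g. H1g u g \<longrightarrow> (\<integral>q. u q \<partial>torus) = 0 \<longrightarrow>
    \<bar>\<Sum>j\<in>UNIV. \<integral>q. proj R (\<lambda>q. g q $ j) q * (g q \<bullet> flux_osc j (real k *\<^sub>R q)) \<partial>torus\<bar> \<le> \<delta> / 2 * sqn g"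
    using flux_osc_proj_vanishing[of "\<delta> / 2" R] by blast
  show ?thesis
  proof (intro exI[of _ "k1 + (R + R)"] allI impI)
    fix k and u :: "real^'n \<Rightarrow> real" and g :: "real^'n \<Rightarrow> real^'n" assume k: "k1 + (R + R) \<le> k" and ug: "H1g u g" "(\<integral>q. u q \<partial>torus) = 0"
    have kR: "R + R < k" using k k1(1) by simp
    have k0: "k > 0" using kR by simp
    note gL = H1gD(2)[OF ug(1)]
    let ?Ak = "\<lambda>q. A (real k *\<^sub>R q)" and ?P = "\<lambda>j. corr_field A (axis j 1)"
    have Ak: "coeff a b ?Ak" by (rule coeff_dilate[OF A k0])
    define \<xi> where "\<xi> = (\<lambda>j. proj R (\<lambda>q. g q $ j))"
    have \<xi>s: "smooth_torus (\<xi> j)" and \<xi>t: "trig R (\<xi> j)" for j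
      unfolding \<xi>_def by (intro trig_proj trig_smooth[OF trig_proj])+
    define T where "T = (\<Sum>i\<in>UNIV. \<Sum>j\<in>UNIV. A_bar A $ i $ j * parseval_sum R (\<lambda>q. g q $ i) (\<lambda>q. g q $ j))"
    define v where "v = (\<lambda>j q. \<xi> j q *\<^sub>R ?P j (real k *\<^sub>R q))"
    define \<eta> where "\<eta> = (\<lambda>q. \<Sum>j\<in>UNIV. v j q)"
    have vL: "L2 (v j)" for j unfolding v_def
      by (intro L2_mult_smooth L2_dilate L2_corr_field[OF A a b] k0 \<xi>s)
    have \<eta>L: "L2 \<eta>" unfolding \<eta>_def by (intro L2_sum vL)
    \<comment> \<open>Products of two projections have frequencies in \<open>fbox (R + R)\<close>
      and \<open>k\<close> exceeds \<open>R + R\<close>, so the corrected energies average exactly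
      to the entries of \<open>A_bar\<close>.\<close>
    have vv: "energy ?Ak (v i) (v j) = A_bar A $ i $ j * parseval_sum R (\<lambda>q. g q $ i) (\<lambda>q. g q $ j)" for i j
    proof -
      let ?f = "\<lambda>q. ?P i q \<bullet> (A q *v ?P j q)"
      note PL = L2_corr_field[OF A a b]
      have "energy ?Ak (v i) (v j) = (\<integral>q. ?f (real k *\<^sub>R q) * (\<xi> i q * \<xi> j q) \<partial>torus)"
        unfolding energy_def v_def by (simp add: matrix_vector_mult_scaleR mult_ac)
      also have "\<dots> = (\<integral>q. ?f q \<partial>torus) * (\<integral>q. \<xi> i q * \<xi> j q \<partial>torus)"
      proof -
        have "periodic ?f" "?f \<in> borel_measurable lebesgue"
          using A PL by (auto simp: coeff_def L2_def periodic_def intro!: borel_measurable_inner borel_measurable_mult_vec)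
        then show ?thesis
          using integrable_energy[OF A a b PL PL] trig_mult[OF \<xi>t \<xi>t] kR by (rule integral_dilate_mult_trig)
      qed
      also have "(\<integral>q. \<xi> i q * \<xi> j q \<partial>torus) = parseval_sum R (\<lambda>q. g q $ i) (\<lambda>q. g q $ j)"
        unfolding \<xi>_def by (rule integral_proj_proj) (rule L2_nth[OF gL])+
      also have "(\<integral>q. ?f q \<partial>torus) = axis i 1 \<bullet> (A_bar A *v axis j 1)"
        unfolding A_bar_form[OF A a b] by (simp add: energy_def)
      also have "\<dots> = A_bar A $ i $ j" by (simp add: inner_axis' matrix_vector_mult_basis column_def)
      finally show ?thesis .
    qed
    have "energy ?Ak \<eta> \<eta> = (\<Sum>j\<in>UNIV. energy ?Ak \<eta> (v j))"
      unfolding \<eta>_def[abs_def] using vL by (intro energy_sum_right[OF Ak a b] L2_sum)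
    also have "\<dots> = (\<Sum>j\<in>UNIV. \<Sum>i\<in>UNIV. energy ?Ak (v j) (v i))"
      using energy_sym[OF Ak a b \<eta>L vL] energy_sum_right[OF Ak a b vL, of UNIV v] vL by (simp add: \<eta>_def)
    also have "\<dots> = T" unfolding vv T_def ..
    finally have \<eta>\<eta>: "energy ?Ak \<eta> \<eta> = T" .
    define err where "err = (\<Sum>j\<in>UNIV. \<integral>q. \<xi> j q * (g q \<bullet> flux_osc j (real k *\<^sub>R q)) \<partial>torus)"
    have err: "\<bar>err\<bar> \<le> \<delta> / 2 * sqn g" using k1(2) k ug unfolding err_def \<xi>_def by simp
    \<comment> \<open>The flux is split into its mean, which pairs with \<open>g\<close> to the
      homogenized term, and \<open>flux_osc\<close>.\<close>
    have gv: "energy ?Ak g (v j) = (\<integral>q. \<xi> j q * (g q \<bullet> flux_osc j (real k *\<^sub>R q)) \<partial>torus) +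
        (\<Sum>i\<in>UNIV. A_bar A $ i $ j * parseval_sum R (\<lambda>q. g q $ i) (\<lambda>q. g q $ j))" for j
    proof -
      let ?c = "A_bar A *v axis j 1"
      have i1: "integrable torus (\<lambda>q. \<xi> j q * (g q \<bullet> flux_osc j (real k *\<^sub>R q)))"
        using L2_inner[OF L2_mult_smooth[OF gL \<xi>s] L2_dilate[OF L2_flux_osc k0]] by simp
      have i2: "integrable torus (\<lambda>q. \<xi> j q * g q $ i)" for i
        using L2_mult[OF L2_smooth[OF \<xi>s] L2_nth[OF gL]] .
      have "energy ?Ak g (v j) = (\<integral>q. \<xi> j q * (g q \<bullet> flux_osc j (real k *\<^sub>R q)) + (\<Sum>i\<in>UNIV. A_bar A $ i $ j * (\<xi> j q * g q $ i)) \<partial>torus)"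
        unfolding energy_def
      proof (intro Bochner_Integration.integral_cong refl)
        fix q
        have "g q \<bullet> ?c = (\<Sum>i\<in>UNIV. A_bar A $ i $ j * g q $ i)"
          by (simp add: inner_vec_def matrix_vector_mult_basis column_def mult.commute)
        then have "\<xi> j q * (g q \<bullet> ?c) = (\<Sum>i\<in>UNIV. A_bar A $ i $ j * (\<xi> j q * g q $ i))"
          by (simp add: sum_distrib_left mult_ac)
        moreover have "g q \<bullet> (?Ak q *v v j q) = \<xi> j q * (g q \<bullet> flux j (real k *\<^sub>R q))"
          by (simp add: v_def flux_def matrix_vector_mult_scaleR)
        ultimately show "g q \<bullet> (?Ak q *v v j q) = \<xi> j q * (g q \<bullet> flux_osc j (real k *\<^sub>R q)) + (\<Sum>i\<in>UNIV. A_bar A $ i $ j * (\<xi> j q * g q $ i))"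
          by (simp add: flux_osc_def inner_diff_right right_diff_distrib)
      qed
      also have "\<dots> = (\<integral>q. \<xi> j q * (g q \<bullet> flux_osc j (real k *\<^sub>R q)) \<partial>torus) + (\<Sum>i\<in>UNIV. A_bar A $ i $ j * (\<integral>q. \<xi> j q * g q $ i \<partial>torus))"
        using i1 i2 by simp
      finally show ?thesis
        by (simp add: \<xi>_def integral_proj_mult[OF L2_nth[OF gL]] parseval_sum_commute[of R "\<lambda>q. g q $ j"])
    qed
    have "energy ?Ak g \<eta> = (\<Sum>j\<in>UNIV. energy ?Ak g (v j))"
      unfolding \<eta>_def by (rule energy_sum_right[OF Ak a b gL vL])
    also have "\<dots> = err + T" unfolding gv sum.distrib err_def T_def by (subst (2) sum.swap) (rule refl)
    finally have g\<eta>: "energy ?Ak g \<eta> = err + T" .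
    have "0 \<le> energy ?Ak (\<lambda>q. g q + (-1) *\<^sub>R \<eta> q) (\<lambda>q. g q + (-1) *\<^sub>R \<eta> q)"
      by (intro energy_nonneg[OF Ak a b] L2_add L2_scaleR gL \<eta>L)
    also have "\<dots> = energy ?Ak g g + 2 * (-1) * energy ?Ak g \<eta> + (-1)\<^sup>2 * energy ?Ak \<eta> \<eta>"
      by (rule energy_add_scale_sq[OF Ak a b gL \<eta>L])
    finally have "T + 2 * err \<le> energy ?Ak g g" unfolding g\<eta> \<eta>\<eta> by simp
    then have "T \<le> energy ?Ak g g + \<delta> * sqn g" using err by (simp add: abs_le_iff)
    then show "(\<Sum>m\<in>fbox R. 4 * pi\<^sup>2 * (ivec m \<bullet> (A_bar A *v ivec m)) * coeff_sq u m)
      \<le> energy ?Ak g g + \<delta> * sqn g"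
      unfolding T_def parseval_sum_grad[OF ug(1)] .
  qed
qed

text \<open>Bounding the square norm by the energy, rather than conversely, makes the errors
  additive: Young's splitting of low and high frequencies, the high-frequency tail, and the
  homogenization error at low frequencies.\<close>

lemma energy_two_scale_lower:
  fixes W :: "real^'n \<Rightarrow> real"
  assumes W: "weight C W" and Z: "Z = (\<integral>q. W q \<partial>torus)"
    and \<Lambda>: "\<Lambda> > 0" "\<And>n. n \<noteq> 0 \<Longrightarrow> Z * \<Lambda> \<le> 4 * pi\<^sup>2 * (ivec n \<bullet> (A_bar A *v ivec n))"
    and \<epsilon>: "\<epsilon> > 0"
  shows "\<exists>k0. \<forall>k\<ge>k0. \<forall>u g. H1g u g \<longrightarrow> (\<integral>q. u q \<partial>torus) = 0 \<longrightarrow>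
    (\<integral>q. (u q)\<^sup>2 * W (real k *\<^sub>R q) \<partial>torus) \<le> (1 / \<Lambda> + \<epsilon>) * energy (\<lambda>q. A (real k *\<^sub>R q)) g g"
proof -
  have Z0: "Z > 0" unfolding Z by (rule weight_integral_pos[OF W])
  have C0: "0 \<le> C" by (rule weight_const_nonneg[OF W])
  \<comment> \<open>Each error gets \<open>\<epsilon> / 3\<close>: \<open>t\<close> through Young's
    inequality, \<open>R\<close> through \<open>c1\<close>, and \<open>\<delta>\<close> through
    \<open>c2\<close>.\<close>
  define t where "t = \<epsilon> * \<Lambda> / 3"
  have t: "t > 0" using \<epsilon> \<Lambda>(1) by (simp add: t_def)
  define c1 where "c1 = (1 + 1 / t) * C / a"
  have c1: "c1 \<ge> 0" unfolding c1_def using t C0 a by (intro divide_nonneg_pos mult_nonneg_nonneg) auto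
  obtain R :: nat where R: "3 * c1 / \<epsilon> \<le> real R" using real_arch_simple by blast
  define c2 where "c2 = (1 + t) / \<Lambda> / a"
  have c2: "c2 > 0" unfolding c2_def using t \<Lambda>(1) a by simp
  define \<delta> where "\<delta> = \<epsilon> / 3 / c2"
  have \<delta>: "\<delta> > 0" using \<epsilon> c2 by (simp add: \<delta>_def)
  obtain k1 where k1: "\<forall>k\<ge>k1. \<forall>u g. H1g u g \<longrightarrow> (\<integral>q. u q \<partial>torus) = 0 \<longrightarrow>
    (\<Sum>m\<in>fbox R. 4 * pi\<^sup>2 * (ivec m \<bullet> (A_bar A *v ivec m)) * coeff_sq u m)
      \<le> energy (\<lambda>q. A (real k *\<^sub>R q)) g g + \<delta> * sqn g"
    using energy_ge_homogenized[OF \<delta>, of R] by blast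
  show ?thesis
  proof (intro exI[of _ "Suc (k1 + (R + R))"] allI impI)
    fix k and u :: "real^'n \<Rightarrow> real" and g :: "real^'n \<Rightarrow> real^'n" assume k: "Suc (k1 + (R + R)) \<le> k" and ug: "H1g u g" "(\<integral>q. u q \<partial>torus) = 0"
    have kR: "R + R < k" and k0: "k > 0" using k by simp_all
    let ?Wk = "\<lambda>q. W (real k *\<^sub>R q)" and ?E = "energy (\<lambda>q. A (real k *\<^sub>R q)) g g"
    have Wk: "weight C ?Wk" by (rule weight_dilate[OF W k0])
    note u = H1gD(1)[OF ug(1)] and gL = H1gD(2)[OF ug(1)]
    define v where "v = proj R u"
    define r where "r = (\<lambda>q. u q - v q)"
    have vL: "L2 v" unfolding v_def by (rule L2_proj)
    have rL: "L2 r" unfolding r_def by (rule L2_diff[OF u vL])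
    have E: "a * sqn g \<le> ?E" by (rule energy_lower[OF coeff_dilate[OF A k0] a b gL])
    then have gE: "sqn g \<le> ?E / a" using a by (simp add: field_simps)
    have E0: "0 \<le> ?E" using E a sqn_nonneg[of g] by (meson less_imp_le mult_nonneg_nonneg order_trans)
    have v2: "(\<integral>q. (v q)\<^sup>2 * ?Wk q \<partial>torus) = Z * (\<Sum>m\<in>fbox R. coeff_sq u m)"
    proof -
      have "(\<integral>q. ?Wk q * (v q * v q) \<partial>torus) = Z * (\<integral>q. v q * v q \<partial>torus)"
        unfolding Z v_def using W L2_integrable[OF L2_weight[OF W]] trig_mult[OF trig_proj trig_proj] kR
        by (intro integral_dilate_mult_trig) (auto simp: weight_def)
      also have "(\<integral>q. v q * v q \<partial>torus) = (\<Sum>m\<in>fbox R. coeff_sq u m)"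
        unfolding v_def integral_proj_proj[OF u u] parseval_sum_self ..
      finally show ?thesis by (simp add: power2_eq_square mult_ac)
    qed
    have "\<Lambda> * (Z * (\<Sum>m\<in>fbox R. coeff_sq u m)) = (\<Sum>m\<in>fbox R. (Z * \<Lambda>) * coeff_sq u m)"
      by (simp add: sum_distrib_left mult_ac)
    also have "\<dots> \<le> (\<Sum>m\<in>fbox R. 4 * pi\<^sup>2 * (ivec m \<bullet> (A_bar A *v ivec m)) * coeff_sq u m)"
    proof (rule sum_mono)
      fix m :: "int^'n"
      \<comment> \<open>The hypothesis on \<open>\<Lambda>\<close> leaves out frequency 0, whose
        coefficient vanishes because \<open>u\<close> has mean zero.\<close>
      show "(Z * \<Lambda>) * coeff_sq u m \<le> 4 * pi\<^sup>2 * (ivec m \<bullet> (A_bar A *v ivec m)) * coeff_sq u m"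
        using coeff_sq_0_mean_zero[OF ug(2)] \<Lambda>(2)[of m] by (cases "m = 0") (auto intro: mult_right_mono)
    qed
    also have "\<dots> \<le> ?E + \<delta> * sqn g" using k1 k ug by simp
    also have "\<dots> \<le> ?E + \<delta> * (?E / a)" using gE \<delta> by (intro add_left_mono mult_left_mono) auto
    finally have hom: "(\<integral>q. (v q)\<^sup>2 * ?Wk q \<partial>torus) \<le> (?E + \<delta> * (?E / a)) / \<Lambda>"
      unfolding v2 using \<Lambda>(1) by (simp add: field_simps)
    have r2: "(\<integral>q. (r q)\<^sup>2 * ?Wk q \<partial>torus) \<le> C * (?E / a) / (real R + 1)"
    proof -
      have "(real R + 1) * (\<integral>q. (r q)\<^sup>2 \<partial>torus) \<le> 4 * pi\<^sup>2 * (real R + 1)\<^sup>2 * (\<integral>q. (r q)\<^sup>2 \<partial>torus)"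
      proof (rule mult_right_mono)
        have "1 \<le> pi\<^sup>2" using power_mono[of 1 pi 2] pi_ge_two by simp
        then have "1 * (real R + 1) \<le> (4 * pi\<^sup>2) * (real R + 1)\<^sup>2"
          by (intro mult_mono) (auto simp: power2_eq_square)
        then show "real R + 1 \<le> 4 * pi\<^sup>2 * (real R + 1)\<^sup>2" by simp
      qed simp
      also have "\<dots> \<le> sqn g" unfolding r_def v_def by (rule Poincare_tail[OF ug(1)])
      also note gE
      finally have "(\<integral>q. (r q)\<^sup>2 \<partial>torus) \<le> ?E / a / (real R + 1)" by (simp add: pos_le_divide_eq mult.commute del: divide_divide_eq_left)
      then have "C * (\<integral>q. (r q)\<^sup>2 \<partial>torus) \<le> C * (?E / a / (real R + 1))" using C0 by (rule mult_left_mono)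
      then show ?thesis using integral_weight_sq_le[OF Wk rL] by simp
    qed
    have young: "(u q)\<^sup>2 \<le> (1 + t) * (v q)\<^sup>2 + (1 + 1 / t) * (r q)\<^sup>2" for q
    proof -
      have "0 \<le> (t * v q - r q)\<^sup>2 / t" using t by simp
      also have "\<dots> = t * (v q)\<^sup>2 - 2 * (v q * r q) + 1 / t * (r q)\<^sup>2"
        using t by (simp add: power2_eq_square field_simps)
      finally have "2 * (v q * r q) \<le> t * (v q)\<^sup>2 + 1 / t * (r q)\<^sup>2" by simp
      moreover have "(u q)\<^sup>2 = (v q)\<^sup>2 + 2 * (v q * r q) + (r q)\<^sup>2"
        by (simp add: r_def power2_eq_square algebra_simps)
      ultimately show ?thesis by (simp add: distrib_right)
    qed
    have "(\<integral>q. (u q)\<^sup>2 * ?Wk q \<partial>torus) \<le> (\<integral>q. (1 + t) * ((v q)\<^sup>2 * ?Wk q) + (1 + 1 / t) * ((r q)\<^sup>2 * ?Wk q) \<partial>torus)"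
    proof (rule Bochner_Integration.integral_mono)
      show "(u q)\<^sup>2 * ?Wk q \<le> (1 + t) * ((v q)\<^sup>2 * ?Wk q) + (1 + 1 / t) * ((r q)\<^sup>2 * ?Wk q)" for q
        using mult_right_mono[OF young[of q], of "?Wk q"] weight_pos[OF Wk, of q] by (simp add: distrib_right mult.assoc)
    qed (use integrable_weight_square[OF Wk u] integrable_weight_square[OF Wk vL] integrable_weight_square[OF Wk rL] in auto)
    also have "\<dots> = (1 + t) * (\<integral>q. (v q)\<^sup>2 * ?Wk q \<partial>torus) + (1 + 1 / t) * (\<integral>q. (r q)\<^sup>2 * ?Wk q \<partial>torus)"
      using integrable_weight_square[OF Wk vL] integrable_weight_square[OF Wk rL] by simp
    also have "\<dots> \<le> (1 + t) * ((?E + \<delta> * (?E / a)) / \<Lambda>) + (1 + 1 / t) * (C * (?E / a) / (real R + 1))"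
      using hom r2 t by (intro add_mono mult_left_mono) auto
    also have "\<dots> = ((1 + t) / \<Lambda> + \<delta> * c2 + c1 / (real R + 1)) * ?E"
    proof -
      have "(1 + t) * ((?E + \<delta> * (?E / a)) / \<Lambda>) = ((1 + t) / \<Lambda> + \<delta> * c2) * ?E"
        by (simp add: c2_def distrib_right distrib_left add_divide_distrib mult_ac)
      moreover have "(1 + 1 / t) * (C * (?E / a) / (real R + 1)) = c1 / (real R + 1) * ?E"
        by (simp add: c1_def mult_ac)
      ultimately show ?thesis by (simp add: distrib_right)
    qed
    also have "\<dots> \<le> (1 / \<Lambda> + \<epsilon>) * ?E"
    proof (rule mult_right_mono[OF _ E0])
      have "(1 + t) / \<Lambda> = 1 / \<Lambda> + \<epsilon> / 3" using \<Lambda>(1) by (simp add: t_def field_simps)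
      moreover have "\<delta> * c2 = \<epsilon> / 3" using c2 by (simp add: \<delta>_def)
      moreover have "c1 / (real R + 1) \<le> \<epsilon> / 3"
      proof -
        have "3 * c1 \<le> \<epsilon> * real R" using R \<epsilon> by (simp add: field_simps)
        also have "\<dots> \<le> \<epsilon> * (real R + 1)" using \<epsilon> by simp
        finally show ?thesis by (simp add: pos_divide_le_eq)
      qed
      ultimately show "(1 + t) / \<Lambda> + \<delta> * c2 + c1 / (real R + 1) \<le> 1 / \<Lambda> + \<epsilon>" by linarith
    qed
    finally show "(\<integral>q. (u q)\<^sup>2 * ?Wk q \<partial>torus) \<le> (1 / \<Lambda> + \<epsilon>) * ?E" .
  qed
qed

end

section \<open>Admissible diffusions\<close>

text \<open>The endpoint 0 is included; there convexity reduces to \<open>t powr p \<le> t\<close>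
  for \<open>t\<close> between 0 and 1.\<close>

lemma convex_on_powr:
  assumes "1 \<le> p" shows "convex_on {0..} (\<lambda>x::real. x powr p)"
proof (rule convex_onI)
  fix t x y :: real assume t: "0 < t" "t < 1" and x: "x \<in> {0..}" and y: "y \<in> {0..}"
  have small: "s powr p \<le> s" if "0 < s" "s < 1" for s :: real
    using powr_mono'[of 1 p s] assms that by simp
  consider "x = 0" | "y = 0" | "x > 0" "y > 0" using x y by fastforce
  then show "((1 - t) *\<^sub>R x + t *\<^sub>R y) powr p \<le> (1 - t) * x powr p + t * y powr p"
  proof cases
    case 1
    then show ?thesis using small[OF t] y t by (simp add: powr_mult mult_right_mono)
  next
    case 2
    then show ?thesis using small[of "1 - t"] x t by (simp add: powr_mult mult_right_mono)
  next
    case 3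
    then show ?thesis using convex_onD[OF powr_convex[OF assms], of t x y] t by simp
  qed
qed simp

lemma smooth_oscillating: "smooth_torus V \<Longrightarrow> smooth_torus (oscillating V k)"
  using smooth_torus_dilate[of V k 0] by (simp add: oscillating_def[abs_def])

context
  fixes N :: "real^'n^'n \<Rightarrow> real"
  assumes N: "loewner_monotone_norm N"
begin

lemma N_nonneg: "0 \<le> N M" and N_scale: "N (c *\<^sub>R M) = \<bar>c\<bar> * N M"
  and N_triangle: "N (M + M') \<le> N M + N M'" and N_eq_0: "N M = 0 \<longleftrightarrow> M = 0"
  using N unfolding loewner_monotone_norm_def by blast+

text \<open>Triangle inequality and homogeneity. In finite dimension convexity also gives
  continuity, hence \<open>measurable_N\<close>.\<close>

lemma convex_on_N: "convex_on UNIV N"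
proof (rule convex_onI)
  fix t :: real and x y assume "0 < t" "t < 1"
  then show "N ((1 - t) *\<^sub>R x + t *\<^sub>R y) \<le> (1 - t) * N x + t * N y"
    using N_triangle[of "(1 - t) *\<^sub>R x" "t *\<^sub>R y"] by (simp add: N_scale)
qed simp

lemma measurable_N: "A \<in> borel_measurable M \<Longrightarrow> (\<lambda>x. N (A x)) \<in> borel_measurable M"
  by (rule measurable_compose[OF _ borel_measurable_continuous_onI])
    (auto intro: convex_on_continuous convex_on_N)

lemma measurable_N_powr: "A \<in> borel_measurable M \<Longrightarrow> (\<lambda>x. N (A x) powr p) \<in> borel_measurable M"
  using measurable_N[of A M] by measurable

text \<open>Jensen twice: for \<open>N\<close>, and then for the power \<open>p\<close>, which is
  increasing on the nonnegative half-line.\<close>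

lemma N_average_powr_le:
  fixes M :: "'j \<Rightarrow> real^'n^'n"
  assumes p: "1 \<le> p" and J: "finite J" "J \<noteq> {}"
  shows "N (inverse (real (card J)) *\<^sub>R (\<Sum>j\<in>J. M j)) powr p \<le> inverse (real (card J)) * (\<Sum>j\<in>J. N (M j) powr p)"
proof -
  let ?c = "inverse (real (card J))"
  have c: "0 \<le> ?c" "(\<Sum>j\<in>J. ?c) = 1" using J by simp_all
  have "N (\<Sum>j\<in>J. ?c *\<^sub>R M j) \<le> (\<Sum>j\<in>J. ?c * N (M j))"
    using c by (intro convex_on_sum[OF J convex_on_N]) auto
  then have "N (?c *\<^sub>R (\<Sum>j\<in>J. M j)) powr p \<le> (\<Sum>j\<in>J. ?c * N (M j)) powr p"
    using p by (intro powr_mono2) (auto simp: N_nonneg scaleR_sum_right)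
  also have "\<dots> = (\<Sum>j\<in>J. ?c *\<^sub>R N (M j)) powr p" by simp
  also have "\<dots> \<le> (\<Sum>j\<in>J. ?c * N (M j) powr p)"
    using c by (intro convex_on_sum[OF J convex_on_powr[OF p]]) (auto simp: N_nonneg)
  finally show ?thesis by (simp add: sum_distrib_left)
qed

text \<open>The factor \<open>exp (- p * V q)\<close> is absorbed by homogeneity of
  \<open>N\<close>, so that ellipticity and norm constraint both speak of
  \<open>exp (- V) D\<close>, the field that is averaged and dilated.\<close>

lemma admissible_iff:
  "D \<in> admissible N p a b V \<longleftrightarrow> periodic D \<and> D \<in> borel_measurable lebesgue \<and> (\<forall>q. D q \<in> psd) \<and>
     (AE q in torus. exp (- V q) *\<^sub>R D q \<in> M_ab a b) \<and>
     (\<integral>\<^sup>+q. ennreal (N (exp (- V q) *\<^sub>R D q) powr p) \<partial>torus) \<le> 1"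
proof -
  have "N (D q) powr p * exp (- p * V q) = N (exp (- V q) *\<^sub>R D q) powr p" for q
  proof -
    have "exp (- V q) powr p = exp (- p * V q)" by (simp add: powr_def)
    then show ?thesis by (simp add: N_scale powr_mult N_nonneg mult.commute)
  qed
  then show ?thesis by (simp add: admissible_def)
qed

lemma admissible_coeff:
  assumes V: "smooth_torus V" and D: "D \<in> admissible N p a b V"
  shows "coeff a b (\<lambda>q. exp (- V q) *\<^sub>R D q)"
  using D smooth_torus_periodic[OF V] smooth_torus_measurable[OF V]
  by (auto simp: coeff_def admissible_iff periodic_def)

lemma admissible_dilate:
  assumes V: "smooth_torus V" and D: "D \<in> admissible N p a b V" and k: "k > 0"
  shows "(\<lambda>q. D (real k *\<^sub>R q)) \<in> admissible N p a b (oscillating V k)"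
  unfolding admissible_iff oscillating_def
proof (intro conjI)
  let ?A = "\<lambda>q. exp (- V q) *\<^sub>R D q"
  have A: "coeff a b ?A" by (rule admissible_coeff[OF V D])
  show "periodic (\<lambda>q. D (real k *\<^sub>R q))" using D periodic_dilate[of D k 0] by (simp add: admissible_iff)
  show "(\<lambda>q. D (real k *\<^sub>R q)) \<in> borel_measurable lebesgue"
    using D k by (auto simp: admissible_iff intro: measurable_lebesgue_dilate)
  show "\<forall>q. D (real k *\<^sub>R q) \<in> psd" using D by (simp add: admissible_iff)
  show "AE q in torus. exp (- V (real k *\<^sub>R q)) *\<^sub>R D (real k *\<^sub>R q) \<in> M_ab a b"
    using coeff_dilate[OF A k] by (simp add: coeff_def)
  have "(\<integral>\<^sup>+q. ennreal (N (?A (real k *\<^sub>R q)) powr p) \<partial>torus) = (\<integral>\<^sup>+q. ennreal (N (?A q) powr p) \<partial>torus)"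
    using A measurable_N_powr[of ?A lebesgue p] k
    by (intro nn_integral_torus_dilate[of "\<lambda>q. ennreal (N (?A q) powr p)"]) (auto simp: coeff_def periodic_def)
  then show "(\<integral>\<^sup>+q. ennreal (N (exp (- V (real k *\<^sub>R q)) *\<^sub>R D (real k *\<^sub>R q)) powr p) \<partial>torus) \<le> 1"
    using D by (simp add: admissible_iff)
qed

text \<open>The factor \<open>exp (V q)\<close> turns the averaged coefficient back into a diffusion
  for the base potential. Convexity bounds the power of the norm pointwise by a fold, and folding
  preserves the integral.\<close>

lemma admissible_fold:
  fixes V :: "real^'n \<Rightarrow> real"
  assumes V: "smooth_torus V" and p: "1 \<le> p" and k: "k > 0"
    and D: "D \<in> admissible N p a b (oscillating V k)"
  defines "A \<equiv> \<lambda>q. exp (- oscillating V k q) *\<^sub>R D q"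
  shows "(\<lambda>q. exp (V q) *\<^sub>R fold_torus k A q) \<in> admissible N p a b V"
proof -
  have A: "coeff a b A" unfolding A_def by (rule admissible_coeff[OF smooth_oscillating[OF V] D])
  \<comment> \<open>Admissibility asks for \<open>psd\<close> at every point, while
    \<open>coeff\<close> speaks almost everywhere, so the pointwise property is derived
    separately.\<close>
  have Ap: "A q \<in> psd" for q
    using D psd_average[of "{()}" "\<lambda>_. D q" "exp (- oscillating V k q)"] by (simp add: A_def admissible_iff)
  note F = coeff_fold[OF A k]
  have eq: "exp (- V q) *\<^sub>R (exp (V q) *\<^sub>R fold_torus k A q) = fold_torus k A q" for q
    by (simp flip: exp_add)
  let ?h = "\<lambda>q. N (A q) powr p"
  have hm: "?h \<in> borel_measurable lebesgue" and hp: "periodic ?h"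
    using A measurable_N_powr[of A lebesgue p] by (auto simp: coeff_def periodic_def)
  have h1: "(\<integral>\<^sup>+q. ennreal (?h q) \<partial>torus) \<le> 1" using D by (simp add: admissible_iff A_def)
  have hi: "integrable torus ?h"
    using h1 measurable_torusI[OF hm] by (auto simp: integrable_iff_bounded intro: le_less_trans)
  have pw: "N (fold_torus k A q) powr p \<le> fold_torus k ?h q" for q
    unfolding fold_torus_def card_cells[symmetric] real_scaleR_def
    by (rule N_average_powr_le[OF p finite_cells cells_nonempty[OF k]])
  have h0: "0 \<le> fold_torus k ?h q" for q using pw[of q] by (rule order_trans[OF powr_ge_zero])
  have "(\<integral>\<^sup>+q. ennreal (N (fold_torus k A q) powr p) \<partial>torus) \<le> (\<integral>\<^sup>+q. ennreal (fold_torus k ?h q) \<partial>torus)"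
    by (intro nn_integral_mono ennreal_leI pw)
  also have "\<dots> = ennreal (\<integral>q. fold_torus k ?h q \<partial>torus)"
    using integrable_fold[OF hp hm hi k] h0 by (intro nn_integral_eq_integral) auto
  also have "\<dots> = (\<integral>\<^sup>+q. ennreal (?h q) \<partial>torus)"
    unfolding integral_fold[OF hp hm hi k] using hi by (intro nn_integral_eq_integral[symmetric]) auto
  also note h1
  finally have "(\<integral>\<^sup>+q. ennreal (N (fold_torus k A q) powr p) \<partial>torus) \<le> 1" .
  moreover have "exp (V q) *\<^sub>R fold_torus k A q \<in> psd" for q
  proof -
    have "fold_torus k A q \<in> psd" unfolding fold_torus_def using Ap by (intro psd_average) auto
    then show ?thesis using psd_average[of "{()}" "\<lambda>_. fold_torus k A q" "exp (V q)"] by simp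
  qed
  moreover have "periodic (\<lambda>q. exp (V q) *\<^sub>R fold_torus k A q)"
    "(\<lambda>q. exp (V q) *\<^sub>R fold_torus k A q) \<in> borel_measurable lebesgue"
    using F smooth_torus_periodic[OF V] smooth_torus_measurable[OF V] by (auto simp: coeff_def periodic_def)
  ultimately show ?thesis unfolding admissible_iff eq using F by (simp add: coeff_def)
qed

text \<open>The coefficient is \<open>a\<close> times the identity: \<open>a \<le> a_max N\<close>
  gives the norm constraint and \<open>a * b \<le> 1\<close> the upper ellipticity bound.\<close>

lemma admissible_nonempty:
  fixes V :: "real^'n \<Rightarrow> real"
  assumes V: "smooth_torus V" and p: "1 \<le> p" and a: "0 < a" "a \<le> a_max N" and b: "0 < b" "a * b \<le> 1"
  shows "admissible N p a b V \<noteq> {}"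
proof -
  let ?I = "mat 1 :: real^'n^'n"
  have "?I \<noteq> 0" by (auto simp: vec_eq_iff mat_def)
  then have NI: "N ?I > 0" using N_eq_0[of ?I] N_nonneg[of ?I] by linarith
  have NaI: "N (a *\<^sub>R ?I) \<le> 1" using a NI by (simp add: N_scale a_max_def field_simps)
  have form: "x \<bullet> ((c *\<^sub>R ?I) *v x) = c * (norm x)\<^sup>2" for c and x :: "real^'n"
    by (simp add: scaleR_matrix_vector_assoc[symmetric] power2_norm_eq_inner)
  have psd: "c *\<^sub>R ?I \<in> psd" if "c \<ge> 0" for c
  proof -
    have "transpose (c *\<^sub>R ?I) = c *\<^sub>R ?I" by (simp add: vec_eq_iff transpose_def mat_def)
    then show ?thesis unfolding psd_def mem_Collect_eq form using that by simp
  qed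
  have ab: "a \<le> 1 / b" using b by (simp add: field_simps)
  have Mab: "a *\<^sub>R ?I \<in> M_ab a b"
    unfolding M_ab_def mem_Collect_eq form
    using a psd[of a] by (intro conjI allI order_refl mult_right_mono[OF ab]) auto
  have eq: "exp (- V q) *\<^sub>R ((a * exp (V q)) *\<^sub>R ?I) = a *\<^sub>R ?I" for q
    by (simp add: mult.left_commute flip: exp_add)
  have "(\<integral>\<^sup>+q. ennreal (N (a *\<^sub>R ?I) powr p) \<partial>(torus :: (real^'n) measure)) = ennreal (N (a *\<^sub>R ?I) powr p)"
    using emeasure_torus[where 'n = 'n] by simp
  also have "\<dots> \<le> ennreal 1"
    using p NaI N_nonneg[of "a *\<^sub>R ?I"] powr_mono2[of p "N (a *\<^sub>R ?I)" 1] by (intro ennreal_leI) simp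
  finally have "(\<integral>\<^sup>+q. ennreal (N (a *\<^sub>R ?I) powr p) \<partial>(torus :: (real^'n) measure)) \<le> 1" by simp
  then have "(\<lambda>q. (a * exp (V q)) *\<^sub>R ?I) \<in> admissible N p a b V"
    unfolding admissible_iff eq
    using Mab psd a smooth_torus_periodic[OF V] smooth_torus_measurable[OF V] by (auto simp: periodic_def)
  then show ?thesis by blast
qed

end

section \<open>Convergence of the optimal spectral gaps\<close>

theorem theorem13:
  fixes V :: "real^'n \<Rightarrow> real"
    and N :: "real^'n^'n \<Rightarrow> real"
    and p a b :: real
  assumes "smooth_torus V"
    and "loewner_monotone_norm N"
    and "1 \<le> p"
    and "0 < a" and "a \<le> a_max N"
    and "0 < b"
    and "a * b \<le> 1"
  shows "(\<lambda>k. Lambda_k_star N p a b V k) \<longlonglongrightarrow> Lambda_hom_star N p a b V"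
proof -
  note V = assms(1) and N = assms(2) and p = assms(3) and a = assms(4) and b = assms(6)
  let ?adm = "admissible N p a b V" and ?admk = "\<lambda>k. admissible N p a b (oscillating V k)"
  obtain C where W: "weight C (\<lambda>q. exp (- V q))" using weight_exp[OF V] .
  define Z where "Z = (\<integral>q. exp (- V q) \<partial>torus)"
  have Z0: "Z > 0" unfolding Z_def by (rule weight_integral_pos[OF W])
  have Wk: "weight C (\<lambda>q. exp (- oscillating V k q))" if "k > 0" for k
    using weight_dilate[OF W that] by (simp add: oscillating_def)
  \<comment> \<open>\<open>S\<close> bounds the squared length of the minimizing frequencies
    supplied by \<open>hom\<close>, and \<open>R\<close> is a matching box radius; both depend on
    \<open>a\<close> and \<open>b\<close> only.\<close>
  define S where "S = 1 / (a * b)"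
  obtain R :: nat where R: "S \<le> real R" using real_arch_simple by blast
  note hom = Lambda_hom_eq[OF admissible_coeff[OF N V] a b Z_def[symmetric] Z0]
  have in_fbox: "m \<in> fbox R \<and> (norm (ivec m))\<^sup>2 \<le> S" if "a * (norm (ivec m))\<^sup>2 \<le> 1 / b" for m :: "int^'n"
  proof -
    have mS: "(norm (ivec m))\<^sup>2 \<le> S" using that a b by (simp add: S_def field_simps)
    moreover have "m \<in> fbox R"
    proof (rule ccontr)
      assume "m \<notin> fbox R"
      from order_trans[OF ivec_norm_ge[OF this] order_trans[OF mS R]]
      have "(real R + 1)\<^sup>2 \<le> real R" .
      moreover have "(real R + 1)\<^sup>2 = real R * real R + 2 * real R + 1" by (simp add: power2_eq_square algebra_simps)
      moreover have "0 \<le> real R * real R" by simp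
      ultimately show False by linarith
    qed
    ultimately show ?thesis by blast
  qed
  have ne: "?adm \<noteq> {}" and nek: "?admk k \<noteq> {}" for k
    using admissible_nonempty[OF N V p a assms(5) b assms(7)]
      admissible_nonempty[OF N smooth_oscillating[OF V] p a assms(5) b assms(7)] by auto
  \<comment> \<open>A lattice unit vector tests the homogenized eigenvalue, and
    \<open>A_bar_upper\<close> bounds the result for all diffusions at once.\<close>
  have bdd: "bdd_above (Lambda_hom V ` ?adm)"
  proof (rule bdd_aboveI2)
    fix D assume D: "D \<in> ?adm"
    define e where "e = (axis undefined 1 :: int^'n)"
    have "ivec e = (axis undefined 1 :: real^'n)" by (simp add: e_def vec_eq_iff axis_def)
    then have ne: "norm (ivec e) = 1" by (simp add: norm_axis_1)
    then have "e \<noteq> 0" by auto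
    then have "Z * Lambda_hom V D \<le> 4 * pi\<^sup>2 * (ivec e \<bullet> (A_bar (\<lambda>q. exp (- V q) *\<^sub>R D q) *v ivec e))"
      using hom[OF D] by blast
    also have "\<dots> \<le> 4 * pi\<^sup>2 * (1 / b)"
      using A_bar_upper[OF admissible_coeff[OF N V D] a b, of "ivec e"] ne by (intro mult_left_mono) auto
    finally show "Lambda_hom V D \<le> 4 * pi\<^sup>2 * (1 / b) / Z"
      unfolding pos_le_divide_eq[OF Z0] by (simp only: mult.commute)
  qed
  define \<Lambda> where "\<Lambda> = Lambda_hom_star N p a b V"
  have hom_le: "Lambda_hom V D \<le> \<Lambda>" if "D \<in> ?adm" for D
    unfolding \<Lambda>_def Lambda_hom_star_def using bdd that by (intro cSup_upper) auto
  define K1 where "K1 = 2 * pi\<^sup>2 * S / b + 32 * pi^4 * S^3 / b"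
  define K2 where "K2 = Z / 2 + 4 * pi\<^sup>2 * C * S\<^sup>2 + 4 * pi\<^sup>2 * S\<^sup>2 * C\<^sup>2 / Z"
  \<comment> \<open>Uniform in \<open>D\<close>: \<open>K1\<close> and \<open>K2\<close> involve
    only \<open>a\<close>, \<open>b\<close>, \<open>C\<close> and \<open>Z\<close>. The factor
    \<open>1/2\<close> on both sides is the mean of a squared cosine or sine.\<close>
  have upper: "spectral_gap (oscillating V k) D * (Z / 2 - K2 / k) \<le> Z * \<Lambda> / 2 + K1 / k"
    if k: "k > R + R" and D: "D \<in> ?admk k" for k D
  proof -
    have k0: "k > 0" using k by simp
    let ?A = "\<lambda>q. exp (- oscillating V k q) *\<^sub>R D q"
    have A: "coeff a b ?A" by (rule admissible_coeff[OF N smooth_oscillating[OF V] D])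
    define E where "E = (\<lambda>q. exp (V q) *\<^sub>R fold_torus k ?A q)"
    have E: "E \<in> ?adm" unfolding E_def by (rule admissible_fold[OF N V p k0 D])
    have B: "(\<lambda>q. exp (- V q) *\<^sub>R E q) = fold_torus k ?A"
      by (auto simp: E_def fun_eq_iff simp flip: exp_add)
    obtain m where m: "m \<noteq> 0" "a * (norm (ivec m))\<^sup>2 \<le> 1 / b"
      "Z * Lambda_hom V E = 4 * pi\<^sup>2 * (ivec m \<bullet> (A_bar (fold_torus k ?A) *v ivec m))"
      using hom[OF E] unfolding B by blast
    have L0: "0 \<le> spectral_gap (oscillating V k) D"
      using energy_nonneg[OF A a b H1gD(2)] by (intro spectral_gap_geI[OF Wk[OF k0] A a b]) auto
    have "spectral_gap (oscillating V k) D * (Z / 2 - K2 / k) \<le>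
        2 * pi\<^sup>2 * (ivec m \<bullet> (A_bar (fold_torus k ?A) *v ivec m)) + K1 / k"
      unfolding K1_def K2_def
      by (rule spectral_gap_two_scale_upper[OF W Z_def coeff_fold[OF A k0] a b m(1) _ _ k S_def L0])
        (use in_fbox[OF m(2)] spectral_gap_fold[OF W k0 A a b] in \<open>auto simp: Z_def\<close>)
    also have "2 * pi\<^sup>2 * (ivec m \<bullet> (A_bar (fold_torus k ?A) *v ivec m)) = Z * Lambda_hom V E / 2" using m(3) by simp
    also have "Z * Lambda_hom V E / 2 \<le> Z * \<Lambda> / 2" using hom_le[OF E] Z0 by simp
    finally show ?thesis by simp
  qed
  define \<beta> where "\<beta> = (\<lambda>k. (Z * \<Lambda> / 2 + K1 / real k) / (Z / 2 - K2 / real k))"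
  have lim: "(\<lambda>k. K / real k) \<longlonglongrightarrow> 0" for K
    by (rule lim_const_over_n)
  have \<beta>: "\<beta> \<longlonglongrightarrow> \<Lambda>"
  proof -
    have "\<beta> \<longlonglongrightarrow> (Z * \<Lambda> / 2 + 0) / (Z / 2 - 0)"
      unfolding \<beta>_def using Z0 by (intro tendsto_intros lim) auto
    then show ?thesis using Z0 by simp
  qed
  have "\<forall>\<^sub>F k in sequentially. K2 / real k < Z / 2"
    using lim[of K2] by (rule order_tendstoD(2)) (use Z0 in simp)
  \<comment> \<open>Division needs a positive denominator, which holds once \<open>K2 / k\<close> is
    below \<open>Z / 2\<close>. The bound also shows that the set of gaps is bounded above, as
    \<open>cSup_upper\<close> requires below.\<close>
  then have gap_le: "\<forall>\<^sub>F k in sequentially. \<forall>D\<in>?admk k. spectral_gap (oscillating V k) D \<le> \<beta> k"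
    using eventually_gt_at_top[of "R + R"]
  proof eventually_elim
    case (elim k)
    then show ?case using upper[of k] by (auto simp: \<beta>_def pos_le_divide_eq)
  qed
  have "(\<lambda>k. Lambda_k_star N p a b V k) \<longlonglongrightarrow> \<Lambda>"
  proof (rule order_tendstoI)
    fix y assume "\<Lambda> < y"
    then have "\<forall>\<^sub>F k in sequentially. \<beta> k < y" by (rule order_tendstoD(2)[OF \<beta>])
    with gap_le show "\<forall>\<^sub>F k in sequentially. Lambda_k_star N p a b V k < y"
    proof eventually_elim
      case (elim k)
      have "Lambda_k_star N p a b V k \<le> \<beta> k"
        unfolding Lambda_k_star_def using elim(1) nek[of k] by (intro cSup_least) auto
      then show ?case using elim(2) by simp
    qed
  next
    fix y assume y: "y < \<Lambda>"
    then obtain D where D: "D \<in> ?adm" "y < Lambda_hom V D"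
      unfolding \<Lambda>_def Lambda_hom_star_def using less_cSup_iff[of "Lambda_hom V ` ?adm"] ne bdd by auto
    let ?A = "\<lambda>q. exp (- V q) *\<^sub>R D q"
    have A: "coeff a b ?A" by (rule admissible_coeff[OF N V D(1)])
    define l where "l = Lambda_hom V D"
    obtain m where m: "m \<noteq> 0" "Z * l = 4 * pi\<^sup>2 * (ivec m \<bullet> (A_bar ?A *v ivec m))"
      "\<And>n. n \<noteq> 0 \<Longrightarrow> Z * l \<le> 4 * pi\<^sup>2 * (ivec n \<bullet> (A_bar ?A *v ivec n))"
      using hom[OF D(1)] unfolding l_def by blast
    have l0: "l > 0"
    proof -
      have "norm (ivec m) > 0" using m(1) ivec_eq_iff[of m 0] by simp
      then have "0 < a * (norm (ivec m))\<^sup>2" using a by simp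
      also have "\<dots> \<le> ivec m \<bullet> (A_bar ?A *v ivec m)" by (rule A_bar_lower[OF A a b])
      finally have "0 < Z * l" unfolding m(2) by simp
      then show ?thesis using Z0 by (simp add: zero_less_mult_iff)
    qed
    \<comment> \<open>Chosen so that \<open>1 / (1 / l + \<epsilon>)\<close> is at least
      \<open>l - \<epsilon> * l^2\<close>, which is the midpoint of \<open>y\<close> and
      \<open>l\<close>.\<close>
    define \<epsilon> where "\<epsilon> = (l - y) / 2 / l\<^sup>2"
    have \<epsilon>: "\<epsilon> > 0" using D(2) l0 by (simp add: \<epsilon>_def l_def)
    define L where "L = 1 / (1 / l + \<epsilon>)"
    have s0: "1 / l + \<epsilon> > 0" using l0 \<epsilon> by (simp add: add_pos_pos)
    have Ly: "y < L"
    proof -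
      have "(l - \<epsilon> * l\<^sup>2) * (1 / l + \<epsilon>) = 1 - (\<epsilon> * l)\<^sup>2"
        using l0 by (simp add: field_simps power2_eq_square)
      also have "\<dots> \<le> 1" by simp
      finally have "l - \<epsilon> * l\<^sup>2 \<le> L" unfolding L_def using s0 by (simp add: pos_le_divide_eq)
      moreover have "\<epsilon> * l\<^sup>2 = (l - y) / 2" using l0 by (simp add: \<epsilon>_def)
      moreover have "y < l" using D(2) by (simp add: l_def)
      ultimately show ?thesis by argo
    qed
    obtain k1 where k1: "\<forall>k\<ge>k1. \<forall>u g. H1g u g \<longrightarrow> (\<integral>q. u q \<partial>torus) = 0 \<longrightarrow>
      (\<integral>q. (u q)\<^sup>2 * exp (- V (real k *\<^sub>R q)) \<partial>torus) \<le> (1 / l + \<epsilon>) * energy (\<lambda>q. ?A (real k *\<^sub>R q)) g g"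
      using energy_two_scale_lower[OF A a b W Z_def l0 m(3) \<epsilon>] by blast
    have "\<forall>\<^sub>F k in sequentially. k \<ge> max k1 1" by (rule eventually_ge_at_top)
    with gap_le show "\<forall>\<^sub>F k in sequentially. y < Lambda_k_star N p a b V k"
    proof eventually_elim
      case (elim k)
      then have k0: "k > 0" by simp
      let ?Dk = "\<lambda>q. D (real k *\<^sub>R q)"
      \<comment> \<open>Dilating the one nearly optimal \<open>D\<close> gives a competitor for
        every \<open>k\<close>; its gap exceeds \<open>y\<close> as soon as \<open>k\<close> passes
        \<open>k1\<close>.\<close>
      have Dk: "?Dk \<in> ?admk k" by (rule admissible_dilate[OF N V D(1) k0])
      have "L \<le> spectral_gap (oscillating V k) ?Dk"
      proof (rule spectral_gap_geI[OF Wk[OF k0] admissible_coeff[OF N smooth_oscillating[OF V] Dk] a b])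
        show "0 \<le> L" using s0 by (simp add: L_def)
        fix u :: "real^'n \<Rightarrow> real" and g assume ug: "H1g u g" "(\<integral>q. u q \<partial>torus) = 0"
        have "(\<integral>q. (u q)\<^sup>2 * exp (- V (real k *\<^sub>R q)) \<partial>torus) \<le> (1 / l + \<epsilon>) * energy (\<lambda>q. ?A (real k *\<^sub>R q)) g g"
          using k1 elim(2) ug by simp
        then show "L * (\<integral>q. (u q)\<^sup>2 * exp (- oscillating V k q) \<partial>torus) \<le> energy (\<lambda>q. exp (- oscillating V k q) *\<^sub>R ?Dk q) g g"
          using s0 by (simp add: L_def oscillating_def pos_divide_le_eq mult.commute)
      qed
      also have "\<dots> \<le> Lambda_k_star N p a b V k"
        unfolding Lambda_k_star_def using elim(1) Dk by (intro cSup_upper) (auto simp: bdd_above_def)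
      finally show ?case using Ly by simp
    qed
  qed
  then show ?thesis unfolding \<Lambda>_def .
qed

end
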